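(* Let $\mathcal{A}=(A,d)$ be a dg $k$-algebra such that (P1) $A^i=0$ for $i<0$; (P2) $A^0$ is a semisimple ring; (P3) $d(A^0)=0$. (a) Let $M$ be an indecomposable object of $\mathbf{dgFilt}(\mathcal{A})$ (for objects of $\mathbf{dgFilt}(\mathcal{A})$, indecomposability in $\mathbf{dgFilt}(\mathcal{A})$ and in $\mathrm{dgMod}(\mathcal{A})$ are equivalent). Then any element of $\mathrm{End}_{\mathrm{dgMod}(\mathcal{A})}(M)$ is either an isomorphism or nilpotent, and the nilpotent endomorphisms form an ideal in $\mathrm{End}_{\mathrm{dgMod}(\mathcal{A})}(M)$. The same statement holds for $\mathrm{End}_{\mathrm{dgHot}(\mathcal{A})}(N)$ if $N$ is an indecomposable object of $\mathbf{dgPer}(\mathcal{A})$. In particular both endomorphism rings are local rings. (b) Each object of $\mathbf{dgFilt}(\mathcal{A})$ decomposes into a finite direct sum of indecomposable objects of $\mathbf{dgFilt}(\mathcal{A})$. Each object of $\mathbf{dgPer}(\mathcal{A})$ decomposes into a finite direct sum of indecomposable objects of $\mathbf{dgPer}(\mathcal{A})$. (c) $\mathbf{dgFilt}(\mathcal{A})$ and $\mathbf{dgPer}(\mathcal{A})$ are Krull-Remak-Schmidt categories.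
   Context: $k$ is a commutative ring; algebras are associative and unital. Dg modules over $\mathcal{A}$ are right dg modules. $\mathrm{dgMod}(\mathcal{A})$ is the abelian category of dg modules (morphisms: degree $0$, $A$-linear, commuting with differentials); $\mathrm{dgHot}(\mathcal{A})$ is the homotopy category of dg modules, a triangulated category with shift $(\{1\}M)^i=M^{i+1}$, $d_{\{1\}M}=-d_M$; $\{n\}=\{1\}^n$. $(L_x)_{x\in W}$ is a (finite) set of representatives of the isomorphism classes of simple right $A^0$-modules. $A^0$ is regarded as a dg subalgebra $\mathcal{A}^0$ of $\mathcal{A}$ and each $L_x$ as a dg $\mathcal{A}^0$-module concentrated in degree $0$; $\hat L_x:=L_x\otimes_{\mathcal{A}^0}\mathcal{A}$. $\mathbf{dgPer}(\mathcal{A})$ is the smallest full triangulated subcategory of $\mathrm{dgHot}(\mathcal{A})$ containing $\mathcal{A}$ and closed under taking direct summands (in particular closed under isomorphism). $\mathbf{dgFilt}(\mathcal{A})$ is the full subcategory of $\mathrm{dgHot}(\mathcal{A})$ whose objects are the dg modules $M$ admitting a finite filtration $0=F_0(M)\subset\dots\subset F_n(M)=M$ by dg submodules with $F_i(M)/F_{i-1}(M)\cong\{l_i\}\hat L_{x_i}$ in $\mathrm{dgMod}(\mathcal{A})$ for suitable integers $l_1\ge l_2\ge\dots\ge l_n$ and $x_i\in W$. A Krull-Remak-Schmidt category is an additive category in which every object decomposes into a finite direct sum of objects having local endomorphism rings. Indecomposable objects are nonzero. *)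

theory Defs
  imports "HOL-Algebra.Free_Abelian_Groups" "HOL-Algebra.Generated_Groups" "HOL-Algebra.Module" "HOL-Algebra.Ideal"
begin

section \<open>Preadditive categories\<close>

text \<open>Morphism sets of different pairs of objects may overlap, so composition and identities carry
  their objects as arguments: \<open>Comp C X Y Z g f\<close> is the composite of \<open>f : X \<rightarrow> Y\<close>
  and \<open>g : Y \<rightarrow> Z\<close>.\<close>

record ('o, 'f) precat =
  Obj :: "'o set"
  Mor :: "'o \<Rightarrow> 'o \<Rightarrow> 'f set"
  Comp :: "'o \<Rightarrow> 'o \<Rightarrow> 'o \<Rightarrow> 'f \<Rightarrow> 'f \<Rightarrow> 'f"
  Ident :: "'o \<Rightarrow> 'f"
  Plus :: "'o \<Rightarrow> 'o \<Rightarrow> 'f \<Rightarrow> 'f \<Rightarrow> 'f"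
  Zero :: "'o \<Rightarrow> 'o \<Rightarrow> 'f"

definition mor_group :: "('o, 'f) precat \<Rightarrow> 'o \<Rightarrow> 'o \<Rightarrow> 'f monoid" where
  "mor_group C X Y = \<lparr>carrier = Mor C X Y, monoid.mult = Plus C X Y, one = Zero C X Y\<rparr>"

definition end_ring :: "('o, 'f) precat \<Rightarrow> 'o \<Rightarrow> 'f ring" where
  "end_ring C X = \<lparr>carrier = Mor C X X, monoid.mult = Comp C X X X, one = Ident C X,
     zero = Zero C X X, add = Plus C X X\<rparr>"

definition preadditive :: "('o, 'f) precat \<Rightarrow> bool" where
  "preadditive C \<longleftrightarrow>
     (\<forall>X\<in>Obj C. \<forall>Y\<in>Obj C. comm_group (mor_group C X Y)) \<and>
     (\<forall>X\<in>Obj C. Ident C X \<in> Mor C X X) \<and>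
     (\<forall>X\<in>Obj C. \<forall>Y\<in>Obj C. \<forall>f\<in>Mor C X Y.
        Comp C X Y Y (Ident C Y) f = f \<and> Comp C X X Y f (Ident C X) = f) \<and>
     (\<forall>X\<in>Obj C. \<forall>Y\<in>Obj C. \<forall>Z\<in>Obj C. \<forall>f\<in>Mor C X Y. \<forall>g\<in>Mor C Y Z.
        Comp C X Y Z g f \<in> Mor C X Z) \<and>
     (\<forall>X\<in>Obj C. \<forall>Y\<in>Obj C. \<forall>Z\<in>Obj C. \<forall>U\<in>Obj C.
        \<forall>f\<in>Mor C X Y. \<forall>g\<in>Mor C Y Z. \<forall>h\<in>Mor C Z U.
        Comp C X Z U h (Comp C X Y Z g f) = Comp C X Y U (Comp C Y Z U h g) f) \<and>
     (\<forall>X\<in>Obj C. \<forall>Y\<in>Obj C. \<forall>Z\<in>Obj C.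
        \<forall>f\<in>Mor C X Y. \<forall>f'\<in>Mor C X Y. \<forall>g\<in>Mor C Y Z. \<forall>g'\<in>Mor C Y Z.
        Comp C X Y Z (Plus C Y Z g g') f
          = Plus C X Z (Comp C X Y Z g f) (Comp C X Y Z g' f) \<and>
        Comp C X Y Z g (Plus C X Y f f')
          = Plus C X Z (Comp C X Y Z g f) (Comp C X Y Z g f'))"

definition is_iso_mor :: "('o, 'f) precat \<Rightarrow> 'o \<Rightarrow> 'o \<Rightarrow> 'f \<Rightarrow> bool" where
  "is_iso_mor C X Y f \<longleftrightarrow> f \<in> Mor C X Y \<and>
     (\<exists>g\<in>Mor C Y X. Comp C X Y X g f = Ident C X \<and> Comp C Y X Y f g = Ident C Y)"

definition isomorphic :: "('o, 'f) precat \<Rightarrow> 'o \<Rightarrow> 'o \<Rightarrow> bool" where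
  "isomorphic C X Y \<longleftrightarrow> (\<exists>f. is_iso_mor C X Y f)"

definition zero_object :: "('o, 'f) precat \<Rightarrow> 'o \<Rightarrow> bool" where
  "zero_object C Z \<longleftrightarrow> Z \<in> Obj C \<and>
     (\<forall>X\<in>Obj C. (\<exists>!f. f \<in> Mor C X Z) \<and> (\<exists>!f. f \<in> Mor C Z X))"

text \<open>\<open>M\<close> is the direct sum (biproduct) of the objects in the list \<open>Xs\<close>; for the empty
  list this says that \<open>M\<close> is a zero object.\<close>

definition is_direct_sum :: "('o, 'f) precat \<Rightarrow> 'o \<Rightarrow> 'o list \<Rightarrow> bool" where
  "is_direct_sum C M Xs \<longleftrightarrow> M \<in> Obj C \<and> set Xs \<subseteq> Obj C \<and>
     (\<exists>inj prj.
        (\<forall>i<length Xs. inj i \<in> Mor C (Xs ! i) M \<and> prj i \<in> Mor C M (Xs ! i)) \<and>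
        (\<forall>i<length Xs. \<forall>j<length Xs. Comp C (Xs ! j) M (Xs ! i) (prj i) (inj j)
            = (if i = j then Ident C (Xs ! i) else Zero C (Xs ! j) (Xs ! i))) \<and>
        finsum (end_ring C M) (\<lambda>i. Comp C M (Xs ! i) M (inj i) (prj i)) {..<length Xs}
          = Ident C M)"

definition additive_category :: "('o, 'f) precat \<Rightarrow> bool" where
  "additive_category C \<longleftrightarrow> preadditive C \<and> (\<exists>Z. zero_object C Z) \<and>
     (\<forall>X\<in>Obj C. \<forall>Y\<in>Obj C. \<exists>M. is_direct_sum C M [X, Y])"

definition indecomposable :: "('o, 'f) precat \<Rightarrow> 'o \<Rightarrow> bool" where
  "indecomposable C M \<longleftrightarrow> M \<in> Obj C \<and> \<not> zero_object C M \<and>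
     (\<forall>X Y. is_direct_sum C M [X, Y] \<longrightarrow> zero_object C X \<or> zero_object C Y)"

definition full_subcat :: "('o, 'f) precat \<Rightarrow> 'o set \<Rightarrow> ('o, 'f) precat" where
  "full_subcat C S = C\<lparr>Obj := Obj C \<inter> S\<rparr>"

definition nilpotent :: "('a, 'z) ring_scheme \<Rightarrow> 'a \<Rightarrow> bool" where
  "nilpotent R x \<longleftrightarrow> x \<in> carrier R \<and> (\<exists>n::nat. x [^]\<^bsub>R\<^esub> n = \<zero>\<^bsub>R\<^esub>)"

text \<open>A ring is local if its non-units form a two-sided ideal. The zero ring is not local: its set
  of non-units is empty, hence not an ideal.\<close>

definition local_ring :: "('a, 'z) ring_scheme \<Rightarrow> bool" where
  "local_ring R \<longleftrightarrow> ring R \<and> ideal (carrier R - Units R) R"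

definition Krull_Remak_Schmidt :: "('o, 'f) precat \<Rightarrow> bool" where
  "Krull_Remak_Schmidt C \<longleftrightarrow> additive_category C \<and>
     (\<forall>M\<in>Obj C. \<exists>Xs. is_direct_sum C M Xs \<and> (\<forall>X\<in>set Xs. local_ring (end_ring C X)))"


section \<open>Right modules and semisimple rings\<close>

text \<open>As in \<open>HOL-Algebra.Module\<close>, modules are records extending rings, of which only the additive
  part is used. \<open>ract M m r\<close> is the product of \<open>m\<close> with the scalar \<open>r\<close> on the right.\<close>

record ('a, 'm) rmodule = "'m ring" +
  ract :: "'m \<Rightarrow> 'a \<Rightarrow> 'm"

locale right_module = R?: ring R + M?: abelian_group M
  for R (structure) and M :: "('a, 'm, 'y) rmodule_scheme" (structure) +
  assumes ract_closed: "\<lbrakk>m \<in> carrier M; r \<in> carrier R\<rbrakk> \<Longrightarrow> ract M m r \<in> carrier M"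
    and ract_l_distr: "\<lbrakk>m \<in> carrier M; n \<in> carrier M; r \<in> carrier R\<rbrakk>
      \<Longrightarrow> ract M (m \<oplus>\<^bsub>M\<^esub> n) r = ract M m r \<oplus>\<^bsub>M\<^esub> ract M n r"
    and ract_r_distr: "\<lbrakk>m \<in> carrier M; r \<in> carrier R; s \<in> carrier R\<rbrakk>
      \<Longrightarrow> ract M m (r \<oplus>\<^bsub>R\<^esub> s) = ract M m r \<oplus>\<^bsub>M\<^esub> ract M m s"
    and ract_assoc: "\<lbrakk>m \<in> carrier M; r \<in> carrier R; s \<in> carrier R\<rbrakk>
      \<Longrightarrow> ract M (ract M m r) s = ract M m (r \<otimes>\<^bsub>R\<^esub> s)"
    and ract_one: "m \<in> carrier M \<Longrightarrow> ract M m \<one>\<^bsub>R\<^esub> = m"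

definition rsubmodule ::
    "('a, 'z) ring_scheme \<Rightarrow> ('a, 'm, 'y) rmodule_scheme \<Rightarrow> 'm set \<Rightarrow> bool" where
  "rsubmodule R M N \<longleftrightarrow> additive_subgroup N M \<and>
     (\<forall>n\<in>N. \<forall>r\<in>carrier R. ract M n r \<in> N)"

definition simple_rmodule ::
    "('a, 'z) ring_scheme \<Rightarrow> ('a, 'm, 'y) rmodule_scheme \<Rightarrow> bool" where
  "simple_rmodule R M \<longleftrightarrow> right_module R M \<and> carrier M \<noteq> {\<zero>\<^bsub>M\<^esub>} \<and>
     (\<forall>N. rsubmodule R M N \<longrightarrow> N = {\<zero>\<^bsub>M\<^esub>} \<or> N = carrier M)"

definition rmodule_iso ::
    "('a, 'z) ring_scheme \<Rightarrow> ('a, 'm, 'y) rmodule_scheme \<Rightarrow> ('a, 'n, 'w) rmodule_scheme \<Rightarrow> bool"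
  where
  "rmodule_iso R M N \<longleftrightarrow> (\<exists>f. bij_betw f (carrier M) (carrier N) \<and>
     (\<forall>x\<in>carrier M. \<forall>y\<in>carrier M. f (x \<oplus>\<^bsub>M\<^esub> y) = f x \<oplus>\<^bsub>N\<^esub> f y) \<and>
     (\<forall>x\<in>carrier M. \<forall>r\<in>carrier R. f (ract M x r) = ract N (f x) r))"

text \<open>Internal direct sum of a possibly infinite family of additive subgroups.\<close>

definition internal_direct_sum :: "('a, 'z) ring_scheme \<Rightarrow> 'i set \<Rightarrow> ('i \<Rightarrow> 'a set) \<Rightarrow> bool" where
  "internal_direct_sum G I S \<longleftrightarrow> (\<forall>i\<in>I. additive_subgroup (S i) G) \<and>
     (\<forall>x\<in>carrier G. \<exists>!c. c \<in> (\<Pi>\<^sub>E i\<in>I. S i) \<and> finite {i\<in>I. c i \<noteq> \<zero>\<^bsub>G\<^esub>} \<and>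
        x = (\<Oplus>\<^bsub>G\<^esub>i\<in>{i\<in>I. c i \<noteq> \<zero>\<^bsub>G\<^esub>}. c i))"

definition regular_rmodule :: "('a, 'z) ring_scheme \<Rightarrow> ('a, 'a) rmodule" where
  "regular_rmodule R = \<lparr>carrier = carrier R, monoid.mult = (\<otimes>\<^bsub>R\<^esub>), one = \<one>\<^bsub>R\<^esub>,
     zero = \<zero>\<^bsub>R\<^esub>, add = (\<oplus>\<^bsub>R\<^esub>), ract = (\<otimes>\<^bsub>R\<^esub>)\<rparr>"

text \<open>A ring is semisimple if it is, as a right module over itself, a direct sum of simple
  submodules.\<close>

definition semisimple_ring :: "('a, 'z) ring_scheme \<Rightarrow> bool" where
  "semisimple_ring R \<longleftrightarrow> ring R \<and>
     (\<exists>\<S>. (\<forall>S\<in>\<S>. rsubmodule R (regular_rmodule R) S \<and>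
                simple_rmodule R ((regular_rmodule R)\<lparr>carrier := S\<rparr>)) \<and>
          internal_direct_sum (regular_rmodule R) \<S> (\<lambda>S. S))"

text \<open>Completeness is required with respect to simple modules carried by the type \<open>'m\<close>. If \<open>R\<close>
  embeds into \<open>'m\<close>, these are all simple modules up to isomorphism, since a simple module is a
  quotient of \<open>R\<close>.\<close>

definition simple_representatives ::
    "('a, 'z) ring_scheme \<Rightarrow> 'x set \<Rightarrow> ('x \<Rightarrow> ('a, 'm) rmodule) \<Rightarrow> bool" where
  "simple_representatives R W L \<longleftrightarrow>
     (\<forall>x\<in>W. simple_rmodule R (L x)) \<and>
     (\<forall>x\<in>W. \<forall>y\<in>W. rmodule_iso R (L x) (L y) \<longrightarrow> x = y) \<and>
     (\<forall>S :: ('a, 'm) rmodule. simple_rmodule R S \<longrightarrow> (\<exists>x\<in>W. rmodule_iso R S (L x)))"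


section \<open>Dg algebras and dg modules\<close>

record ('k, 'a) dgalgebra = "('k, 'a) module" +
  agr :: "int \<Rightarrow> 'a set"
  adiff :: "'a \<Rightarrow> 'a"

record ('a, 'm) dgmodule = "('a, 'm) rmodule" +
  mgr :: "int \<Rightarrow> 'm set"
  mdiff :: "'m \<Rightarrow> 'm"

definition sign :: "('a, 'z) ring_scheme \<Rightarrow> int \<Rightarrow> 'a \<Rightarrow> 'a" where
  "sign G i x = (if even i then x else \<ominus>\<^bsub>G\<^esub> x)"

text \<open>The locale \<open>algebra\<close> of \<open>HOL-Algebra\<close> assumes commutativity, hence is not used.\<close>

locale dg_algebra = module K A + A: ring A
  for K :: "('k, 'z) ring_scheme" (structure) and A :: "('k, 'a) dgalgebra" (structure) +
  assumes smult_mult_left: "\<lbrakk>c \<in> carrier K; x \<in> carrier A; y \<in> carrier A\<rbrakk>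
      \<Longrightarrow> c \<odot>\<^bsub>A\<^esub> (x \<otimes>\<^bsub>A\<^esub> y) = (c \<odot>\<^bsub>A\<^esub> x) \<otimes>\<^bsub>A\<^esub> y"
    and smult_mult_right: "\<lbrakk>c \<in> carrier K; x \<in> carrier A; y \<in> carrier A\<rbrakk>
      \<Longrightarrow> c \<odot>\<^bsub>A\<^esub> (x \<otimes>\<^bsub>A\<^esub> y) = x \<otimes>\<^bsub>A\<^esub> (c \<odot>\<^bsub>A\<^esub> y)"
    and agr_sum: "internal_direct_sum A UNIV (agr A)"
    and agr_smult: "\<lbrakk>c \<in> carrier K; x \<in> agr A i\<rbrakk> \<Longrightarrow> c \<odot>\<^bsub>A\<^esub> x \<in> agr A i"
    and agr_one: "\<one>\<^bsub>A\<^esub> \<in> agr A 0"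
    and agr_mult: "\<lbrakk>x \<in> agr A i; y \<in> agr A j\<rbrakk> \<Longrightarrow> x \<otimes>\<^bsub>A\<^esub> y \<in> agr A (i + j)"
    and adiff_closed: "x \<in> carrier A \<Longrightarrow> adiff A x \<in> carrier A"
    and adiff_add: "\<lbrakk>x \<in> carrier A; y \<in> carrier A\<rbrakk>
      \<Longrightarrow> adiff A (x \<oplus>\<^bsub>A\<^esub> y) = adiff A x \<oplus>\<^bsub>A\<^esub> adiff A y"
    and adiff_smult: "\<lbrakk>c \<in> carrier K; x \<in> carrier A\<rbrakk>
      \<Longrightarrow> adiff A (c \<odot>\<^bsub>A\<^esub> x) = c \<odot>\<^bsub>A\<^esub> adiff A x"
    and adiff_agr: "x \<in> agr A i \<Longrightarrow> adiff A x \<in> agr A (i + 1)"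
    and adiff_adiff: "x \<in> carrier A \<Longrightarrow> adiff A (adiff A x) = \<zero>\<^bsub>A\<^esub>"
    and adiff_mult: "\<lbrakk>x \<in> agr A i; y \<in> carrier A\<rbrakk> \<Longrightarrow>
      adiff A (x \<otimes>\<^bsub>A\<^esub> y) = adiff A x \<otimes>\<^bsub>A\<^esub> y \<oplus>\<^bsub>A\<^esub> sign A i (x \<otimes>\<^bsub>A\<^esub> adiff A y)"

text \<open>The \<open>k\<close>-module structure of a dg module is determined by the action of \<open>A\<close>, since \<open>c\<close> acts
  as right multiplication by \<open>c \<odot> \<one>\<close>. Homogeneity, \<open>k\<close>-linearity of the differential and of
  morphisms follow, so \<open>k\<close> does not occur in the following.\<close>

locale dg_module = right_module A M
  for A :: "('k, 'a) dgalgebra" (structure) and M :: "('a, 'm) dgmodule" (structure) +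
  assumes mgr_sum: "internal_direct_sum M UNIV (mgr M)"
    and mgr_ract: "\<lbrakk>m \<in> mgr M i; a \<in> agr A j\<rbrakk> \<Longrightarrow> ract M m a \<in> mgr M (i + j)"
    and mdiff_closed: "m \<in> carrier M \<Longrightarrow> mdiff M m \<in> carrier M"
    and mdiff_add: "\<lbrakk>m \<in> carrier M; n \<in> carrier M\<rbrakk>
      \<Longrightarrow> mdiff M (m \<oplus>\<^bsub>M\<^esub> n) = mdiff M m \<oplus>\<^bsub>M\<^esub> mdiff M n"
    and mdiff_mgr: "m \<in> mgr M i \<Longrightarrow> mdiff M m \<in> mgr M (i + 1)"
    and mdiff_mdiff: "m \<in> carrier M \<Longrightarrow> mdiff M (mdiff M m) = \<zero>\<^bsub>M\<^esub>"
    and mdiff_ract: "\<lbrakk>m \<in> mgr M i; a \<in> carrier A\<rbrakk> \<Longrightarrow>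
      mdiff M (ract M m a) = ract M (mdiff M m) a \<oplus>\<^bsub>M\<^esub> sign M i (ract M m (adiff A a))"

definition regular_dgmodule :: "('k, 'a) dgalgebra \<Rightarrow> ('a, 'a) dgmodule" where
  "regular_dgmodule A = \<lparr>carrier = carrier A, monoid.mult = (\<otimes>\<^bsub>A\<^esub>), one = \<one>\<^bsub>A\<^esub>,
     zero = \<zero>\<^bsub>A\<^esub>, add = (\<oplus>\<^bsub>A\<^esub>), ract = (\<otimes>\<^bsub>A\<^esub>), mgr = agr A, mdiff = adiff A\<rparr>"

definition degree_zero_ring :: "('k, 'a) dgalgebra \<Rightarrow> ('k, 'a) dgalgebra" where
  "degree_zero_ring A = A\<lparr>carrier := agr A 0\<rparr>"

definition shift :: "int \<Rightarrow> ('a, 'm) dgmodule \<Rightarrow> ('a, 'm) dgmodule" where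
  "shift l M = M\<lparr>mgr := \<lambda>i. mgr M (i + l), mdiff := \<lambda>m. sign M l (mdiff M m)\<rparr>"

text \<open>The cone of \<open>f : M \<rightarrow> N\<close> is \<open>N \<oplus> {1}M\<close> with differential
  \<open>(n, m) \<mapsto> (d n + f m, - d m)\<close>.\<close>

definition cone ::
    "('a, 'm) dgmodule \<Rightarrow> ('a, 'n) dgmodule \<Rightarrow> ('m \<Rightarrow> 'n) \<Rightarrow> ('a, 'n \<times> 'm) dgmodule" where
  "cone M N f = \<lparr>carrier = carrier N \<times> carrier M, monoid.mult = undefined, one = undefined,
     zero = (\<zero>\<^bsub>N\<^esub>, \<zero>\<^bsub>M\<^esub>),
     add = (\<lambda>(n, m) (n', m'). (n \<oplus>\<^bsub>N\<^esub> n', m \<oplus>\<^bsub>M\<^esub> m')),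
     ract = (\<lambda>(n, m) a. (ract N n a, ract M m a)),
     mgr = (\<lambda>i. mgr N i \<times> mgr M (i + 1)),
     mdiff = (\<lambda>(n, m). (mdiff N n \<oplus>\<^bsub>N\<^esub> f m, \<ominus>\<^bsub>M\<^esub> mdiff M m))\<rparr>"

definition dg_submodule :: "('k, 'a) dgalgebra \<Rightarrow> ('a, 'm) dgmodule \<Rightarrow> 'm set \<Rightarrow> bool" where
  "dg_submodule A M N \<longleftrightarrow> N \<subseteq> carrier M \<and>
     dg_module A (M\<lparr>carrier := N, mgr := \<lambda>i. N \<inter> mgr M i\<rparr>)"

text \<open>For dg submodules \<open>N \<subseteq> F\<close> of \<open>M\<close>, the dg module \<open>F/N\<close>, whose elements are the cosets of
  \<open>N\<close> in \<open>F\<close>.\<close>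

definition dg_subquotient ::
    "('a, 'm) dgmodule \<Rightarrow> 'm set \<Rightarrow> 'm set \<Rightarrow> ('a, 'm set) dgmodule" where
  "dg_subquotient M F N = \<lparr>carrier = (\<lambda>x. N +>\<^bsub>M\<^esub> x) ` F,
     monoid.mult = undefined, one = undefined,
     zero = N, add = set_add M,
     ract = (\<lambda>X a. \<Union>x\<in>X. N +>\<^bsub>M\<^esub> ract M x a),
     mgr = (\<lambda>i. (\<lambda>x. N +>\<^bsub>M\<^esub> x) ` (F \<inter> mgr M i)),
     mdiff = (\<lambda>X. \<Union>x\<in>X. N +>\<^bsub>M\<^esub> mdiff M x)\<rparr>"


subsection \<open>Extension of scalars along the inclusion of the degree zero part\<close>

text \<open>For a right module \<open>L\<close> over the degree zero part of \<open>A\<close>, regarded as a dg module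
  concentrated in degree \<open>0\<close>, the dg module \<open>L \<otimes> A\<close> (tensor product over the degree zero part)
  is the free abelian group on pairs \<open>(l, a)\<close> modulo the usual relations, with \<open>l \<otimes> a\<close> in degree
  \<open>i\<close> for \<open>a\<close> of degree \<open>i\<close>, and \<open>d (l \<otimes> a) = l \<otimes> d a\<close>; this is the tensor product differential
  when the degree zero part of \<open>A\<close> and \<open>L\<close> have differential zero.\<close>

definition tensor_relations ::
    "('k, 'a) dgalgebra \<Rightarrow> ('a, 'm) rmodule \<Rightarrow> ('m \<times> 'a \<Rightarrow>\<^sub>0 int) set" where
  "tensor_relations A L =
     {frag_of (l \<oplus>\<^bsub>L\<^esub> l', a) - frag_of (l, a) - frag_of (l', a) | l l' a.
        l \<in> carrier L \<and> l' \<in> carrier L \<and> a \<in> carrier A} \<union>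
     {frag_of (l, a \<oplus>\<^bsub>A\<^esub> a') - frag_of (l, a) - frag_of (l, a') | l a a'.
        l \<in> carrier L \<and> a \<in> carrier A \<and> a' \<in> carrier A} \<union>
     {frag_of (ract L l r, a) - frag_of (l, r \<otimes>\<^bsub>A\<^esub> a) | l r a.
        l \<in> carrier L \<and> r \<in> agr A 0 \<and> a \<in> carrier A}"

definition tensor_free ::
    "('k, 'a) dgalgebra \<Rightarrow> ('a, 'm) rmodule \<Rightarrow> ('m \<times> 'a \<Rightarrow>\<^sub>0 int) monoid" where
  "tensor_free A L = free_Abelian_group (carrier L \<times> carrier A)"

definition tensor_class :: "('k, 'a) dgalgebra \<Rightarrow> ('a, 'm) rmodule \<Rightarrow>
    ('m \<times> 'a \<Rightarrow>\<^sub>0 int) \<Rightarrow> ('m \<times> 'a \<Rightarrow>\<^sub>0 int) set" where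
  "tensor_class A L u =
     generate (tensor_free A L) (tensor_relations A L) #>\<^bsub>tensor_free A L\<^esub> u"

definition induced ::
    "('k, 'a) dgalgebra \<Rightarrow> ('a, 'm) rmodule \<Rightarrow> ('a, ('m \<times> 'a \<Rightarrow>\<^sub>0 int) set) dgmodule" where
  "induced A L = \<lparr>
     carrier = tensor_class A L ` carrier (tensor_free A L),
     monoid.mult = undefined, one = undefined,
     zero = tensor_class A L 0,
     add = set_mult (tensor_free A L),
     ract = (\<lambda>X b. \<Union>u\<in>X. tensor_class A L (frag_extend (\<lambda>(l, a). frag_of (l, a \<otimes>\<^bsub>A\<^esub> b)) u)),
     mgr = (\<lambda>i. tensor_class A L ` carrier (free_Abelian_group (carrier L \<times> agr A i))),
     mdiff = (\<lambda>X. \<Union>u\<in>X. tensor_class A L (frag_extend (\<lambda>(l, a). frag_of (l, adiff A a)) u))\<rparr>"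


section \<open>The category of dg modules and its homotopy category\<close>

definition dg_hom ::
    "('k, 'a) dgalgebra \<Rightarrow> ('a, 'm) dgmodule \<Rightarrow> ('a, 'n) dgmodule \<Rightarrow> ('m \<Rightarrow> 'n) set" where
  "dg_hom A M N = {f \<in> carrier M \<rightarrow>\<^sub>E carrier N.
     (\<forall>x\<in>carrier M. \<forall>y\<in>carrier M. f (x \<oplus>\<^bsub>M\<^esub> y) = f x \<oplus>\<^bsub>N\<^esub> f y) \<and>
     (\<forall>x\<in>carrier M. \<forall>a\<in>carrier A. f (ract M x a) = ract N (f x) a) \<and>
     (\<forall>i. \<forall>x\<in>mgr M i. f x \<in> mgr N i) \<and>
     (\<forall>x\<in>carrier M. f (mdiff M x) = mdiff N (f x))}"

definition dg_homotopy :: "('k, 'a) dgalgebra \<Rightarrow> ('a, 'm) dgmodule \<Rightarrow> ('a, 'n) dgmodule \<Rightarrow>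
    ('m \<Rightarrow> 'n) \<Rightarrow> bool" where
  "dg_homotopy A M N h \<longleftrightarrow> h \<in> carrier M \<rightarrow> carrier N \<and>
     (\<forall>x\<in>carrier M. \<forall>y\<in>carrier M. h (x \<oplus>\<^bsub>M\<^esub> y) = h x \<oplus>\<^bsub>N\<^esub> h y) \<and>
     (\<forall>x\<in>carrier M. \<forall>a\<in>carrier A. h (ract M x a) = ract N (h x) a) \<and>
     (\<forall>i. \<forall>x\<in>mgr M i. h x \<in> mgr N (i - 1))"

definition homotopy_rel :: "('k, 'a) dgalgebra \<Rightarrow> ('a, 'm) dgmodule \<Rightarrow> ('a, 'n) dgmodule \<Rightarrow>
    (('m \<Rightarrow> 'n) \<times> ('m \<Rightarrow> 'n)) set" where
  "homotopy_rel A M N = {(f, g). f \<in> dg_hom A M N \<and> g \<in> dg_hom A M N \<and>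
     (\<exists>h. dg_homotopy A M N h \<and>
       (\<forall>x\<in>carrier M. f x \<ominus>\<^bsub>N\<^esub> g x = mdiff N (h x) \<oplus>\<^bsub>N\<^esub> h (mdiff M x)))}"

definition hom_id :: "('a, 'm) dgmodule \<Rightarrow> 'm \<Rightarrow> 'm" where
  "hom_id M = (\<lambda>x\<in>carrier M. x)"

definition hom_zero :: "('a, 'm) dgmodule \<Rightarrow> ('a, 'n) dgmodule \<Rightarrow> 'm \<Rightarrow> 'n" where
  "hom_zero M N = (\<lambda>x\<in>carrier M. \<zero>\<^bsub>N\<^esub>)"

definition hom_plus ::
    "('a, 'm) dgmodule \<Rightarrow> ('a, 'n) dgmodule \<Rightarrow> ('m \<Rightarrow> 'n) \<Rightarrow> ('m \<Rightarrow> 'n) \<Rightarrow> 'm \<Rightarrow> 'n" where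
  "hom_plus M N f g = (\<lambda>x\<in>carrier M. f x \<oplus>\<^bsub>N\<^esub> g x)"

text \<open>All modules of the following categories are carried by subsets of a fixed type \<open>'m\<close>, which
  serves as the universe. If \<open>'m\<close> is infinite and \<open>A\<close> embeds into it, then up to isomorphism these
  categories contain \<open>A\<close> and are closed under the finite constructions used below (cones, direct
  sums, subquotients).\<close>

definition dgMod :: "('k, 'a) dgalgebra \<Rightarrow> (('a, 'm) dgmodule, 'm \<Rightarrow> 'm) precat" where
  "dgMod A = \<lparr>Obj = {M. dg_module A M}, Mor = dg_hom A,
     Comp = (\<lambda>X Y Z g f. compose (carrier X) g f), Ident = hom_id,
     Plus = hom_plus, Zero = hom_zero\<rparr>"

definition dgHot :: "('k, 'a) dgalgebra \<Rightarrow> (('a, 'm) dgmodule, ('m \<Rightarrow> 'm) set) precat" where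
  "dgHot A = \<lparr>Obj = {M. dg_module A M},
     Mor = (\<lambda>X Y. dg_hom A X Y // homotopy_rel A X Y),
     Comp = (\<lambda>X Y Z G F. \<Union>g\<in>G. \<Union>f\<in>F. homotopy_rel A X Z `` {compose (carrier X) g f}),
     Ident = (\<lambda>X. homotopy_rel A X X `` {hom_id X}),
     Plus = (\<lambda>X Y F G. \<Union>f\<in>F. \<Union>g\<in>G. homotopy_rel A X Y `` {hom_plus X Y f g}),
     Zero = (\<lambda>X Y. homotopy_rel A X Y `` {hom_zero X Y})\<rparr>"

text \<open>Isomorphism in \<open>dgMod\<close> and in \<open>dgHot\<close> for dg modules that are possibly carried by different
  types.\<close>

definition dg_iso :: "('k, 'a) dgalgebra \<Rightarrow> ('a, 'm) dgmodule \<Rightarrow> ('a, 'n) dgmodule \<Rightarrow> bool" where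
  "dg_iso A M N \<longleftrightarrow> (\<exists>f\<in>dg_hom A M N. \<exists>g\<in>dg_hom A N M.
     compose (carrier M) g f = hom_id M \<and> compose (carrier N) f g = hom_id N)"

definition homotopy_equivalent ::
    "('k, 'a) dgalgebra \<Rightarrow> ('a, 'm) dgmodule \<Rightarrow> ('a, 'n) dgmodule \<Rightarrow> bool" where
  "homotopy_equivalent A M N \<longleftrightarrow> (\<exists>f\<in>dg_hom A M N. \<exists>g\<in>dg_hom A N M.
     (compose (carrier M) g f, hom_id M) \<in> homotopy_rel A M M \<and>
     (compose (carrier N) f g, hom_id N) \<in> homotopy_rel A N N)"


section \<open>The categories dgPer and dgFilt\<close>

text \<open>The object sets of strictly full triangulated subcategories of \<open>dgHot\<close>. Every distinguished
  triangle is isomorphic to one coming from the cone of a morphism of dg modules.\<close>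

definition triangulated_subcategory ::
    "('k, 'a) dgalgebra \<Rightarrow> ('a, 'm) dgmodule set \<Rightarrow> bool" where
  "triangulated_subcategory A T \<longleftrightarrow> T \<subseteq> {M. dg_module A M} \<and>
     (\<forall>Z. zero_object (dgHot A) Z \<longrightarrow> Z \<in> T) \<and>
     (\<forall>M\<in>T. \<forall>N. dg_module A N \<and> isomorphic (dgHot A) M N \<longrightarrow> N \<in> T) \<and>
     (\<forall>M\<in>T. \<forall>l. shift l M \<in> T) \<and>
     (\<forall>M\<in>T. \<forall>N\<in>T. \<forall>f\<in>dg_hom A M N. \<forall>C.
        dg_module A C \<and> homotopy_equivalent A C (cone M N f) \<longrightarrow> C \<in> T)"

definition closed_under_summands ::
    "('k, 'a) dgalgebra \<Rightarrow> ('a, 'm) dgmodule set \<Rightarrow> bool" where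
  "closed_under_summands A T \<longleftrightarrow>
     (\<forall>P\<in>T. \<forall>X Y. is_direct_sum (dgHot A) P [X, Y] \<longrightarrow> X \<in> T)"

definition contains_regular :: "('k, 'a) dgalgebra \<Rightarrow> ('a, 'm) dgmodule set \<Rightarrow> bool" where
  "contains_regular A T \<longleftrightarrow>
     (\<forall>P. dg_module A P \<and> homotopy_equivalent A P (regular_dgmodule A) \<longrightarrow> P \<in> T)"

definition per_objects :: "('k, 'a) dgalgebra \<Rightarrow> ('a, 'm) dgmodule set" where
  "per_objects A =
     \<Inter> {T. triangulated_subcategory A T \<and> closed_under_summands A T \<and> contains_regular A T}"

definition dgPer :: "('k, 'a) dgalgebra \<Rightarrow> (('a, 'm) dgmodule, ('m \<Rightarrow> 'm) set) precat" where
  "dgPer A = full_subcat (dgHot A) (per_objects A)"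

definition filt_objects ::
    "('k, 'a) dgalgebra \<Rightarrow> 'x set \<Rightarrow> ('x \<Rightarrow> ('a, 'm) rmodule) \<Rightarrow> ('a, 'm) dgmodule set" where
  "filt_objects A W L = {M. dg_module A M \<and>
     (\<exists>(n::nat) F l x.
        F 0 = {\<zero>\<^bsub>M\<^esub>} \<and> F n = carrier M \<and>
        (\<forall>i\<le>n. dg_submodule A M (F i)) \<and>
        (\<forall>i\<in>{1..n}. F (i - 1) \<subseteq> F i) \<and>
        (\<forall>i\<in>{1..n}. \<forall>j\<in>{1..n}. i \<le> j \<longrightarrow> l j \<le> l i) \<and>
        (\<forall>i\<in>{1..n}. x i \<in> W \<and>
           dg_iso A (dg_subquotient M (F i) (F (i - 1))) (shift (l i) (induced A (L (x i))))))}"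

definition dgFilt :: "('k, 'a) dgalgebra \<Rightarrow> 'x set \<Rightarrow> ('x \<Rightarrow> ('a, 'm) rmodule) \<Rightarrow>
    (('a, 'm) dgmodule, ('m \<Rightarrow> 'm) set) precat" where
  "dgFilt A W L = full_subcat (dgHot A) (filt_objects A W L)"

definition iso_or_nilpotent_endos :: "('o, 'f) precat \<Rightarrow> 'o \<Rightarrow> bool" where
  "iso_or_nilpotent_endos C M \<longleftrightarrow>
     (\<forall>f\<in>Mor C M M. is_iso_mor C M M f \<or> nilpotent (end_ring C M) f) \<and>
     ideal {f \<in> Mor C M M. nilpotent (end_ring C M) f} (end_ring C M)"

end

theory Submission
  imports Defs
begin

text \<open>The degree zero part of \<open>A\<close> is semisimple and has differential zero, so a dg module in dgFilt is
  built from cells \<open>e A\<close> (with \<open>e\<close> a primitive idempotent of degree zero) attached in increasing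
  degree. Since \<open>A\<close> vanishes in negative degrees, an endomorphism acts on the cells of lowest degree
  through matrices over division rings, whence Fitting's lemma: some power of an endomorphism \<open>f\<close> of
  \<open>M\<close> splits \<open>M\<close> into a part where \<open>f\<close> is invertible and a part where \<open>f\<close> is nilpotent, and both parts
  are again in dgFilt. A null-homotopic endomorphism lowers the degree of cells and is nilpotent, so
  only the zero object of dgFilt is contractible.

  The dg modules that are homotopy retracts of objects of dgFilt form a thick triangulated subcategory
  containing \<open>A\<close>: for the cone of a map between objects of dgFilt one attaches the cells one
  at a time, and a cell whose boundary hits a cell of higher degree cancels against it. Homotopy
  idempotents of objects of dgFilt split by Fitting's lemma, so every object of dgPer is homotopy
  equivalent to one of dgFilt, to which (a), (b) and (c) are transferred.\<close>

section \<open>Internal direct sums\<close>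

text \<open>An object of dgFilt need not have finite length over \<open>A\<close>, and an
  endomorphism need not respect a given filtration. What replaces length is the sorted list of
  degrees of the cells: by \<open>exchange\<close>, an element of lowest degree whose boundary lies
  in the submodule already built can take the place of a cell of that degree without changing the
  list. This is a Steinitz exchange, in which Schur's lemma for the simple modules e A^0
  (\<open>prim_inverse\<close>) supplies the inverses. Filtrations can thus be adapted to an
  endomorphism or an idempotent, and the inductions run over the list.

  In dgHot one works with homotopy retracts (\<open>dominated\<close>) rather than equivalences. A
  retract involves only one composite, passes through cones on either side by explicit formulas, and
  is inherited by direct summands at once; strict models return in \<open>filt_replacement\<close>.
  Cones live on product types, hence \<open>transport\<close> and the injections
  \<open>\<rho>\<close> and \<open>\<sigma>\<close> that carry modules back to the universe
  \<open>'m\<close>.\<close>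

definition addmap :: "('a, 'y) ring_scheme \<Rightarrow> ('b, 'z) ring_scheme \<Rightarrow> ('a \<Rightarrow> 'b) \<Rightarrow> bool" where
  "addmap G H f \<longleftrightarrow> f \<in> carrier G \<rightarrow> carrier H \<and>
     (\<forall>x\<in>carrier G. \<forall>y\<in>carrier G. f (x \<oplus>\<^bsub>G\<^esub> y) = f x \<oplus>\<^bsub>H\<^esub> f y)"

lemma addmapI:
  assumes "\<And>x. x \<in> carrier G ==> f x \<in> carrier H"
    and "\<And>x y. [|x \<in> carrier G; y \<in> carrier G|] ==> f (x \<oplus>\<^bsub>G\<^esub> y) = f x \<oplus>\<^bsub>H\<^esub> f y"
  shows "addmap G H f"
  using assms by (auto simp: addmap_def)

lemma addmap_closed: "[|addmap G H f; x \<in> carrier G|] ==> f x \<in> carrier H"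
  by (auto simp: addmap_def)

lemma addmap_add: "[|addmap G H f; x \<in> carrier G; y \<in> carrier G|] ==> f (x \<oplus>\<^bsub>G\<^esub> y) = f x \<oplus>\<^bsub>H\<^esub> f y"
  by (auto simp: addmap_def)

lemma (in abelian_group) idem_zero:
  assumes "x \<in> carrier G" "x \<oplus> x = x" shows "x = \<zero>"
  using assms by (metis add.r_cancel_one')

lemma addmap_zero:
  assumes "abelian_group G" "abelian_group H" "addmap G H f"
  shows "f (zero G) = (zero H)"
proof -
  interpret G: abelian_group G by fact
  interpret H: abelian_group H by fact
  have "f (zero G) \<oplus>\<^bsub>H\<^esub> f (zero G) = f (zero G)" using addmap_add[OF assms(3), of "zero G" "zero G"] by simp
  thus ?thesis using H.idem_zero addmap_closed[OF assms(3)] by simp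
qed

lemma addmap_minus:
  assumes "abelian_group G" "abelian_group H" "addmap G H f" "x \<in> carrier G"
  shows "f (\<ominus>\<^bsub>G\<^esub> x) = \<ominus>\<^bsub>H\<^esub> f x"
proof -
  interpret G: abelian_group G by fact
  interpret H: abelian_group H by fact
  have "f (\<ominus>\<^bsub>G\<^esub> x) \<oplus>\<^bsub>H\<^esub> f x = (zero H)"
    using addmap_add[OF assms(3), of "\<ominus>\<^bsub>G\<^esub> x" x] assms addmap_zero[OF assms(1-3)] by (simp add: G.l_neg)
  thus ?thesis using assms addmap_closed[OF assms(3)] by (metis G.a_inv_closed H.minus_equality)
qed

lemma addmap_diff:
  assumes "abelian_group G" "abelian_group H" "addmap G H f" "x \<in> carrier G" "y \<in> carrier G"
  shows "f (x \<ominus>\<^bsub>G\<^esub> y) = f x \<ominus>\<^bsub>H\<^esub> f y"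
  using assms by (simp add: a_minus_def addmap_add addmap_minus abelian_group.a_inv_closed)

lemma addmap_comp: "[|addmap G H f; addmap H J g|] ==> addmap G J (\<lambda>x. g (f x))"
  by (auto simp: addmap_def Pi_iff)

lemma addmap_finsum:
  assumes "abelian_group G" "abelian_group H" "addmap G H f" "finite J" "c \<in> J \<rightarrow> carrier G"
  shows "f (finsum G c J) = finsum H (\<lambda>i. f (c i)) J"
  using assms(4,5)
proof (induction J)
  case empty
  thus ?case using addmap_zero[OF assms(1-3)]
    by (simp add: abelian_monoid.finsum_empty assms abelian_group.axioms)
next
  case (insert i J)
  interpret G: abelian_group G by fact
  interpret H: abelian_group H by fact
  have "(\<lambda>i. f (c i)) \<in> J \<rightarrow> carrier H" "f (c i) \<in> carrier H"
    using insert.prems addmap_closed[OF assms(3)] by auto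
  moreover have "c \<in> J \<rightarrow> carrier G" "c i \<in> carrier G" using insert.prems by auto
  ultimately show ?case using insert.hyps insert.IH addmap_add[OF assms(3)] by simp
qed

definition dcomp :: "('a, 'z) ring_scheme \<Rightarrow> 'i set \<Rightarrow> ('i \<Rightarrow> 'a set) \<Rightarrow> 'i \<Rightarrow> 'a \<Rightarrow> 'a" where
  "dcomp G I S i x = (THE c. c \<in> (\<Pi>\<^sub>E i\<in>I. S i) \<and> finite {i\<in>I. c i \<noteq> (zero G)} \<and>
        x = finsum G c {i\<in>I. c i \<noteq> (zero G)}) i"

locale int_sum = abelian_group G for G :: "('a, 'z) ring_scheme" (structure) +
  fixes I :: "'i set" and S :: "'i \<Rightarrow> 'a set"
  assumes ids: "internal_direct_sum G I S"
begin

lemma S_subgroup: "i \<in> I ==> additive_subgroup (S i) G"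
  using ids by (simp add: internal_direct_sum_def)

lemma S_carrier: "i \<in> I ==> x \<in> S i ==> x \<in> carrier G"
  using additive_subgroup.a_subset[OF S_subgroup] by blast

lemma S_zero: "i \<in> I ==> \<zero> \<in> S i"
  using additive_subgroup.zero_closed[OF S_subgroup] .

lemma S_add: "[|i \<in> I; x \<in> S i; y \<in> S i|] ==> x \<oplus> y \<in> S i"
  using additive_subgroup.a_closed[OF S_subgroup] .

abbreviation "dc \<equiv> dcomp G I S"

lemma dcomp_spec:
  assumes "x \<in> carrier G"
  shows "i \<in> I ==> dc i x \<in> S i" "finite {i\<in>I. dc i x \<noteq> \<zero>}"
    "x = finsum G (\<lambda>i. dc i x) {i\<in>I. dc i x \<noteq> \<zero>}"
proof -
  let ?P = "\<lambda>c. c \<in> (\<Pi>\<^sub>E i\<in>I. S i) \<and> finite {i\<in>I. c i \<noteq> \<zero>} \<and> x = finsum G c {i\<in>I. c i \<noteq> \<zero>}"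
  have "\<exists>!c. ?P c" using ids assms by (simp add: internal_direct_sum_def)
  from theI'[OF this] have *: "?P (THE c. ?P c)" .
  have eq: "(THE c. ?P c) = (\<lambda>i. dc i x)" by (simp add: dcomp_def fun_eq_iff)
  show "i \<in> I ==> dc i x \<in> S i" "finite {i\<in>I. dc i x \<noteq> \<zero>}"
    "x = finsum G (\<lambda>i. dc i x) {i\<in>I. dc i x \<noteq> \<zero>}"
    using * unfolding eq by blast+
qed

text \<open>Uniqueness of the decomposition in a flexible form: \<open>c\<close> need not be
  extensional and \<open>J\<close> may exceed its support. Restricting \<open>c\<close> to
  \<open>I\<close> and dropping the zero terms gives the family in the definition of
  \<open>dcomp\<close>.\<close>

lemma dcomp_eqI:
  assumes c: "\<And>i. i \<in> I ==> c i \<in> S i" and J: "finite J" "J \<subseteq> I"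
    and 0: "\<And>i. i \<in> I ==> i \<notin> J ==> c i = \<zero>" and x: "x = finsum G c J" and i: "i \<in> I"
  shows "dc i x = c i"
proof -
  let ?P = "\<lambda>c. c \<in> (\<Pi>\<^sub>E i\<in>I. S i) \<and> finite {i\<in>I. c i \<noteq> \<zero>} \<and> x = finsum G c {i\<in>I. c i \<noteq> \<zero>}"
  have cG: "\<And>i. i \<in> I ==> c i \<in> carrier G" using c S_carrier by blast
  have cc: "c \<in> J \<rightarrow> carrier G" using cG J by blast
  have xc: "x \<in> carrier G" using x cc by simp
  have u: "\<exists>!c. ?P c" using ids xc by (simp add: internal_direct_sum_def)
  have fin: "finite {i\<in>I. c i \<noteq> \<zero>}" by (rule finite_subset[OF _ J(1)]) (use 0 in auto)
  have eq: "{i\<in>I. restrict c I i \<noteq> \<zero>} = {i\<in>I. c i \<noteq> \<zero>}" by auto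
  have "finsum G c J = finsum G c {i\<in>I. c i \<noteq> \<zero>}"
    by (rule add.finprod_mono_neutral_cong_right) (use J 0 cG in auto)
  also have "\<dots> = finsum G (restrict c I) {i\<in>I. c i \<noteq> \<zero>}"
    by (rule finsum_cong') (use cG in auto)
  finally have "?P (restrict c I)" using fin c x eq by (auto simp: PiE_iff)
  hence "(THE c. ?P c) = restrict c I" using u by (intro the1_equality)
  thus ?thesis using i unfolding dcomp_def by simp
qed

lemma dcomp_mem:
  assumes "i \<in> I" "j \<in> I" "x \<in> S j"
  shows "dc i x = (if i = j then x else \<zero>)"
proof (rule dcomp_eqI[where J = "{j}", OF _ _ _ _ _ assms(1)])
  show "x = finsum G (\<lambda>i. if i = j then x else \<zero>) {j}" using S_carrier[OF assms(2,3)] by simp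
qed (use assms S_zero in auto)

lemma dcomp_add:
  assumes "i \<in> I" "x \<in> carrier G" "y \<in> carrier G"
  shows "dc i (x \<oplus> y) = dc i x \<oplus> dc i y"
proof (rule dcomp_eqI[where J = "{i\<in>I. dc i x \<noteq> \<zero>} \<union> {i\<in>I. dc i y \<noteq> \<zero>}", OF _ _ _ _ _ assms(1)])
  let ?J = "{i\<in>I. dc i x \<noteq> \<zero>} \<union> {i\<in>I. dc i y \<noteq> \<zero>}"
  note sx = dcomp_spec[OF assms(2)] and sy = dcomp_spec[OF assms(3)]
  have f: "finite ?J" using sx(2) sy(2) by simp
  have xG: "\<And>i. i \<in> I ==> dc i x \<in> carrier G" and yG: "\<And>i. i \<in> I ==> dc i y \<in> carrier G"
    using sx(1) sy(1) S_carrier by blast+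
  have "x = finsum G (\<lambda>i. dc i x) ?J"
    by (subst sx(3), rule add.finprod_mono_neutral_cong_left) (use f xG in auto)
  moreover have "y = finsum G (\<lambda>i. dc i y) ?J"
    by (subst sy(3), rule add.finprod_mono_neutral_cong_left) (use f yG in auto)
  moreover have "finsum G (\<lambda>i. dc i x \<oplus> dc i y) ?J = finsum G (\<lambda>i. dc i x) ?J \<oplus> finsum G (\<lambda>i. dc i y) ?J"
    by (rule finsum_addf) (use xG yG in auto)
  ultimately show "x \<oplus> y = finsum G (\<lambda>i. dc i x \<oplus> dc i y) ?J" by simp
  show "finite ?J" by (rule f)
  show "dc i x \<oplus> dc i y \<in> S i" if "i \<in> I" for i
    using that S_add dcomp_spec(1) assms by blast
qed auto

lemma dcomp_addmap: "i \<in> I ==> addmap G G (dc i)"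
  by (rule addmapI) (simp_all add: dcomp_add S_carrier[OF _ dcomp_spec(1)])

lemma int_sum_induct [consumes 1, case_names zero hom add]:
  assumes "x \<in> carrier G" and "P \<zero>"
    and "\<And>i x. [|i \<in> I; x \<in> S i|] ==> P x"
    and "\<And>x y. [|x \<in> carrier G; y \<in> carrier G; P x; P y|] ==> P (x \<oplus> y)"
  shows "P x"
proof -
  note s = dcomp_spec[OF assms(1)]
  have sG: "\<And>i. i \<in> I ==> dc i x \<in> carrier G" using s(1) S_carrier by blast
  have "finite J ==> J \<subseteq> I ==> P (finsum G (\<lambda>i. dc i x) J)" for J
  proof (induction J rule: finite_induct)
    case (insert i J)
    have "dc i x \<in> carrier G" "(\<lambda>i. dc i x) \<in> J \<rightarrow> carrier G" using insert.prems sG by auto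
    thus ?case using insert s assms(3)[of i "dc i x"] by (simp add: assms(4))
  qed (simp add: assms(2))
  from this[of "{i\<in>I. dc i x \<noteq> \<zero>}"] show ?thesis using s by auto
qed

end

text \<open>Finite sums built one homogeneous term at a time, so that generation by the
  \<open>S i\<close> can be shown by induction, without exhibiting a finitely supported
  family.\<close>

inductive_set hspan :: "('a, 'z) ring_scheme \<Rightarrow> 'i set \<Rightarrow> ('i \<Rightarrow> 'a set) \<Rightarrow> 'a set"
  for G :: "('a, 'z) ring_scheme" and I and S where
  zero: "(zero G) \<in> hspan G I S"
| step: "[|i \<in> I; x \<in> S i; y \<in> hspan G I S|] ==> x \<oplus>\<^bsub>G\<^esub> y \<in> hspan G I S"

lemma (in abelian_group) hspan_add:
  assumes S: "\<And>i. i \<in> I ==> additive_subgroup (S i) G"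
    and "x \<in> hspan G I S" "y \<in> hspan G I S"
  shows "x \<oplus> y \<in> hspan G I S \<and> x \<in> carrier G"
proof -
  have Sc: "i \<in> I ==> z \<in> S i ==> z \<in> carrier G" for i z
    using S additive_subgroup.a_subset by blast
  have c: "z \<in> hspan G I S ==> z \<in> carrier G" for z
    by (induction rule: hspan.induct) (blast intro: Sc a_closed zero_closed)+
  show ?thesis using assms(2,3)
  proof (induction rule: hspan.induct)
    case zero
    thus ?case using c by simp
  next
    case (step i x z)
    hence "x \<oplus> (z \<oplus> y) \<in> hspan G I S" by (meson hspan.step)
    thus ?case using Sc[OF step(1,2)] c[OF step(3)] c[OF assms(3)] by (simp add: a_assoc)
  qed
qed

text \<open>The projections \<open>p i\<close> serve twice: the values \<open>p i x\<close> are the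
  required family, and applied to any other finite sum with value \<open>x\<close> they return its
  terms, which gives uniqueness.\<close>

lemma (in abelian_group) internal_direct_sumI:
  assumes S: "\<And>i. i \<in> I ==> additive_subgroup (S i) G"
    and p: "\<And>i. i \<in> I ==> addmap G G (p i)"
    and pS: "\<And>i j x. [|i \<in> I; j \<in> I; x \<in> S j|] ==> p i x = (if i = j then x else \<zero>)"
    and span: "\<And>x. x \<in> carrier G ==> x \<in> hspan G I S"
  shows "internal_direct_sum G I S"
  unfolding internal_direct_sum_def
proof (intro conjI ballI S)
  fix x assume xG: "x \<in> carrier G"
  have Sc: "i \<in> I ==> z \<in> S i ==> z \<in> carrier G" for i z
    using S additive_subgroup.a_subset by blast
  have S0: "i \<in> I ==> \<zero> \<in> S i" for i using S additive_subgroup.zero_closed by metis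
  have Sa: "i \<in> I ==> z \<in> S i ==> w \<in> S i ==> z \<oplus> w \<in> S i" for i z w
    using additive_subgroup.a_closed[OF S] .
  have hc: "z \<in> hspan G I S ==> z \<in> carrier G" for z
    by (induction rule: hspan.induct) (blast intro: Sc a_closed zero_closed)+
  have p0: "i \<in> I ==> p i \<zero> = \<zero>" for i
    using addmap_zero[OF abelian_group_axioms abelian_group_axioms p] .
  \<comment> \<open>A finite \<open>J\<close> outside which all components vanish is carried along;
    the support itself may shrink when terms cancel.\<close>
  have ex: "\<exists>J. finite J \<and> J \<subseteq> I \<and> (\<forall>i\<in>I. p i x \<in> S i) \<and> (\<forall>i\<in>I - J. p i x = \<zero>) \<and>
      x = finsum G (\<lambda>i. p i x) J"
    using span[OF xG]
  proof (induction rule: hspan.induct)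
    case zero
    show ?case by (rule exI[of _ "{}"]) (auto simp: p0 S0)
  next
    case (step k z y)
    then obtain J where J: "finite J" "J \<subseteq> I" "\<forall>i\<in>I. p i y \<in> S i" "\<forall>i\<in>I - J. p i y = \<zero>"
      "y = finsum G (\<lambda>i. p i y) J" by blast
    have zc: "z \<in> carrier G" and yc: "y \<in> carrier G" using step Sc hc by auto
    have pz: "i \<in> I ==> p i (z \<oplus> y) = (if i = k then z else \<zero>) \<oplus> p i y" for i
      using addmap_add[OF p zc yc] pS step by simp
    let ?J = "insert k J"
    have pc: "(\<lambda>i. p i y) \<in> ?J \<rightarrow> carrier G" using J(2) step(1) addmap_closed[OF p yc] by auto
    have "y = finsum G (\<lambda>i. p i y) ?J"
      by (subst J(5), rule add.finprod_mono_neutral_cong_left) (use J(1,2,4) pc step(1) in auto)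
    moreover have "finsum G (\<lambda>i. if i = k then z else \<zero>) ?J = finsum G (\<lambda>i. z) {k}"
      by (rule add.finprod_mono_neutral_cong_right) (use J(1) zc in auto)
    moreover have "finsum G (\<lambda>i. p i (z \<oplus> y)) ?J = finsum G (\<lambda>i. (if i = k then z else \<zero>) \<oplus> p i y) ?J"
      by (rule finsum_cong') (use J(2) pz pc zc step(1) in auto)
    moreover have "\<dots> = finsum G (\<lambda>i. if i = k then z else \<zero>) ?J \<oplus> finsum G (\<lambda>i. p i y) ?J"
      by (rule finsum_addf) (use zc pc in auto)
    ultimately have "z \<oplus> y = finsum G (\<lambda>i. p i (z \<oplus> y)) ?J" using zc by simp
    moreover have "\<forall>i\<in>I. p i (z \<oplus> y) \<in> S i" using J(3) step(2) pz S0 Sa by simp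
    moreover have "\<forall>i\<in>I - ?J. p i (z \<oplus> y) = \<zero>" using J(4) pz by simp
    ultimately show ?case using J(1,2) step(1) by (intro exI[of _ ?J]) blast
  qed
  then obtain J where J: "finite J" "J \<subseteq> I" "\<forall>i\<in>I. p i x \<in> S i" "\<forall>i\<in>I - J. p i x = \<zero>"
      "x = finsum G (\<lambda>i. p i x) J" by blast
  let ?P = "\<lambda>c. c \<in> (\<Pi>\<^sub>E i\<in>I. S i) \<and> finite {i\<in>I. c i \<noteq> \<zero>} \<and> x = finsum G c {i\<in>I. c i \<noteq> \<zero>}"
  show "\<exists>!c. ?P c"
  proof (rule ex1I)
    let ?c = "restrict (\<lambda>i. p i x) I"
    have eq: "{i\<in>I. ?c i \<noteq> \<zero>} = {i\<in>I. p i x \<noteq> \<zero>}" by auto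
    have "finsum G (\<lambda>i. p i x) J = finsum G ?c {i\<in>I. p i x \<noteq> \<zero>}"
      by (rule add.finprod_mono_neutral_cong_right) (use J(1,2,4) addmap_closed[OF p xG] in auto)
    moreover have "finite {i\<in>I. p i x \<noteq> \<zero>}" by (rule finite_subset[OF _ J(1)]) (use J in auto)
    ultimately show "?P ?c" using J eq by (auto simp: PiE_iff)
  next
    fix c assume c: "?P c"
    let ?K = "{i\<in>I. c i \<noteq> \<zero>}"
    have cS: "i \<in> I ==> c i \<in> S i" for i using c by (auto simp: PiE_iff)
    have cG: "i \<in> I ==> c i \<in> carrier G" for i using cS Sc by blast
    have "p i x = c i" if i: "i \<in> I" for i
    proof -
      have "p i (finsum G c ?K) = finsum G (\<lambda>j. p i (c j)) ?K"
        by (rule addmap_finsum[OF abelian_group_axioms abelian_group_axioms p[OF i]]) (use c cG in auto)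
      also have "\<dots> = finsum G (\<lambda>j. if i = j then c j else \<zero>) ?K"
        by (rule finsum_cong') (use cG pS[OF i _ cS] in auto)
      also have "\<dots> = c i"
      proof (cases "c i = \<zero>")
        case True
        have "finsum G (\<lambda>j. if i = j then c j else \<zero>) ?K = finsum G (\<lambda>j. \<zero>) ?K"
          by (rule finsum_cong') (use True in auto)
        thus ?thesis using True by simp
      next
        case False
        have "finsum G (\<lambda>j. if i = j then c j else \<zero>) ?K = finsum G (\<lambda>j. c i) {i}"
          by (rule add.finprod_mono_neutral_cong_right) (use c cG i False in auto)
        thus ?thesis using cG[OF i] by simp
      qed
      finally show ?thesis using c by simp
    qed
    thus "c = restrict (\<lambda>i. p i x) I"
      using c by (intro ext) (auto simp: PiE_iff extensional_def)
  qed
qed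

section \<open>Dg modules and homogeneous components\<close>

definition hc :: "('a, 'm) dgmodule \<Rightarrow> int \<Rightarrow> 'm \<Rightarrow> 'm" where
  "hc M = dcomp M UNIV (mgr M)"

context dg_module
begin

lemma int_sum_M: "int_sum M UNIV (mgr M)"
  using mgr_sum M.abelian_group_axioms by (simp add: int_sum_def int_sum_axioms_def)

lemma mgr_carrier: "x \<in> mgr M i ==> x \<in> carrier M"
  using int_sum.S_carrier[OF int_sum_M] by simp

lemma mgr_zero: "(zero M) \<in> mgr M i"
  using int_sum.S_zero[OF int_sum_M] by simp

lemma mgr_add: "[|x \<in> mgr M i; y \<in> mgr M i|] ==> x \<oplus>\<^bsub>M\<^esub> y \<in> mgr M i"
  using int_sum.S_add[OF int_sum_M] by simp

lemma mgr_subgroup: "additive_subgroup (mgr M i) M"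
  using int_sum.S_subgroup[OF int_sum_M] by simp

lemma mgr_minus: "x \<in> mgr M i ==> \<ominus>\<^bsub>M\<^esub> x \<in> mgr M i"
  using additive_subgroup.a_inv_closed[OF mgr_subgroup] .

lemma mgr_diff: "[|x \<in> mgr M i; y \<in> mgr M i|] ==> x \<ominus>\<^bsub>M\<^esub> y \<in> mgr M i"
  by (simp add: a_minus_def mgr_add mgr_minus)

lemma hc_mgr: "x \<in> carrier M ==> hc M i x \<in> mgr M i"
  using int_sum.dcomp_spec(1)[OF int_sum_M] by (simp add: hc_def)

lemma hc_closed: "x \<in> carrier M ==> hc M i x \<in> carrier M"
  by (rule mgr_carrier[OF hc_mgr])

lemma hc_hom: "x \<in> mgr M j ==> hc M i x = (if i = j then x else (zero M))"
  using int_sum.dcomp_mem[OF int_sum_M] by (simp add: hc_def)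

lemma hc_addmap: "addmap M M (hc M i)"
  using int_sum.dcomp_addmap[OF int_sum_M] by (simp add: hc_def)

lemma hc_add: "[|x \<in> carrier M; y \<in> carrier M|] ==> hc M i (x \<oplus>\<^bsub>M\<^esub> y) = hc M i x \<oplus>\<^bsub>M\<^esub> hc M i y"
  by (rule addmap_add[OF hc_addmap])

lemma homog_induct [consumes 1, case_names zero hom add]:
  assumes "x \<in> carrier M" and "P (zero M)" and "\<And>i x. x \<in> mgr M i ==> P x"
    and "\<And>x y. [|x \<in> carrier M; y \<in> carrier M; P x; P y|] ==> P (x \<oplus>\<^bsub>M\<^esub> y)"
  shows "P x"
proof (rule int_sum.int_sum_induct[OF int_sum_M assms(1), of P])
  show "P x" if "x \<in> mgr M i" for i x using that by (rule assms(3))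
  show "P (x \<oplus>\<^bsub>M\<^esub> y)" if "x \<in> carrier M" "y \<in> carrier M" "P x" "P y" for x y using that by (rule assms(4))
qed (rule assms(2))

lemma hc_all_imp:
  assumes "x \<in> carrier M" "\<And>i. hc M i x \<in> N" "(zero M) \<in> N" "N \<subseteq> carrier M"
    "\<And>x y. x \<in> N ==> y \<in> N ==> x \<oplus>\<^bsub>M\<^esub> y \<in> N"
  shows "x \<in> N"
proof -
  note s = int_sum.dcomp_spec[OF int_sum_M assms(1), folded hc_def]
  have "finite J ==> finsum M (\<lambda>i. hc M i x) J \<in> N" for J
  proof (induction J rule: finite_induct)
    case (insert i J)
    thus ?case using assms(2,4,5) by (subst M.finsum_insert) auto
  qed (simp add: assms)
  from this[OF s(2)] show ?thesis using s(3) by simp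
qed

lemma ract_zero_l: "a \<in> carrier A ==> ract M (zero M) a = (zero M)"
  by (rule M.idem_zero) (simp_all add: ract_closed flip: ract_l_distr)

lemma ract_zero_r: "m \<in> carrier M ==> ract M m (zero A) = (zero M)"
  by (rule M.idem_zero) (simp_all add: ract_closed flip: ract_r_distr)

lemma ract_addmap_l: "a \<in> carrier A ==> addmap M M (\<lambda>m. ract M m a)"
  by (rule addmapI) (simp_all add: ract_closed ract_l_distr)

lemma ract_addmap_r: "m \<in> carrier M ==> addmap A M (ract M m)"
  by (rule addmapI) (simp_all add: ract_closed ract_r_distr)

lemma mdiff_addmap: "addmap M M (mdiff M)"
  by (rule addmapI) (simp_all add: mdiff_closed mdiff_add)

lemma ract_minus_l: "[|a \<in> carrier A; m \<in> carrier M|] ==> ract M (\<ominus>\<^bsub>M\<^esub> m) a = \<ominus>\<^bsub>M\<^esub> ract M m a"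
  using addmap_minus[OF M.abelian_group_axioms M.abelian_group_axioms ract_addmap_l] .

lemma ract_minus_r: "[|a \<in> carrier A; m \<in> carrier M|] ==> ract M m (\<ominus>\<^bsub>A\<^esub> a) = \<ominus>\<^bsub>M\<^esub> ract M m a"
  using addmap_minus[OF R.abelian_group_axioms M.abelian_group_axioms ract_addmap_r] .

lemma ract_diff_l: "[|a \<in> carrier A; m \<in> carrier M; n \<in> carrier M|]
    ==> ract M (m \<ominus>\<^bsub>M\<^esub> n) a = ract M m a \<ominus>\<^bsub>M\<^esub> ract M n a"
  using addmap_diff[OF M.abelian_group_axioms M.abelian_group_axioms ract_addmap_l] .

lemma ract_diff_r: "[|a \<in> carrier A; b \<in> carrier A; m \<in> carrier M|]
    ==> ract M m (a \<ominus>\<^bsub>A\<^esub> b) = ract M m a \<ominus>\<^bsub>M\<^esub> ract M m b"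
  using addmap_diff[OF R.abelian_group_axioms M.abelian_group_axioms ract_addmap_r] .

lemma mdiff_zero: "mdiff M (zero M) = (zero M)"
  using addmap_zero[OF M.abelian_group_axioms M.abelian_group_axioms mdiff_addmap] .

lemma mdiff_minus: "x \<in> carrier M ==> mdiff M (\<ominus>\<^bsub>M\<^esub> x) = \<ominus>\<^bsub>M\<^esub> mdiff M x"
  using addmap_minus[OF M.abelian_group_axioms M.abelian_group_axioms mdiff_addmap] .

lemma mdiff_diff: "[|x \<in> carrier M; y \<in> carrier M|] ==> mdiff M (x \<ominus>\<^bsub>M\<^esub> y) = mdiff M x \<ominus>\<^bsub>M\<^esub> mdiff M y"
  using addmap_diff[OF M.abelian_group_axioms M.abelian_group_axioms mdiff_addmap] .

lemma hc_zero: "hc M i (zero M) = (zero M)"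
  using addmap_zero[OF M.abelian_group_axioms M.abelian_group_axioms hc_addmap] .

lemma hc_diff: "[|x \<in> carrier M; y \<in> carrier M|] ==> hc M i (x \<ominus>\<^bsub>M\<^esub> y) = hc M i x \<ominus>\<^bsub>M\<^esub> hc M i y"
  using addmap_diff[OF M.abelian_group_axioms M.abelian_group_axioms hc_addmap] .

end

text \<open>The degree shift \<open>s\<close> admits as \<open>f\<close> not only morphisms
  (\<open>s = 0\<close>) but also \<open>a\<close> to v a for a homogeneous \<open>v\<close>, with
  the regular module as source; see \<open>hc_ract\<close>.\<close>

lemma hc_commute:
  assumes "dg_module A M" "dg_module B N" "addmap M N f"
    and f: "\<And>i x. x \<in> mgr M i ==> f x \<in> mgr N (i + s)" and "x \<in> carrier M"
  shows "hc N (i + s) (f x) = f (hc M i x)"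
proof -
  interpret M: dg_module A M by fact
  interpret N: dg_module B N by fact
  have f0: "f (zero M) = (zero N)"
    using addmap_zero[OF M.M.abelian_group_axioms N.M.abelian_group_axioms assms(3)] .
  show ?thesis using assms(5)
  proof (induction x rule: M.homog_induct)
    case zero
    thus ?case by (simp add: f0 M.hc_zero N.hc_zero)
  next
    case (hom j x)
    thus ?case using N.hc_hom[OF f[OF hom]] M.hc_hom[OF hom] by (simp add: f0)
  next
    case (add x y)
    thus ?case
      by (simp add: addmap_add[OF assms(3)] N.hc_add M.hc_add M.hc_closed addmap_closed[OF assms(3)])
  qed
qed

text \<open>The axiom on direct sums is traded for projections \<open>p i\<close> and generation by
  homogeneous elements, which is how submodules, shifts and cones present their gradings.\<close>

lemma dg_moduleI:
  fixes A :: "('k, 'a) dgalgebra" and M :: "('a, 'm) dgmodule"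
  assumes "right_module A M"
    and "\<And>i. mgr M i \<subseteq> carrier M" "\<And>i. (zero M) \<in> mgr M i"
    and ad: "\<And>i x y. [|x \<in> mgr M i; y \<in> mgr M i|] ==> x \<oplus>\<^bsub>M\<^esub> y \<in> mgr M i"
    and ne: "\<And>i x. x \<in> mgr M i ==> \<ominus>\<^bsub>M\<^esub> x \<in> mgr M i"
    and "\<And>i. addmap M M (p i)"
    and "\<And>i j x. x \<in> mgr M j ==> p i x = (if i = j then x else (zero M))"
    and "\<And>x. x \<in> carrier M ==> x \<in> hspan M UNIV (mgr M)"
    and "\<And>m i a j. [|m \<in> mgr M i; a \<in> agr A j|] ==> ract M m a \<in> mgr M (i + j)"
    and "addmap M M (mdiff M)"
    and "\<And>m i. m \<in> mgr M i ==> mdiff M m \<in> mgr M (i + 1)"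
    and "\<And>m. m \<in> carrier M ==> mdiff M (mdiff M m) = (zero M)"
    and "\<And>m i a. [|m \<in> mgr M i; a \<in> carrier A|] ==>
      mdiff M (ract M m a) = ract M (mdiff M m) a \<oplus>\<^bsub>M\<^esub> sign M i (ract M m (adiff A a))"
  shows "dg_module A M"
proof -
  interpret right_module A M by fact
  have "additive_subgroup (mgr M i) M" for i
  proof (intro additive_subgroupI M.add.subgroupI)
    show "mgr M i \<noteq> {}" using assms(3)[of i] by blast
  qed (use assms(2) ad ne in \<open>simp_all add: a_inv_def\<close>)
  hence "internal_direct_sum M UNIV (mgr M)"
    by (rule M.internal_direct_sumI[where p = p]) (simp_all add: assms(6-8))
  thus ?thesis
    by unfold_locales
      (simp_all add: assms(9,11-13) addmap_closed[OF assms(10)] addmap_add[OF assms(10)])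
qed

lemma dg_module_hspan:
  assumes "dg_module A M" "x \<in> carrier M"
  shows "x \<in> hspan M UNIV (mgr M)"
proof -
  interpret dg_module A M by fact
  show ?thesis using assms(2)
  proof (induction rule: homog_induct)
    case zero
    thus ?case by (rule hspan.zero)
  next
    case (hom i x)
    have "x \<oplus>\<^bsub>M\<^esub> (zero M) \<in> hspan M UNIV (mgr M)" by (meson UNIV_I hom hspan.intros)
    thus ?case using mgr_carrier[OF hom] by simp
  next
    case (add x y)
    thus ?case using M.hspan_add[of UNIV "mgr M" x y, OF mgr_subgroup] by simp
  qed
qed

section \<open>Positively graded dg algebras with semisimple degree zero part\<close>

text \<open>An idempotent \<open>e\<close> for which the right ideal e A^0 is simple: every nonzero
  element of that ideal generates \<open>e\<close>.\<close>

definition prim :: "('k, 'a) dgalgebra \<Rightarrow> 'a \<Rightarrow> bool" where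
  "prim A e \<longleftrightarrow> e \<in> agr A 0 \<and> e \<otimes>\<^bsub>A\<^esub> e = e \<and> e \<noteq> (zero A) \<and>
     (\<forall>b\<in>agr A 0. e \<otimes>\<^bsub>A\<^esub> b \<noteq> (zero A) \<longrightarrow> (\<exists>c\<in>agr A 0. e \<otimes>\<^bsub>A\<^esub> b \<otimes>\<^bsub>A\<^esub> c = e))"

text \<open>The assumptions on \<open>A\<close> in the form used below. Semisimplicity enters
  through \<open>prims\<close>: the unit is a finite sum of orthogonal idempotents with simple right
  ideals. The assumption \<open>reg\<close> expresses the ring, grading and differential axioms
  through the regular module.\<close>

locale pdga =
  fixes A :: "('k, 'a) dgalgebra" (structure)
  assumes reg: "dg_module A (regular_dgmodule A)"
    and one_deg: "\<one> \<in> agr A 0"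
    and nonneg: "\<And>i a. [|i < 0; a \<in> agr A i|] ==> a = \<zero>"
    and adiff0: "\<And>a. a \<in> agr A 0 ==> adiff A a = \<zero>"
    and prims: "\<exists>(n::nat) E. (\<forall>k<n. prim A (E k)) \<and>
      (\<forall>k<n. \<forall>l<n. k \<noteq> l \<longrightarrow> E k \<otimes> E l = \<zero>) \<and> finsum A E {..<n} = \<one>"

sublocale pdga \<subseteq> A: ring A
  using reg by (simp add: dg_module_def right_module_def)

context pdga
begin

lemma reg_simps:
  "carrier (regular_dgmodule A) = carrier A" "zero (regular_dgmodule A) = \<zero>"
  "add (regular_dgmodule A) = add A" "ract (regular_dgmodule A) = mult A"
  "mgr (regular_dgmodule A) = agr A" "mdiff (regular_dgmodule A) = adiff A"
  by (simp_all add: regular_dgmodule_def)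

lemma agr_carrier: "a \<in> agr A i ==> a \<in> carrier A"
  using dg_module.mgr_carrier[OF reg, unfolded reg_simps] .

lemma agr_zero: "\<zero> \<in> agr A i"
  using dg_module.mgr_zero[OF reg, unfolded reg_simps] .

lemma agr_mult: "[|a \<in> agr A i; b \<in> agr A j|] ==> a \<otimes> b \<in> agr A (i + j)"
  using dg_module.mgr_ract[OF reg, unfolded reg_simps] .

lemma agr_mult0: "[|a \<in> agr A 0; b \<in> agr A 0|] ==> a \<otimes> b \<in> agr A 0"
  using agr_mult[of a 0 b 0] by simp

lemma prim_deg: "prim A e ==> e \<in> agr A 0" and prim_idem: "prim A e ==> e \<otimes> e = e"
  and prim_nz: "prim A e ==> e \<noteq> \<zero>"
  by (simp_all add: prim_def)

lemma prim_carrier: "prim A e ==> e \<in> carrier A"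
  using prim_deg agr_carrier by blast

text \<open>A nonzero homomorphism between minimal right ideals generated by idempotents has a two-sided inverse.\<close>

lemma prim_inverse:
  assumes e: "prim A e" and e1: "prim A e1" and b: "b \<in> agr A 0" "e1 \<otimes> b \<otimes> e = b" "b \<noteq> \<zero>"
  shows "\<exists>c\<in>agr A 0. b \<otimes> c = e1 \<and> e \<otimes> c \<otimes> b = e"
proof -
  have ec [simp]: "e \<in> carrier A" "e1 \<in> carrier A" "b \<in> carrier A"
    using e e1 b prim_carrier agr_carrier by auto
  have e1b: "e1 \<otimes> b = b" and be: "b \<otimes> e = b"
    using b(2) prim_idem[OF e] prim_idem[OF e1] by (metis A.m_assoc A.m_closed ec)+
  then obtain c where c: "c \<in> agr A 0" "b \<otimes> c = e1"
    using e1 b unfolding prim_def by metis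
  have cc [simp]: "c \<in> carrier A" using c agr_carrier by auto
  \<comment> \<open>The element \<open>c\<close> with b c = e1 is already a right inverse, and
    \<open>f\<close> is the other composite. It is a nonzero idempotent with f e = f, and it
    generates \<open>e\<close>, say f g = e. So f = f e = f f g = f g = e.\<close>
  define f where "f = e \<otimes> c \<otimes> b"
  have fc [simp]: "f \<in> carrier A" by (simp add: f_def)
  have f0: "f \<in> agr A 0" using e b c by (simp add: f_def agr_mult0 prim_deg)
  have ef: "e \<otimes> f = f" using prim_idem[OF e] by (simp add: f_def flip: A.m_assoc)
  have fe: "f \<otimes> e = f" by (simp add: f_def A.m_assoc be)
  have "b \<otimes> f = (b \<otimes> e) \<otimes> c \<otimes> b" by (simp add: f_def A.m_assoc)
  hence bf: "b \<otimes> f = b" by (simp add: be c(2) e1b)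
  hence "f \<noteq> \<zero>" using b(3) by auto
  then obtain g where g: "g \<in> agr A 0" "f \<otimes> g = e"
    using e f0 ef unfolding prim_def by metis
  have gc [simp]: "g \<in> carrier A" using g agr_carrier by auto
  have "f \<otimes> f = e \<otimes> c \<otimes> (b \<otimes> f)" by (simp add: f_def A.m_assoc)
  also have "\<dots> = f" by (simp add: bf) (simp add: f_def)
  finally have ff: "f \<otimes> f = f" .
  have "f = f \<otimes> (f \<otimes> g)" using fe g by simp
  also have "\<dots> = f \<otimes> g" using ff by (simp flip: A.m_assoc)
  finally have "f = e" using g by simp
  hence "e \<otimes> c \<otimes> b = e" unfolding f_def .
  with c show ?thesis by (intro bexI[of _ c]) auto
qed

end

text \<open>Elementwise criterion, equivalent to \<open>dg_submodule\<close> by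
  \<open>dg_submodule_iff\<close>. Negatives come from multiplication by the negative of the unit,
  and the grading from closure under homogeneous components.\<close>

definition dsub :: "('k, 'a) dgalgebra \<Rightarrow> ('a, 'm) dgmodule \<Rightarrow> 'm set \<Rightarrow> bool" where
  "dsub A M N \<longleftrightarrow> N \<subseteq> carrier M \<and> (zero M) \<in> N \<and> (\<forall>x\<in>N. \<forall>y\<in>N. x \<oplus>\<^bsub>M\<^esub> y \<in> N) \<and>
     (\<forall>x\<in>N. \<forall>a\<in>carrier A. ract M x a \<in> N) \<and> (\<forall>x\<in>N. mdiff M x \<in> N) \<and> (\<forall>x\<in>N. \<forall>i. hc M i x \<in> N)"

definition adj :: "('k, 'a) dgalgebra \<Rightarrow> ('a, 'm) dgmodule \<Rightarrow> 'm set \<Rightarrow> 'm \<Rightarrow> 'm set" where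
  "adj A M N v = {n \<oplus>\<^bsub>M\<^esub> ract M v a | n a. n \<in> N \<and> a \<in> carrier A}"

text \<open>A cell: \<^term>\<open>adj A M N v\<close> is an extension of \<^term>\<open>N\<close> by a shift of the right ideal generated by \<^term>\<open>e\<close>.\<close>

definition cell ::
    "('k, 'a) dgalgebra \<Rightarrow> ('a, 'm) dgmodule \<Rightarrow> int \<Rightarrow> 'a \<Rightarrow> 'm \<Rightarrow> 'm set \<Rightarrow> bool" where
  "cell A M j e v N \<longleftrightarrow> v \<in> mgr M j \<and> prim A e \<and> ract M v e = v \<and> mdiff M v \<in> N \<and>
     (\<forall>a\<in>carrier A. ract M v a \<in> N \<longrightarrow> e \<otimes>\<^bsub>A\<^esub> a = (zero A))"

text \<open>The list records only the degrees of the cells from \<open>N\<close> up to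
  \<open>T\<close>. Generators and idempotents are forgotten, because \<open>exchange\<close>
  changes them while keeping the degrees. The head of the list is the cell next to \<open>N\<close>,
  so inductions enlarge \<open>N\<close> from below.\<close>

inductive rf :: "('k, 'a) dgalgebra \<Rightarrow> ('a, 'm) dgmodule \<Rightarrow> int list \<Rightarrow> 'm set \<Rightarrow> 'm set \<Rightarrow> bool"
  for A :: "('k, 'a) dgalgebra" and M :: "('a, 'm) dgmodule" where
  Nil: "rf A M [] N N"
| Cons: "[|cell A M j e v N; rf A M js (adj A M N v) T|] ==> rf A M (j # js) N T"

locale pdgm = pdga A + dg_module A M
  for A :: "('k, 'a) dgalgebra" (structure) and M :: "('a, 'm) dgmodule" (structure)
begin

abbreviation "sub \<equiv> dsub A M"
abbreviation "ad \<equiv> adj A M"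

text \<open>The unit is a sum of primitive idempotents, so \<open>z\<close> is a sum of elements z
  e. In contrapositive form an element outside \<open>N\<close> has a multiple z e outside
  \<open>N\<close>.\<close>

lemma prim_test:
  assumes z: "z \<in> carrier M" and N: "N \<subseteq> carrier M" "(zero M) \<in> N" "\<And>x y. x \<in> N ==> y \<in> N ==> x \<oplus>\<^bsub>M\<^esub> y \<in> N"
    and "\<And>e. prim A e ==> ract M z e \<in> N"
  shows "z \<in> N"
proof -
  obtain n :: nat and E where E: "\<forall>k<n. prim A (E k)" "finsum A E {..<n} = \<one>" using prims by blast
  have Ec: "E \<in> {..<n} \<rightarrow> carrier A" using E prim_carrier by auto
  have "z = ract M z (finsum A E {..<n})" using E z ract_one by simp
  also have "\<dots> = finsum M (\<lambda>k. ract M z (E k)) {..<n}"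
    by (rule addmap_finsum[OF A.abelian_group_axioms M.abelian_group_axioms ract_addmap_r[OF z] _ Ec]) simp
  finally have eq: "z = finsum M (\<lambda>k. ract M z (E k)) {..<n}" .
  have "m \<le> n ==> finsum M (\<lambda>k. ract M z (E k)) {..<m} \<in> N" for m
  proof (induction m)
    case (Suc m)
    have "(\<lambda>k. ract M z (E k)) \<in> {..<m} \<rightarrow> carrier M" "ract M z (E m) \<in> carrier M" "ract M z (E m) \<in> N"
      using Suc.prems E assms(5) N by auto
    thus ?case using Suc N by (simp add: lessThan_Suc)
  qed (simp add: N)
  from this[of n] eq show ?thesis by simp
qed

lemma prim_witness:
  assumes "z \<in> carrier M" "z \<notin> N" "sub N"
  obtains e where "prim A e" "ract M z e \<notin> N"
  using prim_test[of z N] assms unfolding dsub_def by metis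

section \<open>Submodules and their extension by one homogeneous generator\<close>

lemma sub_carrier: "[|sub N; x \<in> N|] ==> x \<in> carrier M"
  and sub_zero: "sub N ==> (zero M) \<in> N"
  and sub_add: "[|sub N; x \<in> N; y \<in> N|] ==> x \<oplus>\<^bsub>M\<^esub> y \<in> N"
  and sub_ract: "[|sub N; x \<in> N; a \<in> carrier A|] ==> ract M x a \<in> N"
  and sub_mdiff: "[|sub N; x \<in> N|] ==> mdiff M x \<in> N"
  and sub_hc: "[|sub N; x \<in> N|] ==> hc M i x \<in> N"
  by (auto simp: dsub_def)

lemma sub_minus: "[|sub N; x \<in> N|] ==> \<ominus>\<^bsub>M\<^esub> x \<in> N"
proof -
  assume a: "sub N" "x \<in> N"
  have "ract M x (\<ominus> \<one>) = \<ominus>\<^bsub>M\<^esub> x" using ract_minus_r[of \<one> x] sub_carrier[OF a] by (simp add: ract_one)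
  thus ?thesis using sub_ract[OF a, of "\<ominus> \<one>"] by simp
qed

lemma sub_diff: "[|sub N; x \<in> N; y \<in> N|] ==> x \<ominus>\<^bsub>M\<^esub> y \<in> N"
  by (simp add: a_minus_def sub_add sub_minus)

lemma add_cancel: "[|x \<in> carrier M; y \<in> carrier M|] ==> x \<oplus>\<^bsub>M\<^esub> y \<ominus>\<^bsub>M\<^esub> x = y"
  by (metis M.a_comm M.add.inv_solve_right' M.minus_eq M.add.m_closed)

lemma sub_cancel_l: "[|sub N; x \<in> N; y \<in> carrier M; x \<oplus>\<^bsub>M\<^esub> y \<in> N|] ==> y \<in> N"
  using sub_diff[of N "x \<oplus>\<^bsub>M\<^esub> y" x] add_cancel[of x y] sub_carrier[of N x] by simp

lemma sub_UNIV: "sub (carrier M)"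
  by (auto simp: dsub_def ract_closed mdiff_closed hc_closed)

lemma adI: "[|n \<in> N; a \<in> carrier A; x = n \<oplus>\<^bsub>M\<^esub> ract M v a|] ==> x \<in> ad N v"
  by (auto simp: adj_def)

lemma adE:
  assumes "x \<in> ad N v"
  obtains n a where "n \<in> N" "a \<in> carrier A" "x = n \<oplus>\<^bsub>M\<^esub> ract M v a"
  using assms by (auto simp: adj_def)

lemma ad_base: "[|sub N; v \<in> carrier M; x \<in> N|] ==> x \<in> ad N v"
  by (rule adI[of x _ \<zero>]) (auto simp: ract_zero_r sub_carrier)

lemma ad_gen: "[|sub N; v \<in> carrier M; a \<in> carrier A|] ==> ract M v a \<in> ad N v"
  by (rule adI[of "zero M" _ a]) (auto simp: sub_zero ract_closed)

lemma ad_self: "[|sub N; v \<in> carrier M|] ==> v \<in> ad N v"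
  using ad_gen[of N v \<one>] by (simp add: ract_one)

lemma hc_ract: "[|v \<in> mgr M j; a \<in> carrier A|] ==> hc M (i + j) (ract M v a) = ract M v (hc (regular_dgmodule A) i a)"
  using hc_commute[of A "regular_dgmodule A" A M "ract M v" j a i] reg dg_module_axioms
    ract_addmap_r[OF mgr_carrier[of v j]] mgr_ract[of v j _ _]
  by (simp add: reg_simps addmap_def add.commute)

lemma hcA_closed: "a \<in> carrier A ==> hc (regular_dgmodule A) i a \<in> carrier A"
  using dg_module.hc_closed[OF reg] by (simp add: reg_simps)

lemma hcA_agr: "a \<in> carrier A ==> hc (regular_dgmodule A) i a \<in> agr A i"
  using dg_module.hc_mgr[OF reg] by (simp add: reg_simps)

text \<open>As \<open>x\<close> is homogeneous, \<open>n\<close> and \<open>a\<close> may be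
  replaced by their components of degrees \<open>q\<close> and \<open>q - j\<close>. In degrees
  below \<open>j\<close>, where \<open>A\<close> contributes nothing, this leaves only elements of
  \<open>N\<close>.\<close>

lemma ad_deg:
  assumes "sub N" "v \<in> mgr M j" "x \<in> ad N v" "x \<in> mgr M q"
  obtains n a where "n \<in> N" "n \<in> mgr M q" "a \<in> agr A (q - j)" "x = n \<oplus>\<^bsub>M\<^esub> ract M v a"
proof -
  obtain n a where na: "n \<in> N" "a \<in> carrier A" "x = n \<oplus>\<^bsub>M\<^esub> ract M v a" using assms adE by metis
  have vc: "v \<in> carrier M" using assms mgr_carrier by auto
  have nc: "n \<in> carrier M" using na assms sub_carrier by auto
  have "x = hc M q x" using assms hc_hom[of x q q] by simp
  also have "\<dots> = hc M q n \<oplus>\<^bsub>M\<^esub> hc M ((q - j) + j) (ract M v a)"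
    using na nc vc by (simp add: hc_add ract_closed)
  also have "\<dots> = hc M q n \<oplus>\<^bsub>M\<^esub> ract M v (hc (regular_dgmodule A) (q - j) a)"
    using hc_ract[OF assms(2) na(2), of "q - j"] by simp
  finally show ?thesis using that[of "hc M q n"] na assms hc_mgr[OF nc] hcA_agr[OF na(2)] sub_hc by blast
qed

text \<open>Closure under the differential is where the boundary of \<open>v\<close> enters: d(v a)
  is (dv) a plus or minus v (da).\<close>

lemma sub_ad:
  assumes N: "sub N" and v: "v \<in> mgr M j" "mdiff M v \<in> N"
  shows "sub (ad N v)"
  unfolding dsub_def
proof (intro conjI ballI allI)
  have vc: "v \<in> carrier M" using v mgr_carrier by auto
  note NC = sub_carrier[OF N]
  show "ad N v \<subseteq> carrier M" using NC vc by (auto simp: adj_def ract_closed)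
  show "(zero M) \<in> ad N v" using ad_base[OF N vc] sub_zero[OF N] by simp
  fix x assume "x \<in> ad N v"
  then obtain n a where x: "n \<in> N" "a \<in> carrier A" "x = n \<oplus>\<^bsub>M\<^esub> ract M v a" by (rule adE)
  note nc = NC[OF x(1)] and ac = ract_closed[OF vc x(2)]
  {
    fix y assume "y \<in> ad N v"
    then obtain m b where y: "m \<in> N" "b \<in> carrier A" "y = m \<oplus>\<^bsub>M\<^esub> ract M v b" by (rule adE)
    have "x \<oplus>\<^bsub>M\<^esub> y = (n \<oplus>\<^bsub>M\<^esub> m) \<oplus>\<^bsub>M\<^esub> ract M v (a \<oplus> b)"
      using x y nc NC[OF y(1)] vc by (simp add: ract_r_distr ract_closed M.a_ac)
    thus "x \<oplus>\<^bsub>M\<^esub> y \<in> ad N v" using x y sub_add[OF N] by (intro adI[of "n \<oplus>\<^bsub>M\<^esub> m" _ "a \<oplus> b"]) auto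
  next
    fix b assume b: "b \<in> carrier A"
    have "ract M x b = ract M n b \<oplus>\<^bsub>M\<^esub> ract M v (a \<otimes> b)"
      using x b nc vc by (simp add: ract_l_distr ract_closed ract_assoc)
    thus "ract M x b \<in> ad N v" using x b sub_ract[OF N] by (intro adI) auto
  next
    have da: "adiff A a \<in> carrier A"
      using dg_module.mdiff_closed[OF reg] x(2) by (simp add: reg_simps)
    have sg: "sign M j (ract M v (adiff A a)) = ract M v (sign A j (adiff A a))"
      using da vc by (simp add: sign_def ract_minus_r)
    have "mdiff M x = (mdiff M n \<oplus>\<^bsub>M\<^esub> ract M (mdiff M v) a) \<oplus>\<^bsub>M\<^esub> ract M v (sign A j (adiff A a))"
      using x nc vc ac da mdiff_ract[OF v(1) x(2)] sg
      by (simp add: mdiff_add mdiff_closed ract_closed M.a_assoc sign_def)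
    moreover have "sign A j (adiff A a) \<in> carrier A" using da by (simp add: sign_def)
    ultimately show "mdiff M x \<in> ad N v"
      using sub_add[OF N sub_mdiff[OF N x(1)] sub_ract[OF N v(2) x(2)]] by (metis adI)
  next
    fix i
    have "hc M i x = hc M i n \<oplus>\<^bsub>M\<^esub> hc M ((i - j) + j) (ract M v a)"
      using x nc ac by (simp add: hc_add)
    also have "\<dots> = hc M i n \<oplus>\<^bsub>M\<^esub> ract M v (hc (regular_dgmodule A) (i - j) a)"
      using hc_ract[OF v(1) x(2), of "i - j"] by simp
    finally show "hc M i x \<in> ad N v"
      using sub_hc[OF N x(1)] hcA_closed[OF x(2)] by (intro adI) auto
  }
qed

lemma ad_least:
  assumes "sub N'" "N \<subseteq> N'" "v \<in> N'"
  shows "ad N v \<subseteq> N'"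
  using assms by (auto simp: adj_def intro: sub_add sub_ract)

lemma ad_mono: "N \<subseteq> N' ==> ad N v \<subseteq> ad N' v"
  by (auto simp: adj_def)

lemma ad_swap:
  assumes "N \<subseteq> carrier M" "v \<in> carrier M" "x \<in> carrier M"
  shows "ad (ad N v) x = ad (ad N x) v"
proof -
  have "ad (ad N v) x \<subseteq> ad (ad N x) v" if "v \<in> carrier M" "x \<in> carrier M" for v x
  proof
    fix y assume "y \<in> ad (ad N v) x"
    then obtain n a b where *: "n \<in> N" "a \<in> carrier A" "b \<in> carrier A"
      "y = n \<oplus>\<^bsub>M\<^esub> ract M v a \<oplus>\<^bsub>M\<^esub> ract M x b" by (auto simp: adj_def)
    hence "y = n \<oplus>\<^bsub>M\<^esub> ract M x b \<oplus>\<^bsub>M\<^esub> ract M v a"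
      using that assms(1) ract_closed[of v a] ract_closed[of x b] by (simp add: M.a_ac subset_iff)
    thus "y \<in> ad (ad N x) v" using * by (auto simp: adj_def)
  qed
  thus ?thesis using assms by blast
qed

section \<open>Cells, relative filtrations and the exchange lemma\<close>

lemma cellD:
  assumes "cell A M j e v N"
  shows "v \<in> mgr M j" "prim A e" "ract M v e = v" "mdiff M v \<in> N" "v \<in> carrier M"
    "[|a \<in> carrier A; ract M v a \<in> N|] ==> e \<otimes> a = \<zero>"
    "[|a \<in> carrier A; ract M v a \<in> N|] ==> ract M v a = (zero M)"
proof -
  show *: "v \<in> mgr M j" "prim A e" "ract M v e = v" "mdiff M v \<in> N" "v \<in> carrier M"
    "[|a \<in> carrier A; ract M v a \<in> N|] ==> e \<otimes> a = \<zero>"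
    using assms mgr_carrier by (auto simp: cell_def)
  \<comment> \<open>From v a = v (e a): the cell condition says that vA meets \<open>N\<close> only
    in zero.\<close>
  show "ract M v a = (zero M)" if "a \<in> carrier A" "ract M v a \<in> N"
    using ract_assoc[OF *(5) prim_carrier[OF *(2)] that(1)] *(3,6) that ract_zero_r[OF *(5)] by simp
qed

lemma cell_sub: "[|sub N; cell A M j e v N|] ==> sub (ad N v)"
  using sub_ad cellD(1,4) by blast

lemma cell_notin: "cell A M j e v N ==> v \<notin> N"
  using cellD(6)[of j e v N \<one>] prim_nz[OF cellD(2)] cellD(5) prim_carrier[OF cellD(2)]
  by (metis A.one_closed A.r_one ract_one)

lemma rf_sub: "[|rf A M js N T; sub N|] ==> sub T"
  by (induction rule: rf.induct) (auto intro: cell_sub)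

lemma rf_subset: "[|rf A M js N T; sub N|] ==> N \<subseteq> T"
proof (induction rule: rf.induct)
  case (Cons j e v N js T)
  thus ?case using ad_base[OF Cons.prems cellD(5)[OF Cons.hyps(1)]] cell_sub by blast
qed simp

lemma rf_append: "[|rf A M js N T; rf A M js' T U|] ==> rf A M (js @ js') N U"
  by (induction rule: rf.induct) (auto intro: rf.Cons)

lemma rf_append_split: "rf A M (js @ js') N U ==> \<exists>T. rf A M js N T \<and> rf A M js' T U"
proof (induction js arbitrary: N)
  case Nil
  thus ?case using rf.Nil by auto
next
  case (Cons j js)
  from Cons.prems[simplified] obtain e v where "cell A M j e v N" "rf A M (js @ js') (ad N v) U"
    by (cases rule: rf.cases) auto
  with Cons.IH[of "ad N v"] obtain T where T: "rf A M js (ad N v) T" "rf A M js' T U" by blast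
  have "rf A M (j # js) N T" by (rule rf.Cons) fact+
  thus ?case using T by blast
qed

text \<open>A cell of degree \<open>j\<close> contributes products v a with \<open>a\<close> of
  degree at least zero, hence nothing below \<open>j\<close>.\<close>

lemma rf_low:
  assumes "rf A M js N T" "sub N" "x \<in> mgr M q" "x \<in> T" "\<forall>j\<in>set js. q < j"
  shows "x \<in> N"
  using assms
proof (induction rule: rf.induct)
  case (Cons j e v N js T)
  note cD = cellD[OF Cons.hyps(1)]
  have "x \<in> ad N v" using Cons cell_sub by auto
  then obtain n a where na: "n \<in> N" "n \<in> mgr M q" "a \<in> agr A (q - j)" "x = n \<oplus>\<^bsub>M\<^esub> ract M v a"
    using ad_deg[OF Cons.prems(1) cD(1) _ Cons.prems(2)] by blast
  hence "a = \<zero>" using Cons.prems nonneg[of "q - j" a] by auto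
  thus ?case using na cD ract_zero_r mgr_carrier by auto
qed simp

text \<open>Both generators have degree \<open>j\<close>, so x = n + v a with \<open>a\<close> in
  A^0. The corner e1 a e is nonzero, hence invertible between the simple ideals by
  \<open>prim_inverse\<close>, and \<open>v\<close> can be recovered from \<open>x\<close>.\<close>

lemma exchange_step:
  assumes N: "sub N" and c: "cell A M j e1 v N" and x: "x \<in> mgr M j" "x \<notin> N" "ract M x e = x"
    "mdiff M x \<in> N" "prim A e" "x \<in> ad N v"
  shows "cell A M j e x N \<and> ad N x = ad N v"
proof -
  note cD = cellD[OF c]
  have xc: "x \<in> carrier M" using x mgr_carrier by auto
  have ec [simp]: "e \<in> carrier A" "e1 \<in> carrier A" using x(5) cD(2) prim_carrier by auto
  obtain n a where na: "n \<in> N" "n \<in> mgr M j" "a \<in> agr A (j - j)" "x = n \<oplus>\<^bsub>M\<^esub> ract M v a"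
    using ad_deg[OF N cD(1) x(6,1)] by blast
  have a0: "a \<in> agr A 0" and ac [simp]: "a \<in> carrier A" using na agr_carrier by auto
  have nc: "n \<in> carrier M" using na sub_carrier[OF N] by auto
  \<comment> \<open>The corner may replace \<open>a\<close>: the factor \<open>e1\<close> is
    absorbed by v e1 = v, and multiplying the equation for \<open>x\<close> by \<open>e\<close> on
    the right leaves \<open>x\<close> unchanged.\<close>
  define b where "b = e1 \<otimes> a \<otimes> e"
  have b0: "b \<in> agr A 0" using a0 x(5) cD(2) by (simp add: b_def agr_mult0 prim_deg)
  hence bc [simp]: "b \<in> carrier A" using agr_carrier by auto
  have ebe: "e1 \<otimes> b \<otimes> e = b"
  proof -
    have "e1 \<otimes> b \<otimes> e = (e1 \<otimes> e1) \<otimes> a \<otimes> (e \<otimes> e)" by (simp add: b_def A.m_assoc)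
    thus ?thesis using prim_idem[OF x(5)] prim_idem[OF cD(2)] by (simp add: b_def)
  qed
  have "ract M v b = ract M (ract M (ract M v e1) a) e" using cD(5) by (simp add: b_def ract_assoc ract_closed A.m_assoc)
  hence vb: "ract M v b = ract M (ract M v a) e" using cD(3) by simp
  define n' where "n' = ract M n e"
  have n': "n' \<in> N" "n' \<in> carrier M" using na sub_ract[OF N] nc by (auto simp: n'_def ract_closed)
  have xe: "x = n' \<oplus>\<^bsub>M\<^esub> ract M v b"
    using x(3) na(4) nc cD(5) ract_l_distr[of n "ract M v a" e] by (simp add: n'_def ract_closed vb)
  have bn: "b \<noteq> \<zero>"
  proof
    assume "b = \<zero>"
    thus False using xe n' x(2) cD(5) by (simp add: ract_zero_r)
  qed
  from prim_inverse[OF x(5) cD(2) b0 ebe bn] obtain c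
    where c: "c \<in> agr A 0" "b \<otimes> c = e1" "e \<otimes> c \<otimes> b = e" by blast
  have cc [simp]: "c \<in> carrier A" using c agr_carrier by auto
  have xc': "ract M x c = ract M n' c \<oplus>\<^bsub>M\<^esub> v"
    using n' cD(5) cD(3) c(2) by (subst xe) (simp add: ract_l_distr ract_closed ract_assoc)
  have sx: "sub (ad N x)" and sv: "sub (ad N v)" using sub_ad[OF N x(1,4)] cell_sub[OF N assms(2)] by auto
  \<comment> \<open>Multiplying x = n' + v b by \<open>c\<close> gives x c = n' c + v.\<close>
  have "v \<in> ad N x"
    by (rule sub_cancel_l[OF sx _ cD(5), of "ract M n' c"])
      (use xc' ad_gen[OF N xc, of c] ad_base[OF N xc] sub_ract[OF N n'(1), of c] in auto)
  hence eq: "ad N x = ad N v"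
    using ad_least[OF sx _ \<open>v \<in> ad N x\<close>, of N] ad_least[OF sv _ x(6), of N] ad_base[OF N xc] ad_base[OF N cD(5)]
    by blast
  have "e \<otimes> a' = \<zero>" if a': "a' \<in> carrier A" "ract M x a' \<in> N" for a'
  proof -
    have "ract M x a' = ract M n' a' \<oplus>\<^bsub>M\<^esub> ract M v (b \<otimes> a')"
      using n' cD(5) a'(1) by (subst xe) (simp add: ract_l_distr ract_closed ract_assoc)
    hence "ract M v (b \<otimes> a') \<in> N"
      using sub_cancel_l[OF N, of "ract M n' a'" "ract M v (b \<otimes> a')"] a' cD(5) sub_ract[OF N n'(1), of a']
      by (simp add: ract_closed)
    hence "e1 \<otimes> (b \<otimes> a') = \<zero>" using cD(6)[of "b \<otimes> a'"] a' by simp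
    moreover have "e1 \<otimes> b = b" using ebe prim_idem[OF cD(2)] by (metis A.m_assoc A.m_closed bc ec)
    ultimately have "b \<otimes> a' = \<zero>" using a' by (simp flip: A.m_assoc)
    hence "e \<otimes> c \<otimes> b \<otimes> a' = \<zero>" using a' by (simp add: A.m_assoc)
    thus ?thesis using c(3) by simp
  qed
  thus ?thesis using x eq by (auto simp: cell_def)
qed

text \<open>Going up the filtration, \<open>x\<close> is absorbed at some cell \<open>v\<close>.
  That cell has degree \<open>j\<close> by \<open>rf_low\<close>, and \<open>exchange_step\<close>
  replaces it by \<open>x\<close>. The cells passed before are then moved above \<open>x\<close> one
  by one. Since the list is sorted and \<open>j\<close> is minimal, they have degree
  \<open>j\<close> too, so the list does not change.\<close>

lemma exchange:
  assumes "rf A M js N T" "sub N" "sorted js" "\<forall>i\<in>set js. j \<le> i" "x \<in> mgr M j" "x \<in> T" "x \<notin> N"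
    "prim A e" "ract M x e = x" "mdiff M x \<in> N"
  shows "\<exists>js'. js = j # js' \<and> cell A M j e x N \<and> rf A M js' (ad N x) T"
  using assms
proof (induction rule: rf.induct)
  case (Nil N)
  thus ?case by simp
next
  case (Cons j1 e1 v N js T)
  note cD = cellD[OF Cons.hyps(1)]
  note N = \<open>sub N\<close>
  have xc: "x \<in> carrier M" using Cons.prems mgr_carrier by auto
  have N1: "sub (ad N v)" using cell_sub[OF N Cons.hyps(1)] .
  show ?case
  proof (cases "x \<in> ad N v")
    case True
    have "j1 = j"
    proof (rule ccontr)
      assume "j1 \<noteq> j"
      hence "j < j1" using Cons.prems by auto
      moreover have "rf A M [j1] N (ad N v)" using Cons.hyps(1) rf.intros by metis
      ultimately have "x \<in> N" using rf_low[of "[j1]" N "ad N v" x j] N Cons.prems True by simp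
      thus False using Cons.prems by simp
    qed
    thus ?thesis using exchange_step[OF N, of j e1 v x e] Cons.hyps Cons.prems True by auto
  next
    case False
    have "\<exists>js'. js = j # js' \<and> cell A M j e x (ad N v) \<and> rf A M js' (ad (ad N v) x) T"
      by (rule Cons.IH) (use Cons.prems N1 False ad_base[OF N cD(5)] in auto)
    then obtain js' where js': "js = j # js'" "cell A M j e x (ad N v)" "rf A M js' (ad (ad N v) x) T" by blast
    note xD = cellD[OF js'(2)]
    have j1: "j1 = j" using Cons.prems js'(1) by auto
    have "cell A M j e x N" using js'(2) Cons.prems ad_base[OF N cD(5)] by (auto simp: cell_def)
    \<comment> \<open>If v a = n + x b, then x b lies in N + vA, over which \<open>x\<close> is a
      cell. So x b vanishes and v a lies in \<open>N\<close>.\<close>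
    moreover have "cell A M j e1 v (ad N x)"
      unfolding cell_def
    proof (intro conjI ballI impI)
      show "v \<in> mgr M j" "prim A e1" "ract M v e1 = v" "mdiff M v \<in> ad N x"
        using cD j1 ad_base[OF N xc] by auto
      fix a assume a: "a \<in> carrier A" "ract M v a \<in> ad N x"
      then obtain n b where nb: "n \<in> N" "b \<in> carrier A" "ract M v a = n \<oplus>\<^bsub>M\<^esub> ract M x b" by (blast elim: adE)
      have "ract M x b \<in> ad N v"
        using sub_cancel_l[OF N1 ad_base[OF N cD(5) nb(1)], of "ract M x b"]
          ad_gen[OF N cD(5) a(1)] nb xc by (simp add: ract_closed)
      hence "ract M x b = (zero M)" using xD(7) nb by blast
      hence "ract M v a \<in> N" using nb sub_carrier[OF N] by simp
      thus "e1 \<otimes> a = \<zero>" using cD(6) a by blast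
    qed
    ultimately show ?thesis
      using js' j1 ad_swap[of N v x] cD(5) xc sub_carrier[OF N] rf.Cons[of A M j e1 v "ad N x" js' T]
      by (auto simp: subset_iff)
  qed
qed

end

section \<open>Endomorphisms of filtered dg modules\<close>

lemma dg_homD:
  assumes "f \<in> dg_hom A M N"
  shows "x \<in> carrier M ==> f x \<in> carrier N"
    "[|x \<in> carrier M; y \<in> carrier M|] ==> f (x \<oplus>\<^bsub>M\<^esub> y) = f x \<oplus>\<^bsub>N\<^esub> f y"
    "[|x \<in> carrier M; a \<in> carrier A|] ==> f (ract M x a) = ract N (f x) a"
    "x \<in> mgr M i ==> f x \<in> mgr N i"
    "x \<in> carrier M ==> f (mdiff M x) = mdiff N (f x)"
    "f \<in> extensional (carrier M)"
    "addmap M N f"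
  using assms by (auto simp: dg_hom_def addmap_def PiE_iff)

lemma dg_homI:
  assumes "\<And>x. x \<in> carrier M ==> f x \<in> carrier N"
    "\<And>x y. [|x \<in> carrier M; y \<in> carrier M|] ==> f (x \<oplus>\<^bsub>M\<^esub> y) = f x \<oplus>\<^bsub>N\<^esub> f y"
    "\<And>x a. [|x \<in> carrier M; a \<in> carrier A|] ==> f (ract M x a) = ract N (f x) a"
    "\<And>x i. x \<in> mgr M i ==> f x \<in> mgr N i"
    "\<And>x. x \<in> carrier M ==> f (mdiff M x) = mdiff N (f x)"
    "f \<in> extensional (carrier M)"
  shows "f \<in> dg_hom A M N"
  using assms by (auto simp: dg_hom_def PiE_iff)

lemma dg_hom_hc:
  assumes "dg_module A M" "dg_module A N" "f \<in> dg_hom A M N" "x \<in> carrier M"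
  shows "hc N i (f x) = f (hc M i x)"
  using hc_commute[OF assms(1,2) dg_homD(7)[OF assms(3)], of 0 x i] dg_homD(4)[OF assms(3)] assms(4)
  by simp

lemma dg_homotopyD:
  assumes "dg_homotopy A M N h"
  shows "x \<in> carrier M ==> h x \<in> carrier N"
    "[|x \<in> carrier M; y \<in> carrier M|] ==> h (x \<oplus>\<^bsub>M\<^esub> y) = h x \<oplus>\<^bsub>N\<^esub> h y"
    "[|x \<in> carrier M; a \<in> carrier A|] ==> h (ract M x a) = ract N (h x) a"
    "x \<in> mgr M i ==> h x \<in> mgr N (i - 1)"
    "addmap M N h"
  using assms by (auto simp: dg_homotopy_def addmap_def)

context pdgm
begin

lemma mdiff_ract0: "[|v \<in> mgr M j; a \<in> agr A 0|] ==> mdiff M (ract M v a) = ract M (mdiff M v) a"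
  using mdiff_ract[of v j a] adiff0[of a] agr_carrier[of a 0] mgr_carrier[of v j]
  by (simp add: sign_def ract_zero_r ract_closed mdiff_closed)

text \<open>\<open>h\<close> lowers degrees by one, so by \<open>rf_low\<close> it sends the lowest
  generator into \<open>N\<close>. Hence \<open>h\<close>, and with it dh + hd, maps N + vA into
  \<open>N\<close>: each cell costs one power of \<open>f\<close>.\<close>

lemma rf_homotopy_nilpotent:
  assumes "rf A M js N T" "T = carrier M" "sub N" "sorted js" and h: "dg_homotopy A M M h"
    and "\<And>x. x \<in> N ==> h x \<in> N"
    and f: "\<And>x. x \<in> carrier M ==> f x = mdiff M (h x) \<oplus>\<^bsub>M\<^esub> h (mdiff M x)"
    and x: "x \<in> carrier M"
  shows "(f ^^ length js) x \<in> N"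
  using assms(1-4,6)
proof (induction rule: rf.induct)
  case (Nil N)
  thus ?case using x by simp
next
  case (Cons j e v N js T)
  note N = \<open>sub N\<close> and c = Cons.hyps(1) and hN = Cons.prems(4)
  note cD = cellD[OF c] and N1 = cell_sub[OF N c] and hD = dg_homotopyD[OF h]
  have "rf A M (j # js) N T" by (rule rf.Cons) (use Cons in auto)
  moreover have "\<forall>i\<in>set (j # js). j - 1 < i" using \<open>sorted (j # js)\<close> by fastforce
  ultimately have hv: "h v \<in> N"
    using rf_low[of "j # js" N T "h v" "j - 1"] N hD(4)[OF cD(1)] hD(1)[OF cD(5)] Cons.prems by auto
  have hN1: "h y \<in> N" if "y \<in> ad N v" for y
  proof -
    from that obtain n a where y: "n \<in> N" "a \<in> carrier A" "y = n \<oplus>\<^bsub>M\<^esub> ract M v a" by (rule adE)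
    have "h y = h n \<oplus>\<^bsub>M\<^esub> ract M (h v) a"
      using y hD(2)[of n "ract M v a"] hD(3)[of v a] cD(5) sub_carrier[OF N y(1)] by (simp add: ract_closed)
    thus ?thesis using sub_add[OF N hN[OF y(1)] sub_ract[OF N hv y(2)]] by simp
  qed
  have "(f ^^ length js) x \<in> ad N v"
    by (rule Cons.IH) (use Cons.prems N1 hN1 ad_base[OF N cD(5)] in auto)
  moreover have "f y \<in> N" if y: "y \<in> ad N v" for y
    using f[OF sub_carrier[OF N1 y]] sub_add[OF N sub_mdiff[OF N hN1[OF y]] hN1[OF sub_mdiff[OF N1 y]]] by simp
  ultimately show ?case by simp
qed

text \<open>Complementary idempotents split a filtration, because \<^term>\<open>exchange\<close> lets one start with a
  cell lying in one of the two summands.\<close>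

lemma split_cell:
  assumes p: "p \<in> dg_hom A M M" and q: "q \<in> dg_hom A M M"
    and pq: "\<And>x. x \<in> carrier M ==> x = p x \<oplus>\<^bsub>M\<^esub> q x \<and> p (q x) = (zero M) \<and> q (p x) = (zero M)"
    and r: "rf A M (j # js) N (carrier M)" and N: "sub N" and s: "sorted (j # js)"
    and pN: "p ` N \<subseteq> N" and qN: "q ` N \<subseteq> N"
    and v: "v \<in> mgr M j" "mdiff M v \<in> N" "prim A e" "ract M v e = v" "p v \<notin> N"
    and IH: "\<And>N'. [|rf A M js N' (carrier M); sub N'; p ` N' \<subseteq> N'; q ` N' \<subseteq> N'|] ==>
      \<exists>js1 js2. sorted js1 \<and> sorted js2 \<and> set js1 \<subseteq> set js \<and> set js2 \<subseteq> set js \<and>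
        length js1 + length js2 = length js \<and>
        rf A M js1 (p ` N') (p ` carrier M) \<and> rf A M js2 (q ` N') (q ` carrier M)"
  shows "\<exists>js1 js2. sorted js1 \<and> sorted js2 \<and> set js1 \<subseteq> set (j # js) \<and> set js2 \<subseteq> set (j # js) \<and>
        length js1 + length js2 = length (j # js) \<and>
        rf A M js1 (p ` N) (p ` carrier M) \<and> rf A M js2 (q ` N) (q ` carrier M)"
proof -
  note pD = dg_homD[OF p] and qD = dg_homD[OF q]
  have vc: "v \<in> carrier M" using v mgr_carrier by auto
  have ec: "e \<in> carrier A" using v prim_carrier by auto
  have pvc: "p v \<in> carrier M" using pD(1) vc by simp
  have pve: "ract M (p v) e = p v" using pD(3)[OF vc ec] v by simp
  have pvd: "mdiff M (p v) = p (mdiff M v)" using pD(5)[OF vc] by simp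
  hence pvN: "mdiff M (p v) \<in> p ` N" "mdiff M (p v) \<in> N" using v pN by auto
  \<comment> \<open>The boundary of \<open>p v\<close> is p(dv), which lies in p N and thus in
    \<open>N\<close>, so \<open>p v\<close> may serve as lowest cell.\<close>
  from exchange[OF r N s, of j "p v" e] pD(4)[OF v(1)] pvc v pve pvN s
  have c: "cell A M j e (p v) N" "rf A M js (ad N (p v)) (carrier M)" by auto
  have pp: "p (p x) = p x" if "x \<in> carrier M" for x
  proof -
    have "p x = p (p x) \<oplus>\<^bsub>M\<^esub> q (p x)" "q (p x) = (zero M)"
      using pq[OF pD(1)[OF that]] pq[OF that] by blast+
    thus ?thesis using pD(1)[OF pD(1)[OF that]] by (metis M.r_zero)
  qed
  have qp0: "q (p v) = (zero M)" using pq[OF vc] by blast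
  have NC: "N \<subseteq> carrier M" using sub_carrier[OF N] by auto
  have p1: "p (n \<oplus>\<^bsub>M\<^esub> ract M (p v) a) = p n \<oplus>\<^bsub>M\<^esub> ract M (p v) a" if "n \<in> N" "a \<in> carrier A" for n a
    using pD(2)[OF subsetD[OF NC that(1)] ract_closed[OF pvc that(2)]] pD(3)[OF pvc that(2)] pp[OF vc] by simp
  have q1: "q (n \<oplus>\<^bsub>M\<^esub> ract M (p v) a) = q n" if "n \<in> N" "a \<in> carrier A" for n a
    using qD(2)[OF subsetD[OF NC that(1)] ract_closed[OF pvc that(2)]] qD(3)[OF pvc that(2)] qp0
      qD(1)[OF subsetD[OF NC that(1)]] ract_zero_l[OF that(2)] by simp
  \<comment> \<open>Adjoining \<open>p v\<close> enlarges only the image under \<open>p\<close>,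
    because \<open>q\<close> kills it. The new cell is credited to the first summand and the second
    is left as it was.\<close>
  have pN1: "p ` ad N (p v) = ad (p ` N) (p v)" 
  proof (intro equalityI subsetI)
    fix y assume "y \<in> p ` ad N (p v)"
    then obtain n a where "n \<in> N" "a \<in> carrier A" "y = p (n \<oplus>\<^bsub>M\<^esub> ract M (p v) a)" by (auto simp: adj_def)
    thus "y \<in> ad (p ` N) (p v)" using p1 by (auto intro: adI)
  next
    fix y assume "y \<in> ad (p ` N) (p v)"
    then obtain n a where "n \<in> N" "a \<in> carrier A" "y = p n \<oplus>\<^bsub>M\<^esub> ract M (p v) a" by (auto simp: adj_def)
    hence "y = p (n \<oplus>\<^bsub>M\<^esub> ract M (p v) a)" "n \<oplus>\<^bsub>M\<^esub> ract M (p v) a \<in> ad N (p v)"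
      using p1 by (auto intro: adI)
    thus "y \<in> p ` ad N (p v)" by blast
  qed
  have qN1: "q ` ad N (p v) = q ` N"
  proof
    show "q ` ad N (p v) \<subseteq> q ` N"
    proof
      fix y assume "y \<in> q ` ad N (p v)"
      then obtain n a where "n \<in> N" "a \<in> carrier A" "y = q (n \<oplus>\<^bsub>M\<^esub> ract M (p v) a)" by (auto simp: adj_def)
      thus "y \<in> q ` N" using q1 by auto
    qed
    show "q ` N \<subseteq> q ` ad N (p v)" using ad_base[OF N pvc] by auto
  qed
  have "p ` ad N (p v) \<subseteq> ad N (p v)" unfolding pN1 by (rule ad_mono[OF pN])
  moreover have "q ` ad N (p v) \<subseteq> ad N (p v)" unfolding qN1 using qN ad_base[OF N pvc] by auto
  ultimately obtain js1 js2 where js: "sorted js1" "sorted js2" "set js1 \<subseteq> set js" "set js2 \<subseteq> set js"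
        "length js1 + length js2 = length js"
        "rf A M js1 (ad (p ` N) (p v)) (p ` carrier M)" "rf A M js2 (q ` N) (q ` carrier M)"
    using IH[OF c(2) cell_sub[OF N c(1)]] unfolding pN1 qN1 by blast
  have "cell A M j e (p v) (p ` N)" using c(1) pvN pN by (auto simp: cell_def)
  hence "rf A M (j # js1) (p ` N) (p ` carrier M)" using js(6) by (rule rf.Cons)
  thus ?thesis
    by (intro exI[of _ "j # js1"] exI[of _ js2]) (use js s in auto)
qed

text \<open>Since v = p v + q v lies outside \<open>N\<close>, so does \<open>p v\<close> or
  \<open>q v\<close>, and \<open>split_cell\<close> makes it the next cell of its summand. The
  second case is the first with \<open>p\<close> and \<open>q\<close>, and the two lists,
  interchanged.\<close>

lemma rf_split:
  assumes p: "p \<in> dg_hom A M M" and q: "q \<in> dg_hom A M M"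
    and pq: "\<And>x. x \<in> carrier M ==> x = p x \<oplus>\<^bsub>M\<^esub> q x \<and> p (q x) = (zero M) \<and> q (p x) = (zero M)"
    and "rf A M js N (carrier M)" "sub N" "sorted js" "p ` N \<subseteq> N" "q ` N \<subseteq> N"
  shows "\<exists>js1 js2. sorted js1 \<and> sorted js2 \<and> set js1 \<subseteq> set js \<and> set js2 \<subseteq> set js \<and>
        length js1 + length js2 = length js \<and>
        rf A M js1 (p ` N) (p ` carrier M) \<and> rf A M js2 (q ` N) (q ` carrier M)"
  using assms(4-)
proof (induction js arbitrary: N)
  case Nil
  from Nil(1) have "N = carrier M" by (cases rule: rf.cases) auto
  thus ?case using rf.Nil by auto
next
  case (Cons j js)
  note N = \<open>sub N\<close>
  from Cons.prems(1) obtain e v where c: "cell A M j e v N" by (cases rule: rf.cases) auto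
  note cD = cellD[OF c]
  have qp: "x = q x \<oplus>\<^bsub>M\<^esub> p x \<and> q (p x) = (zero M) \<and> p (q x) = (zero M)" if "x \<in> carrier M" for x
    using pq[OF that] dg_homD(1)[OF p that] dg_homD(1)[OF q that] by (metis M.a_comm)
  have "p v \<notin> N \<or> q v \<notin> N" using cell_notin[OF c] pq[OF cD(5)] sub_add[OF N] by metis
  thus ?case
  proof
    assume "p v \<notin> N"
    from split_cell[OF p q pq Cons.prems(1,2,3,4,5) cD(1,4,2,3) this Cons.IH] Cons.prems(3)
    show ?thesis by simp
  next
    assume a: "q v \<notin> N"
    have "\<exists>js1 js2. sorted js1 \<and> sorted js2 \<and> set js1 \<subseteq> set js \<and> set js2 \<subseteq> set js \<and>
        length js1 + length js2 = length js \<and>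
        rf A M js1 (q ` N') (q ` carrier M) \<and> rf A M js2 (p ` N') (p ` carrier M)"
      if "rf A M js N' (carrier M)" "sub N'" "q ` N' \<subseteq> N'" "p ` N' \<subseteq> N'" for N'
    proof -
      from Cons.IH[OF that(1,2) _ that(4,3)] Cons.prems(3) obtain js1 js2 where
        "sorted js1" "sorted js2" "set js1 \<subseteq> set js" "set js2 \<subseteq> set js" "length js1 + length js2 = length js"
        "rf A M js1 (p ` N') (p ` carrier M)" "rf A M js2 (q ` N') (q ` carrier M)" by auto
      thus ?thesis by (intro exI[of _ js2] exI[of _ js1]) auto
    qed
    from split_cell[OF q p qp Cons.prems(1,2,3,5,4) cD(1,4,2,3) a this]
    obtain js1 js2 where
        "sorted js1" "sorted js2" "set js1 \<subseteq> set (j # js)" "set js2 \<subseteq> set (j # js)"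
        "length js1 + length js2 = length (j # js)"
        "rf A M js1 (q ` N) (q ` carrier M)" "rf A M js2 (p ` N) (p ` carrier M)" by auto
    thus ?thesis by (intro exI[of _ js2] exI[of _ js1]) auto
  qed
qed

lemma diff_add: "[|a \<in> carrier M; b \<in> carrier M; c \<in> carrier M|] ==> (a \<ominus>\<^bsub>M\<^esub> b) \<oplus>\<^bsub>M\<^esub> (b \<ominus>\<^bsub>M\<^esub> c) = a \<ominus>\<^bsub>M\<^esub> c"
  by (simp add: a_minus_def M.a_assoc M.r_neg2 M.r_neg1)

lemma diff_diff: "[|a \<in> carrier M; b \<in> carrier M; c \<in> carrier M|] ==> (a \<ominus>\<^bsub>M\<^esub> b) \<ominus>\<^bsub>M\<^esub> c = a \<ominus>\<^bsub>M\<^esub> (b \<oplus>\<^bsub>M\<^esub> c)"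
  by (simp add: a_minus_def M.minus_add M.a_assoc)

lemma sub_diff_trans:
  "[|sub N; a \<in> carrier M; b \<in> carrier M; c \<in> carrier M; a \<ominus>\<^bsub>M\<^esub> b \<in> N; b \<ominus>\<^bsub>M\<^esub> c \<in> N|] ==> a \<ominus>\<^bsub>M\<^esub> c \<in> N"
  using sub_add[of N "a \<ominus>\<^bsub>M\<^esub> b" "b \<ominus>\<^bsub>M\<^esub> c"] by (simp add: diff_add)

lemma diff_self: "a \<in> carrier M ==> a \<ominus>\<^bsub>M\<^esub> a = (zero M)"
  by (simp add: a_minus_def M.r_neg)

lemma diff_zero_eq: "[|a \<in> carrier M; b \<in> carrier M; a \<ominus>\<^bsub>M\<^esub> b = (zero M)|] ==> a = b"
  using M.minus_equality[of a "\<ominus>\<^bsub>M\<^esub> b"] by (simp add: a_minus_def)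

lemma sub_diff_mem: "[|sub N; a \<in> carrier M; b \<in> N; a \<ominus>\<^bsub>M\<^esub> b \<in> N|] ==> a \<in> N"
  using sub_add[of N "a \<ominus>\<^bsub>M\<^esub> b" b] sub_carrier[of N b] by (simp add: a_minus_def M.a_assoc M.l_neg)

end

text \<open>The induced endomorphism of \<open>T / N\<close> satisfies Fitting's lemma with exponent \<open>n\<close>.\<close>

definition fitn :: "('a, 'm) dgmodule \<Rightarrow> ('m \<Rightarrow> 'm) \<Rightarrow> nat \<Rightarrow> 'm set \<Rightarrow> 'm set \<Rightarrow> bool" where
  "fitn M f n N T \<longleftrightarrow> (\<forall>x\<in>T. (f ^^ Suc n) x \<in> N \<longrightarrow> (f ^^ n) x \<in> N) \<and>
     (\<forall>x\<in>T. \<exists>y\<in>T. (f ^^ n) x \<ominus>\<^bsub>M\<^esub> (f ^^ Suc n) y \<in> N)"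

section \<open>Fitting's lemma for endomorphisms of relative filtrations\<close>

locale pdgm_end = pdgm A M for A :: "('k, 'a) dgalgebra" (structure) and M :: "('a, 'm) dgmodule" (structure) +
  fixes f :: "'m \<Rightarrow> 'm"
  assumes fhom: "f \<in> dg_hom A M M"
begin

lemmas fD = dg_homD[OF fhom]

abbreviation "fstab N \<equiv> f ` N \<subseteq> N"

lemma pow_stable: "[|fstab N; x \<in> N|] ==> (f ^^ n) x \<in> N"
  by (induction n) auto

lemma stable_M: "fstab (carrier M)"
  using fD(1) by auto

lemma pow_closed: "x \<in> carrier M ==> (f ^^ n) x \<in> carrier M"
  using pow_stable[OF stable_M] .

lemma pow_addmap: "addmap M M (f ^^ n)"
proof (induction n)
  case 0
  thus ?case by (simp add: addmap_def)
next
  case (Suc n)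
  thus ?case using addmap_comp[OF Suc fD(7)] by (simp add: addmap_def)
qed

lemma pow_add: "[|x \<in> carrier M; y \<in> carrier M|] ==> (f ^^ n) (x \<oplus>\<^bsub>M\<^esub> y) = (f ^^ n) x \<oplus>\<^bsub>M\<^esub> (f ^^ n) y"
  by (rule addmap_add[OF pow_addmap])

lemma pow_diff: "[|x \<in> carrier M; y \<in> carrier M|] ==> (f ^^ n) (x \<ominus>\<^bsub>M\<^esub> y) = (f ^^ n) x \<ominus>\<^bsub>M\<^esub> (f ^^ n) y"
  by (rule addmap_diff[OF M.abelian_group_axioms M.abelian_group_axioms pow_addmap])

lemma f_diff: "[|x \<in> carrier M; y \<in> carrier M|] ==> f (x \<ominus>\<^bsub>M\<^esub> y) = f x \<ominus>\<^bsub>M\<^esub> f y"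
  using pow_diff[of x y 1] by simp

lemma pow_pow: "(f ^^ m) ((f ^^ n) x) = (f ^^ (m + n)) x"
  by (simp add: funpow_add)

lemma fit_ker:
  assumes "fitn M f n N T" "fstab T" "x \<in> T" "(f ^^ (n + k)) x \<in> N"
  shows "(f ^^ n) x \<in> N"
  using assms(4)
proof (induction k)
  case (Suc k)
  have "(f ^^ Suc n) ((f ^^ k) x) \<in> N" using Suc.prems by (simp add: pow_pow)
  hence "(f ^^ n) ((f ^^ k) x) \<in> N"
    using assms(1) pow_stable[OF assms(2,3)] unfolding fitn_def by blast
  thus ?case using Suc.IH by (simp add: pow_pow)
qed simp

lemma fit_im:
  assumes "fitn M f n N T" "sub N" "fstab N" "fstab T" "T \<subseteq> carrier M" "x \<in> T"
  shows "\<exists>y\<in>T. (f ^^ n) x \<ominus>\<^bsub>M\<^esub> (f ^^ (n + k)) y \<in> N"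
proof (induction k)
  case 0
  thus ?case using assms pow_closed[of x n] by (intro bexI[of _ x]) (auto simp: diff_self sub_zero)
next
  case (Suc k)
  then obtain y where y: "y \<in> T" "(f ^^ n) x \<ominus>\<^bsub>M\<^esub> (f ^^ (n + k)) y \<in> N" by blast
  obtain z where z: "z \<in> T" "(f ^^ n) y \<ominus>\<^bsub>M\<^esub> (f ^^ Suc n) z \<in> N" using assms(1) y(1) unfolding fitn_def by blast
  have c: "x \<in> carrier M" "y \<in> carrier M" "z \<in> carrier M" using assms y z by auto
  have "(f ^^ k) ((f ^^ n) y \<ominus>\<^bsub>M\<^esub> (f ^^ Suc n) z) \<in> N" by (rule pow_stable[OF assms(3) z(2)])
  hence "(f ^^ (n + k)) y \<ominus>\<^bsub>M\<^esub> (f ^^ (n + Suc k)) z \<in> N"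
    using pow_diff[OF pow_closed[OF c(2)] pow_closed[OF c(3)], of k n "Suc n"]
    unfolding pow_pow by (simp add: ac_simps)
  hence "(f ^^ n) x \<ominus>\<^bsub>M\<^esub> (f ^^ (n + Suc k)) z \<in> N"
    by (rule sub_diff_trans[OF assms(2) pow_closed[OF c(1)] pow_closed[OF c(2)] pow_closed[OF c(3)] y(2)])
  thus ?case using z by blast
qed

lemma fit_mono:
  assumes "fitn M f n N T" "sub N" "fstab N" "fstab T" "T \<subseteq> carrier M"
  shows "fitn M f (n + k) N T"
  unfolding fitn_def
proof (intro conjI ballI impI)
  fix x assume x: "x \<in> T"
  show "(f ^^ (n + k)) x \<in> N" if "(f ^^ Suc (n + k)) x \<in> N"
  proof -
    have "(f ^^ n) ((f ^^ k) x) \<in> N"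
      by (rule fit_ker[OF assms(1,4) pow_stable[OF assms(4) x], of 1]) (use that in \<open>simp add: pow_pow\<close>)
    thus ?thesis by (simp add: pow_pow)
  qed
  obtain y where y: "y \<in> T" "(f ^^ n) x \<ominus>\<^bsub>M\<^esub> (f ^^ Suc n) y \<in> N" using assms(1) x unfolding fitn_def by blast
  have c: "x \<in> carrier M" "y \<in> carrier M" using assms y x by auto
  have "(f ^^ k) ((f ^^ n) x \<ominus>\<^bsub>M\<^esub> (f ^^ Suc n) y) \<in> N" by (rule pow_stable[OF assms(3) y(2)])
  hence "(f ^^ (n + k)) x \<ominus>\<^bsub>M\<^esub> (f ^^ Suc (n + k)) y \<in> N"
    using pow_diff[OF pow_closed[OF c(1)] pow_closed[OF c(2)], of k n "Suc n"]
    unfolding pow_pow by (simp add: ac_simps)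
  thus "\<exists>y\<in>T. (f ^^ (n + k)) x \<ominus>\<^bsub>M\<^esub> (f ^^ Suc (n + k)) y \<in> N" using y by blast
qed

text \<open>Both exponents are raised to a common \<open>n\<close>, and then \<open>n + n\<close>
  works for the extension.\<close>

lemma fit_ext:
  assumes a: "fitn M f m N N'" "fitn M f m' N' T" and N: "sub N" "sub N'" "sub T"
    and st: "fstab N" "fstab N'" "fstab T" and ss: "N \<subseteq> N'" "N' \<subseteq> T"
  shows "\<exists>n. fitn M f n N T"
proof -
  define n where "n = m + m'"
  have TC: "T \<subseteq> carrier M" "N' \<subseteq> carrier M" using sub_carrier[OF N(3)] sub_carrier[OF N(2)] by auto
  have f1: "fitn M f n N N'" unfolding n_def by (rule fit_mono[OF a(1) N(1) st(1,2) TC(2)])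
  have f2: "fitn M f n N' T" unfolding n_def add.commute[of m] by (rule fit_mono[OF a(2) N(2) st(2,3) TC(1)])
  have "fitn M f (n + n) N T"
    unfolding fitn_def
  proof (intro conjI ballI impI)
    fix x assume x: "x \<in> T"
    \<comment> \<open>The condition for T/N' places f^n x in N', and there the condition for N'/N
      applies to it.\<close>
    show "(f ^^ (n + n)) x \<in> N" if k: "(f ^^ Suc (n + n)) x \<in> N"
    proof -
      have "(f ^^ n) x \<in> N'" by (rule fit_ker[OF f2 st(3) x, of "Suc n"]) (use k ss in auto)
      moreover have "(f ^^ Suc n) ((f ^^ n) x) \<in> N" using k by (simp add: pow_pow)
      ultimately have "(f ^^ n) ((f ^^ n) x) \<in> N" using f1 unfolding fitn_def by blast
      thus ?thesis by (simp add: pow_pow)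
    qed
    obtain y where y: "y \<in> T" "(f ^^ n) x \<ominus>\<^bsub>M\<^esub> (f ^^ Suc n) y \<in> N'" using f2 x unfolding fitn_def by blast
    \<comment> \<open>The error f^n x - f^(n+1) y lies in N'. Its image under f^n agrees modulo
      \<open>N\<close> with some f^(2n+1) u, so y + u corrects \<open>y\<close>.\<close>
    from fit_im[OF f1 N(1) st(1,2) TC(2) y(2), of "Suc n"] obtain u where u: "u \<in> N'"
      "(f ^^ n) ((f ^^ n) x \<ominus>\<^bsub>M\<^esub> (f ^^ Suc n) y) \<ominus>\<^bsub>M\<^esub> (f ^^ (n + Suc n)) u \<in> N" by blast
    have c: "x \<in> carrier M" "y \<in> carrier M" "u \<in> carrier M" using x y u TC by auto
    have "(f ^^ n) ((f ^^ n) x \<ominus>\<^bsub>M\<^esub> (f ^^ Suc n) y) = (f ^^ (n + n)) x \<ominus>\<^bsub>M\<^esub> (f ^^ Suc (n + n)) y"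
      using pow_diff[OF pow_closed[OF c(1)] pow_closed[OF c(2)], of n n "Suc n"] unfolding pow_pow by simp
    hence "(f ^^ (n + n)) x \<ominus>\<^bsub>M\<^esub> (f ^^ Suc (n + n)) (y \<oplus>\<^bsub>M\<^esub> u) \<in> N"
      using u(2) pow_add[OF c(2,3), of "Suc (n + n)"] pow_closed[OF c(1)] pow_closed[OF c(2)] pow_closed[OF c(3)]
        diff_diff[OF pow_closed[OF c(1)] pow_closed[OF c(2)] pow_closed[OF c(3)], of "n + n" "Suc (n + n)" "n + Suc n"]
      by simp
    thus "\<exists>y\<in>T. (f ^^ (n + n)) x \<ominus>\<^bsub>M\<^esub> (f ^^ Suc (n + n)) y \<in> N"
      using sub_add[OF N(3) y(1)] u ss by blast
  qed
  thus ?thesis by blast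
qed

end

section \<open>One step of Fitting's lemma: the cells of lowest degree above a stable
  submodule\<close>

locale fit_step = pdgm_end A M f
  for A :: "('k, 'a) dgalgebra" (structure) and M :: "('a, 'm) dgmodule" (structure) and f +
  fixes N j js
  assumes rN: "rf A M (j # js) N (carrier M)" and N: "sub N" and srt: "sorted (j # js)"
    and fN: "fstab N"
begin

text \<open>Up to multiplication by primitive idempotents, the elements of \<open>Z\<close> outside
  \<open>N\<close> are the ones that \<open>exchange\<close> accepts as lowest cells. Modulo
  \<open>N\<close> they play the role of a finite-dimensional vector space on which \<open>f\<close>
  acts.\<close>

definition "Z = {z \<in> mgr M j. mdiff M z \<in> N}"

lemma ZD: "z \<in> Z ==> z \<in> mgr M j" "z \<in> Z ==> mdiff M z \<in> N" "z \<in> Z ==> z \<in> carrier M"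
  using mgr_carrier by (auto simp: Z_def)

lemma Z_ract: "[|z \<in> Z; a \<in> agr A 0|] ==> ract M z a \<in> Z"
  using mdiff_ract0[of z j a] mgr_ract[of z j a 0] sub_ract[OF N, of "mdiff M z" a] agr_carrier[of a 0]
  by (simp add: Z_def)

lemma Z_f: "z \<in> Z ==> f z \<in> Z"
  using fD(4)[of z j] fD(5)[of z] fN mgr_carrier[of z j] by (auto simp: Z_def)

lemma Z_diff: "[|z \<in> Z; w \<in> Z|] ==> z \<ominus>\<^bsub>M\<^esub> w \<in> Z"
  using mgr_diff[of z j w] mdiff_diff[of z w] sub_diff[OF N] mgr_carrier by (auto simp: Z_def)

abbreviation "adjs \<equiv> foldl ad N"

text \<open>The analogue of a linearly independent list in \<open>Z\<close> modulo \<open>N\<close>,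
  each member being tied to a primitive idempotent.\<close>

inductive good :: "'m list \<Rightarrow> bool" where
  Nil: "good []"
| snoc: "[|good xs; x \<in> Z; x \<notin> adjs xs; prim A e; ract M x e = x|] ==> good (xs @ [x])"

lemma adjs_sub: "set xs \<subseteq> Z ==> sub (adjs xs) \<and> N \<subseteq> adjs xs"
proof (induction xs rule: rev_induct)
  case (snoc x xs)
  hence *: "sub (adjs xs)" "N \<subseteq> adjs xs" "x \<in> Z" by auto
  have "mdiff M x \<in> adjs xs" using ZD(2)[OF *(3)] *(2) by auto
  hence "sub (ad (adjs xs) x)" using sub_ad[OF *(1) ZD(1)[OF *(3)]] by simp
  moreover have "adjs xs \<subseteq> ad (adjs xs) x" using ad_base[OF *(1) ZD(3)[OF *(3)]] by auto
  ultimately show ?case using * by auto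
qed (simp add: N)

lemma adjs_least: "[|sub N'; N \<subseteq> N'; set xs \<subseteq> N'|] ==> adjs xs \<subseteq> N'"
proof (induction xs rule: rev_induct)
  case (snoc x xs)
  thus ?case using ad_least[of N' "adjs xs" x] by simp
qed simp

lemma good_Z: "good xs ==> set xs \<subseteq> Z"
  by (induction rule: good.induct) auto

text \<open>Repeated exchange turns the members of a good list into the first cells. So a good list
  is never longer than the filtration, and \<open>good_max\<close> finds one of maximal
  length.\<close>

lemma good_rf:
  assumes "good xs"
  shows "\<exists>js'. j # js = replicate (length xs) j @ js' \<and> rf A M js' (adjs xs) (carrier M)"
    "[|x \<in> Z; x \<notin> adjs xs; prim A e; ract M x e = x|] ==> cell A M j e x (adjs xs)"
proof -
  have step: "cell A M j e x (adjs xs) \<and> (\<exists>js''. js' = j # js'' \<and> rf A M js'' (ad (adjs xs) x) (carrier M))"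
    if "good xs" "j # js = replicate (length xs) j @ js'" "rf A M js' (adjs xs) (carrier M)"
      "x \<in> Z" "x \<notin> adjs xs" "prim A e" "ract M x e = x" for xs x e js'
  proof -
    have "sorted (replicate (length xs) j @ js')" "sorted (j # js)" using srt that(2) by auto
    hence "sorted js'" "\<forall>i\<in>set js'. j \<le> i"
      using that(2) by (auto simp: sorted_append)
    thus ?thesis
      using exchange[OF that(3), of j x e] adjs_sub[OF good_Z[OF that(1)]] ZD[OF that(4)] that by blast
  qed
  show 1: "\<exists>js'. j # js = replicate (length xs) j @ js' \<and> rf A M js' (adjs xs) (carrier M)"
    using assms
  proof (induction rule: good.induct)
    case Nil
    thus ?case using rN by simp
  next
    case (snoc xs x e)
    then obtain js' where js': "j # js = replicate (length xs) j @ js'" "rf A M js' (adjs xs) (carrier M)" by blast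
    obtain js'' where js'': "js' = j # js''" "rf A M js'' (ad (adjs xs) x) (carrier M)"
      using step[OF snoc(1) js' snoc(2-5)] by blast
    have "j # js = replicate (length (xs @ [x])) j @ js''"
      using js'(1) js''(1) by (simp add: replicate_app_Cons_same)
    thus ?case using js''(2) by auto
  qed
  then obtain js' where js': "j # js = replicate (length xs) j @ js'" "rf A M js' (adjs xs) (carrier M)" by blast
  show "[|x \<in> Z; x \<notin> adjs xs; prim A e; ract M x e = x|] ==> cell A M j e x (adjs xs)"
    using step[OF assms js'] by blast
qed

lemma good_max: obtains xs where "good xs" "\<And>ys. good ys ==> length ys \<le> length xs"
proof -
  have b: "length xs \<le> length (j # js)" if "good xs" for xs
  proof -
    obtain js' where js': "j # js = replicate (length xs) j @ js'" using good_rf(1)[OF \<open>good xs\<close>] by blast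
    show ?thesis unfolding js' by simp
  qed
  hence "\<exists>xs. good xs \<and> (\<forall>ys. good ys \<longrightarrow> length ys \<le> length xs)"
    using ex_has_greatest_nat[of good "[]" length "length (j # js) + 1"] good.Nil by (metis less_Suc_eq_le Suc_eq_plus1)
  thus ?thesis using that by blast
qed

text \<open>A maximal independent list spans: an element of \<open>Z\<close> outside the span has a
  multiple by a primitive idempotent outside it, which would prolong the list.\<close>

lemma max_Z:
  assumes "good xs" "\<And>ys. good ys ==> length ys \<le> length xs" "z \<in> Z"
  shows "z \<in> adjs xs"
proof (rule ccontr)
  assume "z \<notin> adjs xs"
  then obtain e where e: "prim A e" "ract M z e \<notin> adjs xs"
    using prim_witness[OF ZD(3)[OF assms(3)]] adjs_sub[OF good_Z[OF assms(1)]] by blast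
  have "ract M (ract M z e) e = ract M z e"
    using ZD(3)[OF assms(3)] prim_carrier[OF e(1)] prim_idem[OF e(1)] by (simp add: ract_assoc)
  hence "good (xs @ [ract M z e])"
    using good.snoc[OF assms(1) Z_ract[OF assms(3) prim_deg[OF e(1)]] e(2,1)] by simp
  thus False using assms(2) by fastforce
qed

lemma adjs_map1: "[|set xs \<subseteq> Z; z \<in> adjs xs|] ==> f z \<in> adjs (map f xs)"
proof (induction xs arbitrary: z rule: rev_induct)
  case Nil
  thus ?case using fN by auto
next
  case (snoc x xs)
  from snoc.prems obtain n a where z: "n \<in> adjs xs" "a \<in> carrier A" "z = n \<oplus>\<^bsub>M\<^esub> ract M x a"
    by (auto elim: adE)
  have c: "n \<in> carrier M" "x \<in> carrier M" using z snoc.prems sub_carrier[of "adjs xs" n] adjs_sub[of xs] ZD by auto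
  hence "f z = f n \<oplus>\<^bsub>M\<^esub> ract M (f x) a" using z fD(2)[of n "ract M x a"] fD(3)[of x a] by (simp add: ract_closed)
  thus ?case using snoc z by (auto intro: adI)
qed

text \<open>The counterpart of \<open>adjs_map1\<close> can only hold modulo \<open>N\<close>,
  because \<open>f\<close> need not map \<open>N\<close> onto itself.\<close>

lemma adjs_map2: "[|set xs \<subseteq> Z; y \<in> adjs (map f xs)|] ==> \<exists>z\<in>adjs xs. y \<ominus>\<^bsub>M\<^esub> f z \<in> N"
proof (induction xs arbitrary: y rule: rev_induct)
  case Nil
  have z: "f (zero M) = (zero M)" by (rule addmap_zero[OF M.abelian_group_axioms M.abelian_group_axioms fD(7)])
  have "y \<in> carrier M" using Nil sub_carrier[OF N] by auto
  hence "y \<ominus>\<^bsub>M\<^esub> f (zero M) = y" by (simp add: z a_minus_def)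
  thus ?case using Nil sub_zero[OF N] by (intro bexI[of _ "zero M"]) auto
next
  case (snoc x xs)
  from snoc.prems obtain n a where y: "n \<in> adjs (map f xs)" "a \<in> carrier A" "y = n \<oplus>\<^bsub>M\<^esub> ract M (f x) a"
    by (auto elim: adE)
  from snoc y obtain z where z: "z \<in> adjs xs" "n \<ominus>\<^bsub>M\<^esub> f z \<in> N" by auto
  have s: "sub (adjs xs)" "sub (adjs (map f xs))"
    using adjs_sub[of xs] adjs_sub[of "map f xs"] snoc.prems Z_f by auto
  have c: "n \<in> carrier M" "x \<in> carrier M" "z \<in> carrier M" "f x \<in> carrier M" "f z \<in> carrier M"
    using y z snoc.prems sub_carrier[OF s(1)] sub_carrier[OF s(2)] ZD fD(1) by auto
  have "f (z \<oplus>\<^bsub>M\<^esub> ract M x a) = f z \<oplus>\<^bsub>M\<^esub> ract M (f x) a" using c y fD(2,3) by (simp add: ract_closed)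
  hence "y \<ominus>\<^bsub>M\<^esub> f (z \<oplus>\<^bsub>M\<^esub> ract M x a) = n \<ominus>\<^bsub>M\<^esub> f z"
    using c y ract_closed[of "f x" a] by (simp add: a_minus_def M.minus_add M.a_assoc M.r_neg1 M.a_lcomm[of "ract M (f x) a"] M.r_neg)
  thus ?case using y z by (intro bexI[of _ "z \<oplus>\<^bsub>M\<^esub> ract M x a"]) (auto intro: adI)
qed

text \<open>The coefficients of a degree \<open>j\<close> element may be taken of degree zero, where
  the differential of \<open>A\<close> vanishes, so multiplying by them keeps boundaries in
  \<open>N\<close>.\<close>

lemma adjs_Z: "[|set xs \<subseteq> Z; z \<in> adjs xs; z \<in> mgr M j|] ==> z \<in> Z \<or> z \<in> N"
proof (induction xs arbitrary: z rule: rev_induct)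
  case (snoc x xs)
  have s: "sub (adjs xs)" "x \<in> Z" using adjs_sub[of xs] snoc.prems by auto
  obtain n a where z: "n \<in> adjs xs" "n \<in> mgr M j" "a \<in> agr A (j - j)" "z = n \<oplus>\<^bsub>M\<^esub> ract M x a"
    using ad_deg[OF s(1) ZD(1)[OF s(2)], of z j] snoc.prems by auto
  have "n \<in> Z \<or> n \<in> N" using snoc z by auto
  hence "mdiff M n \<in> N" using ZD sub_mdiff[OF N] by auto
  hence "mdiff M z \<in> N"
    using z ZD[OF Z_ract[OF s(2), of a]] mdiff_add[of n "ract M x a"] mgr_carrier[OF z(2)] sub_add[OF N] by auto
  thus ?case using snoc.prems by (auto simp: Z_def)
qed simp

text \<open>By injectivity modulo \<open>N\<close> a maximal good list is carried to a good list of
  the same length, which is again maximal. Both span all of \<open>Z\<close>, hence the same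
  submodule N', and \<open>f\<close> is bijective on N'/N: exponent zero.\<close>

lemma fit_step:
  assumes inj: "\<And>z. [|z \<in> Z; f z \<in> N|] ==> z \<in> N"
  shows "\<exists>N' js'. sub N' \<and> N \<subseteq> N' \<and> fstab N' \<and> length js' < length (j # js) \<and> sorted js' \<and>
    rf A M js' N' (carrier M) \<and> fitn M f 0 N N'"
proof -
  obtain xs where xs: "good xs" and mx: "\<And>ys. good ys ==> length ys \<le> length xs" by (rule good_max) blast
  have gm: "good (map f xs)" if "good xs" for xs
    using that
  proof (induction rule: good.induct)
    case Nil
    thus ?case by (simp add: good.Nil)
  next
    case (snoc xs x e)
    have xsZ: "set xs \<subseteq> Z" by (rule good_Z) fact
    note s = adjs_sub[OF xsZ]
    have "f x \<notin> adjs (map f xs)"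
    proof
      assume "f x \<in> adjs (map f xs)"
      from adjs_map2[OF xsZ this] obtain z where z: "z \<in> adjs xs" "f x \<ominus>\<^bsub>M\<^esub> f z \<in> N" by blast
      have c: "x \<in> carrier M" "z \<in> carrier M" using ZD snoc z s sub_carrier by auto
      \<comment> \<open>\<open>z\<close> need not be homogeneous, but its component of degree
        \<open>j\<close> stays in the span, and taking that component of f x - f z shows that f(x -
        y) lies in \<open>N\<close>.\<close>
      define y where "y = hc M j z"
      have y: "y \<in> adjs xs" "y \<in> mgr M j" using z s sub_hc hc_mgr c by (auto simp: y_def)
      have "hc M j (f x \<ominus>\<^bsub>M\<^esub> f z) = hc M j (f x) \<ominus>\<^bsub>M\<^esub> hc M j (f z)" using c fD(1) by (simp add: hc_diff)
      also have "\<dots> = f x \<ominus>\<^bsub>M\<^esub> f y"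
        using dg_hom_hc[OF dg_module_axioms dg_module_axioms fhom] c hc_hom[OF ZD(1)[OF snoc(2)]]
        by (simp add: y_def)
      also have "\<dots> = f (x \<ominus>\<^bsub>M\<^esub> y)" using c y mgr_carrier by (simp add: f_diff)
      finally have fy: "f (x \<ominus>\<^bsub>M\<^esub> y) \<in> N" using sub_hc[OF N z(2)] by metis
      have "x \<ominus>\<^bsub>M\<^esub> y \<in> Z" using adjs_Z[OF xsZ y] sub_mdiff[OF N] y(2) Z_diff[OF snoc(2)] by (auto simp: Z_def)
      hence "x \<ominus>\<^bsub>M\<^esub> y \<in> N" using inj fy by blast
      hence "x \<in> adjs xs" using sub_diff_mem[of "adjs xs" x y] s c y by blast
      thus False using snoc by blast
    qed
    moreover have "ract M (f x) e = f x" using fD(3)[of x e] snoc prim_carrier ZD by simp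
    ultimately show ?case using good.snoc[OF snoc.IH Z_f[OF snoc(2)] _ snoc(4)] by simp
  qed
  have fx: "good (map f xs)" and mxf: "\<And>ys. good ys ==> length ys \<le> length (map f xs)" using gm[OF xs] mx by auto
  let ?N' = "adjs xs"
  have xsZ: "set xs \<subseteq> Z" using good_Z[OF xs] .
  note s = adjs_sub[OF xsZ]
  have fxZ: "set (map f xs) \<subseteq> Z" using xsZ Z_f by auto
  have ZN': "Z \<subseteq> ?N'" using max_Z[OF xs mx] by blast
  have ZfN': "Z \<subseteq> adjs (map f xs)" using max_Z[OF fx mxf] by blast
  have "adjs (map f xs) \<subseteq> ?N'" by (rule adjs_least) (use s fxZ ZN' in auto)
  hence st: "fstab ?N'" using adjs_map1[OF xsZ] by auto
  have "?N' \<subseteq> adjs (map f xs)" by (rule adjs_least) (use adjs_sub[OF fxZ] xsZ ZfN' in auto)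
  hence surj: "\<exists>z\<in>?N'. y \<ominus>\<^bsub>M\<^esub> f z \<in> N" if "y \<in> ?N'" for y using adjs_map2[OF xsZ] that by blast
  \<comment> \<open>Injectivity modulo \<open>N\<close> on all of N', not only in degree
    \<open>j\<close>: the cell condition for \<open>f x\<close> over the span of the earlier images
    removes the top term of \<open>z\<close>.\<close>
  have injN': "good xs ==> z \<in> adjs xs ==> f z \<in> N ==> z \<in> N" for xs z
  proof (induction arbitrary: z rule: good.induct)
    case (snoc xs x e)
    from snoc.prems obtain n a where z: "n \<in> adjs xs" "a \<in> carrier A" "z = n \<oplus>\<^bsub>M\<^esub> ract M x a"
      by (auto elim: adE)
    have xsZ: "set xs \<subseteq> Z" "x \<in> Z" using good_Z snoc by auto
    have fxsZ: "set (map f xs) \<subseteq> Z" using xsZ Z_f by auto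
    note s = adjs_sub[OF xsZ(1)] and sf = adjs_sub[OF fxsZ]
    have c: "n \<in> carrier M" "x \<in> carrier M" "f x \<in> carrier M" using z s sub_carrier ZD xsZ fD(1) by auto
    have fz: "f z = f n \<oplus>\<^bsub>M\<^esub> ract M (f x) a" using z c fD(2)[of n "ract M x a"] fD(3)[of x a] by (simp add: ract_closed)
    have g: "good (map f xs @ [f x])" using gm[OF good.snoc[OF snoc(1-5)]] by simp
    hence nin: "f x \<notin> adjs (map f xs)" by (cases rule: good.cases) auto
    have e: "ract M (f x) e = f x" using fD(3)[of x e] snoc prim_carrier c by simp
    have cl: "cell A M j e (f x) (adjs (map f xs))"
      by (rule good_rf(2)[OF gm[OF snoc(1)] Z_f[OF xsZ(2)] nin snoc(4) e])
    have "ract M (f x) a \<in> adjs (map f xs)"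
      by (rule sub_cancel_l[of _ "f n"]) (use sf adjs_map1[OF xsZ(1) z(1)] c z snoc.prems fz ract_closed in auto)
    hence "e \<otimes> a = \<zero>" using cellD(6)[OF cl] z by blast
    hence "ract M x a = (zero M)"
      using ract_assoc[OF c(2) prim_carrier[OF snoc(4)] z(2)] snoc(5) ract_zero_r[OF c(2)] by simp
    hence "z = n" using z c by simp
    thus ?case using snoc.IH z snoc.prems by simp
  qed simp
  obtain js' where js': "j # js = replicate (length xs) j @ js'" "rf A M js' ?N' (carrier M)"
    using good_rf(1)[OF xs] by blast
  \<comment> \<open>The generator of the first cell belongs to \<open>Z\<close> but not to
    \<open>N\<close>, so at least one cell is used up and the list gets shorter.\<close>
  have "xs \<noteq> []"
  proof
    assume "xs = []"
    hence "Z \<subseteq> N" using ZN' by simp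
    moreover obtain e v where "cell A M j e v N" using rN by (cases rule: rf.cases) auto
    hence "v \<in> Z" "v \<notin> N" using cellD(1,4) cell_notin by (auto simp: Z_def)
    ultimately show False by blast
  qed
  hence "length js' < length (j # js)" unfolding js'(1) by simp
  moreover have "sorted js'" using srt unfolding js'(1) by (simp add: sorted_append)
  moreover have "fitn M f 0 N ?N'"
    using injN'[OF xs] surj by (auto simp: fitn_def)
  ultimately show ?thesis using s st js'(2) by blast
qed

end

context pdgm_end
begin

text \<open>Either \<open>f\<close> is injective on \<open>Z\<close> modulo \<open>N\<close>, and
  \<open>fit_step\<close> peels off a layer with exponent zero, or a kernel element \<open>x\<close>
  becomes the lowest cell and gives a layer N + xA that \<open>f\<close> maps into \<open>N\<close>,
  with exponent one. In both cases the new submodule is stable under \<open>f\<close> and fewer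
  cells remain.\<close>

lemma rf_fit:
  assumes "rf A M js N (carrier M)" "sub N" "sorted js" "fstab N"
  shows "\<exists>n. fitn M f n N (carrier M)"
  using assms
proof (induction "length js" arbitrary: js N rule: less_induct)
  case less
  show ?case
  proof (cases js)
    case Nil
    hence "N = carrier M" using less.prems(1) by (auto elim: rf.cases)
    hence "fitn M f 0 N (carrier M)" using sub_UNIV by (auto simp: fitn_def intro!: sub_diff fD(1))
    thus ?thesis by blast
  next
    case (Cons j js0)
    interpret fit_step A M f N j js0 using less.prems by unfold_locales (auto simp: Cons)
    have "\<exists>N' js' n. sub N' \<and> N \<subseteq> N' \<and> fstab N' \<and> length js' < length (j # js0) \<and> sorted js' \<and>
      rf A M js' N' (carrier M) \<and> fitn M f n N N'"
    proof (cases "\<exists>z\<in>Z. f z \<in> N \<and> z \<notin> N")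
      case False
      thus ?thesis using fit_step by blast
    next
      case True
      then obtain z where z: "z \<in> Z" "f z \<in> N" "z \<notin> N" by blast
      obtain e where e: "prim A e" "ract M z e \<notin> N" using prim_witness[OF ZD(3)[OF z(1)] z(3) N] .
      define x where "x = ract M z e"
      have ec: "e \<in> carrier A" using e prim_carrier by auto
      have x: "x \<in> Z" "x \<notin> N" "f x \<in> N" "ract M x e = x"
        using Z_ract[OF z(1) prim_deg[OF e(1)]] e(2) fD(3)[OF ZD(3)[OF z(1)] ec] sub_ract[OF N z(2) ec]
          ZD(3)[OF z(1)] ec prim_idem[OF e(1)] by (auto simp: x_def ract_assoc)
      have xc: "x \<in> carrier M" using x ZD by auto
      have "rf A M js0 (ad N x) (carrier M)" "cell A M j e x N"
        using exchange[OF rN N srt _ ZD(1)[OF x(1)] xc x(2) e(1) x(4) ZD(2)[OF x(1)]] srt by auto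
      moreover have fa: "f y \<in> N" if "y \<in> ad N x" for y
      proof -
        from that obtain n a where y: "n \<in> N" "a \<in> carrier A" "y = n \<oplus>\<^bsub>M\<^esub> ract M x a" by (rule adE)
        have "f y = f n \<oplus>\<^bsub>M\<^esub> ract M (f x) a"
          using y sub_carrier[OF N y(1)] xc fD(2)[of n "ract M x a"] fD(3)[of x a] by (simp add: ract_closed)
        moreover have "f n \<in> N" using y fN by auto
        ultimately show ?thesis using sub_add[OF N] sub_ract[OF N x(3) y(2)] by simp
      qed
      moreover have "N \<subseteq> ad N x" using ad_base[OF N xc] by auto
      moreover have "fitn M f 1 N (ad N x)"
        unfolding fitn_def
      proof (intro conjI ballI impI)
        fix y assume y: "y \<in> ad N x"
        show "(f ^^ 1) y \<in> N" using fa[OF y] by simp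
        have "(f ^^ 1) y \<ominus>\<^bsub>M\<^esub> (f ^^ Suc 1) y \<in> N" using fa[OF y] fN sub_diff[OF N] by auto
        thus "\<exists>ya\<in>ad N x. (f ^^ 1) y \<ominus>\<^bsub>M\<^esub> (f ^^ Suc 1) ya \<in> N" using y by blast
      qed
      ultimately show ?thesis
        using cell_sub[OF N] srt by (intro exI[of _ "ad N x"] exI[of _ js0] exI[of _ 1]) auto
    qed
    then obtain N' js' n where *: "sub N'" "N \<subseteq> N'" "fstab N'" "length js' < length (j # js0)" "sorted js'"
      "rf A M js' N' (carrier M)" "fitn M f n N N'" by blast
    then obtain m where "fitn M f m N' (carrier M)" using less.hyps Cons by blast
    from fit_ext[OF *(7) this N *(1) sub_UNIV fN *(3) stable_M *(2)] sub_carrier[OF *(1)]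
    show ?thesis by auto
  qed
qed

lemma sub_zeroset: "sub {zero M}"
  by (auto simp: dsub_def ract_zero_l mdiff_zero hc_zero)

lemma pow_hom:
  shows "[|x \<in> carrier M; a \<in> carrier A|] ==> (f ^^ n) (ract M x a) = ract M ((f ^^ n) x) a"
    "x \<in> mgr M i ==> (f ^^ n) x \<in> mgr M i"
    "x \<in> carrier M ==> (f ^^ n) (mdiff M x) = mdiff M ((f ^^ n) x)"
    "x \<in> carrier M ==> hc M i ((f ^^ n) x) = (f ^^ n) (hc M i x)"
  by (induction n) (simp_all add: fD pow_closed dg_hom_hc[OF dg_module_axioms dg_module_axioms fhom])

text \<open>\<open>p\<close> is the projection onto the image of f^n along the kernel of f^n;
  \<open>g\<close> inverts f^n on that image and vanishes on the kernel.\<close>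

lemma fitting:
  assumes "rf A M js {zero M} (carrier M)" "sorted js"
  obtains n p g where "n > 0" "p \<in> dg_hom A M M" "g \<in> dg_hom A M M"
    "\<And>x. x \<in> carrier M ==> p (p x) = p x \<and> (f ^^ n) (p x) = (f ^^ n) x \<and> p ((f ^^ n) x) = (f ^^ n) x \<and>
      (f ^^ n) (g x) = p x \<and> g ((f ^^ n) x) = p x"
proof -
  have f0: "f (zero M) = (zero M)" by (rule addmap_zero[OF M.abelian_group_axioms M.abelian_group_axioms fD(7)])
  have st0: "fstab {zero M}" using f0 by auto
  obtain n0 where n0: "fitn M f n0 {zero M} (carrier M)"
    using rf_fit[OF assms(1) sub_zeroset assms(2) st0] by blast
  \<comment> \<open>The extra one makes \<open>n\<close> positive, so that statements about f^n can
    be passed on to \<open>f\<close>.\<close>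
  define n where "n = n0 + 1"
  have fn: "fitn M f n {zero M} (carrier M)"
    unfolding n_def by (rule fit_mono[OF n0 sub_zeroset st0 stable_M]) simp
  \<comment> \<open>\<open>R m x\<close> is the preimage of f^n x under f^m inside the image of f^n,
    on which \<open>f\<close> is bijective. Thus m = n gives \<open>p\<close>, and m = 2n gives
    \<open>g\<close>.\<close>
  define R where "R m x = (if x \<in> carrier M then (f ^^ n) (SOME y. y \<in> carrier M \<and> (f ^^ (n + m)) y = (f ^^ n) x)
    else undefined)" for m x
  have ex: "\<exists>y. y \<in> carrier M \<and> (f ^^ (n + m)) y = (f ^^ n) x" if "x \<in> carrier M" for m x
    using fit_im[OF fn sub_zeroset st0 stable_M subset_refl that, of m] diff_zero_eq[OF pow_closed[OF that] pow_closed]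
    by (metis singletonD)
  have uniq: "(f ^^ n) y = (f ^^ n) z"
    if "y \<in> carrier M" "z \<in> carrier M" "(f ^^ (n + m)) y = (f ^^ (n + m)) z" for m y z
  proof -
    have "(f ^^ (n + m)) (y \<ominus>\<^bsub>M\<^esub> z) \<in> {zero M}" using that pow_closed by (simp add: pow_diff diff_self)
    hence "(f ^^ n) (y \<ominus>\<^bsub>M\<^esub> z) \<in> {zero M}" by (rule fit_ker[OF fn stable_M, rotated]) (use that in simp)
    thus ?thesis using that pow_closed by (simp add: pow_diff diff_zero_eq)
  qed
  have Req: "R m x = (f ^^ n) y" if "x \<in> carrier M" "y \<in> carrier M" "(f ^^ (n + m)) y = (f ^^ n) x" for m x y
    unfolding R_def using that someI_ex[OF ex[OF that(1), of m]] by (auto intro: uniq[where m = m])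
  have Rex: "\<exists>y. y \<in> carrier M \<and> (f ^^ (n + m)) y = (f ^^ n) x \<and> R m x = (f ^^ n) y" if "x \<in> carrier M" for m x
    using ex[OF that, of m] Req[OF that] by blast
  have Rhom: "R m \<in> dg_hom A M M" for m
  proof (rule dg_homI)
    fix x assume x: "x \<in> carrier M"
    obtain y where y: "y \<in> carrier M" "(f ^^ (n + m)) y = (f ^^ n) x" "R m x = (f ^^ n) y" using Rex[OF x, of m] by blast
    show "R m x \<in> carrier M" using y pow_closed by simp
    show "R m (x \<oplus>\<^bsub>M\<^esub> x') = R m x \<oplus>\<^bsub>M\<^esub> R m x'" if x': "x' \<in> carrier M" for x'
    proof -
      obtain y' where y': "y' \<in> carrier M" "(f ^^ (n + m)) y' = (f ^^ n) x'" "R m x' = (f ^^ n) y'"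
        using Rex[OF x', of m] by blast
      show ?thesis using Req[of "x \<oplus>\<^bsub>M\<^esub> x'" "y \<oplus>\<^bsub>M\<^esub> y'" m] x x' y y' by (simp add: pow_add)
    qed
    show "R m (ract M x a) = ract M (R m x) a" if "a \<in> carrier A" for a
      using Req[of "ract M x a" "ract M y a" m] x y that by (simp add: pow_hom ract_closed)
    show "R m (mdiff M x) = mdiff M (R m x)"
      using Req[of "mdiff M x" "mdiff M y" m] x y by (simp add: pow_hom mdiff_closed)
  next
    fix x i assume x: "x \<in> mgr M i"
    hence xc: "x \<in> carrier M" using mgr_carrier by auto
    obtain y where y: "y \<in> carrier M" "(f ^^ (n + m)) y = (f ^^ n) x" using ex[OF xc, of m] by blast
    have "(f ^^ (n + m)) (hc M i y) = (f ^^ n) x"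
      using y pow_hom(4)[OF y(1), of i "n + m", symmetric] pow_hom(2)[OF x, of n] hc_hom[of "(f ^^ n) x" i i] by simp
    hence "R m x = (f ^^ n) (hc M i y)" using Req[OF xc] hc_closed y by blast
    thus "R m x \<in> mgr M i" using pow_hom(2)[OF hc_mgr[OF y(1)]] by simp
  qed (auto simp: R_def extensional_def)
  show ?thesis
  proof (rule that[of n "R n" "R (n + n)"])
    show "n > 0" by (simp add: n_def)
    fix x assume x: "x \<in> carrier M"
    obtain y where y: "y \<in> carrier M" "(f ^^ (n + n)) y = (f ^^ n) x" "R n x = (f ^^ n) y" using Rex[OF x, of n] by blast
    obtain z where z: "z \<in> carrier M" "(f ^^ (n + (n + n))) z = (f ^^ n) x" "R (n + n) x = (f ^^ n) z"
      using Rex[OF x, of "n + n"] by blast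
    have a: "R n ((f ^^ n) x) = (f ^^ n) x" if "x \<in> carrier M" for x
      using Req[of "(f ^^ n) x" x n] that by (simp add: pow_pow pow_closed)
    have b: "(f ^^ n) (R n x) = (f ^^ n) x" using y by (simp add: pow_pow)
    have c: "R n (R n x) = R n x" using a[OF y(1)] y by simp
    have "R n x = (f ^^ n) ((f ^^ n) z)" by (rule Req) (use x z in \<open>simp_all add: pow_pow pow_closed add.assoc\<close>)
    hence d: "(f ^^ n) (R (n + n) x) = R n x" using z by simp
    have "(f ^^ (n + (n + n))) y = (f ^^ n) ((f ^^ n) x)" using y by (simp add: pow_pow flip: y(2))
    hence "R (n + n) ((f ^^ n) x) = (f ^^ n) y" by (intro Req) (use x y pow_closed in auto)
    thus "R n (R n x) = R n x \<and> (f ^^ n) (R n x) = (f ^^ n) x \<and> R n ((f ^^ n) x) = (f ^^ n) x \<and>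
      (f ^^ n) (R (n + n) x) = R n x \<and> R (n + n) ((f ^^ n) x) = R n x"
      using a[OF x] b c d y by simp
  qed (rule Rhom)+
qed

end

section \<open>Constructions of dg modules\<close>

lemma (in abelian_group) add_diff_add:
  "[|a \<in> carrier G; b \<in> carrier G; c \<in> carrier G; d \<in> carrier G|] ==> (a \<oplus> b) \<ominus> (c \<oplus> d) = (a \<ominus> c) \<oplus> (b \<ominus> d)"
  by (simp add: a_minus_def minus_add a_ac)

lemma (in abelian_group) diff_add_diff:
  "[|a \<in> carrier G; b \<in> carrier G; c \<in> carrier G|] ==> (a \<ominus> b) \<oplus> (b \<ominus> c) = a \<ominus> c"
  by (simp add: a_minus_def a_assoc r_neg1)

lemma (in abelian_group) minus_diff:
  "[|a \<in> carrier G; b \<in> carrier G|] ==> \<ominus> (a \<ominus> b) = b \<ominus> a"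
  by (simp add: a_minus_def minus_add a_comm)

lemma (in abelian_group) add_subgroupI:
  assumes "H \<subseteq> carrier G" "\<zero> \<in> H" "\<And>x y. [|x \<in> H; y \<in> H|] ==> x \<oplus> y \<in> H" "\<And>x. x \<in> H ==> \<ominus> x \<in> H"
  shows "additive_subgroup H G"
proof (intro additive_subgroupI add.subgroupI)
  show "H \<noteq> {}" using assms(2) by blast
qed (use assms in \<open>simp_all add: a_inv_def\<close>)

section \<open>Restriction to submodules and transport of structure\<close>

definition rst :: "('a, 'm) dgmodule \<Rightarrow> 'm set \<Rightarrow> ('a, 'm) dgmodule" where
  "rst M N = M\<lparr>carrier := N, mgr := \<lambda>i. N \<inter> mgr M i\<rparr>"

lemma rst_simps [simp]:
  "carrier (rst M N) = N" "zero (rst M N) = zero M" "add (rst M N) = add M"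
  "ract (rst M N) = ract M" "mgr (rst M N) = (\<lambda>i. N \<inter> mgr M i)" "mdiff (rst M N) = mdiff M"
  by (simp_all add: rst_def)

lemma (in pdga) adiff_closed: "a \<in> carrier A ==> adiff A a \<in> carrier A"
  using dg_module.mdiff_closed[OF reg, unfolded reg_simps] .

lemma (in pdga) pdgmI: "dg_module A M ==> pdgm A M"
  using pdgm.intro pdga_axioms by blast

context pdgm
begin

lemma rst_dg_module:
  assumes "dsub A M N" shows "dg_module A (rst M N)"
proof -
  have NC: "N \<subseteq> carrier M" and n0: "(zero M) \<in> N" and na: "\<And>x y. x \<in> N ==> y \<in> N ==> x \<oplus>\<^bsub>M\<^esub> y \<in> N"
    and nr: "\<And>x a. x \<in> N ==> a \<in> carrier A ==> ract M x a \<in> N" and nd: "\<And>x. x \<in> N ==> mdiff M x \<in> N"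
    and nh: "\<And>x i. x \<in> N ==> hc M i x \<in> N"
    using assms by (auto simp: dsub_def)
  have nc: "x \<in> N ==> x \<in> carrier M" for x using NC by auto
  have ab: "abelian_group (rst M N)"
  proof (rule abelian_groupI)
    fix x assume "x \<in> carrier (rst M N)"
    thus "\<exists>y\<in>carrier (rst M N). y \<oplus>\<^bsub>rst M N\<^esub> x = \<zero>\<^bsub>rst M N\<^esub>"
      using sub_minus[OF assms] nc by (intro bexI[of _ "\<ominus>\<^bsub>M\<^esub> x"]) (auto simp: M.l_neg)
  qed (auto simp: na n0 nc M.a_ac)
  have inv: "\<ominus>\<^bsub>rst M N\<^esub> x = \<ominus>\<^bsub>M\<^esub> x" if "x \<in> N" for x
    using abelian_group.minus_equality[OF ab, of "\<ominus>\<^bsub>M\<^esub> x" x] that sub_minus[OF assms that] nc[OF that]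
    by (simp add: M.l_neg)
  have rm: "right_module A (rst M N)"
    by (intro right_module.intro right_module_axioms.intro A.ring_axioms ab)
      (simp_all add: nr nc ract_l_distr ract_r_distr ract_assoc ract_one)
  have sub: "additive_subgroup (N \<inter> mgr M i) (rst M N)" for i
    by (rule abelian_group.add_subgroupI[OF ab])
      (auto simp: n0 mgr_zero na mgr_add inv sub_minus[OF assms] mgr_minus)
  show ?thesis
  proof (rule dg_moduleI[where p = "\<lambda>i. hc M i"])
    fix x assume "x \<in> carrier (rst M N)"
    hence x: "x \<in> N" by simp
    have hspanN: "y \<in> N \<and> y \<in> carrier M" if "y \<in> hspan (rst M N) UNIV (\<lambda>i. N \<inter> mgr M i)" for y
      using that by (induction rule: hspan.induct) (auto simp: n0 na nc)
    have hin: "y \<in> hspan (rst M N) UNIV (\<lambda>i. N \<inter> mgr M i)" if "y \<in> N" "y \<in> mgr M i" for y i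
    proof -
      have "y \<oplus>\<^bsub>rst M N\<^esub> \<zero>\<^bsub>rst M N\<^esub> \<in> hspan (rst M N) UNIV (\<lambda>i. N \<inter> mgr M i)"
        using that by (meson IntI UNIV_I hspan.intros)
      thus ?thesis using nc[OF that(1)] by simp
    qed
    have "x \<in> hspan (rst M N) UNIV (\<lambda>i. N \<inter> mgr M i)"
    proof (rule hc_all_imp)
      show "x \<in> carrier M" using x nc by simp
      show "hc M i x \<in> hspan (rst M N) UNIV (\<lambda>i. N \<inter> mgr M i)" for i
        using hin[OF nh[OF x] hc_mgr] x nc by simp
      show "(zero M) \<in> hspan (rst M N) UNIV (\<lambda>i. N \<inter> mgr M i)"
        using hspan.zero[of "rst M N" UNIV "\<lambda>i. N \<inter> mgr M i"] by simp
      show "hspan (rst M N) UNIV (\<lambda>i. N \<inter> mgr M i) \<subseteq> carrier M" using hspanN by blast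
      show "y \<oplus>\<^bsub>M\<^esub> z \<in> hspan (rst M N) UNIV (\<lambda>i. N \<inter> mgr M i)"
        if "y \<in> hspan (rst M N) UNIV (\<lambda>i. N \<inter> mgr M i)" "z \<in> hspan (rst M N) UNIV (\<lambda>i. N \<inter> mgr M i)" for y z
        using abelian_group.hspan_add[OF ab, of UNIV "\<lambda>i. N \<inter> mgr M i" y z] sub that by simp
    qed
    thus "x \<in> hspan (rst M N) UNIV (mgr (rst M N))" by simp
  next
    fix m i a assume m: "m \<in> mgr (rst M N) i" and a: "a \<in> carrier A"
    have r: "ract M m b \<in> N" if "b \<in> carrier A" for b using m nr that by simp
    have e: "mdiff M (ract M m a) = ract M (mdiff M m) a \<oplus>\<^bsub>M\<^esub> sign M i (ract M m (adiff A a))"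
      using mdiff_ract[of m i a] m a by simp
    have "\<ominus>\<^bsub>rst M N\<^esub> (ract M m (adiff A a)) = \<ominus>\<^bsub>M\<^esub> (ract M m (adiff A a))"
      using inv r adiff_closed[OF a] by simp
    thus "mdiff (rst M N) (ract (rst M N) m a) =
        ract (rst M N) (mdiff (rst M N) m) a \<oplus>\<^bsub>rst M N\<^esub> sign (rst M N) i (ract (rst M N) m (adiff A a))"
      using e by (simp add: sign_def)
  qed (use rm n0 mgr_zero mgr_add mgr_minus na sub_minus[OF assms] inv hc_add nh nc mgr_ract agr_carrier nr nd mdiff_mgr
        mdiff_add mdiff_mdiff hc_hom in \<open>auto simp: addmap_def\<close>)
qed


text \<open>For a dg submodule, induction over its homogeneous elements shows that the components
  taken in \<open>M\<close> stay inside it.\<close>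

lemma dg_submodule_iff: "dg_submodule A M N \<longleftrightarrow> dsub A M N"
proof
  assume N: "dsub A M N"
  hence "N \<subseteq> carrier M" by (simp add: dsub_def)
  thus "dg_submodule A M N" using rst_dg_module[OF N] by (simp add: dg_submodule_def rst_def)
next
  assume "dg_submodule A M N"
  hence NC: "N \<subseteq> carrier M" and "dg_module A (rst M N)" by (auto simp: dg_submodule_def rst_def)
  then interpret N: dg_module A "rst M N" by simp
  have z: "(zero M) \<in> N" using N.M.zero_closed by simp
  have "\<forall>i. hc M i x \<in> N" if "x \<in> carrier (rst M N)" for x
    using that
  proof (induction x rule: N.homog_induct)
    case zero
    thus ?case using z by (simp add: hc_zero)
  next
    case (hom i x)
    thus ?case using z hc_hom[of x i] by simp
  next
    case (add x y)
    thus ?case using NC N.M.a_closed by (auto simp: hc_add subset_iff)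
  qed
  thus "dsub A M N"
    using NC z N.M.a_closed N.ract_closed N.mdiff_closed by (auto simp: dsub_def)
qed

end

text \<open>Transport of structure: \<open>N\<close> is just a record whose operations correspond to
  those of \<open>M\<close> under \<open>h\<close>. This yields the axioms for copies in another
  type, for tensor products and for subquotients without computing with classes or cosets.\<close>

lemma dg_module_bij:
  assumes "dg_module A M" and bij: "bij_betw h (carrier M) (carrier N)"
    and h0: "h (zero M) = (zero N)"
    and ha: "\<And>x y. [|x \<in> carrier M; y \<in> carrier M|] ==> h (x \<oplus>\<^bsub>M\<^esub> y) = h x \<oplus>\<^bsub>N\<^esub> h y"
    and hr: "\<And>x a. [|x \<in> carrier M; a \<in> carrier A|] ==> h (ract M x a) = ract N (h x) a"
    and hg: "\<And>i. mgr N i = h ` mgr M i"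
    and hd: "\<And>x. x \<in> carrier M ==> h (mdiff M x) = mdiff N (h x)"
    and "pdga A"
  shows "dg_module A N"
proof -
  interpret M: dg_module A M by fact
  interpret A: pdga A by fact
  have im: "carrier N = h ` carrier M" using bij by (simp add: bij_betw_def)
  have hc: "h x \<in> carrier N" if "x \<in> carrier M" for x using that im by auto
  have inj: "h x = h y \<longleftrightarrow> x = y" if "x \<in> carrier M" "y \<in> carrier M" for x y
    using bij that by (auto simp: bij_betw_def inj_on_def)
  define k where "k = inv_into (carrier M) h"
  have kh: "k (h x) = x" if "x \<in> carrier M" for x
    using bij that by (simp add: k_def bij_betw_def)
  have ab: "abelian_group N"
  proof (rule abelian_groupI)
    show "(zero N) \<in> carrier N" using hc[of "zero M"] h0 by simp
    fix x assume x: "x \<in> carrier N"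
    then obtain x' where x': "x' \<in> carrier M" "x = h x'" using im by auto
    show "\<exists>y\<in>carrier N. y \<oplus>\<^bsub>N\<^esub> x = (zero N)"
      using x' hc[of "\<ominus>\<^bsub>M\<^esub> x'"] by (intro bexI[of _ "h (\<ominus>\<^bsub>M\<^esub> x')"]) (auto simp: M.M.l_neg h0 simp flip: ha)
    show "(zero N) \<oplus>\<^bsub>N\<^esub> x = x" using x' by (simp flip: h0 ha)
    fix y assume "y \<in> carrier N"
    then obtain y' where y': "y' \<in> carrier M" "y = h y'" using im by auto
    show "x \<oplus>\<^bsub>N\<^esub> y \<in> carrier N" using x' y' hc by (simp flip: ha)
    show "x \<oplus>\<^bsub>N\<^esub> y = y \<oplus>\<^bsub>N\<^esub> x" using x' y' by (simp add: M.M.a_comm flip: ha)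
    fix z assume "z \<in> carrier N"
    then obtain z' where z': "z' \<in> carrier M" "z = h z'" using im by auto
    show "x \<oplus>\<^bsub>N\<^esub> y \<oplus>\<^bsub>N\<^esub> z = x \<oplus>\<^bsub>N\<^esub> (y \<oplus>\<^bsub>N\<^esub> z)" using x' y' z' by (simp add: M.M.a_assoc flip: ha)
  qed
  interpret N: abelian_group N by (rule ab)
  have am: "addmap M N h" using hc ha by (auto intro: addmapI)
  have hm: "h (\<ominus>\<^bsub>M\<^esub> x) = \<ominus>\<^bsub>N\<^esub> h x" if "x \<in> carrier M" for x
    by (rule addmap_minus[OF M.M.abelian_group_axioms ab am that])
  have rm: "right_module A N"
  proof (intro right_module.intro right_module_axioms.intro M.R.ring_axioms ab)
    fix m n r s assume m: "m \<in> carrier N" and r: "r \<in> carrier A"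
    then obtain m' where m': "m' \<in> carrier M" "m = h m'" using im by auto
    show "ract N m r \<in> carrier N" using m' r hc M.ract_closed by (simp flip: hr)
    show "ract N (m \<oplus>\<^bsub>N\<^esub> n) r = ract N m r \<oplus>\<^bsub>N\<^esub> ract N n r" if nN: "n \<in> carrier N"
    proof -
      obtain n' where n': "n' \<in> carrier M" "n = h n'" using im nN by auto
      show ?thesis using m' n' r by (simp add: M.ract_l_distr M.ract_closed flip: ha hr)
    qed
    assume s: "s \<in> carrier A"
    show "ract N m (r \<oplus>\<^bsub>A\<^esub> s) = ract N m r \<oplus>\<^bsub>N\<^esub> ract N m s"
      using m' r s by (simp add: M.ract_r_distr M.ract_closed flip: ha hr)
    show "ract N (ract N m r) s = ract N m (r \<otimes>\<^bsub>A\<^esub> s)"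
      using m' r s by (simp add: M.ract_assoc M.ract_closed flip: hr)
  next
    fix m assume m: "m \<in> carrier N"
    then obtain m' where m': "m' \<in> carrier M" "m = h m'" using im by auto
    show "ract N m \<one>\<^bsub>A\<^esub> = m" using m' by (simp add: M.ract_one flip: hr)
  qed
  show ?thesis
  proof (rule dg_moduleI[OF rm, where p = "\<lambda>i x. h (hc M i (k x))"])
    fix i
    show "mgr N i \<subseteq> carrier N" using hg hc M.mgr_carrier by auto
    show "(zero N) \<in> mgr N i" using hg M.mgr_zero h0 by (metis image_eqI)
    show "addmap N N (\<lambda>x. h (hc M i (k x)))"
    proof (rule addmapI)
      fix x assume "x \<in> carrier N"
      then obtain x' where x': "x' \<in> carrier M" "x = h x'" using im by auto
      show "h (hc M i (k x)) \<in> carrier N" using x' hc M.hc_closed kh by simp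
      fix y assume "y \<in> carrier N"
      then obtain y' where y': "y' \<in> carrier M" "y = h y'" using im by auto
      show "h (hc M i (k (x \<oplus>\<^bsub>N\<^esub> y))) = h (hc M i (k x)) \<oplus>\<^bsub>N\<^esub> h (hc M i (k y))"
        using x' y' by (simp add: kh M.hc_add M.hc_closed flip: ha)
    qed
    fix x assume "x \<in> mgr N i"
    then obtain x' where x': "x' \<in> mgr M i" "x = h x'" "x' \<in> carrier M" using hg M.mgr_carrier by auto
    show "\<ominus>\<^bsub>N\<^esub> x \<in> mgr N i" using x' hg M.mgr_minus by (auto simp flip: hm)
    show "mdiff N x \<in> mgr N (i + 1)" using x' hg M.mdiff_mgr by (auto simp flip: hd)
    show "ract N x a \<in> mgr N (i + j)" if "a \<in> agr A j" for a j
      using x' hg M.mgr_ract[OF x'(1) that] A.agr_carrier[OF that] by (auto simp flip: hr)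
    show "mdiff N (ract N x a) = ract N (mdiff N x) a \<oplus>\<^bsub>N\<^esub> sign N i (ract N x (adiff A a))" if a: "a \<in> carrier A" for a
    proof -
      have "sign N i (ract N x (adiff A a)) = h (sign M i (ract M x' (adiff A a)))"
        using x' A.adiff_closed[OF a] by (simp add: sign_def hr hm M.ract_closed)
      moreover have "sign M i (ract M x' (adiff A a)) \<in> carrier M"
        using x' A.adiff_closed[OF a] by (simp add: sign_def M.ract_closed)
      ultimately show ?thesis
        using x' a M.mdiff_ract[OF x'(1) a] by (simp add: M.mdiff_closed M.ract_closed flip: hd hr ha)
    qed
    show "h (hc M j (k x)) = (if j = i then x else (zero N))" for j
      using x' by (simp add: kh M.hc_hom h0)
    fix y assume "y \<in> mgr N i"
    then obtain y' where y': "y' \<in> mgr M i" "y = h y'" "y' \<in> carrier M" using hg M.mgr_carrier by auto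
    show "x \<oplus>\<^bsub>N\<^esub> y \<in> mgr N i" using x' y' hg M.mgr_add by (auto simp flip: ha)
  next
    fix x assume "x \<in> carrier N"
    then obtain x' where x': "x' \<in> carrier M" "x = h x'" using im by auto
    have "h y \<in> hspan N UNIV (mgr N) \<and> y \<in> carrier M" if "y \<in> hspan M UNIV (mgr M)" for y
      using that
    proof (induction rule: hspan.induct)
      case zero
      thus ?case using hspan.zero[of N UNIV "mgr N"] h0 by simp
    next
      case (step i x y)
      have "h x \<oplus>\<^bsub>N\<^esub> h y \<in> hspan N UNIV (mgr N)" using hspan.step[of i UNIV "h x" "mgr N" "h y" N] step hg[of i] by simp
      thus ?case using step M.mgr_carrier by (simp add: ha)
    qed
    thus "x \<in> hspan N UNIV (mgr N)" using dg_module_hspan[OF assms(1) x'(1)] x' by simp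
  next
    show "addmap N N (mdiff N)"
    proof (rule addmapI)
      fix x assume "x \<in> carrier N"
      then obtain x' where x': "x' \<in> carrier M" "x = h x'" using im by auto
      show "mdiff N x \<in> carrier N" using x' hc M.mdiff_closed by (simp flip: hd)
      fix y assume "y \<in> carrier N"
      then obtain y' where y': "y' \<in> carrier M" "y = h y'" using im by auto
      show "mdiff N (x \<oplus>\<^bsub>N\<^esub> y) = mdiff N x \<oplus>\<^bsub>N\<^esub> mdiff N y"
        using x' y' by (simp add: M.mdiff_add M.mdiff_closed flip: ha hd)
    qed
  next
    fix x assume "x \<in> carrier N"
    then obtain x' where x': "x' \<in> carrier M" "x = h x'" using im by auto
    show "mdiff N (mdiff N x) = (zero N)" using x' by (simp add: M.mdiff_mdiff h0 M.mdiff_closed flip: hd)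
  qed
qed

text \<open>A copy of \<open>M\<close> along an injection. It brings modules on product types, such
  as cones, back to the type that serves as universe.\<close>

definition transport :: "('m \<Rightarrow> 'n) \<Rightarrow> ('a, 'm) dgmodule \<Rightarrow> ('a, 'n) dgmodule" where
  "transport h M = \<lparr>carrier = h ` carrier M, monoid.mult = undefined, one = undefined,
     zero = h (zero M),
     add = (\<lambda>x y. h (inv_into (carrier M) h x \<oplus>\<^bsub>M\<^esub> inv_into (carrier M) h y)),
     ract = (\<lambda>x a. h (ract M (inv_into (carrier M) h x) a)),
     mgr = (\<lambda>i. h ` mgr M i), mdiff = (\<lambda>x. h (mdiff M (inv_into (carrier M) h x)))\<rparr>"

lemma sign_closed: "abelian_group G ==> x \<in> carrier G ==> sign G i x \<in> carrier G"
  by (simp add: sign_def abelian_group.a_inv_closed)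

context pdga
begin

lemma transport_dg_module:
  assumes M: "dg_module A M" and h: "inj_on h (carrier M)"
  shows "dg_module A (transport h M)"
proof -
  interpret M: dg_module A M by fact
  show ?thesis
    by (rule dg_module_bij[OF M, where h = h])
      (use h in \<open>auto simp: transport_def bij_betw_def pdga_axioms M.ract_closed M.mdiff_closed\<close>)
qed

lemma transport_iso:
  assumes M: "dg_module A M" and h: "inj_on h (carrier M)"
  shows "restrict h (carrier M) \<in> dg_hom A M (transport h M)"
    "restrict (inv_into (carrier M) h) (h ` carrier M) \<in> dg_hom A (transport h M) M"
proof -
  interpret M: dg_module A M by fact
  show "restrict h (carrier M) \<in> dg_hom A M (transport h M)"
    by (rule dg_homI) (use h M.mgr_carrier in \<open>auto simp: transport_def M.ract_closed M.mdiff_closed\<close>)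
  show "restrict (inv_into (carrier M) h) (h ` carrier M) \<in> dg_hom A (transport h M) M"
    by (rule dg_homI) (use h M.mgr_carrier in \<open>auto simp: inj_on_eq_iff[OF h] transport_def M.ract_closed M.mdiff_closed\<close>)
qed

section \<open>Shifts and mapping cones\<close>

lemma shift_simps [simp]:
  "carrier (shift l M) = carrier M" "zero (shift l M) = zero M" "add (shift l M) = add M"
  "ract (shift l M) = ract M" "mgr (shift l M) = (\<lambda>i. mgr M (i + l))"
  "mdiff (shift l M) = (\<lambda>m. sign M l (mdiff M m))"
  by (simp_all add: shift_def)

lemma shift_a_inv [simp]: "\<ominus>\<^bsub>shift l M\<^esub> x = \<ominus>\<^bsub>M\<^esub> x"
  by (simp add: a_inv_def m_inv_def)

lemma shift_dg_module:
  assumes M: "dg_module A M" shows "dg_module A (shift l M)"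
proof -
  interpret M: dg_module A M by fact
  have ab: "abelian_group (shift l M)"
  proof (rule abelian_groupI)
    fix x assume "x \<in> carrier (shift l M)"
    thus "\<exists>y\<in>carrier (shift l M). y \<oplus>\<^bsub>shift l M\<^esub> x = \<zero>\<^bsub>shift l M\<^esub>"
      by (intro bexI[of _ "\<ominus>\<^bsub>M\<^esub> x"]) (auto simp: M.M.l_neg)
  qed (auto simp: M.M.a_ac)
  have rm: "right_module A (shift l M)"
    by (intro right_module.intro right_module_axioms.intro A.ring_axioms ab)
      (simp_all add: M.ract_closed M.ract_l_distr M.ract_r_distr M.ract_assoc M.ract_one)
  show ?thesis
  proof (rule dg_moduleI[OF rm, where p = "\<lambda>i. hc M (i + l)"])
    fix m i assume m: "m \<in> mgr (shift l M) i"
    thus "mdiff (shift l M) m \<in> mgr (shift l M) (i + 1)"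
      using M.mdiff_mgr[of m "i + l"] M.mgr_minus[of "mdiff M m" "i + l + 1"]
      by (simp add: sign_def ac_simps)
    show "ract (shift l M) m a \<in> mgr (shift l M) (i + j)" if "a \<in> agr A j" for a j
      using M.mgr_ract[of m "i + l" a j] m that by (simp add: ac_simps)
    \<comment> \<open>The signs cancel: the factor (-1)^l of the differential and the sign
      (-1)^(i+l) of the degree in \<open>M\<close> leave (-1)^i.\<close>
    show "mdiff (shift l M) (ract (shift l M) m a) = ract (shift l M) (mdiff (shift l M) m) a \<oplus>\<^bsub>shift l M\<^esub>
      sign (shift l M) i (ract (shift l M) m (adiff A a))" if "a \<in> carrier A" for a
      using M.mdiff_ract[of m "i + l" a] m that adiff_closed[OF that] M.mgr_carrier[of m "i + l"]
      by (auto simp: sign_def M.M.minus_add M.ract_closed M.mdiff_closed M.ract_minus_l)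
  next
    fix x assume x: "x \<in> carrier (shift l M)"
    have "y \<in> hspan (shift l M) UNIV (mgr (shift l M))" if "y \<in> hspan M UNIV (mgr M)" for y
      using that
    proof (induction rule: hspan.induct)
      case zero
      thus ?case using hspan.zero[of "shift l M" UNIV "mgr (shift l M)"] by simp
    next
      case (step i x y)
      thus ?case using hspan.step[of "i - l" UNIV x "mgr (shift l M)" y "shift l M"] by simp
    qed
    thus "x \<in> hspan (shift l M) UNIV (mgr (shift l M))" using dg_module_hspan[OF M] x by simp
    show "mdiff (shift l M) (mdiff (shift l M) x) = \<zero>\<^bsub>shift l M\<^esub>"
      using x by (simp add: sign_def M.mdiff_mdiff M.mdiff_minus M.mdiff_closed)
  next
    show "addmap (shift l M) (shift l M) (mdiff (shift l M))"
      by (rule addmapI) (auto simp: sign_def M.mdiff_closed M.mdiff_add M.M.minus_add)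
  next
    show "addmap (shift l M) (shift l M) (hc M (i + l))" for i
      by (rule addmapI) (auto simp: M.hc_add M.hc_closed)
  qed (auto simp: M.mgr_carrier M.mgr_zero M.mgr_add M.mgr_minus M.hc_hom)
qed

lemma cone_simps [simp]:
  "carrier (cone M N f) = carrier N \<times> carrier M" "zero (cone M N f) = (zero N, zero M)"
  "add (cone M N f) (n, m) (n', m') = (n \<oplus>\<^bsub>N\<^esub> n', m \<oplus>\<^bsub>M\<^esub> m')"
  "ract (cone M N f) (n, m) a = (ract N n a, ract M m a)"
  "mgr (cone M N f) = (\<lambda>i. mgr N i \<times> mgr M (i + 1))"
  "mdiff (cone M N f) (n, m) = (mdiff N n \<oplus>\<^bsub>N\<^esub> f m, \<ominus>\<^bsub>M\<^esub> mdiff M m)"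
  by (simp_all add: cone_def)

lemma cone_abelian_group:
  assumes "abelian_group M" "abelian_group N"
  shows "abelian_group (cone M N f)"
    "[|n \<in> carrier N; m \<in> carrier M|] ==> \<ominus>\<^bsub>cone M N f\<^esub> (n, m) = (\<ominus>\<^bsub>N\<^esub> n, \<ominus>\<^bsub>M\<^esub> m)"
proof -
  interpret M: abelian_group M by fact
  interpret N: abelian_group N by fact
  show ab: "abelian_group (cone M N f)"
  proof (rule abelian_groupI)
    fix x assume "x \<in> carrier (cone M N f)"
    then obtain n m where "x = (n, m)" "n \<in> carrier N" "m \<in> carrier M" by auto
    thus "\<exists>y\<in>carrier (cone M N f). y \<oplus>\<^bsub>cone M N f\<^esub> x = \<zero>\<^bsub>cone M N f\<^esub>"
      by (intro bexI[of _ "(\<ominus>\<^bsub>N\<^esub> n, \<ominus>\<^bsub>M\<^esub> m)"]) (auto simp: M.l_neg N.l_neg)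
  qed (auto simp: M.a_ac N.a_ac)
  show "\<ominus>\<^bsub>cone M N f\<^esub> (n, m) = (\<ominus>\<^bsub>N\<^esub> n, \<ominus>\<^bsub>M\<^esub> m)" if "n \<in> carrier N" "m \<in> carrier M"
    by (rule abelian_group.minus_equality[OF ab]) (use that in \<open>auto simp: M.l_neg N.l_neg\<close>)
qed

lemma cone_dg_module:
  assumes M: "dg_module A M" and N: "dg_module A N" and f: "f \<in> dg_hom A M N"
  shows "dg_module A (cone M N f)"
proof -
  interpret M: dg_module A M by fact
  interpret N: dg_module A N by fact
  note fD = dg_homD[OF f]
  let ?C = "cone M N f"
  note ab = cone_abelian_group(1)[OF M.M.abelian_group_axioms N.M.abelian_group_axioms, of f]
    and inv = cone_abelian_group(2)[OF M.M.abelian_group_axioms N.M.abelian_group_axioms, of _ _ f]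
  have fm: "f (\<ominus>\<^bsub>M\<^esub> x) = \<ominus>\<^bsub>N\<^esub> f x" if "x \<in> carrier M" for x
    by (rule addmap_minus[OF M.M.abelian_group_axioms N.M.abelian_group_axioms fD(7) that])
  have rm: "right_module A ?C"
    by (intro right_module.intro right_module_axioms.intro A.ring_axioms ab)
      (auto simp: M.ract_closed M.ract_l_distr M.ract_r_distr M.ract_assoc M.ract_one
        N.ract_closed N.ract_l_distr N.ract_r_distr N.ract_assoc N.ract_one)
  have am: "addmap ?C ?C (\<lambda>(n, m). (hc N i n, hc M (i + 1) m))" for i
    by (rule addmapI) (auto simp: M.hc_add N.hc_add M.hc_closed N.hc_closed)
  have sub: "additive_subgroup (mgr ?C i) ?C" for i
    by (rule abelian_group.add_subgroupI[OF ab])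
      (auto simp: M.mgr_carrier N.mgr_carrier M.mgr_zero N.mgr_zero M.mgr_add N.mgr_add inv M.mgr_minus N.mgr_minus)
  show ?thesis
  proof (rule dg_moduleI[OF rm, where p = "\<lambda>i (n, m). (hc N i n, hc M (i + 1) m)"])
    fix x i assume "x \<in> mgr ?C i"
    then obtain n m where x: "x = (n, m)" "n \<in> mgr N i" "m \<in> mgr M (i + 1)" by auto
    have c: "n \<in> carrier N" "m \<in> carrier M" using x M.mgr_carrier N.mgr_carrier by auto
    show "mdiff ?C x \<in> mgr ?C (i + 1)"
      using x N.mgr_add[OF N.mdiff_mgr[OF x(2)] fD(4)[OF x(3)]] M.mgr_minus[OF M.mdiff_mgr[OF x(3)]] by simp
    show "ract ?C x a \<in> mgr ?C (i + j)" if "a \<in> agr A j" for a j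
      using x M.mgr_ract[OF x(3) that] N.mgr_ract[OF x(2) that] by (simp add: ac_simps)
    show "\<ominus>\<^bsub>?C\<^esub> x \<in> mgr ?C i" using x c by (simp add: inv M.mgr_minus N.mgr_minus)
    fix a assume a: "a \<in> carrier A"
    show "mdiff ?C (ract ?C x a) = ract ?C (mdiff ?C x) a \<oplus>\<^bsub>?C\<^esub> sign ?C i (ract ?C x (adiff A a))"
      using x c a adiff_closed[OF a] M.mdiff_ract[OF x(3) a] N.mdiff_ract[OF x(2) a] fD(1) fD(3)[OF c(2) a]
      by (auto simp: sign_def inv M.ract_closed N.ract_closed M.mdiff_closed N.mdiff_closed N.ract_l_distr
          M.M.minus_add M.ract_minus_l N.M.a_ac)
  next
    fix x assume "x \<in> carrier ?C"
    then obtain n m where x: "x = (n, m)" "n \<in> carrier N" "m \<in> carrier M" by auto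
    show "mdiff ?C (mdiff ?C x) = (zero ?C)"
      using x fD(1,5) by (auto simp: N.mdiff_add N.mdiff_closed M.mdiff_closed N.mdiff_mdiff M.mdiff_minus
          M.mdiff_mdiff fm N.M.r_neg)
    have "(n, (zero M)) \<in> hspan ?C UNIV (mgr ?C)" if "n \<in> hspan N UNIV (mgr N)" for n
      using that
    proof (induction rule: hspan.induct)
      case zero
      thus ?case using hspan.zero[of ?C UNIV "mgr ?C"] by simp
    next
      case (step i x y)
      thus ?case using hspan.step[of i UNIV "(x, (zero M))" "mgr ?C" "(y, (zero M))" ?C] by (simp add: M.mgr_zero)
    qed
    \<comment> \<open>In the second summand degrees drop by one, hence the index
      \<open>i - 1\<close>.\<close>
    moreover have "((zero N), m) \<in> hspan ?C UNIV (mgr ?C)" if "m \<in> hspan M UNIV (mgr M)" for m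
      using that
    proof (induction rule: hspan.induct)
      case zero
      thus ?case using hspan.zero[of ?C UNIV "mgr ?C"] by simp
    next
      case (step i x y)
      thus ?case using hspan.step[of "i - 1" UNIV "((zero N), x)" "mgr ?C" "((zero N), y)" ?C] by (simp add: N.mgr_zero)
    qed
    ultimately have "(n, (zero M)) \<oplus>\<^bsub>?C\<^esub> ((zero N), m) \<in> hspan ?C UNIV (mgr ?C)"
      using dg_module_hspan[OF M x(3)] dg_module_hspan[OF N x(2)] abelian_group.hspan_add[OF ab, of UNIV "mgr ?C"] sub
      by blast
    thus "x \<in> hspan ?C UNIV (mgr ?C)" using x by simp
  next
    show "addmap ?C ?C (mdiff ?C)"
      by (rule addmapI) (auto simp: fD M.mdiff_closed N.mdiff_closed M.mdiff_add N.mdiff_add M.M.minus_add N.M.a_ac)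
  qed (auto simp: am M.mgr_carrier N.mgr_carrier M.mgr_zero N.mgr_zero M.mgr_add N.mgr_add M.hc_hom N.hc_hom)
qed

end

section \<open>Homotopies\<close>

lemma (in abelian_group) diff_eqD:
  "[|a \<in> carrier G; b \<in> carrier G; c \<in> carrier G; a \<ominus> b = c|] ==> a = b \<oplus> c"
  by (auto simp: a_minus_def a_lcomm r_neg)

lemma (in abelian_group) diff_eqI:
  "[|b \<in> carrier G; c \<in> carrier G; a = b \<oplus> c|] ==> a \<ominus> b = c"
  by (simp add: a_minus_def a_comm[of b c] a_assoc r_neg)

lemma (in abelian_group) add_neg_mid:
  "[|p \<in> carrier G; q \<in> carrier G|] ==> q \<oplus> (p \<oplus> \<ominus> q) = p"
  by (simp add: a_lcomm[of q] r_neg)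

text \<open>Homotopy for arbitrary functions, not only for members of \<open>dg_hom\<close>:
  composites can be written as lambda terms, and \<open>htp_cong\<close> disregards values outside
  the carrier.\<close>

definition htp :: "('k, 'a) dgalgebra \<Rightarrow> ('a, 'm) dgmodule \<Rightarrow> ('a, 'n) dgmodule \<Rightarrow>
    ('m \<Rightarrow> 'n) \<Rightarrow> ('m \<Rightarrow> 'n) \<Rightarrow> bool" where
  "htp A M N f g \<longleftrightarrow> (\<exists>h. dg_homotopy A M N h \<and>
     (\<forall>x\<in>carrier M. f x \<ominus>\<^bsub>N\<^esub> g x = mdiff N (h x) \<oplus>\<^bsub>N\<^esub> h (mdiff M x)))"

lemma homotopy_rel_iff:
  "(f, g) \<in> homotopy_rel A M N \<longleftrightarrow> f \<in> dg_hom A M N \<and> g \<in> dg_hom A M N \<and> htp A M N f g"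
  by (auto simp: homotopy_rel_def htp_def)

lemma htp_cong:
  assumes "\<And>x. x \<in> carrier M ==> f x = f' x" "\<And>x. x \<in> carrier M ==> g x = g' x"
  shows "htp A M N f g \<longleftrightarrow> htp A M N f' g'"
  using assms by (simp add: htp_def)

text \<open>\<open>N\<close> is a retract of \<open>M\<close> up to homotopy. The two modules may be
  carried by different types.\<close>

definition dominated :: "('k, 'a) dgalgebra \<Rightarrow> ('a, 'm) dgmodule \<Rightarrow> ('a, 'n) dgmodule \<Rightarrow> bool" where
  "dominated A N M \<longleftrightarrow> (\<exists>i\<in>dg_hom A N M. \<exists>r\<in>dg_hom A M N. htp A N N (\<lambda>x. r (i x)) (\<lambda>x. x))"

lemma homotopy_equivalentE:
  assumes "homotopy_equivalent A M N"
  obtains f g where "f \<in> dg_hom A M N" "g \<in> dg_hom A N M"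
    "htp A M M (\<lambda>x. g (f x)) (\<lambda>x. x)" "htp A N N (\<lambda>x. f (g x)) (\<lambda>x. x)"
proof -
  obtain f g where fg: "f \<in> dg_hom A M N" "g \<in> dg_hom A N M"
    "htp A M M (compose (carrier M) g f) (hom_id M)" "htp A N N (compose (carrier N) f g) (hom_id N)"
    using assms by (auto simp: homotopy_equivalent_def homotopy_rel_iff)
  show ?thesis
    using that[OF fg(1,2)] fg(3,4)
      htp_cong[of M "compose (carrier M) g f" "\<lambda>x. g (f x)" "hom_id M" "\<lambda>x. x" A M]
      htp_cong[of N "compose (carrier N) f g" "\<lambda>x. f (g x)" "hom_id N" "\<lambda>x. x" A N]
    by (simp add: compose_eq hom_id_def)
qed

context pdga
begin

lemma hom_compose:
  assumes "dg_module A L" "f \<in> dg_hom A L M" "g \<in> dg_hom A M N"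
  shows "compose (carrier L) g f \<in> dg_hom A L N"
proof -
  interpret L: dg_module A L by fact
  note fD = dg_homD[OF assms(2)] and gD = dg_homD[OF assms(3)]
  show ?thesis
    by (rule dg_homI) (simp_all add: compose_def fD gD L.ract_closed L.mdiff_closed L.mgr_carrier)
qed

lemma hom_id_hom:
  assumes "dg_module A M" shows "hom_id M \<in> dg_hom A M M"
proof -
  interpret M: dg_module A M by fact
  show ?thesis by (rule dg_homI) (simp_all add: hom_id_def M.ract_closed M.mdiff_closed M.mgr_carrier)
qed

lemma hom_zero_hom:
  assumes "dg_module A M" "dg_module A N" shows "hom_zero M N \<in> dg_hom A M N"
proof -
  interpret M: dg_module A M by fact
  interpret N: dg_module A N by fact
  show ?thesis
    by (rule dg_homI) (simp_all add: hom_zero_def M.ract_closed M.mdiff_closed M.mgr_carrier N.mgr_zero N.ract_zero_l N.mdiff_zero)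
qed

lemma hom_plus_hom:
  assumes "dg_module A M" "dg_module A N" "f \<in> dg_hom A M N" "g \<in> dg_hom A M N"
  shows "hom_plus M N f g \<in> dg_hom A M N"
proof -
  interpret M: dg_module A M by fact
  interpret N: dg_module A N by fact
  note fD = dg_homD[OF assms(3)] and gD = dg_homD[OF assms(4)]
  show ?thesis
    by (rule dg_homI) (simp_all add: hom_plus_def fD(1-5) gD(1-5) M.ract_closed M.mdiff_closed M.mgr_carrier
        N.mgr_add N.ract_l_distr N.mdiff_add N.M.a_ac)
qed

lemma hom_minus_hom:
  assumes "dg_module A M" "dg_module A N" "f \<in> dg_hom A M N"
  shows "(\<lambda>x\<in>carrier M. \<ominus>\<^bsub>N\<^esub> f x) \<in> dg_hom A M N"
proof -
  interpret M: dg_module A M by fact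
  interpret N: dg_module A N by fact
  note fD = dg_homD[OF assms(3)]
  show ?thesis
    by (rule dg_homI) (simp_all add: fD(1-5) M.ract_closed M.mdiff_closed M.mgr_carrier
        N.mgr_minus N.ract_minus_l N.mdiff_minus N.M.minus_add)
qed

lemma hom_comp_fun:
  assumes "dg_module A L" "f \<in> dg_hom A L M" "g \<in> dg_hom A M N"
  shows "(\<lambda>x\<in>carrier L. g (f x)) \<in> dg_hom A L N"
  using hom_compose[OF assms] by (simp add: compose_def)

lemma htp_refl:
  assumes "dg_module A M" "dg_module A N" "f \<in> carrier M \<rightarrow> carrier N"
  shows "htp A M N f f"
proof -
  interpret M: dg_module A M by fact
  interpret N: dg_module A N by fact
  have "f x \<in> carrier N" if "x \<in> carrier M" for x using assms(3) that by auto
  thus ?thesis unfolding htp_def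
    by (intro exI[of _ "\<lambda>x. (zero N)"])
      (simp add: dg_homotopy_def N.mgr_zero N.ract_zero_l N.mdiff_zero a_minus_def N.M.r_neg)
qed

lemma htp_sym:
  assumes "dg_module A M" "dg_module A N" "f \<in> carrier M \<rightarrow> carrier N" "g \<in> carrier M \<rightarrow> carrier N"
    "htp A M N f g"
  shows "htp A M N g f"
proof -
  interpret M: dg_module A M by fact
  interpret N: dg_module A N by fact
  obtain h where h: "dg_homotopy A M N h"
    and e: "\<And>x. x \<in> carrier M ==> f x \<ominus>\<^bsub>N\<^esub> g x = mdiff N (h x) \<oplus>\<^bsub>N\<^esub> h (mdiff M x)"
    using assms(5) by (auto simp: htp_def)
  note hD = dg_homotopyD[OF h]
  have "dg_homotopy A M N (\<lambda>x. \<ominus>\<^bsub>N\<^esub> h x)"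
    by (simp add: dg_homotopy_def hD(1-4) N.M.minus_add N.ract_minus_l N.mgr_minus)
  moreover have "g x \<ominus>\<^bsub>N\<^esub> f x = mdiff N (\<ominus>\<^bsub>N\<^esub> h x) \<oplus>\<^bsub>N\<^esub> \<ominus>\<^bsub>N\<^esub> h (mdiff M x)" if x: "x \<in> carrier M" for x
  proof -
    have "g x \<ominus>\<^bsub>N\<^esub> f x = \<ominus>\<^bsub>N\<^esub> (f x \<ominus>\<^bsub>N\<^esub> g x)" using N.M.minus_diff[of "f x" "g x"] funcset_mem[OF assms(3) x] funcset_mem[OF assms(4) x] by simp
    thus ?thesis using x hD(1) M.mdiff_closed by (simp add: e N.M.minus_add N.mdiff_minus N.mdiff_closed)
  qed
  ultimately show ?thesis unfolding htp_def by blast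
qed

lemma htp_plus:
  assumes "dg_module A M" "dg_module A N" "f \<in> carrier M \<rightarrow> carrier N" "g \<in> carrier M \<rightarrow> carrier N"
    "f' \<in> carrier M \<rightarrow> carrier N" "g' \<in> carrier M \<rightarrow> carrier N"
    "htp A M N f g" "htp A M N f' g'"
  shows "htp A M N (\<lambda>x. f x \<oplus>\<^bsub>N\<^esub> f' x) (\<lambda>x. g x \<oplus>\<^bsub>N\<^esub> g' x)"
proof -
  interpret M: dg_module A M by fact
  interpret N: dg_module A N by fact
  obtain h where h: "dg_homotopy A M N h"
    and e: "\<And>x. x \<in> carrier M ==> f x \<ominus>\<^bsub>N\<^esub> g x = mdiff N (h x) \<oplus>\<^bsub>N\<^esub> h (mdiff M x)"
    using assms(7) by (auto simp: htp_def)
  obtain h' where h': "dg_homotopy A M N h'"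
    and e': "\<And>x. x \<in> carrier M ==> f' x \<ominus>\<^bsub>N\<^esub> g' x = mdiff N (h' x) \<oplus>\<^bsub>N\<^esub> h' (mdiff M x)"
    using assms(8) by (auto simp: htp_def)
  note hD = dg_homotopyD[OF h] and hD' = dg_homotopyD[OF h']
  have "dg_homotopy A M N (\<lambda>x. h x \<oplus>\<^bsub>N\<^esub> h' x)"
    by (simp add: dg_homotopy_def hD(1-4) hD'(1-4) N.M.a_ac N.ract_l_distr N.ract_closed N.mgr_add)
  moreover have "(f x \<oplus>\<^bsub>N\<^esub> f' x) \<ominus>\<^bsub>N\<^esub> (g x \<oplus>\<^bsub>N\<^esub> g' x) = mdiff N (h x \<oplus>\<^bsub>N\<^esub> h' x) \<oplus>\<^bsub>N\<^esub> (h (mdiff M x) \<oplus>\<^bsub>N\<^esub> h' (mdiff M x))"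
    if x: "x \<in> carrier M" for x
  proof -
    have "(f x \<oplus>\<^bsub>N\<^esub> f' x) \<ominus>\<^bsub>N\<^esub> (g x \<oplus>\<^bsub>N\<^esub> g' x) = (f x \<ominus>\<^bsub>N\<^esub> g x) \<oplus>\<^bsub>N\<^esub> (f' x \<ominus>\<^bsub>N\<^esub> g' x)"
      using assms(3-6) x by (intro N.M.add_diff_add) auto
    thus ?thesis using x hD(1) hD'(1) M.mdiff_closed
      by (simp add: e e' N.mdiff_add N.mdiff_closed N.M.a_ac)
  qed
  ultimately show ?thesis unfolding htp_def by blast
qed

lemma htp_trans:
  assumes "dg_module A M" "dg_module A N" "f \<in> carrier M \<rightarrow> carrier N" "g \<in> carrier M \<rightarrow> carrier N"
    "k \<in> carrier M \<rightarrow> carrier N" "htp A M N f g" "htp A M N g k"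
  shows "htp A M N f k"
proof -
  interpret M: dg_module A M by fact
  interpret N: dg_module A N by fact
  obtain h where h: "dg_homotopy A M N h"
    and e: "\<And>x. x \<in> carrier M ==> f x \<ominus>\<^bsub>N\<^esub> g x = mdiff N (h x) \<oplus>\<^bsub>N\<^esub> h (mdiff M x)"
    using assms(6) by (auto simp: htp_def)
  obtain h' where h': "dg_homotopy A M N h'"
    and e': "\<And>x. x \<in> carrier M ==> g x \<ominus>\<^bsub>N\<^esub> k x = mdiff N (h' x) \<oplus>\<^bsub>N\<^esub> h' (mdiff M x)"
    using assms(7) by (auto simp: htp_def)
  note hD = dg_homotopyD[OF h] and hD' = dg_homotopyD[OF h']
  have "dg_homotopy A M N (\<lambda>x. h x \<oplus>\<^bsub>N\<^esub> h' x)"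
    by (simp add: dg_homotopy_def hD(1-4) hD'(1-4) N.M.a_ac N.ract_l_distr N.ract_closed N.mgr_add)
  moreover have "f x \<ominus>\<^bsub>N\<^esub> k x = mdiff N (h x \<oplus>\<^bsub>N\<^esub> h' x) \<oplus>\<^bsub>N\<^esub> (h (mdiff M x) \<oplus>\<^bsub>N\<^esub> h' (mdiff M x))"
    if x: "x \<in> carrier M" for x
  proof -
    have "f x \<ominus>\<^bsub>N\<^esub> k x = (f x \<ominus>\<^bsub>N\<^esub> g x) \<oplus>\<^bsub>N\<^esub> (g x \<ominus>\<^bsub>N\<^esub> k x)"
      using assms(3-5) x by (intro N.M.diff_add_diff[symmetric]) auto
    thus ?thesis using x hD(1) hD'(1) M.mdiff_closed
      by (simp add: e e' N.mdiff_add N.mdiff_closed N.M.a_ac)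
  qed
  ultimately show ?thesis unfolding htp_def by blast
qed

lemma htp_postcomp:
  assumes "dg_module A L" "dg_module A M" "dg_module A N"
    "f \<in> carrier L \<rightarrow> carrier M" "f' \<in> carrier L \<rightarrow> carrier M" "htp A L M f f'" "g \<in> dg_hom A M N"
  shows "htp A L N (\<lambda>x. g (f x)) (\<lambda>x. g (f' x))"
proof -
  interpret L: dg_module A L by fact
  interpret M: dg_module A M by fact
  interpret N: dg_module A N by fact
  obtain h where h: "dg_homotopy A L M h"
    and e: "\<And>x. x \<in> carrier L ==> f x \<ominus>\<^bsub>M\<^esub> f' x = mdiff M (h x) \<oplus>\<^bsub>M\<^esub> h (mdiff L x)"
    using assms(6) by (auto simp: htp_def)
  note hD = dg_homotopyD[OF h] and gD = dg_homD[OF assms(7)]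
  have "dg_homotopy A L N (\<lambda>x. g (h x))"
    by (simp add: dg_homotopy_def hD(1-4) gD(1-5))
  moreover have "g (f x) \<ominus>\<^bsub>N\<^esub> g (f' x) = mdiff N (g (h x)) \<oplus>\<^bsub>N\<^esub> g (h (mdiff L x))" if x: "x \<in> carrier L" for x
  proof -
    have "g (f x) \<ominus>\<^bsub>N\<^esub> g (f' x) = g (f x \<ominus>\<^bsub>M\<^esub> f' x)"
      using assms(4,5) x by (subst addmap_diff[OF M.M.abelian_group_axioms N.M.abelian_group_axioms gD(7)]) auto
    thus ?thesis using x hD(1) L.mdiff_closed by (simp add: e gD(2,5) M.mdiff_closed)
  qed
  ultimately show ?thesis unfolding htp_def by blast
qed

lemma htp_precomp:
  assumes "dg_module A L" "f \<in> dg_hom A L M" "htp A M N g g'"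
  shows "htp A L N (\<lambda>x. g (f x)) (\<lambda>x. g' (f x))"
proof -
  interpret L: dg_module A L by fact
  obtain h where h: "dg_homotopy A M N h"
    and e: "\<And>x. x \<in> carrier M ==> g x \<ominus>\<^bsub>N\<^esub> g' x = mdiff N (h x) \<oplus>\<^bsub>N\<^esub> h (mdiff M x)"
    using assms(3) by (auto simp: htp_def)
  note hD = dg_homotopyD[OF h] and fD = dg_homD[OF assms(2)]
  have "dg_homotopy A L N (\<lambda>x. h (f x))"
    by (simp add: dg_homotopy_def hD(1-4) fD(1-5))
  moreover have "g (f x) \<ominus>\<^bsub>N\<^esub> g' (f x) = mdiff N (h (f x)) \<oplus>\<^bsub>N\<^esub> h (f (mdiff L x))" if "x \<in> carrier L" for x
    using that fD(1,5) by (simp add: e)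
  ultimately show ?thesis unfolding htp_def by blast
qed

section \<open>Homotopy retracts and their behaviour under cones\<close>

lemma dominatedI:
  assumes "i \<in> dg_hom A N M" "r \<in> dg_hom A M N" "htp A N N (\<lambda>x. r (i x)) (\<lambda>x. x)"
  shows "dominated A N M"
  using assms by (auto simp: dominated_def)

lemma dominated_trans:
  assumes L: "dg_module A L" and M: "dg_module A M" and N: "dg_module A N"
    and "dominated A L M" "dominated A M N"
  shows "dominated A L N"
proof -
  obtain i r where i: "i \<in> dg_hom A L M" and r: "r \<in> dg_hom A M L" and h: "htp A L L (\<lambda>x. r (i x)) (\<lambda>x. x)"
    using assms(4) by (auto simp: dominated_def)
  obtain i' r' where i': "i' \<in> dg_hom A M N" and r': "r' \<in> dg_hom A N M" and h': "htp A M M (\<lambda>x. r' (i' x)) (\<lambda>x. x)"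
    using assms(5) by (auto simp: dominated_def)
  note D = dg_homD(1)[OF i] dg_homD(1)[OF r] dg_homD(1)[OF i'] dg_homD(1)[OF r']
  have "htp A L M (\<lambda>x. r' (i' (i x))) (\<lambda>x. i x)" using htp_precomp[OF L i h'] .
  hence "htp A L L (\<lambda>x. r (r' (i' (i x)))) (\<lambda>x. r (i x))"
    by (rule htp_postcomp[OF L M L _ _ _ r, rotated -1]) (simp_all add: D)
  hence *: "htp A L L (\<lambda>x. r (r' (i' (i x)))) (\<lambda>x. x)"
    by (rule htp_trans[OF L L _ _ _ _ h, rotated -1]) (simp_all add: D)
  show ?thesis
  proof (rule dominatedI[OF hom_comp_fun[OF L i i'] hom_comp_fun[OF N r' r]])
    show "htp A L L (\<lambda>x. restrict (\<lambda>x. r (r' x)) (carrier N) (restrict (\<lambda>x. i' (i x)) (carrier L) x)) (\<lambda>x. x)"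
      using * by (rule htp_cong[THEN iffD1, rotated -1]) (simp_all add: D)
  qed
qed

lemma homotopy_equivalent_dominated:
  assumes "homotopy_equivalent A M N"
  shows "dominated A M N" "dominated A N M"
  using homotopy_equivalentE[OF assms] dominatedI by metis+

lemma transport_dominated:
  assumes M: "dg_module A M" and h: "inj_on h (carrier M)"
  shows "homotopy_equivalent A M (transport h M)" "homotopy_equivalent A (transport h M) M"
proof -
  note T = transport_dg_module[OF M h] and f = transport_iso(1)[OF M h] and g = transport_iso(2)[OF M h]
  let ?f = "restrict h (carrier M)" and ?g = "restrict (inv_into (carrier M) h) (h ` carrier M)"
  have c: "carrier (transport h M) = h ` carrier M" by (simp add: transport_def)
  have 1: "compose (carrier M) ?g ?f = hom_id M"
    using h by (auto simp: compose_def hom_id_def fun_eq_iff)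
  have 2: "compose (carrier (transport h M)) ?f ?g = hom_id (transport h M)"
    using h by (auto simp: compose_def hom_id_def fun_eq_iff c)
  have "(hom_id M, hom_id M) \<in> homotopy_rel A M M"
    using hom_id_hom[OF M] htp_refl[OF M M, of "hom_id M"] by (simp add: homotopy_rel_iff hom_id_def)
  moreover have "(hom_id (transport h M), hom_id (transport h M)) \<in> homotopy_rel A (transport h M) (transport h M)"
    using hom_id_hom[OF T] htp_refl[OF T T, of "hom_id (transport h M)"] by (simp add: homotopy_rel_iff hom_id_def)
  ultimately show "homotopy_equivalent A M (transport h M)" "homotopy_equivalent A (transport h M) M"
    unfolding homotopy_equivalent_def using f g 1 2 by metis+
qed

text \<open>The retraction maps (n, m) to (a' n + h(f m), m). The term with \<open>h\<close>
  compensates for a' a being only homotopic to the identity, and makes the map commute with the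
  differentials.\<close>

lemma dominated_cone_post:
  assumes M: "dg_module A M" and N: "dg_module A N" and N': "dg_module A N'"
    and f: "f \<in> dg_hom A M N" and a: "a \<in> dg_hom A N N'" and a': "a' \<in> dg_hom A N' N"
    and h: "htp A N N (\<lambda>x. a' (a x)) (\<lambda>x. x)"
  shows "dominated A (cone M N f) (cone M N' (\<lambda>x\<in>carrier M. a (f x)))"
proof -
  interpret M: dg_module A M by fact
  interpret N: dg_module A N by fact
  interpret N': dg_module A N' by fact
  obtain h where h: "dg_homotopy A N N h"
    and e: "\<And>x. x \<in> carrier N ==> a' (a x) \<ominus>\<^bsub>N\<^esub> x = mdiff N (h x) \<oplus>\<^bsub>N\<^esub> h (mdiff N x)"
    using h by (auto simp: htp_def)
  note fD = dg_homD[OF f] and aD = dg_homD[OF a] and bD = dg_homD[OF a'] and hD = dg_homotopyD[OF h]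
  have e': "a' (a x) = x \<oplus>\<^bsub>N\<^esub> (mdiff N (h x) \<oplus>\<^bsub>N\<^esub> h (mdiff N x))" if "x \<in> carrier N" for x
    by (rule N.M.diff_eqD[OF _ _ _ e[OF that]]) (use that in \<open>simp_all add: aD(1) bD(1) hD(1) N.mdiff_closed\<close>)
  have hm: "h (\<ominus>\<^bsub>N\<^esub> x) = \<ominus>\<^bsub>N\<^esub> h x" if "x \<in> carrier N" for x
    by (rule addmap_minus[OF N.M.abelian_group_axioms N.M.abelian_group_axioms hD(5) that])
  have fm: "f (\<ominus>\<^bsub>M\<^esub> x) = \<ominus>\<^bsub>N\<^esub> f x" if "x \<in> carrier M" for x
    by (rule addmap_minus[OF M.M.abelian_group_axioms N.M.abelian_group_axioms fD(7) that])
  have f0: "f (zero M) = (zero N)"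
    by (rule addmap_zero[OF M.M.abelian_group_axioms N.M.abelian_group_axioms fD(7)])
  have m0: "\<ominus>\<^bsub>M\<^esub> (zero M) = (zero M)" using M.M.minus_equality[of "zero M" "zero M"] by simp
  let ?f' = "\<lambda>x\<in>carrier M. a (f x)"
  let ?C = "cone M N f" and ?C' = "cone M N' ?f'"
  let ?i = "\<lambda>(n, m)\<in>carrier N \<times> carrier M. (a n, m)"
  let ?r = "\<lambda>(n, m)\<in>carrier N' \<times> carrier M. (a' n \<oplus>\<^bsub>N\<^esub> h (f m), m)"
  have i: "?i \<in> dg_hom A ?C ?C'"
    by (rule dg_homI) (auto simp: aD(1-5) fD(1) M.ract_closed M.mdiff_closed M.mgr_carrier N.ract_closed
        N.mdiff_closed N.mgr_carrier)
  have r: "?r \<in> dg_hom A ?C' ?C"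
  proof (rule dg_homI)
    fix x y assume "x \<in> carrier ?C'" "y \<in> carrier ?C'"
    thus "?r (x \<oplus>\<^bsub>?C'\<^esub> y) = ?r x \<oplus>\<^bsub>?C\<^esub> ?r y"
      by (auto simp: bD(1,2) hD(1,2) fD(1,2) N.M.a_ac)
  next
    fix x assume "x \<in> carrier ?C'"
    then obtain n m where x: "x = (n, m)" "n \<in> carrier N'" "m \<in> carrier M" by auto
    show "?r (mdiff ?C' x) = mdiff ?C (?r x)"
      using x e'[of "f m"] by (simp add: aD(1) bD(1,2,5) fD(1) fm hm hD(1) M.mdiff_closed N'.mdiff_closed
          N.mdiff_closed N.mdiff_add fD(5) N.M.a_ac N.M.r_neg N.M.r_neg1 N.M.r_neg2)
  qed (auto simp: bD(1-5) hD(1,3) fD(1,3) N.ract_l_distr M.ract_closed N'.ract_closed M.mgr_carrier N'.mgr_carrier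
      intro!: N.mgr_add hD(4)[of _ "_ + 1", simplified] fD(4))
  have C: "dg_module A ?C" by (rule cone_dg_module[OF M N f])
  let ?H = "\<lambda>(n, m). (h n, (zero M))"
  have H: "dg_homotopy A ?C ?C ?H"
    unfolding dg_homotopy_def by (auto simp: hD M.ract_zero_l M.mgr_zero)
  have "?r (?i x) \<ominus>\<^bsub>?C\<^esub> x = mdiff ?C (?H x) \<oplus>\<^bsub>?C\<^esub> ?H (mdiff ?C x)" if xC: "x \<in> carrier ?C" for x
  proof -
    obtain n m where x: "x = (n, m)" "n \<in> carrier N" "m \<in> carrier M" using xC by auto
    show ?thesis
      using x cone_abelian_group(2)[OF M.M.abelian_group_axioms N.M.abelian_group_axioms x(2,3), of f]
      by (simp add: a_minus_def e' aD(1) fD(1) hD(1,2) N.mdiff_closed M.mdiff_closed M.mdiff_zero f0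
          N.M.a_ac N.M.r_neg N.M.r_neg1 N.M.r_neg2 M.M.r_neg m0)
  qed
  hence "htp A ?C ?C (\<lambda>x. ?r (?i x)) (\<lambda>x. x)" using H unfolding htp_def by blast
  thus ?thesis using dominatedI[OF i r] by blast
qed

text \<open>Here the inclusion is corrected, to (n - f(k m), b' m). The homotopy carries a minus
  sign because \<open>M\<close> enters the cone with its differential negated.\<close>

lemma dominated_cone_pre:
  assumes M: "dg_module A M" and N: "dg_module A N" and M': "dg_module A M'"
    and f: "f \<in> dg_hom A M N" and b: "b \<in> dg_hom A M' M" and b': "b' \<in> dg_hom A M M'"
    and k: "htp A M M (\<lambda>x. b (b' x)) (\<lambda>x. x)"
  shows "dominated A (cone M N f) (cone M' N (\<lambda>x\<in>carrier M'. f (b x)))"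
proof -
  interpret M: dg_module A M by fact
  interpret N: dg_module A N by fact
  interpret M': dg_module A M' by fact
  obtain k where k: "dg_homotopy A M M k"
    and e: "\<And>x. x \<in> carrier M ==> b (b' x) \<ominus>\<^bsub>M\<^esub> x = mdiff M (k x) \<oplus>\<^bsub>M\<^esub> k (mdiff M x)"
    using k by (auto simp: htp_def)
  note fD = dg_homD[OF f] and bD = dg_homD[OF b] and bD' = dg_homD[OF b'] and kD = dg_homotopyD[OF k]
  have e': "b (b' x) = x \<oplus>\<^bsub>M\<^esub> (mdiff M (k x) \<oplus>\<^bsub>M\<^esub> k (mdiff M x))" if "x \<in> carrier M" for x
    by (rule M.M.diff_eqD[OF _ _ _ e[OF that]]) (use that in \<open>simp_all add: bD(1) bD'(1) kD(1) M.mdiff_closed\<close>)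
  have km: "k (\<ominus>\<^bsub>M\<^esub> x) = \<ominus>\<^bsub>M\<^esub> k x" if "x \<in> carrier M" for x
    by (rule addmap_minus[OF M.M.abelian_group_axioms M.M.abelian_group_axioms kD(5) that])
  have fm: "f (\<ominus>\<^bsub>M\<^esub> x) = \<ominus>\<^bsub>N\<^esub> f x" if "x \<in> carrier M" for x
    by (rule addmap_minus[OF M.M.abelian_group_axioms N.M.abelian_group_axioms fD(7) that])
  have bm: "b' (\<ominus>\<^bsub>M\<^esub> x) = \<ominus>\<^bsub>M'\<^esub> b' x" if "x \<in> carrier M" for x
    by (rule addmap_minus[OF M.M.abelian_group_axioms M'.M.abelian_group_axioms bD'(7) that])
  have bm': "b (\<ominus>\<^bsub>M'\<^esub> x) = \<ominus>\<^bsub>M\<^esub> b x" if "x \<in> carrier M'" for x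
    by (rule addmap_minus[OF M'.M.abelian_group_axioms M.M.abelian_group_axioms bD(7) that])
  let ?f' = "\<lambda>x\<in>carrier M'. f (b x)"
  let ?C = "cone M N f" and ?C' = "cone M' N ?f'"
  let ?i = "\<lambda>(n, m)\<in>carrier N \<times> carrier M. (n \<ominus>\<^bsub>N\<^esub> f (k m), b' m)"
  let ?r = "\<lambda>(n, m)\<in>carrier N \<times> carrier M'. (n, b m)"
  have r: "?r \<in> dg_hom A ?C' ?C"
    by (rule dg_homI) (auto simp: bD(1-5) bm' fD(1) M'.ract_closed M'.mdiff_closed M'.mgr_carrier N.ract_closed
        N.mdiff_closed N.mgr_carrier)
  have i: "?i \<in> dg_hom A ?C ?C'"
  proof (rule dg_homI)
    fix x y assume "x \<in> carrier ?C" "y \<in> carrier ?C"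
    thus "?i (x \<oplus>\<^bsub>?C\<^esub> y) = ?i x \<oplus>\<^bsub>?C'\<^esub> ?i y"
      by (auto simp: bD'(1,2) kD(1,2) fD(1,2) N.M.add_diff_add)
  next
    fix x assume "x \<in> carrier ?C"
    then obtain n m where x: "x = (n, m)" "n \<in> carrier N" "m \<in> carrier M" by auto
    show "?i (mdiff ?C x) = mdiff ?C' (?i x)"
      using x e'[OF x(3)] by (simp add: bD(1) bD'(1,2,5) bm fD(1,2) fm km kD(1) M.mdiff_closed N.mdiff_closed
          N.mdiff_diff flip: fD(5))
        (simp add: a_minus_def fD(1) kD(1) M.mdiff_closed N.mdiff_closed N.M.a_ac N.M.r_neg N.M.r_neg1 N.M.r_neg2 N.M.add_neg_mid)
  next
    fix x i assume "x \<in> mgr ?C i"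
    then obtain n m where x: "x = (n, m)" "n \<in> mgr N i" "m \<in> mgr M (i + 1)" by auto
    show "?i x \<in> mgr ?C' i"
      using x N.mgr_diff[OF x(2) fD(4)[OF kD(4)[OF x(3)], simplified]] bD'(4) M.mgr_carrier N.mgr_carrier by auto
  qed (auto simp: bD'(1-5) kD(1,3) fD(1,3) N.ract_diff_l M.ract_closed N.ract_closed)
  have C: "dg_module A ?C" by (rule cone_dg_module[OF M N f])
  let ?H = "\<lambda>(n, m). ((zero N), \<ominus>\<^bsub>M\<^esub> k m)"
  have H: "dg_homotopy A ?C ?C ?H"
    unfolding dg_homotopy_def
    by (auto simp: kD(1-3) N.ract_zero_l N.mgr_zero M.ract_minus_l M.M.minus_add intro!: M.mgr_minus kD(4)[of _ "_ + 1", simplified])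
  have "?r (?i x) \<ominus>\<^bsub>?C\<^esub> x = mdiff ?C (?H x) \<oplus>\<^bsub>?C\<^esub> ?H (mdiff ?C x)" if xC: "x \<in> carrier ?C" for x
  proof -
    obtain n m where x: "x = (n, m)" "n \<in> carrier N" "m \<in> carrier M" using xC by auto
    have 1: "(n \<ominus>\<^bsub>N\<^esub> f (k m)) \<oplus>\<^bsub>N\<^esub> \<ominus>\<^bsub>N\<^esub> n = \<ominus>\<^bsub>N\<^esub> f (k m)"
      using x fD(1) kD(1) by (simp add: a_minus_def N.M.a_ac N.M.r_neg N.M.r_neg1 N.M.r_neg2)
    have 2: "b (b' m) \<oplus>\<^bsub>M\<^esub> \<ominus>\<^bsub>M\<^esub> m = mdiff M (k m) \<oplus>\<^bsub>M\<^esub> k (mdiff M m)"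
      using e[OF x(3)] by (simp add: a_minus_def)
    show ?thesis
      using x cone_abelian_group(2)[OF M.M.abelian_group_axioms N.M.abelian_group_axioms x(2,3), of f] 1 2
      by (simp add: a_minus_def[of ?C] bD'(1) fD(1) kD(1) km fm N.mdiff_closed M.mdiff_closed M.mdiff_minus N.mdiff_zero)
  qed
  hence "htp A ?C ?C (\<lambda>x. ?r (?i x)) (\<lambda>x. x)" using H unfolding htp_def by blast
  thus ?thesis using dominatedI[OF i r] by blast
qed

end

section \<open>Preadditive categories with Fitting's lemma\<close>

text \<open>As one differs from zero, units are not nilpotent, so the nilpotent elements are exactly
  the non-units. If x^(n+1) = 0 with x^n nonzero, then x^n annihilates x a from the left and a x
  from the right, so neither product is a unit.\<close>

lemma ring_iso_or_nilpotent:
  assumes "ring R" and one: "\<one>\<^bsub>R\<^esub> \<noteq> (zero R)"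
    and un: "\<And>x. x \<in> carrier R ==> x \<in> Units R \<or> nilpotent R x"
  shows "{x \<in> carrier R. nilpotent R x} = carrier R - Units R" "ideal (carrier R - Units R) R"
proof -
  interpret ring R by fact
  have nu: "x \<notin> Units R" if "nilpotent R x" for x
  proof
    assume u: "x \<in> Units R"
    from that obtain n :: nat where n: "x [^]\<^bsub>R\<^esub> n = (zero R)" by (auto simp: nilpotent_def)
    have "x [^]\<^bsub>R\<^esub> n \<in> Units R" using u by (induction n) (auto intro: Units_m_closed)
    hence "(zero R) \<in> Units R" unfolding n .
    hence "\<one>\<^bsub>R\<^esub> = (zero R)" by (metis Units_l_inv Units_inv_closed r_null)
    thus False using one by simp
  qed
  show eq: "{x \<in> carrier R. nilpotent R x} = carrier R - Units R"
    using un nu by auto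
  have ru: "p = (zero R)" if "p \<in> carrier R" "u \<in> Units R" "p \<otimes>\<^bsub>R\<^esub> u = (zero R)" for p u
  proof -
    have "p = (p \<otimes>\<^bsub>R\<^esub> u) \<otimes>\<^bsub>R\<^esub> inv\<^bsub>R\<^esub> u" using that(1,2) by (simp add: m_assoc Units_closed)
    thus ?thesis using that by simp
  qed
  have lu: "p = (zero R)" if "p \<in> carrier R" "u \<in> Units R" "u \<otimes>\<^bsub>R\<^esub> p = (zero R)" for p u
  proof -
    have "p = inv\<^bsub>R\<^esub> u \<otimes>\<^bsub>R\<^esub> (u \<otimes>\<^bsub>R\<^esub> p)" using that(1,2) by (simp add: Units_closed flip: m_assoc)
    thus ?thesis using that by simp
  qed
  define N where "N = carrier R - Units R"
  have NI: "x \<in> N \<longleftrightarrow> nilpotent R x" for x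
    using eq un unfolding N_def by (auto simp: nilpotent_def)
  have Nc: "x \<in> N ==> x \<in> carrier R" for x by (simp add: N_def)
  have min: "\<exists>n::nat. x [^]\<^bsub>R\<^esub> Suc n = (zero R) \<and> x [^]\<^bsub>R\<^esub> n \<noteq> (zero R)" if x: "x \<in> N" for x
  proof -
    define n where "n = (LEAST n::nat. x [^]\<^bsub>R\<^esub> n = (zero R))"
    have "\<exists>n::nat. x [^]\<^bsub>R\<^esub> n = (zero R)" using x NI by (auto simp: nilpotent_def)
    hence n: "x [^]\<^bsub>R\<^esub> n = (zero R)" unfolding n_def by (rule LeastI_ex)
    have "n \<noteq> 0" using n one by (metis nat_pow_0)
    then obtain m where m: "n = Suc m" using not0_implies_Suc by blast
    have "x [^]\<^bsub>R\<^esub> m \<noteq> (zero R)" using not_less_Least[of m "\<lambda>n. x [^]\<^bsub>R\<^esub> n = (zero R)"] m unfolding n_def by auto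
    thus ?thesis using n m by blast
  qed
  have l: "a \<otimes>\<^bsub>R\<^esub> x \<in> N" "x \<otimes>\<^bsub>R\<^esub> a \<in> N" if x: "x \<in> N" and a: "a \<in> carrier R" for a x
  proof -
    obtain n :: nat where n: "x [^]\<^bsub>R\<^esub> Suc n = (zero R)" "x [^]\<^bsub>R\<^esub> n \<noteq> (zero R)" using min[OF x] by blast
    have xc: "x \<in> carrier R" using Nc x by simp
    have pc: "x [^]\<^bsub>R\<^esub> n \<in> carrier R" using xc by simp
    have z1: "x [^]\<^bsub>R\<^esub> n \<otimes>\<^bsub>R\<^esub> x = (zero R)" using n(1) by simp
    have z2: "x \<otimes>\<^bsub>R\<^esub> x [^]\<^bsub>R\<^esub> n = (zero R)" using n(1) xc nat_pow_Suc2 by metis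
    have "x \<otimes>\<^bsub>R\<^esub> a \<notin> Units R"
    proof
      assume u: "x \<otimes>\<^bsub>R\<^esub> a \<in> Units R"
      have "x [^]\<^bsub>R\<^esub> n \<otimes>\<^bsub>R\<^esub> (x \<otimes>\<^bsub>R\<^esub> a) = (zero R)" using z1 xc a pc by (simp flip: m_assoc)
      thus False using ru[OF pc u] n(2) by simp
    qed
    thus "x \<otimes>\<^bsub>R\<^esub> a \<in> N" using xc a by (simp add: N_def)
    have "a \<otimes>\<^bsub>R\<^esub> x \<notin> Units R"
    proof
      assume u: "a \<otimes>\<^bsub>R\<^esub> x \<in> Units R"
      have "(a \<otimes>\<^bsub>R\<^esub> x) \<otimes>\<^bsub>R\<^esub> x [^]\<^bsub>R\<^esub> n = (zero R)" using z2 xc a pc by (simp add: m_assoc)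
      thus False using lu[OF pc u] n(2) by simp
    qed
    thus "a \<otimes>\<^bsub>R\<^esub> x \<in> N" using xc a by (simp add: N_def)
  qed
  have add: "x \<oplus>\<^bsub>R\<^esub> y \<in> N" if x: "x \<in> N" and y: "y \<in> N" for x y
  proof (rule ccontr)
    assume "x \<oplus>\<^bsub>R\<^esub> y \<notin> N"
    hence u: "x \<oplus>\<^bsub>R\<^esub> y \<in> Units R" using x y by (simp add: N_def)
    define v where "v = inv\<^bsub>R\<^esub> (x \<oplus>\<^bsub>R\<^esub> y)"
    have v: "v \<in> carrier R" "v \<otimes>\<^bsub>R\<^esub> (x \<oplus>\<^bsub>R\<^esub> y) = \<one>\<^bsub>R\<^esub>" using u by (auto simp: v_def)
    \<comment> \<open>After scaling by the inverse of x + y, two nilpotent elements sum to one. With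
      b^(n+1) = 0 and b^n nonzero this gives b^n a = b^n, which iterates to a contradiction with the
      nilpotency of \<open>a\<close>.\<close>
    define a where "a = v \<otimes>\<^bsub>R\<^esub> x"
    define b where "b = v \<otimes>\<^bsub>R\<^esub> y"
    have ab: "a \<in> N" "b \<in> N" using l x y v by (auto simp: a_def b_def)
    have s: "a \<oplus>\<^bsub>R\<^esub> b = \<one>\<^bsub>R\<^esub>" using v x y Nc by (simp add: a_def b_def r_distr)
    obtain n :: nat where n: "b [^]\<^bsub>R\<^esub> Suc n = (zero R)" "b [^]\<^bsub>R\<^esub> n \<noteq> (zero R)" using min[OF ab(2)] by blast
    have bc: "b \<in> carrier R" "a \<in> carrier R" using ab Nc by auto
    have "b [^]\<^bsub>R\<^esub> n \<otimes>\<^bsub>R\<^esub> (a \<oplus>\<^bsub>R\<^esub> b) = b [^]\<^bsub>R\<^esub> n \<otimes>\<^bsub>R\<^esub> a \<oplus>\<^bsub>R\<^esub> b [^]\<^bsub>R\<^esub> n \<otimes>\<^bsub>R\<^esub> b" using bc by (simp add: r_distr)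
    hence e: "b [^]\<^bsub>R\<^esub> n \<otimes>\<^bsub>R\<^esub> a = b [^]\<^bsub>R\<^esub> n" using s n(1) bc by simp
    have "b [^]\<^bsub>R\<^esub> n \<otimes>\<^bsub>R\<^esub> a [^]\<^bsub>R\<^esub> k = b [^]\<^bsub>R\<^esub> n" for k :: nat
    proof (induction k)
      case (Suc k)
      have "b [^]\<^bsub>R\<^esub> n \<otimes>\<^bsub>R\<^esub> a [^]\<^bsub>R\<^esub> Suc k = (b [^]\<^bsub>R\<^esub> n \<otimes>\<^bsub>R\<^esub> a [^]\<^bsub>R\<^esub> k) \<otimes>\<^bsub>R\<^esub> a" using bc by (simp add: m_assoc)
      thus ?case using Suc e by simp
    qed (use bc in simp)
    moreover obtain k :: nat where "a [^]\<^bsub>R\<^esub> k = (zero R)" using ab(1) NI by (auto simp: nilpotent_def)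
    ultimately have "b [^]\<^bsub>R\<^esub> n = (zero R)" using bc by (metis nat_pow_closed r_null)
    thus False using n(2) by simp
  qed
  have z: "(zero R) \<in> N" unfolding NI nilpotent_def by (intro conjI exI[of _ 1]) auto
  show "ideal (carrier R - Units R) R"
    unfolding N_def[symmetric]
  proof (rule idealI[OF ring_axioms])
    show "subgroup N (add_monoid R)"
    proof (rule additive_subgroup.a_subgroup[OF add_subgroupI])
      fix x assume x: "x \<in> N"
      have "\<ominus>\<^bsub>R\<^esub> x = (\<ominus>\<^bsub>R\<^esub> \<one>\<^bsub>R\<^esub>) \<otimes>\<^bsub>R\<^esub> x" using Nc[OF x] by (simp add: l_minus)
      thus "\<ominus>\<^bsub>R\<^esub> x \<in> N" using l(1)[OF x, of "\<ominus>\<^bsub>R\<^esub> \<one>\<^bsub>R\<^esub>"] by simp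
    qed (use Nc z add in auto)
  qed (use l in auto)
qed

lemma (in abelian_monoid) finsum_append:
  fixes f :: "nat \<Rightarrow> 'a"
  assumes "\<And>i. i < m + n ==> f i \<in> carrier G"
  shows "finsum G f {..<m + n} = finsum G f {..<m} \<oplus> finsum G (\<lambda>k. f (m + k)) {..<n}"
  using assms
proof (induction n)
  case (Suc n)
  have c: "f \<in> {..<m + n} \<rightarrow> carrier G" "f (m + n) \<in> carrier G" "f \<in> {..<m} \<rightarrow> carrier G"
    "(\<lambda>k. f (m + k)) \<in> {..<n} \<rightarrow> carrier G" using Suc.prems by auto
  thus ?case using Suc.IH Suc.prems by (simp add: lessThan_Suc a_ac)
qed simp

locale preadd =
  fixes C :: "('o, 'f) precat"
  assumes pre: "preadditive C"
begin

abbreviation "Ob \<equiv> Obj C"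
abbreviation "Mo \<equiv> Mor C"
abbreviation "cp \<equiv> Comp C"
abbreviation "Idn \<equiv> Ident C"
abbreviation "Ze \<equiv> Zero C"
abbreviation "Pl \<equiv> Plus C"

lemma mor_comm_group: "[|X \<in> Ob; Y \<in> Ob|] ==> comm_group (mor_group C X Y)"
  using pre by (simp add: preadditive_def)

lemma mor_simps: "carrier (mor_group C X Y) = Mo X Y" "monoid.mult (mor_group C X Y) = Pl X Y"
  "one (mor_group C X Y) = Ze X Y"
  by (simp_all add: mor_group_def)

lemma Id_mor: "X \<in> Ob ==> Idn X \<in> Mo X X"
  using pre by (simp add: preadditive_def)

lemma cp_mor: "[|X \<in> Ob; Y \<in> Ob; Z \<in> Ob; f \<in> Mo X Y; g \<in> Mo Y Z|] ==> cp X Y Z g f \<in> Mo X Z"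
  using pre by (simp add: preadditive_def)

lemma Id_l: "[|X \<in> Ob; Y \<in> Ob; f \<in> Mo X Y|] ==> cp X Y Y (Idn Y) f = f"
  and Id_r: "[|X \<in> Ob; Y \<in> Ob; f \<in> Mo X Y|] ==> cp X X Y f (Idn X) = f"
  using pre by (simp_all add: preadditive_def)

lemma cp_assoc: "[|X \<in> Ob; Y \<in> Ob; Z \<in> Ob; U \<in> Ob; f \<in> Mo X Y; g \<in> Mo Y Z; h \<in> Mo Z U|]
    ==> cp X Z U h (cp X Y Z g f) = cp X Y U (cp Y Z U h g) f"
  using pre by (simp add: preadditive_def)

lemma Pl_l: "[|X \<in> Ob; Y \<in> Ob; Z \<in> Ob; f \<in> Mo X Y; g \<in> Mo Y Z; g' \<in> Mo Y Z|]
    ==> cp X Y Z (Pl Y Z g g') f = Pl X Z (cp X Y Z g f) (cp X Y Z g' f)"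
  and Pl_r: "[|X \<in> Ob; Y \<in> Ob; Z \<in> Ob; f \<in> Mo X Y; f' \<in> Mo X Y; g \<in> Mo Y Z|]
    ==> cp X Y Z g (Pl X Y f f') = Pl X Z (cp X Y Z g f) (cp X Y Z g f')"
  using pre unfolding preadditive_def by blast+

lemma Ze_mor: "[|X \<in> Ob; Y \<in> Ob|] ==> Ze X Y \<in> Mo X Y"
  using monoid.one_closed[of "mor_group C X Y"] mor_comm_group[of X Y]
  by (simp add: comm_group_def group_def mor_simps)

lemma Pl_Ze: "[|X \<in> Ob; Y \<in> Ob; f \<in> Mo X Y|] ==> Pl X Y f (Ze X Y) = f"
    "[|X \<in> Ob; Y \<in> Ob; f \<in> Mo X Y|] ==> Pl X Y (Ze X Y) f = f"
  using monoid.r_one[of "mor_group C X Y"] monoid.l_one[of "mor_group C X Y"] mor_comm_group[of X Y]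
  by (simp_all add: comm_group_def group_def mor_simps)

lemma Pl_idem:
  assumes "X \<in> Ob" "Y \<in> Ob" "f \<in> Mo X Y" "Pl X Y f f = f"
  shows "f = Ze X Y"
proof -
  interpret comm_group "mor_group C X Y" using mor_comm_group assms by simp
  show ?thesis using assms r_cancel_one'[of f f] by (simp add: mor_simps)
qed

lemma Ze_l: "[|X \<in> Ob; Y \<in> Ob; Z \<in> Ob; f \<in> Mo X Y|] ==> cp X Y Z (Ze Y Z) f = Ze X Z"
  using Pl_l[of X Y Z f "Ze Y Z" "Ze Y Z"] by (intro Pl_idem) (auto simp: Pl_Ze Ze_mor cp_mor)

lemma Ze_r: "[|X \<in> Ob; Y \<in> Ob; Z \<in> Ob; g \<in> Mo Y Z|] ==> cp X Y Z g (Ze X Y) = Ze X Z"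
  using Pl_r[of X Y Z "Ze X Y" "Ze X Y" g] by (intro Pl_idem) (auto simp: Pl_Ze Ze_mor cp_mor)

lemma end_simps [simp]:
  "carrier (end_ring C X) = Mo X X" "monoid.mult (end_ring C X) = cp X X X" "one (end_ring C X) = Idn X"
  "zero (end_ring C X) = Ze X X" "add (end_ring C X) = Pl X X"
  by (simp_all add: end_ring_def)

lemma end_ring:
  assumes X: "X \<in> Ob" shows "ring (end_ring C X)"
proof (rule ringI)
  interpret G: comm_group "mor_group C X X" using mor_comm_group X by simp
  show "abelian_group (end_ring C X)"
  proof (rule abelian_groupI)
    fix f assume f: "f \<in> carrier (end_ring C X)"
    show "\<exists>g\<in>carrier (end_ring C X). g \<oplus>\<^bsub>end_ring C X\<^esub> f = \<zero>\<^bsub>end_ring C X\<^esub>"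
      using G.l_inv[of f] G.inv_closed[of f] f by (intro bexI[of _ "inv\<^bsub>mor_group C X X\<^esub> f"]) (auto simp: mor_simps)
  qed (use G.m_assoc G.m_comm G.m_closed G.l_one G.one_closed in \<open>auto simp: mor_simps\<close>)
  show "monoid (end_ring C X)"
    by (rule monoidI) (use X in \<open>simp_all add: Id_mor cp_mor Id_l Id_r cp_assoc\<close>)
qed (use X in \<open>simp_all add: Pl_l Pl_r\<close>)

lemma is_iso_Units: "X \<in> Ob ==> is_iso_mor C X X f \<longleftrightarrow> f \<in> Units (end_ring C X)"
  by (auto simp: is_iso_mor_def Units_def)

section \<open>Zero objects and finite direct sums\<close>

lemma zero_object_iff: "zero_object C Z \<longleftrightarrow> Z \<in> Ob \<and> Idn Z = Ze Z Z"
proof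
  assume z: "zero_object C Z"
  thus "Z \<in> Ob \<and> Idn Z = Ze Z Z" using Id_mor Ze_mor by (auto simp: zero_object_def)
next
  assume z: "Z \<in> Ob \<and> Idn Z = Ze Z Z"
  have "f = Ze X Z" if "X \<in> Ob" "f \<in> Mo X Z" for X f using Id_l[of X Z f] Ze_l[of X Z Z f] z that by simp
  moreover have "f = Ze Z X" if "X \<in> Ob" "f \<in> Mo Z X" for X f using Id_r[of Z X f] Ze_r[of Z Z X f] z that by simp
  ultimately show "zero_object C Z" unfolding zero_object_def using z Ze_mor by blast
qed

lemma direct_sum_pairI:
  assumes "M \<in> Ob" "X \<in> Ob" "Y \<in> Ob" "i \<in> Mo X M" "p \<in> Mo M X" "j \<in> Mo Y M" "q \<in> Mo M Y"
    "cp X M X p i = Idn X" "cp Y M Y q j = Idn Y" "cp Y M X p j = Ze Y X" "cp X M Y q i = Ze X Y"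
    "Pl M M (cp M X M i p) (cp M Y M j q) = Idn M"
  shows "is_direct_sum C M [X, Y]"
proof -
  interpret ring "end_ring C M" using end_ring assms by simp
  let ?inj = "\<lambda>k::nat. if k = 0 then i else j" and ?prj = "\<lambda>k::nat. if k = 0 then p else q"
  have 2: "{..<2::nat} = {0, 1}" by auto
  have "finsum (end_ring C M) (\<lambda>k. cp M ([X, Y] ! k) M (?inj k) (?prj k)) {..<2} = Idn M"
    unfolding 2 using assms cp_mor by (subst finsum_insert) (auto simp: Pl_Ze)
  thus ?thesis using assms unfolding is_direct_sum_def
    by (intro conjI exI[of _ ?inj] exI[of _ ?prj]) (auto simp: less_Suc_eq numeral_2_eq_2)
qed

lemma direct_sum_pairE:
  assumes "is_direct_sum C M [X, Y]"
  obtains i p j q where "M \<in> Ob" "X \<in> Ob" "Y \<in> Ob" "i \<in> Mo X M" "p \<in> Mo M X" "j \<in> Mo Y M" "q \<in> Mo M Y"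
    "cp X M X p i = Idn X" "cp Y M Y q j = Idn Y" "cp Y M X p j = Ze Y X" "cp X M Y q i = Ze X Y"
    "Pl M M (cp M X M i p) (cp M Y M j q) = Idn M"
proof -
  have ob: "M \<in> Ob" "X \<in> Ob" "Y \<in> Ob" using assms by (auto simp: is_direct_sum_def)
  interpret ring "end_ring C M" using end_ring ob by simp
  obtain inj prj where m: "\<forall>i<2. inj i \<in> Mo ([X, Y] ! i) M \<and> prj i \<in> Mo M ([X, Y] ! i)"
    and o: "\<forall>i<2. \<forall>j<2. cp ([X, Y] ! j) M ([X, Y] ! i) (prj i) (inj j)
            = (if i = j then Idn ([X, Y] ! i) else Ze ([X, Y] ! j) ([X, Y] ! i))"
    and s: "finsum (end_ring C M) (\<lambda>i. cp M ([X, Y] ! i) M (inj i) (prj i)) {..<2} = Idn M"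
    using assms by (auto simp: is_direct_sum_def numeral_2_eq_2)
  have m': "inj 0 \<in> Mo X M" "prj 0 \<in> Mo M X" "inj 1 \<in> Mo Y M" "prj 1 \<in> Mo M Y"
    using m[rule_format, of 0] m[rule_format, of 1] by auto
  have 2: "{..<2::nat} = {0, 1}" by auto
  have "Pl M M (cp M X M (inj 0) (prj 0)) (cp M Y M (inj 1) (prj 1)) = Idn M"
    using s m' ob cp_mor unfolding 2 by (subst (asm) finsum_insert) (auto simp: Pl_Ze)
  thus ?thesis
    using that[OF ob m'] o[rule_format, of 0 0] o[rule_format, of 1 1] o[rule_format, of 0 1] o[rule_format, of 1 0]
    by simp
qed

lemma direct_sum_swap: "is_direct_sum C M [X, Y] ==> is_direct_sum C M [Y, X]"
proof -
  assume "is_direct_sum C M [X, Y]"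
  then obtain i p j q where *: "M \<in> Ob" "X \<in> Ob" "Y \<in> Ob" "i \<in> Mo X M" "p \<in> Mo M X" "j \<in> Mo Y M" "q \<in> Mo M Y"
    "cp X M X p i = Idn X" "cp Y M Y q j = Idn Y" "cp Y M X p j = Ze Y X" "cp X M Y q i = Ze X Y"
    "Pl M M (cp M X M i p) (cp M Y M j q) = Idn M" by (rule direct_sum_pairE)
  interpret ring "end_ring C M" using end_ring * by simp
  have "Pl M M (cp M Y M j q) (cp M X M i p) = Idn M"
    using a_comm[of "cp M Y M j q" "cp M X M i p"] * cp_mor by simp
  thus ?thesis by (intro direct_sum_pairI) (use * in auto)
qed

lemma direct_sumI:
  assumes "M \<in> Ob" "set Xs \<subseteq> Ob"
    "\<And>i. i < length Xs ==> ij i \<in> Mo (Xs ! i) M" "\<And>i. i < length Xs ==> pj i \<in> Mo M (Xs ! i)"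
    "\<And>i j. [|i < length Xs; j < length Xs|] ==> cp (Xs ! j) M (Xs ! i) (pj i) (ij j)
            = (if i = j then Idn (Xs ! i) else Ze (Xs ! j) (Xs ! i))"
    "finsum (end_ring C M) (\<lambda>i. cp M (Xs ! i) M (ij i) (pj i)) {..<length Xs} = Idn M"
  shows "is_direct_sum C M Xs"
  unfolding is_direct_sum_def using assms by blast

lemma direct_sum_single:
  assumes M: "M \<in> Ob" shows "is_direct_sum C M [M]"
proof -
  interpret ring "end_ring C M" using end_ring M by simp
  have "finsum (end_ring C M) (\<lambda>i. cp M ([M] ! i) M (Idn M) (Idn M)) {..<Suc 0} = Idn M"
    using M by (simp add: lessThan_Suc Id_mor Id_l Pl_Ze)
  thus ?thesis
    using M by (intro direct_sumI[where ij = "\<lambda>_. Idn M" and pj = "\<lambda>_. Idn M"]) (auto simp: Id_mor Id_l)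
qed

lemma direct_sum_empty: "[|M \<in> Ob; Idn M = Ze M M|] ==> is_direct_sum C M []"
proof -
  assume M: "M \<in> Ob" "Idn M = Ze M M"
  interpret ring "end_ring C M" using end_ring M by simp
  show ?thesis using M finsum_empty by (auto simp: is_direct_sum_def)
qed

lemma conj_addmap:
  assumes "M \<in> Ob" "X \<in> Ob" "i \<in> Mo X M" "p \<in> Mo M X"
  shows "addmap (end_ring C X) (end_ring C M) (\<lambda>g. cp M X M i (cp M X X g p))"
  by (rule addmapI) (use assms in \<open>simp_all add: cp_mor Pl_l Pl_r\<close>)

text \<open>The assignment of i g p to \<open>g\<close> is additive by \<open>conj_addmap\<close>,
  so a decomposition of the identity of \<open>X\<close> yields one of the composite i p.\<close>

lemma direct_sum_conj:
  assumes ob: "M \<in> Ob" "X \<in> Ob" "i \<in> Mo X M" "p \<in> Mo M X" "set Xs \<subseteq> Ob"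
    and a: "\<And>k. k < length Xs ==> a k \<in> Mo (Xs ! k) X \<and> b k \<in> Mo X (Xs ! k)"
    and s: "finsum (end_ring C X) (\<lambda>k. cp X (Xs ! k) X (a k) (b k)) {..<length Xs} = Idn X"
  shows "finsum (end_ring C M) (\<lambda>k. cp M (Xs ! k) M (cp (Xs ! k) X M i (a k)) (cp M X (Xs ! k) (b k) p))
     {..<length Xs} = cp M X M i p"
proof -
  interpret M: ring "end_ring C M" using end_ring ob by simp
  interpret X: ring "end_ring C X" using end_ring ob by simp
  have o: "Xs ! k \<in> Ob" if "k < length Xs" for k using ob(5) that by auto
  have "cp M X M i (cp M X X (Idn X) p) =
      finsum (end_ring C M) (\<lambda>k. cp M X M i (cp M X X (cp X (Xs ! k) X (a k) (b k)) p)) {..<length Xs}"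
    unfolding s[symmetric]
    by (rule addmap_finsum[OF X.abelian_group_axioms M.abelian_group_axioms conj_addmap])
      (use ob a o in \<open>auto simp: cp_mor\<close>)
  also have "\<dots> = finsum (end_ring C M) (\<lambda>k. cp M (Xs ! k) M (cp (Xs ! k) X M i (a k)) (cp M X (Xs ! k) (b k) p))
     {..<length Xs}"
    by (rule M.finsum_cong') (use ob a o in \<open>auto simp: cp_mor cp_assoc\<close>)
  finally show ?thesis using ob by (simp add: Id_l)
qed

lemma direct_sumE:
  assumes "is_direct_sum C M Xs"
  obtains inj prj where "M \<in> Ob" "set Xs \<subseteq> Ob"
    "\<And>i. i < length Xs ==> inj i \<in> Mo (Xs ! i) M \<and> prj i \<in> Mo M (Xs ! i)"
    "\<And>i j. [|i < length Xs; j < length Xs|] ==> cp (Xs ! j) M (Xs ! i) (prj i) (inj j)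
            = (if i = j then Idn (Xs ! i) else Ze (Xs ! j) (Xs ! i))"
    "finsum (end_ring C M) (\<lambda>i. cp M (Xs ! i) M (inj i) (prj i)) {..<length Xs} = Idn M"
  using assms unfolding is_direct_sum_def by blast

lemma direct_sum_append:
  assumes "is_direct_sum C M [X, Y]" "is_direct_sum C X Xs" "is_direct_sum C Y Ys"
  shows "is_direct_sum C M (Xs @ Ys)"
proof -
  from assms(1) obtain i p j q where *: "M \<in> Ob" "X \<in> Ob" "Y \<in> Ob" "i \<in> Mo X M" "p \<in> Mo M X" "j \<in> Mo Y M" "q \<in> Mo M Y"
    "cp X M X p i = Idn X" "cp Y M Y q j = Idn Y" "cp Y M X p j = Ze Y X" "cp X M Y q i = Ze X Y"
    "Pl M M (cp M X M i p) (cp M Y M j q) = Idn M" by (rule direct_sum_pairE)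
  from assms(2) obtain a b where ab: "set Xs \<subseteq> Ob"
    "\<And>k. k < length Xs ==> a k \<in> Mo (Xs ! k) X \<and> b k \<in> Mo X (Xs ! k)"
    "\<And>k l. [|k < length Xs; l < length Xs|] ==> cp (Xs ! l) X (Xs ! k) (b k) (a l)
            = (if k = l then Idn (Xs ! k) else Ze (Xs ! l) (Xs ! k))"
    "finsum (end_ring C X) (\<lambda>k. cp X (Xs ! k) X (a k) (b k)) {..<length Xs} = Idn X" by (rule direct_sumE) blast
  from assms(3) obtain c d where cd: "set Ys \<subseteq> Ob"
    "\<And>k. k < length Ys ==> c k \<in> Mo (Ys ! k) Y \<and> d k \<in> Mo Y (Ys ! k)"
    "\<And>k l. [|k < length Ys; l < length Ys|] ==> cp (Ys ! l) Y (Ys ! k) (d k) (c l)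
            = (if k = l then Idn (Ys ! k) else Ze (Ys ! l) (Ys ! k))"
    "finsum (end_ring C Y) (\<lambda>k. cp Y (Ys ! k) Y (c k) (d k)) {..<length Ys} = Idn Y" by (rule direct_sumE) blast
  interpret M: ring "end_ring C M" using end_ring * by simp
  let ?m = "length Xs" and ?n = "length Ys" and ?Z = "Xs @ Ys"
  have xo: "Xs ! k \<in> Ob" if "k < ?m" for k using ab(1) that by auto
  have yo: "Ys ! k \<in> Ob" if "k < ?n" for k using cd(1) that by auto
  have am: "a k \<in> Mo (Xs ! k) X" "b k \<in> Mo X (Xs ! k)" if "k < ?m" for k using ab(2) that by auto
  have cm: "c k \<in> Mo (Ys ! k) Y" "d k \<in> Mo Y (Ys ! k)" if "k < ?n" for k using cd(2) that by auto
  define inj where "inj k = (if k < ?m then cp (Xs ! k) X M i (a k) else cp (Ys ! (k - ?m)) Y M j (c (k - ?m)))" for k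
  define prj where "prj k = (if k < ?m then cp M X (Xs ! k) (b k) p else cp M Y (Ys ! (k - ?m)) (d (k - ?m)) q)" for k
  \<comment> \<open>Reassociation that brings the structure maps q' and i' of the coarse
    decomposition together, where their composite is an identity or zero.\<close>
  have mid: "cp V M U (cp M Y' U u q') (cp V X' M i' v) = cp V Y' U u (cp V X' Y' (cp X' M Y' q' i') v)"
    if "U \<in> Ob" "V \<in> Ob" "X' \<in> Ob" "Y' \<in> Ob" "u \<in> Mo Y' U" "v \<in> Mo V X'" "q' \<in> Mo M Y'" "i' \<in> Mo X' M" for U V X' Y' u v q' i'
  proof -
    have "cp V M U (cp M Y' U u q') (cp V X' M i' v) = cp V Y' U u (cp V M Y' q' (cp V X' M i' v))"
      using that * by (intro cp_assoc[symmetric]) (auto intro: cp_mor)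
    thus ?thesis using that * by (simp add: cp_assoc)
  qed
  show ?thesis
  proof (rule direct_sumI[where ij = inj and pj = prj])
    show "M \<in> Ob" "set ?Z \<subseteq> Ob" using * ab cd by auto
    fix k assume k: "k < length ?Z"
    hence k': "\<not> k < ?m ==> k - ?m < ?n" by auto
    show "inj k \<in> Mo (?Z ! k) M" "prj k \<in> Mo M (?Z ! k)"
      using k' * xo yo am cm by (auto simp: inj_def prj_def nth_append intro!: cp_mor)
    fix l assume l: "l < length ?Z"
    hence l': "\<not> l < ?m ==> l - ?m < ?n" by auto
    show "cp (?Z ! l) M (?Z ! k) (prj k) (inj l) = (if k = l then Idn (?Z ! k) else Ze (?Z ! l) (?Z ! k))"
    proof (cases "k < ?m"; cases "l < ?m")
      assume "k < ?m" "l < ?m"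
      thus ?thesis using * xo am ab(3) by (simp add: inj_def prj_def nth_append mid Id_l)
    next
      assume "k < ?m" "\<not> l < ?m"
      thus ?thesis using * xo am yo[OF l'] cm[OF l'] by (simp add: inj_def prj_def nth_append mid Ze_l Ze_r)
    next
      assume "\<not> k < ?m" "l < ?m"
      thus ?thesis using * xo am yo[OF k'] cm[OF k'] by (simp add: inj_def prj_def nth_append mid Ze_l Ze_r)
    next
      assume a: "\<not> k < ?m" "\<not> l < ?m"
      hence "k - ?m = l - ?m \<longleftrightarrow> k = l" by auto
      thus ?thesis using a * yo[OF k'] cm[OF k'] yo[OF l'] cm[OF l'] cd(3)[OF k' l']
        by (simp add: inj_def prj_def nth_append mid Id_l)
    qed
  next
    let ?f = "\<lambda>k. cp M (?Z ! k) M (inj k) (prj k)"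
    have fm: "?f k \<in> Mo M M" if "k < ?m + ?n" for k
    proof (cases "k < ?m")
      case True
      thus ?thesis using * xo am by (auto simp: inj_def prj_def nth_append intro!: cp_mor)
    next
      case False
      hence "k - ?m < ?n" using that by auto
      thus ?thesis using False * yo cm by (auto simp: inj_def prj_def nth_append intro!: cp_mor)
    qed
    have "finsum (end_ring C M) ?f {..<length ?Z} =
        Pl M M (finsum (end_ring C M) ?f {..<?m}) (finsum (end_ring C M) (\<lambda>k. ?f (?m + k)) {..<?n})"
      using M.finsum_append[of ?m ?n ?f] fm by simp
    also have "finsum (end_ring C M) ?f {..<?m} = cp M X M i p"
    proof (subst direct_sum_conj[OF *(1,2,4,5) ab(1,2,4), symmetric], assumption, rule M.finsum_cong')
    qed (use * xo am in \<open>auto simp: inj_def prj_def nth_append intro!: cp_mor\<close>)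
    also have "finsum (end_ring C M) (\<lambda>k. ?f (?m + k)) {..<?n} = cp M Y M j q"
    proof (subst direct_sum_conj[OF *(1,3,6,7) cd(1,2,4), symmetric], assumption, rule M.finsum_cong')
    qed (use * yo cm in \<open>auto simp: inj_def prj_def nth_append intro!: cp_mor\<close>)
    finally show "finsum (end_ring C M) ?f {..<length ?Z} = Idn M" using * by simp
  qed
qed

lemma direct_sum_iso:
  assumes "is_direct_sum C M Xs" "N \<in> Ob" "f \<in> Mo N M" "g \<in> Mo M N"
    "cp N M N g f = Idn N" "cp M N M f g = Idn M"
  shows "is_direct_sum C N Xs"
proof -
  from assms(1) obtain a b where M: "M \<in> Ob" and ab: "set Xs \<subseteq> Ob"
    "\<And>k. k < length Xs ==> a k \<in> Mo (Xs ! k) M \<and> b k \<in> Mo M (Xs ! k)"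
    "\<And>k l. [|k < length Xs; l < length Xs|] ==> cp (Xs ! l) M (Xs ! k) (b k) (a l)
            = (if k = l then Idn (Xs ! k) else Ze (Xs ! l) (Xs ! k))"
    "finsum (end_ring C M) (\<lambda>k. cp M (Xs ! k) M (a k) (b k)) {..<length Xs} = Idn M" by (rule direct_sumE) blast
  have xo: "Xs ! k \<in> Ob" if "k < length Xs" for k using ab(1) that by auto
  have am: "a k \<in> Mo (Xs ! k) M" "b k \<in> Mo M (Xs ! k)" if "k < length Xs" for k using ab(2) that by auto
  show ?thesis
  proof (rule direct_sumI[where ij = "\<lambda>k. cp (Xs ! k) M N g (a k)" and pj = "\<lambda>k. cp N M (Xs ! k) (b k) f"])
    show "N \<in> Ob" "set Xs \<subseteq> Ob" using assms ab by auto
    fix k assume k: "k < length Xs"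
    show "cp (Xs ! k) M N g (a k) \<in> Mo (Xs ! k) N" "cp N M (Xs ! k) (b k) f \<in> Mo N (Xs ! k)"
      using assms M xo[OF k] am[OF k] by (auto intro: cp_mor)
    fix l assume l: "l < length Xs"
    have "cp (Xs ! l) N (Xs ! k) (cp N M (Xs ! k) (b k) f) (cp (Xs ! l) M N g (a l)) =
        cp (Xs ! l) M (Xs ! k) (b k) (cp (Xs ! l) N M f (cp (Xs ! l) M N g (a l)))"
      using assms M xo[OF k] am[OF k] xo[OF l] am[OF l] by (intro cp_assoc[symmetric]) (auto intro: cp_mor)
    also have "\<dots> = cp (Xs ! l) M (Xs ! k) (b k) (a l)"
      using assms M xo[OF k] am[OF k] xo[OF l] am[OF l] by (simp add: cp_assoc Id_l)
    finally show "cp (Xs ! l) N (Xs ! k) (cp N M (Xs ! k) (b k) f) (cp (Xs ! l) M N g (a l)) =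
        (if k = l then Idn (Xs ! k) else Ze (Xs ! l) (Xs ! k))" using ab(3)[OF k l] by simp
  next
    show "finsum (end_ring C N) (\<lambda>k. cp N (Xs ! k) N (cp (Xs ! k) M N g (a k)) (cp N M (Xs ! k) (b k) f))
       {..<length Xs} = Idn N"
      using direct_sum_conj[OF assms(2) M assms(4,3) ab(1,2,4)] assms(5) by simp
  qed
qed

text \<open>The form of Fitting's lemma shared by dgMod and dgHot. It survives isomorphism
  (\<open>fitting_object_iso\<close>) and gives both locality and indecomposability.\<close>

definition fitting_object :: "'o \<Rightarrow> bool" where
  "fitting_object M \<longleftrightarrow> M \<in> Ob \<and> Idn M \<noteq> Ze M M \<and>
     (\<forall>f\<in>Mo M M. is_iso_mor C M M f \<or> nilpotent (end_ring C M) f)"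

lemma fitting_object_local:
  assumes "fitting_object M"
  shows "iso_or_nilpotent_endos C M" "local_ring (end_ring C M)"
proof -
  have M: "M \<in> Ob" "Idn M \<noteq> Ze M M" using assms by (auto simp: fitting_object_def)
  have R: "ring (end_ring C M)" using end_ring M by simp
  have o: "\<one>\<^bsub>end_ring C M\<^esub> \<noteq> \<zero>\<^bsub>end_ring C M\<^esub>" using M by simp
  have un: "x \<in> Units (end_ring C M) \<or> nilpotent (end_ring C M) x" if "x \<in> carrier (end_ring C M)" for x
    using assms that by (auto simp: fitting_object_def is_iso_Units)
  note r = ring_iso_or_nilpotent[OF R o un]
  show "local_ring (end_ring C M)" using r(2) R by (simp add: local_ring_def)
  show "iso_or_nilpotent_endos C M"
    using r assms unfolding iso_or_nilpotent_endos_def fitting_object_def by auto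
qed

text \<open>The idempotent e = i p is invertible or nilpotent. An invertible idempotent is the
  identity, and then \<open>Y\<close> vanishes; a nilpotent one equals its positive powers, hence is
  zero, and then \<open>X\<close> vanishes.\<close>

lemma fitting_object_decomp:
  assumes "fitting_object M" "is_direct_sum C M [X, Y]"
  shows "Idn X = Ze X X \<or> Idn Y = Ze Y Y"
proof -
  from assms(2) obtain i p j q where *: "M \<in> Ob" "X \<in> Ob" "Y \<in> Ob" "i \<in> Mo X M" "p \<in> Mo M X" "j \<in> Mo Y M" "q \<in> Mo M Y"
    "cp X M X p i = Idn X" "cp Y M Y q j = Idn Y" "cp Y M X p j = Ze Y X" "cp X M Y q i = Ze X Y"
    "Pl M M (cp M X M i p) (cp M Y M j q) = Idn M" by (rule direct_sum_pairE)
  interpret M: ring "end_ring C M" using end_ring * by simp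
  note ob = *(1-3) and mo = *(4-7)
  define e where "e = cp M X M i p"
  have e: "e \<in> Mo M M" using * by (auto simp: e_def cp_mor)
  have "cp M M M e e = cp M X M i (cp M M X p e)"
    unfolding e_def using ob mo cp_mor by (intro cp_assoc[symmetric]) auto
  also have "cp M M X p e = cp M X X (cp X M X p i) p" unfolding e_def using ob mo by (intro cp_assoc)
  also have "\<dots> = p" using * by (simp add: Id_l)
  finally have ee: "cp M M M e e = e" by (simp add: e_def)
  have "cp X M M e i = cp X X M i (cp X M X p i)" unfolding e_def using ob mo by (intro cp_assoc[symmetric])
  hence pe: "cp X M X p (cp X M M e i) = Idn X" using * by (simp add: Id_r)
  have "cp Y M M e j = cp Y X M i (cp Y M X p j)" unfolding e_def using ob mo by (intro cp_assoc[symmetric])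
  hence qe: "cp Y M Y q (cp Y M M e j) = Ze Y Y" using * by (simp add: Ze_r)
  from assms(1) e consider "is_iso_mor C M M e" | "nilpotent (end_ring C M) e" unfolding fitting_object_def by blast
  thus ?thesis
  proof cases
    case 1
    then obtain g where g: "g \<in> Mo M M" "cp M M M g e = Idn M" unfolding is_iso_mor_def by blast
    have "e = cp M M M (cp M M M g e) e" using g e * by (simp add: Id_l)
    also have "\<dots> = cp M M M g (cp M M M e e)" using g e * by (simp add: cp_assoc)
    also have "\<dots> = Idn M" using g ee by simp
    finally have "e = Idn M" .
    hence "Idn Y = Ze Y Y" using qe * by (simp add: Id_l)
    thus ?thesis by simp
  next
    case 2
    then obtain n :: nat where n: "e [^]\<^bsub>end_ring C M\<^esub> n = Ze M M" by (auto simp: nilpotent_def)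
    have pw: "e [^]\<^bsub>end_ring C M\<^esub> Suc k = e" for k :: nat
    proof (induction k)
      case (Suc k)
      thus ?case using ee by simp
    qed (use e * in \<open>simp add: Id_l\<close>)
    have "n \<noteq> 0" using n assms(1) by (metis M.nat_pow_0 end_simps(3) fitting_object_def)
    hence "e = Ze M M" using pw n by (metis not0_implies_Suc)
    hence "Idn X = Ze X X" using pe * by (simp add: Ze_l Ze_r)
    thus ?thesis by simp
  qed
qed

lemma full_simps [simp]:
  "Obj (full_subcat C S) = Ob \<inter> S" "Mor (full_subcat C S) = Mo" "Comp (full_subcat C S) = cp"
  "Ident (full_subcat C S) = Idn" "Plus (full_subcat C S) = Pl" "Zero (full_subcat C S) = Ze"
  "end_ring (full_subcat C S) = end_ring C"
  by (simp_all add: full_subcat_def end_ring_def fun_eq_iff)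

lemma full_preadditive: "preadditive (full_subcat C S)"
proof -
  have "mor_group (full_subcat C S) = mor_group C" by (simp add: mor_group_def fun_eq_iff)
  thus ?thesis using pre unfolding preadditive_def by simp
qed

lemma full_zero: "zero_object (full_subcat C S) Z \<longleftrightarrow> zero_object C Z \<and> Z \<in> S"
  using preadd.zero_object_iff[OF preadd.intro[OF full_preadditive], of S Z] zero_object_iff by auto

lemma full_direct_sum:
  "is_direct_sum (full_subcat C S) M Xs \<longleftrightarrow> is_direct_sum C M Xs \<and> M \<in> S \<and> set Xs \<subseteq> S"
  unfolding is_direct_sum_def by auto

lemma fitting_object_indecomposable:
  assumes "fitting_object M" "M \<in> S"
  shows "indecomposable (full_subcat C S) M"
  unfolding indecomposable_def full_zero full_direct_sum
proof (intro conjI allI impI)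
  show "M \<in> Obj (full_subcat C S)" "\<not> (zero_object C M \<and> M \<in> S)"
    using assms zero_object_iff by (auto simp: fitting_object_def)
  fix X Y assume a: "is_direct_sum C M [X, Y] \<and> M \<in> S \<and> set [X, Y] \<subseteq> S"
  hence "X \<in> Ob" "Y \<in> Ob" by (auto simp: is_direct_sum_def)
  thus "zero_object C X \<and> X \<in> S \<or> zero_object C Y \<and> Y \<in> S"
    using fitting_object_decomp[OF assms(1)] a zero_object_iff by auto
qed

end

section \<open>Filtered dg modules and their mapping cones\<close>

lemma (in abelian_group) diff_zero_imp_eq: "[|a \<in> carrier G; b \<in> carrier G; a \<ominus> b = \<zero>|] ==> a = b"
  using minus_equality[of a "\<ominus> b"] by (simp add: a_minus_def)

text \<open>Description of the objects of dgFilt that does not mention the representatives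
  \<open>L\<close>; the comparison is \<open>filt_objects_eq\<close>. A cell of degree
  \<open>j\<close> is a shift by \<open>- j\<close>, so increasing degrees match decreasing
  shifts.\<close>

definition filt :: "('k, 'a) dgalgebra \<Rightarrow> ('a, 'm) dgmodule \<Rightarrow> bool" where
  "filt A M \<longleftrightarrow> dg_module A M \<and> (\<exists>js. sorted js \<and> rf A M js {zero M} (carrier M))"

lemma rst_adj [simp]: "adj A (rst M P) N v = adj A M N v"
  by (simp add: adj_def)

lemma rst_rf:
  assumes "rf A M js N T" "pdgm A M" "dsub A M N" "T \<subseteq> P"
  shows "rf A (rst M P) js N T"
  using assms(1,3,4)
proof (induction rule: rf.induct)
  case (Nil N)
  thus ?case by (simp add: rf.Nil)
next
  case (Cons j e v N js T)
  interpret pdgm A M by fact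
  have s: "dsub A M (adj A M N v)" using cell_sub[OF Cons.prems(1) Cons.hyps(1)] .
  have "v \<in> adj A M N v" using ad_self[OF Cons.prems(1) cellD(5)[OF Cons.hyps(1)]] .
  hence "v \<in> P" using rf_subset[OF Cons.hyps(2) s] Cons.prems by auto
  hence "cell A (rst M P) j e v N" using Cons.hyps(1) by (simp add: cell_def)
  thus ?case using Cons.IH[OF s] Cons.prems by (auto intro: rf.Cons)
qed

text \<open>Injectivity preserves the cell condition, and degrees and idempotents are
  unchanged.\<close>

lemma rf_map:
  assumes "pdgm A M" "pdgm A D" and i: "i \<in> dg_hom A M D" and inj: "inj_on i (carrier M)"
    and "rf A M js N T" "dsub A M N"
  shows "rf A D js (i ` N) (i ` T)"
  using assms(5,6)
proof (induction rule: rf.induct)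
  case (Nil N)
  thus ?case by (simp add: rf.Nil)
next
  case (Cons j e v N js T)
  interpret M: pdgm A M by fact
  interpret D: pdgm A D by fact
  note cD = M.cellD[OF Cons.hyps(1)] and iD = dg_homD[OF i] and N = Cons.prems
  have ec: "e \<in> carrier A" using M.prim_carrier cD by auto
  have "cell A D j e (i v) (i ` N)"
    unfolding cell_def
  proof (intro conjI ballI impI)
    show "ract D (i v) e = i v" using iD(3)[OF cD(5) ec] cD(3) by simp
    show "mdiff D (i v) \<in> i ` N" using iD(5)[OF cD(5)] cD(4) by (metis imageI)
    fix a assume a: "a \<in> carrier A" "ract D (i v) a \<in> i ` N"
    then obtain n where n: "n \<in> N" "i (ract M v a) = i n" using iD(3)[OF cD(5) a(1)] by auto
    hence "ract M v a = n"
      using inj_onD[OF inj n(2)] M.ract_closed[OF cD(5) a(1)] M.sub_carrier[OF N n(1)] by simp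
    thus "e \<otimes>\<^bsub>A\<^esub> a = (zero A)" using cD(6) a n by simp
  qed (use iD(4) cD in auto)
  moreover have "i ` adj A M N v = adj A D (i ` N) (i v)"
  proof -
    have e: "i (n \<oplus>\<^bsub>M\<^esub> ract M v a) = i n \<oplus>\<^bsub>D\<^esub> ract D (i v) a" if "n \<in> N" "a \<in> carrier A" for n a
      using iD(2)[OF M.sub_carrier[OF N that(1)] M.ract_closed[OF cD(5) that(2)]] iD(3)[OF cD(5) that(2)] by simp
    show ?thesis
    proof (intro equalityI subsetI)
      fix y assume "y \<in> i ` adj A M N v"
      then obtain n a where na: "n \<in> N" "a \<in> carrier A" "y = i (n \<oplus>\<^bsub>M\<^esub> ract M v a)" by (auto simp: adj_def)
      thus "y \<in> adj A D (i ` N) (i v)" using e[OF na(1,2)] by (auto simp: adj_def)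
    next
      fix y assume "y \<in> adj A D (i ` N) (i v)"
      then obtain n a where "n \<in> N" "a \<in> carrier A" "y = i n \<oplus>\<^bsub>D\<^esub> ract D (i v) a" by (auto simp: adj_def)
      hence "y = i (n \<oplus>\<^bsub>M\<^esub> ract M v a)" "n \<oplus>\<^bsub>M\<^esub> ract M v a \<in> adj A M N v" using e by (auto simp: adj_def)
      thus "y \<in> i ` adj A M N v" by (rule image_eqI)
    qed
  qed
  ultimately show ?case using Cons.IH[OF M.cell_sub[OF N Cons.hyps(1)]] by (auto intro: rf.Cons)
qed

context pdgm
begin

text \<open>Since tA meets \<open>T\<close> trivially, an equation v a = n + t b forces t b = 0. All
  cells above \<open>N\<close> therefore remain cells above N + tA.\<close>

lemma rf_add_cell:
  assumes "rf A M js N T" "sub N" "t \<in> carrier M" "\<And>a. [|a \<in> carrier A; ract M t a \<in> T|] ==> ract M t a = (zero M)"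
  shows "rf A M js (ad N t) (ad T t)"
  using assms
proof (induction rule: rf.induct)
  case (Nil N)
  thus ?case by (simp add: rf.Nil)
next
  case (Cons j e v N js T)
  note c = Cons.hyps(1) and N = Cons.prems(1) and t = Cons.prems(2)
  note cD = cellD[OF c] and N1 = cell_sub[OF N c]
  have T: "sub T" "ad N v \<subseteq> T" using rf_sub[OF Cons.hyps(2) N1] rf_subset[OF Cons.hyps(2) N1] by auto
  have NT: "N \<subseteq> T" "v \<in> T" using T(2) ad_base[OF N cD(5)] ad_self[OF N cD(5)] by auto
  have "cell A M j e v (ad N t)"
    unfolding cell_def
  proof (intro conjI ballI impI)
    fix a assume a: "a \<in> carrier A" "ract M v a \<in> ad N t"
    then obtain n b where nb: "n \<in> N" "b \<in> carrier A" "ract M v a = n \<oplus>\<^bsub>M\<^esub> ract M t b" by (blast elim: adE)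
    have "ract M t b \<in> T"
      using sub_cancel_l[OF T(1), of n "ract M t b"] nb NT sub_ract[OF T(1) NT(2) a(1)] t by (auto simp: ract_closed)
    hence "ract M t b = (zero M)" by (rule Cons.prems(3)[OF nb(2)])
    hence "ract M v a \<in> N" using nb sub_carrier[OF N nb(1)] by simp
    thus "e \<otimes> a = \<zero>" using cD(6) a by blast
  qed (use cD ad_base[OF N t] in auto)
  moreover have "rf A M js (ad (ad N t) v) (ad T t)"
    using Cons.IH[OF N1 t Cons.prems(3)] ad_swap[OF _ cD(5) t, of N] sub_carrier[OF N] by (simp add: subset_iff)
  ultimately show ?case by (rule rf.Cons)
qed

text \<open>\<open>p\<close> is the identity modulo \<open>N\<close>, so nothing is lost above
  \<open>N\<close>: if p(v a) lies in \<open>N\<close>, then so does v a. This moves a filtration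
  into the image of \<open>p\<close>.\<close>

lemma rf_project:
  assumes "rf A M js N T" "sub N" and p: "p \<in> dg_hom A M M" and pN: "\<And>z. z \<in> carrier M ==> z \<ominus>\<^bsub>M\<^esub> p z \<in> N"
  shows "rf A M js (p ` N) (p ` T)"
  using assms(1,2,4)
proof (induction rule: rf.induct)
  case (Nil N)
  thus ?case by (simp add: rf.Nil)
next
  case (Cons j e v N js T)
  note c = Cons.hyps(1) and N = Cons.prems(1) and pN = Cons.prems(2)
  note cD = cellD[OF c] and N1 = cell_sub[OF N c] and pD = dg_homD[OF p]
  have ec: "e \<in> carrier A" using prim_carrier cD by auto
  have pn: "p n \<in> N" if "n \<in> N" for n
  proof -
    have nc: "n \<in> carrier M" using sub_carrier[OF N that] .
    have "n \<ominus>\<^bsub>M\<^esub> (n \<ominus>\<^bsub>M\<^esub> p n) = p n"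
      using nc pD(1)[OF nc] by (simp add: a_minus_def M.minus_add M.r_neg2 M.r_neg1)
    thus ?thesis using sub_diff[OF N that pN[OF nc]] by simp
  qed
  have "cell A M j e (p v) (p ` N)"
    unfolding cell_def
  proof (intro conjI ballI impI)
    show "ract M (p v) e = p v" using pD(3)[OF cD(5) ec] cD(3) by simp
    show "mdiff M (p v) \<in> p ` N" using pD(5)[OF cD(5)] cD(4) by (metis imageI)
    fix a assume a: "a \<in> carrier A" "ract M (p v) a \<in> p ` N"
    have vc: "ract M v a \<in> carrier M" using ract_closed[OF cD(5) a(1)] .
    have "p (ract M v a) \<in> N" using a pD(3)[OF cD(5) a(1)] pn by auto
    hence "ract M v a \<in> N" using sub_diff_mem[OF N vc _ pN[OF vc]] by simp
    thus "e \<otimes> a = \<zero>" using cD(6) a by blast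
  qed (use pD(4) cD in auto)
  moreover have "p ` ad N v = ad (p ` N) (p v)"
  proof -
    have e: "p (n \<oplus>\<^bsub>M\<^esub> ract M v a) = p n \<oplus>\<^bsub>M\<^esub> ract M (p v) a" if "n \<in> N" "a \<in> carrier A" for n a
      using pD(2)[OF sub_carrier[OF N that(1)] ract_closed[OF cD(5) that(2)]] pD(3)[OF cD(5) that(2)] by simp
    show ?thesis
    proof (intro equalityI subsetI)
      fix y assume "y \<in> p ` ad N v"
      then obtain n a where na: "n \<in> N" "a \<in> carrier A" "y = p (n \<oplus>\<^bsub>M\<^esub> ract M v a)" by (auto simp: adj_def)
      thus "y \<in> ad (p ` N) (p v)" using e[OF na(1,2)] by (auto simp: adj_def)
    next
      fix y assume "y \<in> ad (p ` N) (p v)"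
      then obtain n a where "n \<in> N" "a \<in> carrier A" "y = p n \<oplus>\<^bsub>M\<^esub> ract M (p v) a" by (auto simp: adj_def)
      hence "y = p (n \<oplus>\<^bsub>M\<^esub> ract M v a)" "n \<oplus>\<^bsub>M\<^esub> ract M v a \<in> ad N v" using e by (auto simp: adj_def)
      thus "y \<in> p ` ad N v" by (rule image_eqI)
    qed
  qed
  moreover have "rf A M js (p ` ad N v) (p ` T)"
    by (rule Cons.IH[OF N1]) (use pN ad_base[OF N cD(5)] in auto)
  ultimately show ?case by (auto intro: rf.Cons)
qed

text \<open>Homogeneous linear functionals of degree \<^term>\<open>- r\<close> on a submodule.\<close>

definition fnl :: "int \<Rightarrow> 'm set \<Rightarrow> ('m \<Rightarrow> 'a) \<Rightarrow> bool" where
  "fnl r T g \<longleftrightarrow> (\<forall>x\<in>T. g x \<in> carrier A) \<and> (\<forall>x\<in>T. \<forall>y\<in>T. g (x \<oplus>\<^bsub>M\<^esub> y) = g x \<oplus> g y) \<and>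
     (\<forall>x\<in>T. \<forall>a\<in>carrier A. g (ract M x a) = g x \<otimes> a) \<and> (\<forall>i. \<forall>x\<in>T \<inter> mgr M i. g x \<in> agr A (i - r))"

text \<open>The value g n + k a at n + v a is well defined: if v a lies in \<open>N\<close>, then v
  a = 0 and e a = 0, whence k a = k e a = 0. Functionals ignore the differential, so
  \<open>k\<close> is restricted only by its degree and by k e = k.\<close>

lemma fnl_extend:
  assumes N: "sub N" and c: "cell A M j e v N" and g: "fnl r N g"
    and k: "k \<in> agr A (j - r)" "k \<otimes> e = k"
  shows "\<exists>g'. fnl r (ad N v) g' \<and> (\<forall>x\<in>N. g' x = g x) \<and> g' v = k"
proof -
  note cD = cellD[OF c]
  have kc: "k \<in> carrier A" using k agr_carrier by auto
  have ec: "e \<in> carrier A" using prim_carrier cD by auto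
  have gD: "\<And>x. x \<in> N ==> g x \<in> carrier A" "\<And>x y. [|x \<in> N; y \<in> N|] ==> g (x \<oplus>\<^bsub>M\<^esub> y) = g x \<oplus> g y"
    "\<And>x a. [|x \<in> N; a \<in> carrier A|] ==> g (ract M x a) = g x \<otimes> a" "\<And>x i. [|x \<in> N; x \<in> mgr M i|] ==> g x \<in> agr A (i - r)"
    using g by (auto simp: fnl_def)
  note NC = sub_carrier[OF N]
  define g' where "g' x = (SOME y. \<exists>n a. n \<in> N \<and> a \<in> carrier A \<and> x = n \<oplus>\<^bsub>M\<^esub> ract M v a \<and> y = g n \<oplus> k \<otimes> a)" for x
  have g': "g' (n \<oplus>\<^bsub>M\<^esub> ract M v a) = g n \<oplus> k \<otimes> a" if n: "n \<in> N" and a: "a \<in> carrier A" for n a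
  proof -
    have "\<exists>n' a'. n' \<in> N \<and> a' \<in> carrier A \<and> n \<oplus>\<^bsub>M\<^esub> ract M v a = n' \<oplus>\<^bsub>M\<^esub> ract M v a' \<and>
        g' (n \<oplus>\<^bsub>M\<^esub> ract M v a) = g n' \<oplus> k \<otimes> a'"
      unfolding g'_def by (rule someI_ex) (use n a in blast)
    then obtain n' a' where *: "n' \<in> N" "a' \<in> carrier A" "n \<oplus>\<^bsub>M\<^esub> ract M v a = n' \<oplus>\<^bsub>M\<^esub> ract M v a'"
      "g' (n \<oplus>\<^bsub>M\<^esub> ract M v a) = g n' \<oplus> k \<otimes> a'" by blast
    have cc: "n \<in> carrier M" "n' \<in> carrier M" "ract M v a \<in> carrier M" "ract M v a' \<in> carrier M"
      using n * NC a cD(5) ract_closed by auto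
    have "ract M v (a \<ominus> a') = ract M v a \<ominus>\<^bsub>M\<^esub> ract M v a'" using a *(2) cD(5) by (simp add: ract_diff_r)
    also have "\<dots> = n' \<ominus>\<^bsub>M\<^esub> n"
    proof -
      have "ract M v a = (n \<oplus>\<^bsub>M\<^esub> ract M v a) \<ominus>\<^bsub>M\<^esub> n" using add_cancel cc by simp
      also have "\<dots> = (n' \<oplus>\<^bsub>M\<^esub> ract M v a') \<ominus>\<^bsub>M\<^esub> n" using *(3) by simp
      also have "\<dots> = (n' \<ominus>\<^bsub>M\<^esub> n) \<oplus>\<^bsub>M\<^esub> ract M v a'" using cc by (simp add: a_minus_def M.a_ac)
      finally show ?thesis using cc by (simp add: M.diff_eqI M.a_comm)
    qed
    finally have vd: "ract M v (a \<ominus> a') = n' \<ominus>\<^bsub>M\<^esub> n" .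
    hence in_N: "ract M v (a \<ominus> a') \<in> N" using sub_diff[OF N *(1) n] by simp
    have ad: "a \<ominus> a' \<in> carrier A" using a * by simp
    have e0: "e \<otimes> (a \<ominus> a') = \<zero>" using cD(6)[OF ad in_N] .
    have "n' \<ominus>\<^bsub>M\<^esub> n = (zero M)" using vd cD(7)[OF ad in_N] by simp
    hence nn: "n' = n" using diff_zero_eq cc by blast
    have "k \<otimes> (a \<ominus> a') = (k \<otimes> e) \<otimes> (a \<ominus> a')" using k by simp
    also have "\<dots> = \<zero>" using e0 kc ec ad by (simp add: A.m_assoc)
    finally have "k \<otimes> a \<ominus> k \<otimes> a' = \<zero>" using kc a *(2) by (simp add: a_minus_def A.r_distr A.r_minus)
    hence "k \<otimes> a = k \<otimes> a'" using kc a *(2) by (simp add: A.diff_zero_imp_eq)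
    thus ?thesis using *(4) nn by simp
  qed
  have "fnl r (ad N v) g'"
    unfolding fnl_def
  proof (intro conjI ballI allI)
    fix x assume "x \<in> ad N v"
    then obtain n a where x: "n \<in> N" "a \<in> carrier A" "x = n \<oplus>\<^bsub>M\<^esub> ract M v a" by (rule adE)
    note nc = NC[OF x(1)]
    show "g' x \<in> carrier A" using x g' gD(1) kc by simp
    show "g' (x \<oplus>\<^bsub>M\<^esub> y) = g' x \<oplus> g' y" if "y \<in> ad N v" for y
    proof -
      from that obtain m b where y: "m \<in> N" "b \<in> carrier A" "y = m \<oplus>\<^bsub>M\<^esub> ract M v b" by (rule adE)
      have "x \<oplus>\<^bsub>M\<^esub> y = (n \<oplus>\<^bsub>M\<^esub> m) \<oplus>\<^bsub>M\<^esub> ract M v (a \<oplus> b)"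
        using x y nc NC[OF y(1)] cD(5) by (simp add: ract_r_distr ract_closed M.a_ac)
      thus ?thesis using x y g' gD(1,2) kc sub_add[OF N] by (simp add: A.r_distr A.a_ac)
    qed
    show "g' (ract M x b) = g' x \<otimes> b" if b: "b \<in> carrier A" for b
    proof -
      have "ract M x b = ract M n b \<oplus>\<^bsub>M\<^esub> ract M v (a \<otimes> b)"
        using x b nc cD(5) by (simp add: ract_l_distr ract_closed ract_assoc)
      thus ?thesis using x b g' gD(1,3) kc sub_ract[OF N] by (simp add: A.l_distr A.m_assoc)
    qed
  next
    fix i x assume "x \<in> ad N v \<inter> mgr M i"
    then obtain n a where na: "n \<in> N" "n \<in> mgr M i" "a \<in> agr A (i - j)" "x = n \<oplus>\<^bsub>M\<^esub> ract M v a"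
      using ad_deg[OF N cD(1), of x i] by blast
    have "k \<otimes> a \<in> agr A (i - r)" using agr_mult[OF k(1) na(3)] by simp
    thus "g' x \<in> agr A (i - r)"
      using na g' agr_carrier[OF na(3)] gD(4)[OF na(1,2)] dg_module.mgr_add[OF reg, unfolded reg_simps] by simp
  qed
  moreover have "g' x = g x" if "x \<in> N" for x
    using g'[OF that, of \<zero>] that NC gD(1) kc cD(5) by (simp add: ract_zero_r)
  moreover have "g' v = k"
  proof -
    have "g (zero M) \<oplus> g (zero M) = g (zero M)" using gD(2)[OF sub_zero[OF N] sub_zero[OF N]] by simp
    hence "g (zero M) = \<zero>" by (rule A.idem_zero[OF gD(1)[OF sub_zero[OF N]]])
    thus ?thesis using g'[OF sub_zero[OF N], of \<one>] cD(5) kc by (simp add: ract_one)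
  qed
  ultimately show ?thesis by blast
qed

text \<open>Every further generator is sent to zero.\<close>

lemma fnl_extend_rf:
  assumes "rf A M js N T" "sub N" "fnl r N g"
  shows "\<exists>g'. fnl r T g' \<and> (\<forall>x\<in>N. g' x = g x)"
  using assms
proof (induction arbitrary: g rule: rf.induct)
  case (Nil N)
  thus ?case by blast
next
  case (Cons j e v N js T)
  note cD = cellD[OF Cons.hyps(1)]
  have "\<exists>g'. fnl r (ad N v) g' \<and> (\<forall>x\<in>N. g' x = g x) \<and> g' v = \<zero>"
    by (rule fnl_extend[OF Cons.prems(1) Cons.hyps(1) Cons.prems(2) agr_zero]) (use prim_carrier cD in simp)
  then obtain g1 where g1: "fnl r (ad N v) g1" "\<forall>x\<in>N. g1 x = g x" by blast
  obtain g' where "fnl r T g'" "\<forall>x\<in>ad N v. g' x = g1 x"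
    using Cons.IH[OF cell_sub[OF Cons.prems(1) Cons.hyps(1)] g1(1)] by blast
  thus ?case using g1(2) ad_base[OF Cons.prems(1) cD(5)] by auto
qed

lemma homotopy_hom:
  assumes h: "dg_homotopy A M M h"
  shows "(\<lambda>z\<in>carrier M. z \<ominus>\<^bsub>M\<^esub> (mdiff M (h z) \<oplus>\<^bsub>M\<^esub> h (mdiff M z))) \<in> dg_hom A M M"
proof -
  note hD = dg_homotopyD[OF h]
  let ?s = "\<lambda>z. mdiff M (h z) \<oplus>\<^bsub>M\<^esub> h (mdiff M z)"
  have sc: "?s z \<in> carrier M" if "z \<in> carrier M" for z using that by (simp add: hD(1) mdiff_closed)
  have sa: "?s (z \<oplus>\<^bsub>M\<^esub> w) = ?s z \<oplus>\<^bsub>M\<^esub> ?s w" if "z \<in> carrier M" "w \<in> carrier M" for z w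
    using that by (simp add: hD(1,2) mdiff_closed mdiff_add M.a_ac)
  have h0: "h (zero M) = (zero M)" by (rule addmap_zero[OF M.abelian_group_axioms M.abelian_group_axioms hD(5)])
  have hm: "h (\<ominus>\<^bsub>M\<^esub> x) = \<ominus>\<^bsub>M\<^esub> h x" if "x \<in> carrier M" for x
    by (rule addmap_minus[OF M.abelian_group_axioms M.abelian_group_axioms hD(5) that])
  have sr: "?s (ract M z a) = ract M (?s z) a" if z: "z \<in> carrier M" and a: "a \<in> carrier A" for z a
    using z
  proof (induction z rule: homog_induct)
    case zero
    thus ?case using a by (simp add: ract_zero_l h0 mdiff_zero)
  next
    case (hom i z)
    have zc: "z \<in> carrier M" using hom mgr_carrier by auto
    have da: "adiff A a \<in> carrier A" using adiff_closed[OF a] .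
    \<comment> \<open>The Leibniz terms of dh and hd carry the signs (-1)^(i-1) and (-1)^i and
      cancel in the sum, which makes dh + hd linear.\<close>
    have 1: "mdiff M (h (ract M z a)) = ract M (mdiff M (h z)) a \<oplus>\<^bsub>M\<^esub> sign M (i - 1) (ract M (h z) (adiff A a))"
      using mdiff_ract[OF hD(4)[OF hom] a] hD(3)[OF zc a] by simp
    have 2: "h (mdiff M (ract M z a)) = ract M (h (mdiff M z)) a \<oplus>\<^bsub>M\<^esub> sign M i (ract M (h z) (adiff A a))"
      using mdiff_ract[OF hom a] zc a da hD(2,3) hm by (simp add: sign_def mdiff_closed ract_closed)
    show ?case unfolding 1 2 using zc a da
      by (auto simp: sign_def ract_l_distr hD(1) mdiff_closed ract_closed M.a_ac M.r_neg M.r_neg1 M.r_neg2 M.add_neg_mid)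
  next
    case (add z w)
    have "?s (ract M (z \<oplus>\<^bsub>M\<^esub> w) a) = ?s (ract M z a \<oplus>\<^bsub>M\<^esub> ract M w a)" using add a by (simp add: ract_l_distr)
    also have "\<dots> = ?s (ract M z a) \<oplus>\<^bsub>M\<^esub> ?s (ract M w a)" using add a by (intro sa) (auto simp: ract_closed)
    also have "\<dots> = ract M (?s z \<oplus>\<^bsub>M\<^esub> ?s w) a" using add a sc by (simp add: ract_l_distr)
    also have "\<dots> = ract M (?s (z \<oplus>\<^bsub>M\<^esub> w)) a" using add sa by simp
    finally show ?case .
  qed
  show ?thesis
  proof (rule dg_homI)
    fix x i assume x: "x \<in> mgr M i"
    have "mdiff M (h x) \<in> mgr M i" using mdiff_mgr[OF hD(4)[OF x]] by simp
    moreover have "h (mdiff M x) \<in> mgr M i" using hD(4)[OF mdiff_mgr[OF x]] by simp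
    ultimately show "(\<lambda>z\<in>carrier M. z \<ominus>\<^bsub>M\<^esub> ?s z) x \<in> mgr M i"
      using x mgr_carrier[OF x] by (simp add: mgr_diff mgr_add)
  next
    fix x y assume xy: "x \<in> carrier M" "y \<in> carrier M"
    have "x \<oplus>\<^bsub>M\<^esub> y \<ominus>\<^bsub>M\<^esub> ?s (x \<oplus>\<^bsub>M\<^esub> y) = (x \<ominus>\<^bsub>M\<^esub> ?s x) \<oplus>\<^bsub>M\<^esub> (y \<ominus>\<^bsub>M\<^esub> ?s y)"
      unfolding sa[OF xy] using xy sc by (intro M.add_diff_add) auto
    thus "(\<lambda>z\<in>carrier M. z \<ominus>\<^bsub>M\<^esub> ?s z) (x \<oplus>\<^bsub>M\<^esub> y) = (\<lambda>z\<in>carrier M. z \<ominus>\<^bsub>M\<^esub> ?s z) x \<oplus>\<^bsub>M\<^esub> (\<lambda>z\<in>carrier M. z \<ominus>\<^bsub>M\<^esub> ?s z) y"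
      using xy by simp
  next
    fix x a assume xa: "x \<in> carrier M" "a \<in> carrier A"
    show "(\<lambda>z\<in>carrier M. z \<ominus>\<^bsub>M\<^esub> ?s z) (ract M x a) = ract M ((\<lambda>z\<in>carrier M. z \<ominus>\<^bsub>M\<^esub> ?s z) x) a"
      using xa sr[OF xa] sc[OF xa(1)] ract_closed[OF xa] by (simp add: ract_diff_l)
  next
    fix x assume x: "x \<in> carrier M"
    have "?s (mdiff M x) = mdiff M (?s x)"
      using x by (simp add: mdiff_mdiff h0 mdiff_add hD(1) mdiff_closed)
    thus "(\<lambda>z\<in>carrier M. z \<ominus>\<^bsub>M\<^esub> ?s z) (mdiff M x) = mdiff M ((\<lambda>z\<in>carrier M. z \<ominus>\<^bsub>M\<^esub> ?s z) x)"
      using x sc[OF x] by (simp add: mdiff_closed mdiff_diff)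
  qed (use sc in auto)
qed

end

context pdga
begin

section \<open>Bijective morphisms and the dg modules eA\<close>

lemma hom_bij_inverse:
  assumes M: "dg_module A M" and N: "dg_module A N" and f: "f \<in> dg_hom A M N"
    and b: "bij_betw f (carrier M) (carrier N)"
  shows "restrict (inv_into (carrier M) f) (carrier N) \<in> dg_hom A N M"
proof -
  interpret M: dg_module A M by fact
  interpret N: dg_module A N by fact
  note fD = dg_homD[OF f]
  let ?g = "inv_into (carrier M) f"
  have im: "carrier N = f ` carrier M" and inj: "inj_on f (carrier M)" using b by (auto simp: bij_betw_def)
  have gf: "?g (f x) = x" if "x \<in> carrier M" for x using inj that by simp
  show ?thesis
  proof (rule dg_homI)
    fix y i assume y: "y \<in> mgr N i"
    hence yc: "y \<in> carrier N" using N.mgr_carrier by auto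
    then obtain x where x: "x \<in> carrier M" "y = f x" using im by auto
    \<comment> \<open>Morphisms commute with homogeneous components, so an injective one reflects
      degrees.\<close>
    have "f (hc M i x) = f x" using dg_hom_hc[OF M N f x(1), of i] N.hc_hom[OF y, of i] x(2) by simp
    hence "hc M i x = x" using inj_onD[OF inj] M.hc_closed x(1) by blast
    thus "restrict ?g (carrier N) y \<in> mgr M i" using M.hc_mgr[OF x(1), of i] x yc gf by simp
  next
    fix y assume "y \<in> carrier N"
    then obtain x where x: "x \<in> carrier M" "y = f x" using im by auto
    show "restrict ?g (carrier N) y \<in> carrier M" using x gf fD(1) by simp
    show "restrict ?g (carrier N) (mdiff N y) = mdiff M (restrict ?g (carrier N) y)"
      using x gf fD(1,5) M.mdiff_closed N.mdiff_closed by (simp flip: fD(5))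
    show "restrict ?g (carrier N) (ract N y a) = ract M (restrict ?g (carrier N) y) a" if "a \<in> carrier A" for a
      using x gf fD(1,3) M.ract_closed N.ract_closed that by (simp flip: fD(3))
    show "restrict ?g (carrier N) (y \<oplus>\<^bsub>N\<^esub> y') = restrict ?g (carrier N) y \<oplus>\<^bsub>M\<^esub> restrict ?g (carrier N) y'"
      if "y' \<in> carrier N" for y'
    proof -
      obtain x' where x': "x' \<in> carrier M" "y' = f x'" using im \<open>y' \<in> carrier N\<close> by auto
      show ?thesis using x x' gf fD(1) by (simp flip: fD(2))
    qed
  qed simp
qed

lemma hom_bij_dominated:
  assumes M: "dg_module A M" and N: "dg_module A N" and f: "f \<in> dg_hom A M N"
    and b: "bij_betw f (carrier M) (carrier N)"
  shows "dominated A N M"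
proof -
  let ?g = "restrict (inv_into (carrier M) f) (carrier N)"
  have e: "f (?g x) = x" if "x \<in> carrier N" for x using b that by (simp add: bij_betw_inv_into_right)
  have "htp A N N (\<lambda>x. x) (\<lambda>x. x)" by (rule htp_refl[OF N N]) simp
  hence "htp A N N (\<lambda>x. f (?g x)) (\<lambda>x. x)"
    using htp_cong[of N "\<lambda>x. f (?g x)" "\<lambda>x. x" "\<lambda>x. x" "\<lambda>x. x" A N] e by simp
  thus ?thesis using dominatedI[OF hom_bij_inverse[OF M N f b] f] by blast
qed

lemma dominated_refl: "dg_module A M ==> dominated A M M"
  by (rule hom_bij_dominated[OF _ _ hom_id_hom]) (auto simp: bij_betw_def inj_on_def hom_id_def)

definition eA :: "'a \<Rightarrow> ('a, 'a) dgmodule" where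
  "eA e = rst (regular_dgmodule A) ((\<otimes>) e ` carrier A)"

definition ideal_e :: "'a \<Rightarrow> 'a set" where "ideal_e e = (\<otimes>) e ` carrier A"

lemma eA_simps [simp]:
  "carrier (eA e) = ideal_e e" "zero (eA e) = \<zero>" "add (eA e) = (\<oplus>)" "ract (eA e) = (\<otimes>)"
  "mgr (eA e) = (\<lambda>i. ideal_e e \<inter> agr A i)" "mdiff (eA e) = adiff A"
  by (simp_all add: eA_def reg_simps ideal_e_def)

lemma ideal_eI: "[|prim A e; b \<in> carrier A; e \<otimes> b = b|] ==> b \<in> ideal_e e"
  unfolding ideal_e_def by (metis image_eqI)

lemma ideal_eD: "[|prim A e; b \<in> ideal_e e|] ==> b \<in> carrier A \<and> e \<otimes> b = b"
  unfolding ideal_e_def using prim_carrier[of e] prim_idem[of e] by (auto simp flip: A.m_assoc)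

lemma adiff_mult0: "[|e \<in> agr A 0; a \<in> carrier A|] ==> adiff A (e \<otimes> a) = e \<otimes> adiff A a"
  using dg_module.mdiff_ract[OF reg, unfolded reg_simps, of e 0 a] adiff0[of e] agr_carrier[of e 0] adiff_closed[of a]
  by (simp add: sign_def)

lemma eA_dg_module:
  assumes e: "prim A e" shows "dg_module A (eA e)"
proof -
  interpret R: pdgm A "regular_dgmodule A" by (rule pdgmI[OF reg])
  have ec: "e \<in> carrier A" and e0: "e \<in> agr A 0" using e prim_carrier prim_deg by auto
  have "dsub A (regular_dgmodule A) ((\<otimes>) e ` carrier A)"
    unfolding dsub_def reg_simps
  proof (intro conjI ballI allI)
    show "(\<otimes>) e ` carrier A \<subseteq> carrier A" using ec by auto
    show "\<zero> \<in> (\<otimes>) e ` carrier A" using ec by (intro image_eqI[of _ _ \<zero>]) auto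
    fix x assume "x \<in> (\<otimes>) e ` carrier A"
    then obtain a where a: "a \<in> carrier A" "x = e \<otimes> a" by auto
    show "x \<oplus> y \<in> (\<otimes>) e ` carrier A" if "y \<in> (\<otimes>) e ` carrier A" for y
    proof -
      obtain b where b: "b \<in> carrier A" "y = e \<otimes> b" using \<open>y \<in> (\<otimes>) e ` carrier A\<close> by auto
      show ?thesis using a b ec by (intro image_eqI[of _ _ "a \<oplus> b"]) (auto simp: A.r_distr)
    qed
    show "x \<otimes> b \<in> (\<otimes>) e ` carrier A" if "b \<in> carrier A" for b
      using a ec that by (intro image_eqI[of _ _ "a \<otimes> b"]) (auto simp: A.m_assoc)
    show "adiff A x \<in> (\<otimes>) e ` carrier A"
      using a e0 adiff_mult0 adiff_closed by (intro image_eqI[of _ _ "adiff A a"]) auto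
    show "hc (regular_dgmodule A) i x \<in> (\<otimes>) e ` carrier A" for i
    proof -
      have "hc (regular_dgmodule A) (i + 0) (ract (regular_dgmodule A) e a) =
          ract (regular_dgmodule A) e (hc (regular_dgmodule A) i a)"
        by (rule R.hc_ract) (use e0 a in \<open>simp_all add: reg_simps\<close>)
      thus ?thesis using a R.hcA_closed[OF a(1), of i] by (simp add: reg_simps)
    qed
  qed
  thus ?thesis unfolding eA_def by (rule R.rst_dg_module)
qed

lemma inl_hom:
  assumes M: "dg_module A M" and N: "dg_module A N" and f: "f \<in> dg_hom A M N"
  shows "(\<lambda>x\<in>carrier N. (x, (zero M))) \<in> dg_hom A N (cone M N f)"
proof -
  interpret M: dg_module A M by fact
  interpret N: dg_module A N by fact
  have f0: "f (zero M) = (zero N)"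
    by (rule addmap_zero[OF M.M.abelian_group_axioms N.M.abelian_group_axioms dg_homD(7)[OF f]])
  have m0: "\<ominus>\<^bsub>M\<^esub> (zero M) = (zero M)" using M.M.minus_equality[of "zero M" "zero M"] by simp
  show ?thesis
    by (rule dg_homI) (simp_all add: N.ract_closed N.mdiff_closed N.mgr_carrier M.mgr_zero M.ract_zero_l M.mdiff_zero f0 m0)
qed

text \<open>The minimal model of the cone of a map \<open>s\<close> out of a shift of \<open>e A\<close>. The new cell \<open>t\<close> has
  degree \<open>q\<close> and boundary \<open>s e\<close>. If \<open>s e\<close> only involves cells of degree at most \<open>q\<close>, then \<open>t\<close> can be
  inserted into the filtration; otherwise \<open>s e\<close> may be exchanged for a cell of degree \<open>q + 1\<close>, and
  this cell together with \<open>t\<close> spans a contractible summand.\<close>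

lemma attach_cell:
  fixes X :: "('a, 'm) dgmodule"
  assumes X: "filt A X" and e: "prim A e" and s: "s \<in> dg_hom A (shift (- q - 1) (eA e)) X"
  shows "\<exists>F :: ('a, 'm \<times> 'a) dgmodule. filt A F \<and> dominated A (cone (shift (- q - 1) (eA e)) X s) F \<and>
    carrier F \<subseteq> carrier X \<times> ideal_e e"
proof -
  let ?P = "shift (- q - 1) (eA e)"
  let ?D = "cone ?P X s"
  have Xd: "dg_module A X" using X by (simp add: filt_def)
  have Ed: "dg_module A (eA e)" by (rule eA_dg_module[OF e])
  have Pd: "dg_module A ?P" by (rule shift_dg_module[OF Ed])
  have Dd: "dg_module A ?D" by (rule cone_dg_module[OF Pd Xd s])
  interpret X: pdgm A X by (rule pdgmI[OF Xd])
  interpret D: pdgm A ?D by (rule pdgmI[OF Dd])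
  note sD = dg_homD[OF s]
  have ec: "e \<in> carrier A" and e0: "e \<in> agr A 0" and ee: "e \<otimes> e = e"
    using e prim_carrier prim_deg prim_idem by auto
  have eI: "e \<in> ideal_e e" by (rule ideal_eI[OF e ec ee])
  have zI: "\<zero> \<in> ideal_e e" using ideal_eI[OF e, of \<zero>] ec by simp
  \<comment> \<open>In the shift by \<open>- q - 1\<close> the element \<open>e\<close> has degree
    \<open>q + 1\<close>, and the cone lowers this to \<open>q\<close>. Its boundary
    \<open>u\<close> is \<open>s e\<close>, placed in the first summand.\<close>
  define t where "t = ((zero X), e)"
  define u where "u = (s e, \<zero>)"
  have tg: "t \<in> mgr ?D q" using eI e0 X.mgr_zero by (simp add: t_def)
  have tc: "t \<in> carrier ?D" using tg D.mgr_carrier by blast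
  have ta: "ract ?D t a = ((zero X), e \<otimes> a)" if "a \<in> carrier A" for a using that by (simp add: t_def X.ract_zero_l)
  have te: "ract ?D t e = t" using ta[OF ec] ee by (simp add: t_def)
  have m0: "\<ominus>\<^bsub>eA e\<^esub> \<zero> = \<zero>"
    using abelian_group.minus_equality[of "eA e" \<zero> \<zero>] zI Ed
    by (simp add: dg_module_def right_module_def)
  have dt: "mdiff ?D t = u"
    using adiff0[OF e0] m0 sD(1)[of e] eI
    by (simp add: t_def u_def X.mdiff_zero sign_def)
  let ?i = "\<lambda>x\<in>carrier X. (x, \<zero>)"
  have i: "?i \<in> dg_hom A X ?D" using inl_hom[OF Pd Xd s] by simp
  have inj: "inj_on ?i (carrier X)" by (auto simp: inj_on_def)
  let ?X = "?i ` carrier X"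
  have XI: "(x, \<zero>) \<in> ?X \<longleftrightarrow> x \<in> carrier X" for x by auto
  obtain js where js: "sorted js" "rf A X js {zero X} (carrier X)" using X by (auto simp: filt_def)
  have z: "?i ` {zero X} = {zero ?D}" by simp
  have rX: "rf A ?D js {zero ?D} ?X"
    using rf_map[OF pdgmI[OF Xd] pdgmI[OF Dd] i inj js(2)] pdgm_end.sub_zeroset[of A X "hom_id X"]
      hom_id_hom[OF Xd] pdgmI[OF Xd] z by (simp add: pdgm_end_def pdgm_end_axioms_def)
  have s0: "D.sub {zero ?D}"
    using pdgm_end.sub_zeroset[of A ?D "hom_id ?D"] hom_id_hom[OF Dd] pdgmI[OF Dd]
    by (simp add: pdgm_end_def pdgm_end_axioms_def)
  have sX: "D.sub ?X" by (rule D.rf_sub[OF rX s0])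
  have uX: "u \<in> ?X" using sD(1)[of e] eI by (auto simp: u_def)
  have adX: "D.ad ?X t = carrier ?D"
  proof
    show "D.ad ?X t \<subseteq> carrier ?D" by (rule D.ad_least[OF D.sub_UNIV _ tc]) (use D.sub_carrier[OF sX] in blast)
    show "carrier ?D \<subseteq> D.ad ?X t"
    proof
      fix y assume "y \<in> carrier ?D"
      then obtain x b where y: "y = (x, b)" "x \<in> carrier X" "b \<in> ideal_e e" by auto
      have b: "b \<in> carrier A" "e \<otimes> b = b" using ideal_eD[OF e y(3)] by auto
      have "(x, \<zero>) \<in> ?X" using y by simp
      thus "y \<in> D.ad ?X t" by (rule D.adI[OF _ b(1)]) (use y b ta in simp)
    qed
  qed
  have tX: "e \<otimes> a = \<zero>" if "a \<in> carrier A" "ract ?D t a \<in> ?X" for a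
    using that ta by auto
  have tX': "ract ?D t a = (zero ?D)" if "a \<in> carrier A" "ract ?D t a \<in> ?X" for a
    using tX[OF that] ta[OF that(1)] by simp
  \<comment> \<open>The list is cut where the new degree \<open>q\<close> has to be inserted;
    \<open>N\<close> below is the stage reached after the cells of degree at most
    \<open>q\<close>.\<close>
  define js1 where "js1 = takeWhile (\<lambda>j. j \<le> q) js"
  define js2 where "js2 = dropWhile (\<lambda>j. j \<le> q) js"
  have jsd: "js = js1 @ js2" by (simp add: js1_def js2_def)
  have j1: "\<forall>j\<in>set js1. j \<le> q" unfolding js1_def using set_takeWhileD by metis
  have j2: "\<forall>j\<in>set js2. q + 1 \<le> j"
  proof (cases js2)
    case (Cons a l)
    hence "\<not> a \<le> q" unfolding js2_def using hd_dropWhile[of "\<lambda>j. j \<le> q" js] by (metis list.distinct(1) list.sel(1))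
    moreover have "sorted js2" using js(1) jsd sorted_append by metis
    ultimately show ?thesis using Cons by auto
  qed simp
  have srt: "sorted js1" "sorted js2" using js(1) jsd sorted_append by metis+
  obtain N where N: "rf A ?D js1 {zero ?D} N" "rf A ?D js2 N ?X"
    using D.rf_append_split[of js1 js2] rX jsd by blast
  have sN: "D.sub N" by (rule D.rf_sub[OF N(1) s0])
  have NX: "N \<subseteq> ?X" by (rule D.rf_subset[OF N(2) sN])
  show ?thesis
  proof (cases "u \<in> N")
    case True
    have "cell A ?D q e t N"
      unfolding cell_def using tg e te dt True tX NX by auto
    moreover have "rf A ?D js2 (D.ad N t) (D.ad ?X t)" by (rule D.rf_add_cell[OF N(2) sN tc tX'])
    ultimately have "rf A ?D (q # js2) N (carrier ?D)" unfolding adX by (rule rf.Cons)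
    hence "rf A ?D (js1 @ q # js2) {zero ?D} (carrier ?D)" using D.rf_append[OF N(1)] by blast
    moreover have "sorted (js1 @ q # js2)" using srt j1 j2 by (auto simp: sorted_append) fastforce+
    ultimately have "filt A ?D" using Dd unfolding filt_def by blast
    moreover have "carrier ?D = carrier X \<times> ideal_e e" by simp
    ultimately show ?thesis using dominated_refl[OF Dd] by blast
  next
    case False
    have ug: "u \<in> mgr ?D (q + 1)" using D.mdiff_mgr[OF tg] dt by simp
    have uc: "u \<in> carrier ?D" using ug D.mgr_carrier by blast
    have ue: "ract ?D u e = u" using D.mdiff_ract0[OF tg e0] te dt by simp
    have du: "mdiff ?D u = (zero ?D)" using D.mdiff_mdiff[OF tc] dt by simp
    hence duN: "mdiff ?D u \<in> N" using D.sub_zero[OF sN] by simp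
    obtain js' where js': "js2 = (q + 1) # js'" "cell A ?D (q + 1) e u N" "rf A ?D js' (D.ad N u) ?X"
      using D.exchange[OF N(2) sN srt(2) j2 ug uX False e ue duN] by blast
    have sN1: "D.sub (D.ad N u)" by (rule D.cell_sub[OF sN js'(2)])
    \<comment> \<open>A functional \<open>g\<close> that vanishes on \<open>N\<close> and sends
      \<open>u\<close> to \<open>e\<close> will give a homotopy with values in tA that sends
      \<open>u\<close> back to \<open>t\<close>, thus inverting the differential on this
      pair.\<close>
    have zf: "D.fnl (q + 1) N (\<lambda>_. \<zero>)" by (auto simp: D.fnl_def agr_zero)
    have "\<exists>g'. D.fnl (q + 1) (D.ad N u) g' \<and> (\<forall>x\<in>N. g' x = \<zero>) \<and> g' u = e"
      by (rule D.fnl_extend[OF sN js'(2) zf]) (use e0 ee in simp_all)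
    then obtain g1 where g1: "D.fnl (q + 1) (D.ad N u) g1" "\<forall>x\<in>N. g1 x = \<zero>" "g1 u = e" by blast
    obtain g where g: "D.fnl (q + 1) ?X g" "\<forall>x\<in>D.ad N u. g x = g1 x"
      using D.fnl_extend_rf[OF js'(3) sN1 g1(1)] by blast
    have gN: "g x = \<zero>" if "x \<in> N" for x using g(2) g1(2) D.ad_base[OF sN uc that] that by simp
    have gu: "g u = e" using g(2) g1(3) D.ad_self[OF sN uc] by simp
    have gD: "\<And>x. x \<in> ?X ==> g x \<in> carrier A" "\<And>x y. [|x \<in> ?X; y \<in> ?X|] ==> g (x \<oplus>\<^bsub>?D\<^esub> y) = g x \<oplus> g y"
      "\<And>x a. [|x \<in> ?X; a \<in> carrier A|] ==> g (ract ?D x a) = g x \<otimes> a"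
      "\<And>x i. [|x \<in> ?X; x \<in> mgr ?D i|] ==> g x \<in> agr A (i - (q + 1))"
      using g(1) unfolding D.fnl_def by blast+
    define h where "h z = ract ?D t (g (fst z, \<zero>))" for z :: "'m \<times> 'a"
    have fX: "(fst z, \<zero>) \<in> ?X" if "z \<in> carrier ?D" for z using that by auto
    have hc: "h z \<in> carrier ?D" if "z \<in> carrier ?D" for z
      unfolding h_def by (rule D.ract_closed[OF tc gD(1)[OF fX[OF that]]])
    have h: "dg_homotopy A ?D ?D h"
      unfolding dg_homotopy_def
    proof (intro conjI ballI allI)
      show "h \<in> carrier ?D \<rightarrow> carrier ?D" using hc by auto
      fix x assume x: "x \<in> carrier ?D"
      show "h (x \<oplus>\<^bsub>?D\<^esub> y) = h x \<oplus>\<^bsub>?D\<^esub> h y" if y: "y \<in> carrier ?D" for y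
      proof -
        have eq: "(fst (x \<oplus>\<^bsub>?D\<^esub> y), \<zero>) = (fst x, \<zero>) \<oplus>\<^bsub>?D\<^esub> (fst y, \<zero>)" using x y by auto
        show ?thesis unfolding h_def eq gD(2)[OF fX[OF x] fX[OF y]]
          by (rule D.ract_r_distr[OF tc gD(1)[OF fX[OF x]] gD(1)[OF fX[OF y]]])
      qed
      show "h (ract ?D x a) = ract ?D (h x) a" if a: "a \<in> carrier A" for a
      proof -
        have eq: "(fst (ract ?D x a), \<zero>) = ract ?D (fst x, \<zero>) a" using x a by auto
        show ?thesis unfolding h_def eq gD(3)[OF fX[OF x] a]
          by (rule D.ract_assoc[OF tc gD(1)[OF fX[OF x]] a, symmetric])
      qed
    next
      fix j x assume x: "x \<in> mgr ?D j"
      hence xc: "x \<in> carrier ?D" using D.mgr_carrier by blast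
      have "(fst x, \<zero>) \<in> mgr ?D j" using x zI agr_zero by auto
      hence "g (fst x, \<zero>) \<in> agr A (j - (q + 1))" using gD(4) fX[OF xc] by blast
      hence "ract ?D t (g (fst x, \<zero>)) \<in> mgr ?D (q + (j - (q + 1)))" by (rule D.mgr_ract[OF tg])
      thus "h x \<in> mgr ?D (j - 1)" by (simp add: h_def)
    qed
    define r where "r z = mdiff ?D (h z) \<oplus>\<^bsub>?D\<^esub> h (mdiff ?D z)" for z :: "'m \<times> 'a"
    \<comment> \<open>\<open>p\<close> is homotopic to the identity by construction, and it will be
      seen to kill \<open>t\<close> and \<open>u\<close> and to fix \<open>N\<close>. As the image
      of \<open>h\<close> lies in tA, p h = 0, which makes \<open>p\<close> idempotent.\<close>
    define p where "p = (\<lambda>z\<in>carrier ?D. z \<ominus>\<^bsub>?D\<^esub> r z)"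
    have p: "p \<in> dg_hom A ?D ?D" unfolding p_def r_def by (rule D.homotopy_hom[OF h])
    note pD = dg_homD[OF p] and hD = dg_homotopyD[OF h]
    have rc: "r z \<in> carrier ?D" if "z \<in> carrier ?D" for z using that by (simp add: r_def hD(1) D.mdiff_closed del: cone_simps)
    have pz: "p z = z \<ominus>\<^bsub>?D\<^esub> r z" if "z \<in> carrier ?D" for z using that by (simp add: p_def)
    have zr: "z \<ominus>\<^bsub>?D\<^esub> p z = r z" if "z \<in> carrier ?D" for z
      using that rc[OF that] pz[OF that] by (simp add: a_minus_def D.M.minus_add D.M.r_neg2 D.M.r_neg1 del: cone_simps)
    have hN: "h z = (zero ?D)" if "z \<in> N" for z
    proof -
      have "(fst z, \<zero>) = z" using that NX by auto
      thus ?thesis using gN[OF that] by (simp add: h_def D.ract_zero_r[OF tc] del: cone_simps)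
    qed
    have gz: "g (zero ?D) = \<zero>" using gN D.sub_zero[OF sN] by blast
    have ht: "h t = (zero ?D)" using gz by (simp add: h_def t_def D.ract_zero_r[OF tc, unfolded t_def] del: cone_simps(3-))
    have hu: "h u = t" using gu te by (simp add: h_def u_def)
    have pt: "p t = (zero ?D)"
    proof -
      have "r t = t" using tc by (simp add: r_def ht dt hu D.mdiff_zero del: cone_simps)
      thus ?thesis using pz[OF tc] D.diff_self[OF tc] by simp
    qed
    have pu: "p u = (zero ?D)" using pD(5)[OF tc] pt dt D.mdiff_zero by simp
    have pN: "p n = n" if "n \<in> N" for n
    proof -
      have nc: "n \<in> carrier ?D" using D.sub_carrier[OF sN that] .
      have "r n = (zero ?D)" using hN[OF that] hN[OF D.sub_mdiff[OF sN that]] by (simp add: r_def D.mdiff_zero del: cone_simps)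
      thus ?thesis using pz[OF nc] nc by (simp add: a_minus_def del: cone_simps)
    qed
    have ph: "p (h z) = (zero ?D)" if "z \<in> carrier ?D" for z
      unfolding h_def using pD(3)[OF tc gD(1)[OF fX[OF that]]] pt D.ract_zero_l[OF gD(1)[OF fX[OF that]]] by simp
    have pr: "p (r z) = (zero ?D)" if z: "z \<in> carrier ?D" for z
      using pD(2)[OF D.mdiff_closed[OF hc[OF z]] hc[OF D.mdiff_closed[OF z]]] pD(5)[OF hc[OF z]] ph[OF z]
        ph[OF D.mdiff_closed[OF z]] by (simp add: r_def D.mdiff_zero del: cone_simps)
    have pp: "p (p z) = p z" if z: "z \<in> carrier ?D" for z
    proof -
      have "p (z \<ominus>\<^bsub>?D\<^esub> r z) = p z \<ominus>\<^bsub>?D\<^esub> p (r z)"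
        by (rule addmap_diff[OF D.M.abelian_group_axioms D.M.abelian_group_axioms pD(7) z rc[OF z]])
      thus ?thesis using pz[OF z] pr[OF z] pD(1)[OF z] by (simp add: a_minus_def del: cone_simps)
    qed
    let ?N2 = "D.ad (D.ad N u) t"
    have sN2: "D.sub ?N2" by (rule D.sub_ad[OF sN1 tg]) (use dt D.ad_self[OF sN uc] in simp)
    have zN2: "z \<ominus>\<^bsub>?D\<^esub> p z \<in> ?N2" if z: "z \<in> carrier ?D" for z
    proof -
      have "h w \<in> ?N2" if "w \<in> carrier ?D" for w
        unfolding h_def by (rule D.ad_gen[OF sN1 tc gD(1)[OF fX[OF that]]])
      thus ?thesis unfolding zr[OF z] r_def using z D.mdiff_closed D.sub_add[OF sN2] D.sub_mdiff[OF sN2] by blast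
    qed
    \<comment> \<open>Above N + uA + tA the cells of js' remain, and \<open>p\<close> is the
      identity modulo this submodule while mapping it onto \<open>N\<close>. So the image of
      \<open>p\<close> has the cells of js1 and js'; the pair in degrees \<open>q\<close> and
      \<open>q + 1\<close> has cancelled.\<close>
    have "rf A ?D js' ?N2 (D.ad ?X t)" by (rule D.rf_add_cell[OF js'(3) sN1 tc tX'])
    from D.rf_project[OF this sN2 p zN2] have "rf A ?D js' (p ` ?N2) (p ` carrier ?D)" unfolding adX .
    moreover have "p ` ?N2 = N"
    proof
      show "N \<subseteq> p ` ?N2"
      proof
        fix n assume n: "n \<in> N"
        have "n \<in> ?N2" by (rule D.ad_base[OF sN1 tc D.ad_base[OF sN uc n]])
        thus "n \<in> p ` ?N2" using pN[OF n] by (metis imageI)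
      qed
      show "p ` ?N2 \<subseteq> N"
      proof
        fix y assume "y \<in> p ` ?N2"
        then obtain n a b where y: "n \<in> N" "a \<in> carrier A" "b \<in> carrier A"
          "y = p (n \<oplus>\<^bsub>?D\<^esub> ract ?D u a \<oplus>\<^bsub>?D\<^esub> ract ?D t b)" unfolding adj_def by blast
        have c: "n \<in> carrier ?D" "ract ?D u a \<in> carrier ?D" "ract ?D t b \<in> carrier ?D"
          using D.sub_carrier[OF sN y(1)] D.ract_closed[OF uc y(2)] D.ract_closed[OF tc y(3)] by blast+
        have "y = p n \<oplus>\<^bsub>?D\<^esub> p (ract ?D u a) \<oplus>\<^bsub>?D\<^esub> p (ract ?D t b)"
          unfolding y(4) using pD(2)[OF D.M.a_closed[OF c(1,2)] c(3)] pD(2)[OF c(1,2)] by simp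
        also have "\<dots> = n" using pN[OF y(1)] pD(3)[OF uc y(2)] pD(3)[OF tc y(3)] pu pt D.ract_zero_l y c(1)
          by (simp del: cone_simps)
        finally show "y \<in> N" using y(1) by simp
      qed
    qed
    ultimately have "rf A ?D js' N (p ` carrier ?D)" by simp
    hence rp: "rf A ?D (js1 @ js') {zero ?D} (p ` carrier ?D)" using D.rf_append[OF N(1)] by blast
    have "sorted (js1 @ js')" using srt j1 j2 js'(1) by (auto simp: sorted_append) fastforce+
    have spD: "D.sub (p ` carrier ?D)" by (rule D.rf_sub[OF rp s0])
    let ?F = "rst ?D (p ` carrier ?D)"
    have Fd: "dg_module A ?F" by (rule D.rst_dg_module[OF spD])
    have "rf A ?F (js1 @ js') {zero ?D} (p ` carrier ?D)" by (rule rst_rf[OF rp pdgmI[OF Dd] s0 subset_refl])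
    hence F: "filt A ?F" using Fd \<open>sorted (js1 @ js')\<close> unfolding filt_def by (metis rst_simps(1,2))
    have p1: "p \<in> dg_hom A ?D ?F"
      by (rule dg_homI) (use pD D.mgr_carrier in \<open>auto simp del: cone_simps\<close>)
    have p2: "(\<lambda>x\<in>p ` carrier ?D. x) \<in> dg_hom A ?F ?D"
      by (rule dg_homI) (use D.sub_carrier[OF spD] D.sub_add[OF spD] D.sub_ract[OF spD] D.sub_mdiff[OF spD]
          in \<open>auto simp del: cone_simps\<close>)
    have "htp A ?D ?D (\<lambda>x. x) p"
      unfolding htp_def using h zr by (intro exI[of _ h]) (simp add: r_def)
    hence "htp A ?D ?D p (\<lambda>x. x)" by (rule htp_sym[OF Dd Dd, rotated -1]) (use pD(1) in auto)
    hence "htp A ?D ?D (\<lambda>x. (\<lambda>x\<in>p ` carrier ?D. x) (p x)) (\<lambda>x. x)"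
      using htp_cong[of ?D "\<lambda>x. (\<lambda>x\<in>p ` carrier ?D. x) (p x)" p "\<lambda>x. x" "\<lambda>x. x" A ?D] by simp
    hence "dominated A ?D ?F" using dominatedI[OF p1 p2] by blast
    moreover have "carrier ?F \<subseteq> carrier X \<times> ideal_e e" using D.sub_carrier[OF spD] by auto
    ultimately show ?thesis using F by blast
  qed
qed

end

section \<open>The categories of dg modules are preadditive\<close>

definition hcls :: "('k, 'a) dgalgebra \<Rightarrow> ('a, 'm) dgmodule \<Rightarrow> ('a, 'n) dgmodule \<Rightarrow> ('m \<Rightarrow> 'n) \<Rightarrow> ('m \<Rightarrow> 'n) set" where
  "hcls A M N f = homotopy_rel A M N `` {f}"

lemma dgMod_simps [simp]:
  "Obj (dgMod A) = {M. dg_module A M}" "Mor (dgMod A) = dg_hom A"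
  "Comp (dgMod A) X Y Z g f = compose (carrier X) g f" "Ident (dgMod A) = hom_id"
  "Plus (dgMod A) = hom_plus" "Zero (dgMod A) = hom_zero"
  by (simp_all add: dgMod_def)

context pdga
begin

lemma hom_zero_l: "[|dg_module A M; dg_module A N; f \<in> dg_hom A M N|] ==> hom_plus M N (hom_zero M N) f = f"
proof -
  assume a: "dg_module A M" "dg_module A N" "f \<in> dg_hom A M N"
  interpret N: dg_module A N by fact
  show ?thesis using dg_homD(1,6)[OF a(3)]
    by (auto simp: hom_plus_def hom_zero_def fun_eq_iff extensional_def)
qed

lemma hom_plus_assoc:
  assumes "dg_module A M" "dg_module A N" "f \<in> dg_hom A M N" "g \<in> dg_hom A M N" "h \<in> dg_hom A M N"
  shows "hom_plus M N (hom_plus M N f g) h = hom_plus M N f (hom_plus M N g h)"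
    "hom_plus M N f g = hom_plus M N g f"
proof -
  interpret N: dg_module A N by fact
  note D = dg_homD(1)[OF assms(3)] dg_homD(1)[OF assms(4)] dg_homD(1)[OF assms(5)]
  show "hom_plus M N (hom_plus M N f g) h = hom_plus M N f (hom_plus M N g h)"
    "hom_plus M N f g = hom_plus M N g f"
    using D by (auto simp: hom_plus_def fun_eq_iff N.M.a_ac)
qed

lemma hom_plus_minus:
  assumes "dg_module A M" "dg_module A N" "f \<in> dg_hom A M N"
  shows "hom_plus M N (\<lambda>x\<in>carrier M. \<ominus>\<^bsub>N\<^esub> f x) f = hom_zero M N"
proof -
  interpret N: dg_module A N by fact
  show ?thesis using dg_homD(1)[OF assms(3)] by (auto simp: hom_plus_def hom_zero_def fun_eq_iff N.M.l_neg)
qed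

lemma compose_id:
  assumes "f \<in> dg_hom A M N"
  shows "compose (carrier M) (hom_id N) f = f" "compose (carrier M) f (hom_id M) = f"
  using dg_homD(1,6)[OF assms] by (auto simp: compose_def hom_id_def fun_eq_iff extensional_def)

lemma compose_ass:
  assumes "f \<in> dg_hom A X Y" "g \<in> dg_hom A Y Z"
  shows "compose (carrier X) h (compose (carrier X) g f) = compose (carrier X) (compose (carrier Y) h g) f"
  using dg_homD(1)[OF assms(1)] by (auto simp: compose_def fun_eq_iff)

lemma compose_plus_l:
  assumes "f \<in> dg_hom A X Y"
  shows "compose (carrier X) (hom_plus Y Z g g') f = hom_plus X Z (compose (carrier X) g f) (compose (carrier X) g' f)"
  using dg_homD(1)[OF assms(1)] by (auto simp: compose_def hom_plus_def fun_eq_iff)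

lemma compose_plus_r:
  assumes "f \<in> dg_hom A X Y" "f' \<in> dg_hom A X Y" "g \<in> dg_hom A Y Z"
  shows "compose (carrier X) g (hom_plus X Y f f') = hom_plus X Z (compose (carrier X) g f) (compose (carrier X) g f')"
  using dg_homD(1)[OF assms(1)] dg_homD(1)[OF assms(2)] dg_homD(2)[OF assms(3)]
  by (auto simp: compose_def hom_plus_def fun_eq_iff)

lemma dgMod_preadd: "preadd (dgMod A :: (('a, 'm) dgmodule, _) precat)"
proof
  show "preadditive (dgMod A :: (('a, 'm) dgmodule, _) precat)"
    unfolding preadditive_def dgMod_simps mem_Collect_eq
  proof (intro conjI ballI)
    fix X Y :: "('a, 'm) dgmodule" assume X: "X \<in> {M. dg_module A M}" and Y: "Y \<in> {M. dg_module A M}"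
    show "comm_group (mor_group (dgMod A) X Y)"
    proof (rule comm_groupI)
      fix f assume f: "f \<in> carrier (mor_group (dgMod A) X Y)"
      thus "\<exists>g\<in>carrier (mor_group (dgMod A) X Y). g \<otimes>\<^bsub>mor_group (dgMod A) X Y\<^esub> f = \<one>\<^bsub>mor_group (dgMod A) X Y\<^esub>"
        using X Y hom_plus_minus[of X Y f] hom_minus_hom[of X Y f] by (auto simp: mor_group_def)
    qed (use X Y in \<open>auto simp: mor_group_def hom_plus_hom hom_zero_hom hom_zero_l hom_plus_assoc(1)
        intro: hom_plus_assoc(2)\<close>)
  qed (auto simp: hom_id_hom compose_id hom_compose compose_plus_l compose_plus_r intro: compose_ass)
qed

lemma hom_fun: "f \<in> dg_hom A M N ==> f \<in> carrier M \<rightarrow> carrier N"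
  using dg_homD(1) by fastforce

lemma hcls_eq:
  assumes "dg_module A M" "dg_module A N" "f \<in> dg_hom A M N" "g \<in> dg_hom A M N"
  shows "hcls A M N f = hcls A M N g \<longleftrightarrow> htp A M N f g"
proof
  assume "hcls A M N f = hcls A M N g"
  moreover have "g \<in> hcls A M N g"
    using assms htp_refl[OF assms(1,2) hom_fun[OF assms(4)]] by (simp add: hcls_def homotopy_rel_iff)
  ultimately show "htp A M N f g" by (auto simp: hcls_def homotopy_rel_iff)
next
  assume h: "htp A M N f g"
  note h' = htp_sym[OF assms(1,2) hom_fun[OF assms(3)] hom_fun[OF assms(4)] h]
  note fg = hom_fun[OF assms(3)] hom_fun[OF assms(4)]
  have "htp A M N f k \<longleftrightarrow> htp A M N g k" if "k \<in> dg_hom A M N" for k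
    using htp_trans[OF assms(1,2) fg hom_fun[OF that] h] htp_trans[OF assms(1,2) fg(2,1) hom_fun[OF that] h'] by blast
  thus "hcls A M N f = hcls A M N g"
    using assms by (auto simp: hcls_def homotopy_rel_iff)
qed

lemma hcls_self: "[|dg_module A M; dg_module A N; f \<in> dg_hom A M N|] ==> f \<in> hcls A M N f"
  using htp_refl[OF _ _ hom_fun] by (simp add: hcls_def homotopy_rel_iff)

lemma hcls_mem: "g \<in> hcls A M N f ==> g \<in> dg_hom A M N \<and> f \<in> dg_hom A M N \<and> htp A M N f g"
  by (simp add: hcls_def homotopy_rel_iff)

text \<open>\<open>Comp\<close> is a union over all pairs of representatives. By
  \<open>htp_postcomp\<close> and \<open>htp_precomp\<close> every pair contributes the same class,
  so the union is that class.\<close>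

lemma hcls_comp:
  assumes d: "dg_module A X" "dg_module A Y" "dg_module A Z" and f: "f \<in> dg_hom A X Y" and g: "g \<in> dg_hom A Y Z"
  shows "Comp (dgHot A) X Y Z (hcls A Y Z g) (hcls A X Y f) = hcls A X Z (compose (carrier X) g f)"
proof -
  have *: "hcls A X Z (compose (carrier X) g' f') = hcls A X Z (compose (carrier X) g f)"
    if "g' \<in> hcls A Y Z g" "f' \<in> hcls A X Y f" for g' f'
  proof -
    have m: "g' \<in> dg_hom A Y Z" "f' \<in> dg_hom A X Y" "htp A Y Z g g'" "htp A X Y f f'"
      using hcls_mem[OF that(1)] hcls_mem[OF that(2)] by auto
    have "htp A X Z (\<lambda>x. g (f x)) (\<lambda>x. g (f' x))"
      by (rule htp_postcomp[OF d hom_fun[OF f] hom_fun[OF m(2)] m(4) g])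
    moreover have "htp A X Z (\<lambda>x. g (f' x)) (\<lambda>x. g' (f' x))" by (rule htp_precomp[OF d(1) m(2,3)])
    ultimately have "htp A X Z (\<lambda>x. g (f x)) (\<lambda>x. g' (f' x))"
      by (rule htp_trans[OF d(1,3), rotated -2]) (use dg_homD(1)[OF f] dg_homD(1)[OF g] dg_homD(1)[OF m(1)] dg_homD(1)[OF m(2)] in auto)
    hence "htp A X Z (compose (carrier X) g f) (compose (carrier X) g' f')"
      using htp_cong[of X "compose (carrier X) g f" "\<lambda>x. g (f x)" "compose (carrier X) g' f'" "\<lambda>x. g' (f' x)" A Z]
      by (simp add: compose_def)
    thus ?thesis using hcls_eq[OF d(1,3) hom_compose[OF d(1) f g] hom_compose[OF d(1) m(2,1)]] by simp
  qed
  have "Comp (dgHot A) X Y Z (hcls A Y Z g) (hcls A X Y f) =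
      (\<Union>g'\<in>hcls A Y Z g. \<Union>f'\<in>hcls A X Y f. hcls A X Z (compose (carrier X) g' f'))"
    by (simp add: dgHot_def hcls_def)
  also have "\<dots> = (\<Union>g'\<in>hcls A Y Z g. \<Union>f'\<in>hcls A X Y f. hcls A X Z (compose (carrier X) g f))"
    using * by (intro SUP_cong) auto
  also have "\<dots> = hcls A X Z (compose (carrier X) g f)"
    using hcls_self[OF d(2,3) g] hcls_self[OF d(1,2) f] by auto
  finally show ?thesis .
qed

lemma hcls_plus:
  assumes d: "dg_module A X" "dg_module A Y" and f: "f \<in> dg_hom A X Y" and g: "g \<in> dg_hom A X Y"
  shows "Plus (dgHot A) X Y (hcls A X Y f) (hcls A X Y g) = hcls A X Y (hom_plus X Y f g)"
proof -
  have *: "hcls A X Y (hom_plus X Y f' g') = hcls A X Y (hom_plus X Y f g)"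
    if "f' \<in> hcls A X Y f" "g' \<in> hcls A X Y g" for g' f'
  proof -
    have m: "f' \<in> dg_hom A X Y" "g' \<in> dg_hom A X Y" "htp A X Y f f'" "htp A X Y g g'"
      using hcls_mem[OF that(1)] hcls_mem[OF that(2)] by auto
    have "htp A X Y (\<lambda>x. f x \<oplus>\<^bsub>Y\<^esub> g x) (\<lambda>x. f' x \<oplus>\<^bsub>Y\<^esub> g' x)"
      by (rule htp_plus[OF d hom_fun[OF f] hom_fun[OF m(1)] hom_fun[OF g] hom_fun[OF m(2)] m(3,4)])
    hence "htp A X Y (hom_plus X Y f g) (hom_plus X Y f' g')"
      using htp_cong[of X "hom_plus X Y f g" "\<lambda>x. f x \<oplus>\<^bsub>Y\<^esub> g x" "hom_plus X Y f' g'" "\<lambda>x. f' x \<oplus>\<^bsub>Y\<^esub> g' x" A Y]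
      by (simp add: hom_plus_def)
    thus ?thesis using hcls_eq[OF d hom_plus_hom[OF d f g] hom_plus_hom[OF d m(1,2)]] by simp
  qed
  have "Plus (dgHot A) X Y (hcls A X Y f) (hcls A X Y g) =
      (\<Union>f'\<in>hcls A X Y f. \<Union>g'\<in>hcls A X Y g. hcls A X Y (hom_plus X Y f' g'))"
    by (simp add: dgHot_def hcls_def)
  also have "\<dots> = (\<Union>f'\<in>hcls A X Y f. \<Union>g'\<in>hcls A X Y g. hcls A X Y (hom_plus X Y f g))"
    using * by (intro SUP_cong) auto
  also have "\<dots> = hcls A X Y (hom_plus X Y f g)"
    using hcls_self[OF d g] hcls_self[OF d f] by auto
  finally show ?thesis .
qed

lemma dgHot_simps:
  "Obj (dgHot A) = {M. dg_module A M}" "Mor (dgHot A) X Y = hcls A X Y ` dg_hom A X Y"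
  "Ident (dgHot A) X = hcls A X X (hom_id X)" "Zero (dgHot A) X Y = hcls A X Y (hom_zero X Y)"
  by (auto simp: dgHot_def hcls_def quotient_def)

lemma dgHot_preadd: "preadd (dgHot A :: (('a, 'm) dgmodule, _) precat)"
proof
  show "preadditive (dgHot A :: (('a, 'm) dgmodule, _) precat)"
    unfolding preadditive_def dgHot_simps(1)
  proof (intro conjI ballI)
    fix X Y :: "('a, 'm) dgmodule" assume X: "X \<in> {M. dg_module A M}" and Y: "Y \<in> {M. dg_module A M}"
    hence XY: "dg_module A X" "dg_module A Y" by auto
    show "comm_group (mor_group (dgHot A) X Y)"
    proof (rule comm_groupI)
      fix F assume "F \<in> carrier (mor_group (dgHot A) X Y)"
      then obtain f where f: "f \<in> dg_hom A X Y" "F = hcls A X Y f" by (auto simp: mor_group_def dgHot_simps)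
      show "\<exists>g\<in>carrier (mor_group (dgHot A) X Y). g \<otimes>\<^bsub>mor_group (dgHot A) X Y\<^esub> F = \<one>\<^bsub>mor_group (dgHot A) X Y\<^esub>"
        using XY f hom_plus_minus[OF XY f(1)] hom_minus_hom[OF XY f(1)] hcls_plus[OF XY hom_minus_hom[OF XY f(1)] f(1)]
        by (intro bexI[of _ "hcls A X Y (\<lambda>x\<in>carrier X. \<ominus>\<^bsub>Y\<^esub> f x)"]) (auto simp: mor_group_def dgHot_simps)
      show "\<one>\<^bsub>mor_group (dgHot A) X Y\<^esub> \<otimes>\<^bsub>mor_group (dgHot A) X Y\<^esub> F = F"
        using XY f by (simp add: mor_group_def dgHot_simps hcls_plus hom_zero_hom hom_zero_l)
      fix G assume "G \<in> carrier (mor_group (dgHot A) X Y)"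
      then obtain g where g: "g \<in> dg_hom A X Y" "G = hcls A X Y g" by (auto simp: mor_group_def dgHot_simps)
      show "F \<otimes>\<^bsub>mor_group (dgHot A) X Y\<^esub> G \<in> carrier (mor_group (dgHot A) X Y)"
        using XY f g by (simp add: mor_group_def dgHot_simps hcls_plus hom_plus_hom)
      show "F \<otimes>\<^bsub>mor_group (dgHot A) X Y\<^esub> G = G \<otimes>\<^bsub>mor_group (dgHot A) X Y\<^esub> F"
        using XY f g hom_plus_assoc(2)[OF XY f(1) g(1) g(1)] by (simp add: mor_group_def hcls_plus)
      fix H assume "H \<in> carrier (mor_group (dgHot A) X Y)"
      then obtain h where h: "h \<in> dg_hom A X Y" "H = hcls A X Y h" by (auto simp: mor_group_def dgHot_simps)
      show "F \<otimes>\<^bsub>mor_group (dgHot A) X Y\<^esub> G \<otimes>\<^bsub>mor_group (dgHot A) X Y\<^esub> H =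
          F \<otimes>\<^bsub>mor_group (dgHot A) X Y\<^esub> (G \<otimes>\<^bsub>mor_group (dgHot A) X Y\<^esub> H)"
        using XY f g h by (simp add: mor_group_def hcls_plus hom_plus_hom hom_plus_assoc(1))
    qed (use XY in \<open>auto simp: mor_group_def dgHot_simps hom_zero_hom\<close>)
  qed (auto simp: dgHot_simps hom_id_hom hcls_comp hcls_plus hom_plus_hom compose_id hom_compose compose_plus_l
      compose_plus_r compose_ass)
qed

lemma hot_iso_htp:
  assumes d: "dg_module A M" "dg_module A N" and f: "f \<in> dg_hom A M N" and g: "g \<in> dg_hom A N M"
  shows "Comp (dgHot A) M N M (hcls A N M g) (hcls A M N f) = Ident (dgHot A) M \<longleftrightarrow> htp A M M (\<lambda>x. g (f x)) (\<lambda>x. x)"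
proof -
  have "htp A M M (compose (carrier M) g f) (hom_id M) \<longleftrightarrow> htp A M M (\<lambda>x. g (f x)) (\<lambda>x. x)"
    by (rule htp_cong) (auto simp: compose_def hom_id_def)
  thus ?thesis
    using hcls_comp[OF d(1) d(2) d(1) f g] hcls_eq[OF d(1) d(1) hom_compose[OF d(1) f g] hom_id_hom[OF d(1)]]
    by (simp add: dgHot_simps)
qed

end

section \<open>Perfect dg modules are dominated by filtered ones\<close>

text \<open>The type argument records the universe \<open>'m\<close> of the filtered module; it
  cannot be read off from \<open>N\<close>, which may be a cone on a product type.\<close>

definition domf :: "'m itself \<Rightarrow> ('k, 'a) dgalgebra \<Rightarrow> ('a, 'n) dgmodule \<Rightarrow> bool" where
  "domf T A N \<longleftrightarrow> (\<exists>M :: ('a, 'm) dgmodule. filt A M \<and> dominated A N M)"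

lemma rst_carrier_id: "dg_module A M ==> rst M (carrier M) = M"
proof -
  assume "dg_module A M"
  then interpret dg_module A M .
  have "carrier M \<inter> mgr M i = mgr M i" for i using mgr_carrier by auto
  thus ?thesis by (simp add: rst_def)
qed

lemma eq_adjI:
  assumes "\<And>n a. [|n \<in> N; a \<in> carrier A|] ==> n \<oplus>\<^bsub>M\<^esub> ract M v a \<in> T"
    "\<And>y. y \<in> T ==> \<exists>n a. n \<in> N \<and> a \<in> carrier A \<and> y = n \<oplus>\<^bsub>M\<^esub> ract M v a"
  shows "adj A M N v = T"
  using assms unfolding adj_def by blast

lemma (in abelian_group) add_eq_diff:
  assumes "n \<in> carrier G" "m \<in> carrier G" "x \<in> carrier G" "y \<in> carrier G" "n \<oplus> x = m \<oplus> y"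
  shows "x \<ominus> y = m \<ominus> n"
proof -
  have "x \<ominus> y = (n \<ominus> n) \<oplus> (x \<ominus> y)" using assms by (simp add: a_minus_def r_neg)
  also have "\<dots> = (m \<oplus> y) \<ominus> (n \<oplus> y)" using assms add_diff_add[of n x n y] by simp
  also have "\<dots> = (m \<ominus> n) \<oplus> (y \<ominus> y)" using assms by (intro add_diff_add)
  also have "\<dots> = m \<ominus> n" using assms by (simp add: a_minus_def r_neg)
  finally show ?thesis .
qed

context pdga
begin

lemma pdgm_sub_zero: "dg_module A M ==> dsub A M {zero M}"
  using pdgm_end.sub_zeroset[of A M "hom_id M"] hom_id_hom[of M] pdgmI[of M]
  by (simp add: pdgm_end_def pdgm_end_axioms_def)

lemma filt_dg: "filt A M ==> dg_module A M"
  by (simp add: filt_def)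

lemma hom_zero_val: "[|dg_module A M; dg_module A N; f \<in> dg_hom A M N|] ==> f (zero M) = (zero N)"
  by (rule addmap_zero[OF _ _ dg_homD(7)]) (auto simp: dg_module_def right_module_def)

lemma filt_iso:
  assumes M: "filt A M" and N: "dg_module A N" and f: "f \<in> dg_hom A M N" and b: "bij_betw f (carrier M) (carrier N)"
  shows "filt A N"
proof -
  obtain js where js: "sorted js" "rf A M js {zero M} (carrier M)" using M by (auto simp: filt_def)
  have "rf A N js (f ` {zero M}) (f ` carrier M)"
    by (rule rf_map[OF pdgmI[OF filt_dg[OF M]] pdgmI[OF N] f _ js(2) pdgm_sub_zero[OF filt_dg[OF M]]])
      (use b in \<open>simp add: bij_betw_def\<close>)
  thus ?thesis
    using js(1) N b hom_zero_val[OF filt_dg[OF M] N f] unfolding filt_def by (auto simp: bij_betw_def)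
qed

lemma filt_transport:
  assumes M: "filt A M" and h: "inj_on h (carrier M)"
  shows "filt A (transport h M)"
  by (rule filt_iso[OF M transport_dg_module[OF filt_dg[OF M] h] transport_iso(1)[OF filt_dg[OF M] h]])
    (use h in \<open>auto simp: bij_betw_def transport_def inj_on_def\<close>)

lemma filt_zero:
  assumes "dg_module A M" shows "filt A (rst M {zero M})"
  using pdgm.rst_dg_module[OF pdgmI[OF assms] pdgm_sub_zero[OF assms]] rf.Nil[of A "rst M {zero M}" "{zero M}"]
  unfolding filt_def by (auto intro!: exI[of _ "[]"])

lemma filt_shift:
  assumes M: "filt A M" shows "filt A (shift l M)"
proof -
  interpret pdgm A M by (rule pdgmI[OF filt_dg[OF M]])
  have adj: "adj A (shift l M) N v = ad N v" for N v by (simp add: adj_def)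
  have "rf A (shift l M) (map (\<lambda>j. j - l) js) N T" if "rf A M js N T" "sub N" for js N T
    using that
  proof (induction rule: rf.induct)
    case (Nil N)
    thus ?case by (simp add: rf.Nil)
  next
    case (Cons j e v N js T)
    have "cell A (shift l M) (j - l) e v N"
      using Cons.hyps(1) sub_minus[OF Cons.prems] by (simp add: cell_def sign_def)
    thus ?case using Cons.IH[OF cell_sub[OF Cons.prems Cons.hyps(1)]] by (auto simp: adj intro: rf.Cons)
  qed
  moreover obtain js where js: "sorted js" "rf A M js {zero M} (carrier M)" using M by (auto simp: filt_def)
  moreover have "sorted (map (\<lambda>j. j - l) js)" using js(1) by (simp add: sorted_iff_nth_mono)
  ultimately show ?thesis
    using shift_dg_module[OF filt_dg[OF M], of l] pdgm_sub_zero[OF filt_dg[OF M]] unfolding filt_def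
    by (intro conjI exI[of _ "map (\<lambda>j. j - l) js"]) auto
qed

lemma hom_shift:
  assumes "dg_module A M" "dg_module A N" "f \<in> dg_hom A M N"
  shows "f \<in> dg_hom A (shift l M) (shift l N)"
proof -
  interpret M: dg_module A M by fact
  interpret N: dg_module A N by fact
  note fD = dg_homD[OF assms(3)]
  have fm: "f (\<ominus>\<^bsub>M\<^esub> x) = \<ominus>\<^bsub>N\<^esub> f x" if "x \<in> carrier M" for x
    by (rule addmap_minus[OF M.M.abelian_group_axioms N.M.abelian_group_axioms fD(7) that])
  show ?thesis by (rule dg_homI) (use fD in \<open>auto simp: sign_def fm M.mdiff_closed\<close>)
qed

lemma dominated_shift:
  assumes N: "dg_module A N" and M: "dg_module A M" and d: "dominated A N M"
  shows "dominated A (shift l N) (shift l M)"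
proof -
  interpret N: dg_module A N by fact
  obtain i r where i: "i \<in> dg_hom A N M" and r: "r \<in> dg_hom A M N" and h: "htp A N N (\<lambda>x. r (i x)) (\<lambda>x. x)"
    using d by (auto simp: dominated_def)
  obtain h where h: "dg_homotopy A N N h"
    and e: "\<And>x. x \<in> carrier N ==> r (i x) \<ominus>\<^bsub>N\<^esub> x = mdiff N (h x) \<oplus>\<^bsub>N\<^esub> h (mdiff N x)"
    using h by (auto simp: htp_def)
  note hD = dg_homotopyD[OF h]
  have hm: "h (\<ominus>\<^bsub>N\<^esub> x) = \<ominus>\<^bsub>N\<^esub> h x" if "x \<in> carrier N" for x
    by (rule addmap_minus[OF N.M.abelian_group_axioms N.M.abelian_group_axioms hD(5) that])
  \<comment> \<open>The shifted differential carries the sign (-1)^l, so the homotopy has to carry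
    it too.\<close>
  let ?h = "\<lambda>x. sign N l (h x)"
  have "dg_homotopy A (shift l N) (shift l N) ?h"
    unfolding dg_homotopy_def
  proof (intro conjI ballI allI)
    fix i x assume "x \<in> mgr (shift l N) i"
    hence "h x \<in> mgr N (i + l - 1)" using hD(4)[of x "i + l"] by simp
    thus "?h x \<in> mgr (shift l N) (i - 1)" using N.mgr_minus[of "h x" "i + l - 1"] by (simp add: sign_def algebra_simps)
  qed (auto simp: sign_def hD(1-3) N.M.minus_add N.ract_minus_l)
  moreover have "r (i x) \<ominus>\<^bsub>shift l N\<^esub> x = mdiff (shift l N) (?h x) \<oplus>\<^bsub>shift l N\<^esub> ?h (mdiff (shift l N) x)"
    if "x \<in> carrier (shift l N)" for x
    using that e[of x] by (simp add: sign_def a_minus_def hm hD(1) N.mdiff_minus N.mdiff_closed)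
  ultimately have "htp A (shift l N) (shift l N) (\<lambda>x. r (i x)) (\<lambda>x. x)" unfolding htp_def by blast
  thus ?thesis using dominatedI[OF hom_shift[OF N M i] hom_shift[OF M N r]] by blast
qed

lemma domf_dominated:
  assumes "dg_module A N" "dg_module A M" "dominated A N M" "domf T A M"
  shows "domf T A N"
  using assms dominated_trans[OF assms(1,2)] filt_dg unfolding domf_def by blast

lemma eA_minus:
  assumes "prim A e" "b \<in> ideal_e e" shows "\<ominus>\<^bsub>eA e\<^esub> b = \<ominus> b"
proof -
  interpret E: dg_module A "eA e" by (rule eA_dg_module[OF assms(1)])
  have b: "b \<in> carrier A" "e \<otimes> b = b" using ideal_eD assms by auto
  have "\<ominus> b \<in> ideal_e e" by (rule ideal_eI[OF assms(1)]) (use b prim_carrier[OF assms(1)] in \<open>simp_all add: A.r_minus\<close>)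
  thus ?thesis using E.M.minus_equality[of "\<ominus> b" b] assms(2) b by (simp add: A.l_neg)
qed

text \<open>N + vA is isomorphic to the cone of the map from a shift of eA to \<open>N\<close> that
  sends \<open>b\<close> to (dv) b. Replacing \<open>N\<close> by a filtered module that dominates
  it changes the cone only up to domination, and \<open>attach_cell\<close> applies to the new
  cone.\<close>

lemma domf_cell:
  fixes D :: "('a, 'n) dgmodule"
  assumes D: "dg_module A D" and N: "dsub A D N" and c: "cell A D j e v N"
    and d: "domf TYPE('m) A (rst D N)" and u: "\<exists>\<rho> :: 'm \<times> 'a \<Rightarrow> 'm. inj_on \<rho> (UNIV \<times> carrier A)"
  shows "domf TYPE('m) A (rst D (adj A D N v))"
proof -
  interpret D: pdgm A D by (rule pdgmI[OF D])
  note cD = D.cellD[OF c]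
  let ?R = "rst D N" and ?R' = "rst D (D.ad N v)" and ?P = "shift (- j - 1) (eA e)"
  have Rd: "dg_module A ?R" by (rule D.rst_dg_module[OF N])
  have N1: "D.sub (D.ad N v)" by (rule D.cell_sub[OF N c])
  have Rd': "dg_module A ?R'" by (rule D.rst_dg_module[OF N1])
  have Pd: "dg_module A ?P" by (rule shift_dg_module[OF eA_dg_module[OF cD(2)]])
  have dv: "mdiff D v \<in> carrier D" using D.sub_carrier[OF N cD(4)] .
  have dvg: "mdiff D v \<in> mgr D (j + 1)" using D.mdiff_mgr[OF cD(1)] .
  have bc: "b \<in> carrier A \<and> e \<otimes> b = b" if "b \<in> ideal_e e" for b using ideal_eD[OF cD(2) that] .
  note EM = eA_minus[OF cD(2)]
  have dI: "adiff A b \<in> ideal_e e" if "b \<in> ideal_e e" for b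
    using dg_module.mdiff_closed[OF eA_dg_module[OF cD(2)]] that by simp
  let ?s = "\<lambda>b\<in>ideal_e e. ract D (mdiff D v) b"
  \<comment> \<open>The sign is (-1)^(j+1) because dv has degree j + 1. It agrees with the sign of
    the differential in the shift by \<open>- j - 1\<close>, so the attaching map is a
    morphism.\<close>
  have ddv: "mdiff D (ract D (mdiff D v) b) = sign D (j + 1) (ract D (mdiff D v) (adiff A b))" if "b \<in> carrier A" for b
    using D.mdiff_ract[OF dvg that] D.mdiff_mdiff[OF cD(5)] that dv adiff_closed[OF that]
    by (simp add: D.ract_zero_l sign_closed[OF D.M.abelian_group_axioms] D.ract_closed)
  have s: "?s \<in> dg_hom A ?P ?R"
  proof (rule dg_homI)
    fix x assume "x \<in> carrier ?P"
    hence x: "x \<in> ideal_e e" by simp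
    note xc = bc[OF x]
    show "?s x \<in> carrier ?R" using x D.sub_ract[OF N cD(4)] xc by simp
    show "?s (x \<oplus>\<^bsub>?P\<^esub> y) = ?s x \<oplus>\<^bsub>?R\<^esub> ?s y" if "y \<in> carrier ?P" for y
    proof -
      have y: "y \<in> ideal_e e" using that by simp
      have "x \<oplus> y \<in> ideal_e e" using abelian_group.axioms(1)[of "eA e"] eA_dg_module[OF cD(2)] x y
          abelian_monoid.a_closed[of "eA e" x y] by (simp add: dg_module_def right_module_def)
      thus ?thesis using x y bc dv by (simp add: D.ract_r_distr)
    qed
    show "?s (ract ?P x a) = ract ?R (?s x) a" if "a \<in> carrier A" for a
    proof -
      have "x \<otimes> a \<in> ideal_e e" using right_module.ract_closed[of A "eA e" x a] eA_dg_module[OF cD(2)] x that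
        by (simp add: dg_module_def)
      thus ?thesis using x xc dv that by (simp add: D.ract_assoc)
    qed
    show "?s (mdiff ?P x) = mdiff ?R (?s x)"
    proof -
      have "mdiff ?P x = sign A (j + 1) (adiff A x)" using EM[OF dI[OF x]] by (simp add: sign_def)
      moreover have "mdiff ?P x \<in> ideal_e e" using dg_module.mdiff_closed[OF Pd, of x] x by simp
      ultimately show ?thesis using x xc dv ddv[of x] adiff_closed[of x] by (simp add: sign_def D.ract_minus_r)
    qed
  next
    fix x i assume x: "x \<in> mgr ?P i"
    hence "x \<in> ideal_e e" "x \<in> agr A (i - j - 1)" by (auto simp: algebra_simps)
    thus "?s x \<in> mgr ?R i"
      using D.mgr_ract[OF dvg, of x "i - j - 1"] D.sub_ract[OF N cD(4)] bc by simp
  qed simp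
  let ?C = "cone ?P ?R ?s"
  have Cd: "dg_module A ?C" by (rule cone_dg_module[OF Pd Rd s])
  \<comment> \<open>The pair (n, b) stands for n + v b; injectivity of this map will be the cell
    condition.\<close>
  let ?f = "\<lambda>(n, b)\<in>N \<times> ideal_e e. n \<oplus>\<^bsub>D\<^esub> ract D v b"
  have NC: "n \<in> carrier D" if "n \<in> N" for n using D.sub_carrier[OF N that] .
  have f: "?f \<in> dg_hom A ?C ?R'"
  proof (rule dg_homI)
    fix x assume xC: "x \<in> carrier ?C"
    then obtain n b where x: "x = (n, b)" "n \<in> N" "b \<in> ideal_e e" by auto
    note b = bc[OF x(3)]
    note [simp] = NC[OF x(2)] cD(5)
    show "?f x \<in> carrier ?R'" using x b by (auto intro: D.adI)
    show "?f (x \<oplus>\<^bsub>?C\<^esub> y) = ?f x \<oplus>\<^bsub>?R'\<^esub> ?f y" if yC: "y \<in> carrier ?C" for y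
    proof -
      obtain m c where y: "y = (m, c)" "m \<in> N" "c \<in> ideal_e e" using yC by auto
      have "x \<oplus>\<^bsub>?C\<^esub> y \<in> carrier ?C" using abelian_monoid.a_closed[of ?C x y] xC yC Cd
        by (simp add: dg_module_def right_module_def abelian_group_def)
      hence "n \<oplus>\<^bsub>D\<^esub> m \<in> N" "b \<oplus> c \<in> ideal_e e" using x y by auto
      thus ?thesis using x y b bc[OF y(3)] NC[OF y(2)] by (simp add: D.ract_r_distr D.ract_closed D.M.a_ac)
    qed
    show "?f (ract ?C x a) = ract ?R' (?f x) a" if a: "a \<in> carrier A" for a
    proof -
      have "ract ?C x a \<in> carrier ?C" using right_module.ract_closed[of A ?C x a] xC a Cd by (simp add: dg_module_def)
      hence "ract D n a \<in> N" "b \<otimes> a \<in> ideal_e e" using x by auto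
      thus ?thesis using x b a by (simp add: D.ract_l_distr D.ract_closed D.ract_assoc)
    qed
    show "?f (mdiff ?C x) = mdiff ?R' (?f x)"
    proof -
      have "mdiff ?C x \<in> carrier ?C" using dg_module.mdiff_closed[OF Cd xC] .
      moreover have "mdiff ?C x = (mdiff D n \<oplus>\<^bsub>D\<^esub> ract D (mdiff D v) b, sign A j (adiff A b))"
        using x EM[OF dI[OF x(3)]] EM[of "\<ominus> adiff A b"] dI[OF x(3)] bc[OF dI[OF x(3)]]
          abelian_group.a_inv_closed[of "eA e" "adiff A b"] eA_dg_module[OF cD(2)]
        by (auto simp: sign_def dg_module_def right_module_def)
      ultimately have m: "mdiff D n \<oplus>\<^bsub>D\<^esub> ract D (mdiff D v) b \<in> N" "sign A j (adiff A b) \<in> ideal_e e"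
        "mdiff ?C x = (mdiff D n \<oplus>\<^bsub>D\<^esub> ract D (mdiff D v) b, sign A j (adiff A b))" by auto
      have "ract D v (sign A j (adiff A b)) = sign D j (ract D v (adiff A b))"
        using b adiff_closed[of b] by (simp add: sign_def D.ract_minus_r)
      thus ?thesis
        using x m b D.mdiff_ract[OF cD(1), of b] dv adiff_closed[of b] sign_closed[OF D.M.abelian_group_axioms]
        by (simp add: D.mdiff_add D.ract_closed D.mdiff_closed D.M.a_assoc)
    qed
  next
    fix x i assume "x \<in> mgr ?C i"
    then obtain n b where x: "x = (n, b)" "n \<in> N" "n \<in> mgr D i" "b \<in> ideal_e e" "b \<in> agr A (i - j)"
      by (auto simp: algebra_simps)
    show "?f x \<in> mgr ?R' i"
      using x bc[OF x(4)] D.mgr_add[OF x(3), of "ract D v b"] D.mgr_ract[OF cD(1) x(5)] by (auto intro: D.adI)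
  qed simp
  have bij: "bij_betw ?f (carrier ?C) (carrier ?R')"
    unfolding bij_betw_def
  proof
    show "inj_on ?f (carrier ?C)"
    proof (rule inj_onI)
      fix x y assume xy: "x \<in> carrier ?C" "y \<in> carrier ?C" "?f x = ?f y"
      then obtain n b m c where x: "x = (n, b)" "n \<in> N" "b \<in> ideal_e e" "y = (m, c)" "m \<in> N" "c \<in> ideal_e e" by auto
      have b: "b \<in> carrier A" "e \<otimes> b = b" "c \<in> carrier A" "e \<otimes> c = c" using bc x by auto
      have eq: "n \<oplus>\<^bsub>D\<^esub> ract D v b = m \<oplus>\<^bsub>D\<^esub> ract D v c" using xy x by simp
      have cc: "n \<in> carrier D" "m \<in> carrier D" "ract D v b \<in> carrier D" "ract D v c \<in> carrier D"
        using NC x b cD(5) D.ract_closed by auto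
      have "ract D v (b \<ominus> c) = ract D v b \<ominus>\<^bsub>D\<^esub> ract D v c" using b cD(5) by (simp add: D.ract_diff_r)
      also have "\<dots> = m \<ominus>\<^bsub>D\<^esub> n"
        by (rule D.M.add_eq_diff[OF cc eq])
      finally have "ract D v (b \<ominus> c) \<in> N" using D.sub_diff[OF N x(5,2)] by simp
      hence "e \<otimes> (b \<ominus> c) = \<zero>" using cD(6) b by simp
      hence "b \<ominus> c = \<zero>" using b prim_carrier[OF cD(2)] by (simp add: a_minus_def A.r_distr A.r_minus)
      hence "b = c" using b A.diff_zero_imp_eq by blast
      hence "n = m" using eq cc by simp
      thus "x = y" using \<open>b = c\<close> x by simp
    qed
    show "?f ` carrier ?C = carrier ?R'"
    proof
      show "?f ` carrier ?C \<subseteq> carrier ?R'" using dg_homD(1)[OF f] by blast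
      show "carrier ?R' \<subseteq> ?f ` carrier ?C"
      proof
        fix y assume "y \<in> carrier ?R'"
        then obtain n a where y: "n \<in> N" "a \<in> carrier A" "y = n \<oplus>\<^bsub>D\<^esub> ract D v a" by (auto elim: D.adE)
        have ea: "e \<otimes> a \<in> ideal_e e" using y by (simp add: ideal_e_def)
        have "ract D v (e \<otimes> a) = ract D v a" using D.ract_assoc[OF cD(5) prim_carrier[OF cD(2)] y(2)] cD(3) by simp
        thus "y \<in> ?f ` carrier ?C" using y ea by (intro image_eqI[of _ _ "(n, e \<otimes> a)"]) auto
      qed
    qed
  qed
  have 1: "dominated A ?R' ?C" by (rule hom_bij_dominated[OF Cd Rd' f bij])
  obtain X :: "('a, 'm) dgmodule" where X: "filt A X" "dominated A ?R X" using d by (auto simp: domf_def)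
  then obtain a a' where a: "a \<in> dg_hom A ?R X" "a' \<in> dg_hom A X ?R" "htp A ?R ?R (\<lambda>x. a' (a x)) (\<lambda>x. x)"
    by (auto simp: dominated_def)
  note Xd = filt_dg[OF X(1)]
  have 2: "dominated A ?C (cone ?P X (\<lambda>x\<in>carrier ?P. a (?s x)))"
    by (rule dominated_cone_post[OF Pd Rd Xd s a])
  have as: "(\<lambda>x\<in>carrier ?P. a (?s x)) \<in> dg_hom A ?P X" by (rule hom_comp_fun[OF Pd s a(1)])
  obtain F :: "('a, 'm \<times> 'a) dgmodule" where F: "filt A F" "dominated A (cone ?P X (\<lambda>x\<in>carrier ?P. a (?s x))) F"
    "carrier F \<subseteq> carrier X \<times> ideal_e e"
    using attach_cell[OF X(1) cD(2) as] by blast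
  obtain \<rho> :: "'m \<times> 'a \<Rightarrow> 'm" where \<rho>: "inj_on \<rho> (UNIV \<times> carrier A)" using u by blast
  have C'd: "dg_module A (cone ?P X (\<lambda>x\<in>carrier ?P. a (?s x)))" by (rule cone_dg_module[OF Pd Xd as])
  \<comment> \<open>The bound on the carrier in \<open>attach_cell\<close> makes
    \<open>\<rho>\<close> injective on \<open>F\<close>, so that \<open>F\<close> can be copied to
    \<open>'m\<close>.\<close>
  have Fi: "inj_on \<rho> (carrier F)" by (rule inj_on_subset[OF \<rho>]) (use F(3) bc in auto)
  note Fd = filt_dg[OF F(1)] and tF = filt_transport[OF F(1) Fi]
  have "dominated A F (transport \<rho> F)"
    using homotopy_equivalent_dominated(1)[OF transport_dominated(1)[OF Fd Fi]] .
  hence "dominated A ?R' (transport \<rho> F)"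
    using dominated_trans[OF Rd' Cd Fd 1 dominated_trans[OF Cd C'd Fd 2 F(2)]]
      dominated_trans[OF Rd' Fd filt_dg[OF tF]] by blast
  thus ?thesis using tF unfolding domf_def by blast
qed


lemma domf_rf:
  fixes D :: "('a, 'n) dgmodule"
  assumes "rf A D js N T" "dg_module A D" "dsub A D N" "domf TYPE('m) A (rst D N)"
    and "\<exists>\<rho> :: 'm \<times> 'a \<Rightarrow> 'm. inj_on \<rho> (UNIV \<times> carrier A)"
  shows "domf TYPE('m) A (rst D T)"
  using assms
proof (induction rule: rf.induct)
  case (Cons j e v N js T)
  have "dsub A D (adj A D N v)" by (rule pdgm.cell_sub[OF pdgmI[OF Cons.prems(1)] Cons.prems(2) Cons.hyps(1)])
  thus ?case
    by (rule Cons.IH[OF Cons.prems(1) _ domf_cell[OF Cons.prems(1,2) Cons.hyps(1) Cons.prems(3,4)] Cons.prems(4)])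
qed

text \<open>\<open>N\<close> sits in the cone as a submodule, and the cells of \<open>M\<close>,
  lowered by one degree, are attached to it in turn. The combined list need not be sorted;
  \<open>domf_cell\<close> passes to a sorted model at each step.\<close>

lemma domf_cone_filt:
  assumes M: "filt A M" and N: "filt A (N :: ('a, 'm) dgmodule)" and f: "f \<in> dg_hom A M N"
    and u: "\<exists>\<rho> :: 'm \<times> 'a \<Rightarrow> 'm. inj_on \<rho> (UNIV \<times> carrier A)"
  shows "domf TYPE('m) A (cone M N f)"
proof -
  let ?D = "cone M N f"
  note Md = filt_dg[OF M] and Nd = filt_dg[OF N]
  have Dd: "dg_module A ?D" by (rule cone_dg_module[OF Md Nd f])
  interpret M: pdgm A M by (rule pdgmI[OF Md])
  interpret N: pdgm A N by (rule pdgmI[OF Nd])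
  interpret D: pdgm A ?D by (rule pdgmI[OF Dd])
  note fD = dg_homD[OF f]
  have adj: "adj A ?D (carrier N \<times> P) ((zero N), v) = carrier N \<times> M.ad P v"
    if "P \<subseteq> carrier M" "v \<in> carrier M" for P v
  proof (rule eq_adjI)
    fix x a assume "x \<in> carrier N \<times> P" "a \<in> carrier A"
    thus "x \<oplus>\<^bsub>?D\<^esub> ract ?D ((zero N), v) a \<in> carrier N \<times> M.ad P v"
      by (auto simp: N.ract_zero_l intro: M.adI)
  next
    fix y assume "y \<in> carrier N \<times> M.ad P v"
    then obtain n p a where y: "y = (n, p \<oplus>\<^bsub>M\<^esub> ract M v a)" "n \<in> carrier N" "p \<in> P" "a \<in> carrier A"
      by (auto elim: M.adE)
    thus "\<exists>x a. x \<in> carrier N \<times> P \<and> a \<in> carrier A \<and> y = x \<oplus>\<^bsub>?D\<^esub> ract ?D ((zero N), v) a"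
      by (intro exI[of _ "(n, p)"] exI[of _ a]) (auto simp: N.ract_zero_l)
  qed
  \<comment> \<open>The stages are N \<times> P for the stages \<open>P\<close> of \<open>M\<close>.
    A generator \<open>v\<close> becomes (0, v), with boundary (f v, - dv).\<close>
  have lift: "rf A ?D (map (\<lambda>j. j - 1) js) (carrier N \<times> P) (carrier N \<times> T)"
    if "rf A M js P T" "M.sub P" for js P T
    using that
  proof (induction rule: rf.induct)
    case (Nil P)
    thus ?case by (simp add: rf.Nil)
  next
    case (Cons j e v P js T)
    note cD = M.cellD[OF Cons.hyps(1)] and P = Cons.prems
    have ec: "e \<in> carrier A" using prim_carrier cD by auto
    have "cell A ?D (j - 1) e ((zero N), v) (carrier N \<times> P)"
      unfolding cell_def
    proof (intro conjI ballI impI)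
      show "mdiff ?D ((zero N), v) \<in> carrier N \<times> P"
        using fD(1) cD M.sub_minus[OF P cD(4)] by (simp add: N.mdiff_zero)
      fix a assume "a \<in> carrier A" "ract ?D ((zero N), v) a \<in> carrier N \<times> P"
      thus "e \<otimes> a = \<zero>" using cD(6) by simp
    qed (use cD ec in \<open>auto simp: N.mgr_zero N.ract_zero_l\<close>)
    moreover have "P \<subseteq> carrier M" using M.sub_carrier[OF P] by auto
    ultimately show ?case
      using Cons.IH[OF M.cell_sub[OF P Cons.hyps(1)]] adj[of P v] cD(5) rf.Cons by fastforce
  qed
  obtain js where js: "rf A M js {zero M} (carrier M)" using M by (auto simp: filt_def)
  note r = lift[OF js pdgm_sub_zero[OF Md]]
  let ?i = "\<lambda>x\<in>carrier N. (x, (zero M))"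
  have i: "?i \<in> dg_hom A N ?D" by (rule inl_hom[OF Md Nd f])
  note iD = dg_homD[OF i]
  let ?N = "carrier N \<times> {zero M}"
  have sN: "D.sub ?N"
    unfolding dsub_def
  proof (intro conjI ballI allI)
    fix x assume "x \<in> ?N"
    then obtain n where n: "n \<in> carrier N" "x = ?i n" by auto
    show "mdiff ?D x \<in> ?N" using iD(5)[OF n(1)] n N.mdiff_closed[OF n(1)] by auto
    show "hc ?D k x \<in> ?N" for k
      using dg_hom_hc[OF Nd Dd i n(1), of k] n N.hc_closed[OF n(1), of k] by auto
    show "ract ?D x a \<in> ?N" if "a \<in> carrier A" for a
      using n that N.ract_closed[OF n(1) that] by (auto simp: M.ract_zero_l)
    show "x \<oplus>\<^bsub>?D\<^esub> y \<in> ?N" if "y \<in> ?N" for y using n that by auto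
  qed auto
  have Rd: "dg_module A (rst ?D ?N)" by (rule D.rst_dg_module[OF sN])
  have "?i \<in> dg_hom A N (rst ?D ?N)"
    by (rule dg_homI) (use iD in \<open>auto simp: N.mgr_carrier N.ract_closed N.mdiff_closed M.mgr_zero simp del: cone_simps(6)\<close>)
  hence "dominated A (rst ?D ?N) N"
    by (rule hom_bij_dominated[OF Nd Rd]) (auto simp: bij_betw_def inj_on_def)
  hence "domf TYPE('m) A (rst ?D ?N)" using N unfolding domf_def by blast
  from domf_rf[OF r Dd sN this u] have "domf TYPE('m) A (rst ?D (carrier ?D))" by simp
  thus ?thesis using rst_carrier_id[OF Dd] by simp
qed

text \<open>Both ends are replaced by filtered modules, the target through
  \<open>dominated_cone_post\<close> and the source through
  \<open>dominated_cone_pre\<close>.\<close>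

lemma domf_cone:
  assumes M: "dg_module A M" "domf TYPE('m) A M" and N: "dg_module A N" "domf TYPE('m) A N"
    and f: "f \<in> dg_hom A M N" and u: "\<exists>\<rho> :: 'm \<times> 'a \<Rightarrow> 'm. inj_on \<rho> (UNIV \<times> carrier A)"
  shows "domf TYPE('m) A (cone M N f)"
proof -
  obtain M' :: "('a, 'm) dgmodule" where M': "filt A M'" "dominated A M M'" using M by (auto simp: domf_def)
  obtain N' :: "('a, 'm) dgmodule" where N': "filt A N'" "dominated A N N'" using N by (auto simp: domf_def)
  note Md' = filt_dg[OF M'(1)] and Nd' = filt_dg[OF N'(1)]
  obtain b' b where b: "b' \<in> dg_hom A M M'" "b \<in> dg_hom A M' M" "htp A M M (\<lambda>x. b (b' x)) (\<lambda>x. x)"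
    using M'(2) by (auto simp: dominated_def)
  obtain a a' where a: "a \<in> dg_hom A N N'" "a' \<in> dg_hom A N' N" "htp A N N (\<lambda>x. a' (a x)) (\<lambda>x. x)"
    using N'(2) by (auto simp: dominated_def)
  let ?g = "\<lambda>x\<in>carrier M. a (f x)"
  let ?g' = "\<lambda>x\<in>carrier M'. ?g (b x)"
  have g: "?g \<in> dg_hom A M N'" by (rule hom_comp_fun[OF M(1) f a(1)])
  have g': "?g' \<in> dg_hom A M' N'" by (rule hom_comp_fun[OF Md' b(2) g])
  have 1: "dominated A (cone M N f) (cone M N' ?g)" by (rule dominated_cone_post[OF M(1) N(1) Nd' f a])
  have 2: "dominated A (cone M N' ?g) (cone M' N' ?g')" by (rule dominated_cone_pre[OF M(1) Nd' Md' g b(2,1,3)])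
  note c = cone_dg_module[OF M(1) N(1) f] cone_dg_module[OF M(1) Nd' g] cone_dg_module[OF Md' Nd' g']
  show ?thesis
    using domf_dominated[OF c(1,3) dominated_trans[OF c 1 2] domf_cone_filt[OF M'(1) N'(1) g' u]] .
qed

text \<open>\<open>A\<close> is the sum of the right ideals generated by the orthogonal idempotents
  \<open>E k\<close>, each a cell of degree zero. The invariant that the later idempotents
  annihilate the submodule built so far yields the cell condition for the next one.\<close>

lemma regular_filt: "filt A (regular_dgmodule A)"
proof -
  let ?R = "regular_dgmodule A"
  interpret R: pdgm A ?R by (rule pdgmI[OF reg])
  obtain n :: nat and E where E: "\<forall>k<n. prim A (E k)" "\<forall>k<n. \<forall>l<n. k \<noteq> l \<longrightarrow> E k \<otimes> E l = \<zero>" "finsum A E {..<n} = \<one>"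
    using prims by blast
  have Ec: "E k \<in> carrier A" if "k < n" for k using E(1) prim_carrier that by simp
  have "\<exists>N. rf A ?R (replicate m 0) {\<zero>} N \<and> R.sub N \<and> (\<forall>k<m. E k \<in> N) \<and>
      (\<forall>x\<in>N. \<forall>k<n. m \<le> k \<longrightarrow> E k \<otimes> x = \<zero>)" if "m \<le> n" for m
    using that
  proof (induction m)
    case 0
    show ?case
      using rf.Nil[of A ?R "{\<zero>}"] pdgm_sub_zero[OF reg] Ec by (intro exI[of _ "{\<zero>}"]) (auto simp: reg_simps)
  next
    case (Suc m)
    then obtain N where N: "rf A ?R (replicate m 0) {\<zero>} N" "R.sub N" "\<forall>k<m. E k \<in> N"
      "\<forall>x\<in>N. \<forall>k<n. m \<le> k \<longrightarrow> E k \<otimes> x = \<zero>" by auto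
    have m: "m < n" using Suc.prems by simp
    have pm: "prim A (E m)" using E m by simp
    have c: "cell A ?R 0 (E m) (E m) N"
      unfolding cell_def reg_simps
    proof (intro conjI ballI impI)
      show "adiff A (E m) \<in> N" using adiff0[OF prim_deg[OF pm]] R.sub_zero[OF N(2)] by (simp add: reg_simps)
      fix a assume a: "a \<in> carrier A" "E m \<otimes> a \<in> N"
      hence "E m \<otimes> (E m \<otimes> a) = \<zero>" using N(4) m by simp
      thus "E m \<otimes> a = \<zero>" using a Ec[OF m] prim_idem[OF pm] by (simp flip: A.m_assoc)
    qed (use pm prim_deg prim_idem in auto)
    let ?N = "R.ad N (E m)"
    have "rf A ?R [0] N ?N" using c rf.intros by metis
    hence r: "rf A ?R (replicate (Suc m) 0) {\<zero>} ?N"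
      using R.rf_append[OF N(1), of "[0]" ?N] by (simp add: replicate_append_same)
    have s: "R.sub ?N" by (rule R.cell_sub[OF N(2) c])
    have EmR: "E m \<in> carrier ?R" using Ec[OF m] by (simp add: reg_simps)
    have "E k \<in> ?N" if "k < Suc m" for k
    proof (cases "k = m")
      case True
      thus ?thesis using R.ad_self[OF N(2) EmR] by simp
    next
      case False
      thus ?thesis using R.ad_base[OF N(2) EmR, of "E k"] N(3) that by simp
    qed
    moreover have "E k \<otimes> x = \<zero>" if x: "x \<in> ?N" and k: "k < n" "Suc m \<le> k" for x k
    proof -
      obtain y a where y: "y \<in> N" "a \<in> carrier A" "x = y \<oplus> E m \<otimes> a" using x by (auto elim: R.adE simp: reg_simps)
      have yc: "y \<in> carrier A" using R.sub_carrier[OF N(2) y(1)] by (simp add: reg_simps)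
      have "E k \<otimes> E m = \<zero>" using E(2) k m by simp
      hence "E k \<otimes> (E m \<otimes> a) = \<zero>" using Ec[OF k(1)] Ec[OF m] y by (simp flip: A.m_assoc)
      moreover have "E k \<otimes> y = \<zero>" using N(4) y k by simp
      ultimately show ?thesis using y yc Ec[OF k(1)] Ec[OF m] by (simp add: A.r_distr)
    qed
    ultimately show ?case using r s by (intro exI[of _ ?N]) auto
  qed
  from this[of n] obtain N where N: "rf A ?R (replicate n 0) {\<zero>} N" "R.sub N" "\<forall>k<n. E k \<in> N" by auto
  have "m \<le> n ==> finsum A E {..<m} \<in> N" for m
  proof (induction m)
    case 0
    thus ?case using R.sub_zero[OF N(2)] by (simp add: reg_simps)
  next
    case (Suc m)
    have "E \<in> {..<m} \<rightarrow> carrier A" "E m \<in> carrier A" using Ec Suc.prems by auto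
    hence "finsum A E {..<Suc m} = E m \<oplus> finsum A E {..<m}" by (simp add: lessThan_Suc)
    thus ?case using Suc N(3) R.sub_add[OF N(2), of "E m" "finsum A E {..<m}"] by (simp add: reg_simps)
  qed
  hence "\<one> \<in> N" using E(3) by force
  hence "a \<in> N" if "a \<in> carrier A" for a using R.sub_ract[OF N(2) _ that, of \<one>] that by (simp add: reg_simps)
  hence "N = carrier ?R" using R.sub_carrier[OF N(2)] by (auto simp: reg_simps)
  moreover have "sorted (replicate n (0::int))" by (induction n) auto
  ultimately show ?thesis using N(1) reg unfolding filt_def by (auto simp: reg_simps intro!: exI[of _ "replicate n 0"])
qed

lemma htp_id_zero_dominated:
  assumes "dg_module A Z" "htp A Z Z (\<lambda>x. (zero Z)) (\<lambda>x. x)"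
  shows "dominated A Z (rst Z {zero Z})"
proof -
  interpret pdgm A Z by (rule pdgmI[OF assms(1)])
  have 1: "(\<lambda>x\<in>carrier Z. (zero Z)) \<in> dg_hom A Z (rst Z {zero Z})"
    by (rule dg_homI) (auto simp: ract_zero_l mdiff_zero mgr_zero mgr_carrier ract_closed mdiff_closed)
  have 2: "(\<lambda>x\<in>{zero Z}. (zero Z)) \<in> dg_hom A (rst Z {zero Z}) Z"
    by (rule dg_homI) (auto simp: ract_zero_l mdiff_zero mgr_zero)
  show ?thesis
    by (rule dominatedI[OF 1 2]) (use assms(2) htp_cong[of Z "\<lambda>x. (\<lambda>x\<in>{zero Z}. (zero Z)) ((\<lambda>x\<in>carrier Z. (zero Z)) x)" "\<lambda>x. (zero Z)" "\<lambda>x. x" "\<lambda>x. x" A Z] in simp)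
qed

text \<open>\<open>per_objects\<close> is an intersection, so it suffices that the class of modules
  dominated by filtered ones has the defining closure properties. Cones are covered by
  \<open>domf_cone\<close>; a direct summand or an isomorphic copy in dgHot is in particular a
  homotopy retract.\<close>

lemma per_domf:
  fixes N :: "('a, 'm) dgmodule"
  assumes N: "N \<in> per_objects A" and u: "\<exists>\<rho> :: 'm \<times> 'a \<Rightarrow> 'm. inj_on \<rho> (UNIV \<times> carrier A)"
    and i: "\<exists>\<iota> :: 'a \<Rightarrow> 'm. inj_on \<iota> (carrier A)"
  shows "dg_module A N \<and> domf TYPE('m) A N"
proof -
  let ?T = "{N :: ('a, 'm) dgmodule. dg_module A N \<and> domf TYPE('m) A N}"
  have dom: "X \<in> ?T" if "M \<in> ?T" "dg_module A X" "dominated A X M" for M X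
    using domf_dominated that by blast
  have "triangulated_subcategory A ?T"
    unfolding triangulated_subcategory_def
  proof (intro conjI allI impI ballI)
    fix Z :: "('a, 'm) dgmodule" assume z: "zero_object (dgHot A) Z"
    hence Z: "dg_module A Z" by (simp add: zero_object_def dgHot_simps)
    have "hcls A Z Z (hom_zero Z Z) = hcls A Z Z (hom_id Z)"
      using z hom_zero_hom[OF Z Z] hom_id_hom[OF Z] by (auto simp: zero_object_def dgHot_simps)
    hence "htp A Z Z (hom_zero Z Z) (hom_id Z)"
      using hcls_eq[OF Z Z hom_zero_hom[OF Z Z] hom_id_hom[OF Z]] by simp
    hence "htp A Z Z (\<lambda>x. (zero Z)) (\<lambda>x. x)"
      using htp_cong[of Z "hom_zero Z Z" "\<lambda>x. (zero Z)" "hom_id Z" "\<lambda>x. x" A Z] by (simp add: hom_zero_def hom_id_def)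
    thus "Z \<in> ?T" using htp_id_zero_dominated[OF Z] filt_zero[OF Z] Z unfolding domf_def by blast
  next
    fix M N :: "('a, 'm) dgmodule" assume M: "M \<in> ?T" and N: "dg_module A N \<and> isomorphic (dgHot A) M N"
    obtain F G where F: "F \<in> Mor (dgHot A) M N" "G \<in> Mor (dgHot A) N M"
      "Comp (dgHot A) N M N F G = Ident (dgHot A) N" using N by (auto simp: isomorphic_def is_iso_mor_def)
    obtain f g where f: "f \<in> dg_hom A M N" "F = hcls A M N f" and g: "g \<in> dg_hom A N M" "G = hcls A N M g"
      using F by (auto simp: dgHot_simps)
    have "dominated A N M"
      using F(3) f g hot_iso_htp[of N M g f] M N by (auto intro: dominatedI)
    thus "N \<in> ?T" using dom M N by blast
  next
    fix M :: "('a, 'm) dgmodule" and l assume M: "M \<in> ?T"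
    then obtain M' :: "('a, 'm) dgmodule" where M': "filt A M'" "dominated A M M'" by (auto simp: domf_def)
    hence "domf TYPE('m) A (shift l M)"
      using dominated_shift[of M M' l] filt_shift filt_dg M unfolding domf_def by blast
    thus "shift l M \<in> ?T" using shift_dg_module[of M l] M by simp
  next
    fix M N C :: "('a, 'm) dgmodule" and f
    assume M: "M \<in> ?T" and N: "N \<in> ?T" and f: "f \<in> dg_hom A M N"
      and C: "dg_module A C \<and> homotopy_equivalent A C (cone M N f)"
    have "domf TYPE('m) A (cone M N f)" using domf_cone[of M N f] M N f u by blast
    thus "C \<in> ?T"
      using domf_dominated[of C "cone M N f"] C homotopy_equivalent_dominated(1)[of C "cone M N f"] cone_dg_module[of M N f] M N f by auto
  qed auto
  moreover have "closed_under_summands A ?T"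
    unfolding closed_under_summands_def
  proof (intro ballI allI impI)
    interpret H: preadd "dgHot A :: (('a, 'm) dgmodule, _) precat" by (rule dgHot_preadd)
    fix P X Y :: "('a, 'm) dgmodule" assume P: "P \<in> ?T" and s: "is_direct_sum (dgHot A) P [X, Y]"
    from s obtain I R where *: "X \<in> Obj (dgHot A)" "I \<in> Mor (dgHot A) X P" "R \<in> Mor (dgHot A) P X"
      "Comp (dgHot A) X P X R I = Ident (dgHot A) X" by (rule H.direct_sum_pairE)
    then obtain i r where i: "i \<in> dg_hom A X P" "I = hcls A X P i" and r: "r \<in> dg_hom A P X" "R = hcls A P X r"
      by (auto simp: dgHot_simps)
    have "dominated A X P"
      using * i r hot_iso_htp[of X P i r] P by (auto simp: dgHot_simps intro: dominatedI)
    thus "X \<in> ?T" using dom P * by (simp add: dgHot_simps)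
  qed
  moreover have "contains_regular A ?T"
    unfolding contains_regular_def
  proof (intro allI impI)
    fix P :: "('a, 'm) dgmodule" assume P: "dg_module A P \<and> homotopy_equivalent A P (regular_dgmodule A)"
    obtain \<iota> :: "'a \<Rightarrow> 'm" where \<iota>: "inj_on \<iota> (carrier (regular_dgmodule A))" using i by (auto simp: reg_simps)
    have "dominated A (regular_dgmodule A) (transport \<iota> (regular_dgmodule A))"
      using homotopy_equivalent_dominated(1)[OF transport_dominated(1)[OF reg \<iota>]] .
    hence "domf TYPE('m) A (regular_dgmodule A)" using filt_transport[OF regular_filt \<iota>] unfolding domf_def by blast
    thus "P \<in> ?T" using P homotopy_equivalent_dominated(1)[of P "regular_dgmodule A"] domf_dominated[OF _ reg] by blast
  qed
  ultimately show ?thesis using N unfolding per_objects_def by blast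
qed

end

section \<open>Idempotents of the semisimple degree zero part\<close>

text \<open>\<open>finsum\<close> reads only these three fields, so sums may be moved between a ring
  and its regular module.\<close>

lemma finsum_cong_record:
  fixes G :: "('a, 'y) ring_scheme" and H :: "('a, 'z) ring_scheme"
  assumes "carrier G = carrier H" "add G = add H" "zero G = zero H"
  shows "finsum G f S = finsum H f S"
  using assms by (simp add: finsum_def finprod_def)

lemma internal_direct_sum_cong:
  fixes G :: "('a, 'y) ring_scheme" and H :: "('a, 'z) ring_scheme"
  assumes "carrier G = carrier H" "add G = add H" "zero G = zero H"
  shows "internal_direct_sum G I S \<longleftrightarrow> internal_direct_sum H I S"
proof -
  have fs: "finsum G c J = finsum H c J" for c :: "'b \<Rightarrow> 'a" and J
    by (rule finsum_cong_record[OF assms])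
  have "additive_subgroup X G \<longleftrightarrow> additive_subgroup X H" for X
    using assms by (simp add: additive_subgroup_def subgroup_def m_inv_def)
  thus ?thesis
    using fs assms unfolding internal_direct_sum_def by simp
qed

context dg_algebra
begin

lemma regular_dg: "dg_module A (regular_dgmodule A)"
proof -
  let ?R = "regular_dgmodule A"
  have s: "carrier ?R = carrier A" "zero ?R = zero A" "add ?R = add A" "ract ?R = monoid.mult A"
    "mgr ?R = agr A" "mdiff ?R = adiff A"
    by (simp_all add: regular_dgmodule_def)
  have ab: "abelian_group ?R"
  proof (rule abelian_groupI)
    fix x assume "x \<in> carrier ?R"
    thus "\<exists>y\<in>carrier ?R. y \<oplus>\<^bsub>?R\<^esub> x = (zero ?R)"
      by (intro bexI[of _ "\<ominus>\<^bsub>A\<^esub> x"]) (auto simp: s M.l_neg)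
  qed (auto simp: s M.a_ac)
  have inv: "\<ominus>\<^bsub>?R\<^esub> x = \<ominus>\<^bsub>A\<^esub> x" if "x \<in> carrier A" for x
    using abelian_group.minus_equality[OF ab, of "\<ominus>\<^bsub>A\<^esub> x" x] that by (simp add: s M.l_neg)
  interpret right_module A ?R
    by (intro right_module.intro right_module_axioms.intro ab A.ring_axioms)
      (simp_all add: s A.l_distr A.r_distr A.m_assoc)
  have c: "x \<in> carrier A" if "x \<in> agr A i" for x i
    using agr_sum that additive_subgroup.a_subset[of "agr A i" A] by (auto simp: internal_direct_sum_def)
  show ?thesis
  proof
    show "internal_direct_sum ?R UNIV (mgr ?R)"
      using agr_sum internal_direct_sum_cong[of ?R A UNIV "agr A"] by (simp add: s)
    fix m i a assume "m \<in> mgr ?R i" "a \<in> carrier A"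
    thus "mdiff ?R (ract ?R m a) = ract ?R (mdiff ?R m) a \<oplus>\<^bsub>?R\<^esub> sign ?R i (ract ?R m (adiff A a))"
      using adiff_mult[of m i a] adiff_closed c by (simp add: s sign_def inv)
  qed (simp_all add: s agr_mult adiff_closed adiff_add adiff_agr adiff_adiff)
qed

end

lemma degree_zero_simps [simp]:
  "carrier (degree_zero_ring A) = agr A 0" "monoid.mult (degree_zero_ring A) = monoid.mult A"
  "one (degree_zero_ring A) = one A" "zero (degree_zero_ring A) = zero A" "add (degree_zero_ring A) = add A"
  by (simp_all add: degree_zero_ring_def)

lemma regular_rmodule_simps [simp]:
  "carrier (regular_rmodule R) = carrier R" "add (regular_rmodule R) = add R"
  "zero (regular_rmodule R) = zero R" "ract (regular_rmodule R) = monoid.mult R"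
  by (simp_all add: regular_rmodule_def)

text \<open>The submodule generated by \<open>s\<close> contains \<open>s\<close>, hence is not
  zero.\<close>

lemma simple_rmodule_generator:
  assumes S: "simple_rmodule R S" and R: "ring R" and s: "s \<in> carrier S" "s \<noteq> (zero S)"
  shows "carrier S = (\<lambda>b. ract S s b) ` carrier R"
proof -
  interpret right_module R S using S by (simp add: simple_rmodule_def)
  let ?T = "(\<lambda>b. ract S s b) ` carrier R"
  have am: "addmap R S (ract S s)" using s by (auto intro!: addmapI simp: ract_closed ract_r_distr)
  have z: "ract S s (zero R) = (zero S)" by (rule addmap_zero[OF R.abelian_group_axioms M.abelian_group_axioms am])
  have "additive_subgroup ?T S"
  proof (rule M.add_subgroupI)
    show "(zero S) \<in> ?T" using z by (metis imageI R.zero_closed)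
    fix x assume "x \<in> ?T"
    then obtain b where b: "b \<in> carrier R" "x = ract S s b" by auto
    show "\<ominus>\<^bsub>S\<^esub> x \<in> ?T"
      using addmap_minus[OF R.abelian_group_axioms M.abelian_group_axioms am b(1)] b by (metis imageI R.a_inv_closed)
    fix y assume "y \<in> ?T"
    then obtain c where c: "c \<in> carrier R" "y = ract S s c" by auto
    have "x \<oplus>\<^bsub>S\<^esub> y = ract S s (b \<oplus>\<^bsub>R\<^esub> c)" using b c s by (simp add: ract_r_distr)
    thus "x \<oplus>\<^bsub>S\<^esub> y \<in> ?T" using b c by blast
  qed (use s in \<open>auto simp: ract_closed\<close>)
  moreover have "ract S x c \<in> ?T" if "x \<in> ?T" "c \<in> carrier R" for x c
    using that s by (auto simp: ract_assoc intro!: image_eqI)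
  ultimately have "?T = {zero S} \<or> ?T = carrier S" using S by (simp add: simple_rmodule_def rsubmodule_def)
  moreover have "s \<in> ?T" using s ract_one by (metis imageI R.one_closed)
  ultimately show ?thesis using s(2) by blast
qed

text \<open>The idempotents are the nonzero components of the unit in the simple summands, finitely
  many by definition of a direct sum. Projection to a summand is right linear, hence equals left
  multiplication by the component of the unit. This gives idempotency and orthogonality; primitivity
  is simplicity of the summand.\<close>

lemma semisimple_prims:
  fixes A :: "('k, 'a) dgalgebra"
  assumes ss: "semisimple_ring (degree_zero_ring A)" and reg: "dg_module A (regular_dgmodule A)"
  shows "\<exists>(n::nat) E. (\<forall>k<n. prim A (E k)) \<and>
      (\<forall>k<n. \<forall>l<n. k \<noteq> l \<longrightarrow> E k \<otimes>\<^bsub>A\<^esub> E l = (zero A)) \<and> finsum A E {..<n} = \<one>\<^bsub>A\<^esub>"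
proof -
  let ?R = "degree_zero_ring A"
  let ?G = "regular_rmodule ?R"
  interpret A: ring A using reg by (simp add: dg_module_def right_module_def)
  have ag: "agr A 0 \<subseteq> carrier A"
    using dg_module.mgr_carrier[OF reg] by (auto simp: regular_dgmodule_def)
  have R: "ring ?R" using ss by (simp add: semisimple_ring_def)
  interpret R: ring ?R by (rule R)
  obtain SS where SS: "\<And>S. S \<in> SS ==> rsubmodule ?R ?G S \<and> simple_rmodule ?R (?G\<lparr>carrier := S\<rparr>)"
    and ids: "internal_direct_sum ?G SS (\<lambda>S. S)" using ss by (auto simp: semisimple_ring_def)
  have ab: "abelian_group ?G"
  proof (rule abelian_groupI)
    fix x assume "x \<in> carrier ?G"
    thus "\<exists>y\<in>carrier ?G. y \<oplus>\<^bsub>?G\<^esub> x = (zero ?G)"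
      using R.a_inv_closed[of x] R.l_neg[of x] by (intro bexI[of _ "\<ominus>\<^bsub>?R\<^esub> x"]) simp_all
  qed (use R.a_assoc R.a_comm R.a_closed R.zero_closed R.l_zero in simp_all)
  interpret I: int_sum ?G SS "\<lambda>S. S" using ab ids by (simp add: int_sum_def int_sum_axioms_def)
  let ?c = "\<lambda>S. dcomp ?G SS (\<lambda>S. S) S"
  have Sr: "x \<otimes>\<^bsub>A\<^esub> b \<in> S" if "S \<in> SS" "x \<in> S" "b \<in> agr A 0" for S x b
    using SS[OF that(1)] that by (auto simp: rsubmodule_def)
  \<comment> \<open>Each summand is a right ideal, so right multiplication acts on components
    separately.\<close>
  have mul: "?c S (x \<otimes>\<^bsub>A\<^esub> b) = ?c S x \<otimes>\<^bsub>A\<^esub> b" if x: "x \<in> carrier ?G" and b: "b \<in> agr A 0" and S: "S \<in> SS" for x b S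
    using x
  proof (induction x rule: I.int_sum_induct)
    case zero
    thus ?case using I.dcomp_mem[OF S S I.S_zero[OF S]] b R.l_null[of b] by simp
  next
    case (hom S' x)
    thus ?case using I.dcomp_mem[OF S hom] I.dcomp_mem[OF S hom(1) Sr[OF hom b]] b R.l_null[of b] by simp
  next
    case (add x y)
    have "?c S ((x \<oplus>\<^bsub>A\<^esub> y) \<otimes>\<^bsub>A\<^esub> b) = ?c S (x \<otimes>\<^bsub>A\<^esub> b \<oplus>\<^bsub>A\<^esub> y \<otimes>\<^bsub>A\<^esub> b)"
      using R.l_distr[of x y b] add b by simp
    also have "\<dots> = ?c S (x \<otimes>\<^bsub>A\<^esub> b) \<oplus>\<^bsub>A\<^esub> ?c S (y \<otimes>\<^bsub>A\<^esub> b)"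
      using I.dcomp_add[OF S, of "x \<otimes>\<^bsub>A\<^esub> b" "y \<otimes>\<^bsub>A\<^esub> b"] R.m_closed[of _ b] add b by simp
    also have "\<dots> = (?c S x \<oplus>\<^bsub>A\<^esub> ?c S y) \<otimes>\<^bsub>A\<^esub> b"
      using R.l_distr[of "?c S x" "?c S y" b] I.S_carrier[OF S I.dcomp_spec(1)] add b S by simp
    finally show ?case using I.dcomp_add[OF S, of x y] add by simp
  qed
  define e where "e S = ?c S \<one>\<^bsub>A\<^esub>" for S
  define F where "F = {S \<in> SS. e S \<noteq> (zero A)}"
  have one: "\<one>\<^bsub>A\<^esub> \<in> carrier ?G" using R.one_closed by simp
  have F: "finite F" "finsum ?G e F = \<one>\<^bsub>A\<^esub>"
    using I.dcomp_spec(2)[OF one] I.dcomp_spec(3)[OF one, symmetric] by (simp_all add: F_def e_def[abs_def])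
  have eS: "e S \<in> S" "e S \<in> agr A 0" if "S \<in> SS" for S
    using I.dcomp_spec(1)[OF one that] I.S_carrier[OF that] that by (auto simp: e_def)
  have eb: "e S \<otimes>\<^bsub>A\<^esub> b = (if S = S' then b else (zero A))" if S: "S \<in> SS" "S' \<in> SS" and b: "b \<in> S'" for S S' b
  proof -
    have bc: "b \<in> agr A 0" using I.S_carrier[OF S(2) b] by simp
    have "e S \<otimes>\<^bsub>A\<^esub> b = ?c S (\<one>\<^bsub>A\<^esub> \<otimes>\<^bsub>A\<^esub> b)" using mul[OF one bc S(1)] by (simp add: e_def)
    thus ?thesis using I.dcomp_mem[OF S b] R.l_one[of b] bc by simp
  qed
  have pr: "prim A (e S)" if "S \<in> F" for S
    unfolding prim_def
  proof (intro conjI ballI impI)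
    have S: "S \<in> SS" "e S \<noteq> (zero A)" using that by (auto simp: F_def)
    show "e S \<in> agr A 0" "e S \<otimes>\<^bsub>A\<^esub> e S = e S" "e S \<noteq> (zero A)" using eS[OF S(1)] eb[OF S(1) S(1)] S by auto
    fix b assume b: "b \<in> agr A 0" "e S \<otimes>\<^bsub>A\<^esub> b \<noteq> (zero A)"
    have "carrier (?G\<lparr>carrier := S\<rparr>) = ract (?G\<lparr>carrier := S\<rparr>) (e S \<otimes>\<^bsub>A\<^esub> b) ` carrier ?R"
      by (rule simple_rmodule_generator[OF _ R]) (use SS[OF S(1)] Sr[OF S(1) eS(1)[OF S(1)] b(1)] b in auto)
    hence "e S \<in> (\<otimes>\<^bsub>A\<^esub>) (e S \<otimes>\<^bsub>A\<^esub> b) ` agr A 0" using eS(1)[OF S(1)] by simp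
    thus "\<exists>c\<in>agr A 0. e S \<otimes>\<^bsub>A\<^esub> b \<otimes>\<^bsub>A\<^esub> c = e S" by force
  qed
  obtain h :: "nat \<Rightarrow> 'a set" where h: "bij_betw h {0..<card F} F" using ex_bij_betw_nat_finite[OF F(1)] by blast
  let ?n = "card F" and ?E = "\<lambda>k. e (h k)"
  have hF: "h k \<in> F" if "k < ?n" for k using h that by (auto simp: bij_betw_def)
  have "addmap ?G A (\<lambda>x. x)" using ag by (auto intro!: addmapI)
  hence "finsum A e F = \<one>\<^bsub>A\<^esub>"
    using addmap_finsum[OF ab A.abelian_group_axioms, of "\<lambda>x. x" F e] F eS by (auto simp: F_def)
  moreover have "finsum A e F = finsum A (\<lambda>k. e (h k)) {..<?n}"
  proof -
    have hh: "h ` {..<?n} = F" "inj_on h {..<?n}" using h by (auto simp: bij_betw_def atLeast0LessThan)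
    have "e \<in> h ` {..<?n} \<rightarrow> carrier A" unfolding hh(1) using eS(2) ag by (auto simp: F_def)
    from A.finsum_reindex[OF this hh(2)] show ?thesis using hh(1) by simp
  qed
  moreover have "?E k \<otimes>\<^bsub>A\<^esub> ?E l = (zero A)" if "k < ?n" "l < ?n" "k \<noteq> l" for k l
  proof -
    have "h k \<noteq> h l" using h that by (auto simp: bij_betw_def inj_on_def)
    thus ?thesis using eb[of "h k" "h l" "?E l"] hF[OF that(1)] hF[OF that(2)] eS(1) by (auto simp: F_def)
  qed
  ultimately show ?thesis using pr hF by (intro exI[of _ ?n] exI[of _ ?E]) auto
qed

lemma pdga_dg_algebra:
  assumes "dg_algebra K A" "\<forall>i<0. agr A i = {zero A}" "semisimple_ring (degree_zero_ring A)"
    "\<forall>a\<in>agr A 0. adiff A a = (zero A)"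
  shows "pdga A"
proof -
  interpret dg_algebra K A by fact
  show ?thesis
    by (rule pdga.intro[OF regular_dg agr_one _ _ semisimple_prims[OF assms(3) regular_dg]])
      (use assms(2,4) in auto)
qed

section \<open>Simple modules and their induced dg modules\<close>

text \<open>\<open>l\<close> identifies the right ideal generated by \<open>e\<close> with the module \<open>L\<close>.\<close>

definition gen_by :: "('k, 'a) dgalgebra \<Rightarrow> ('a, 'm) rmodule \<Rightarrow> 'a \<Rightarrow> 'm \<Rightarrow> bool" where
  "gen_by A L e l \<longleftrightarrow> right_module (degree_zero_ring A) L \<and> prim A e \<and> l \<in> carrier L \<and> ract L l e = l \<and>
     (\<forall>x\<in>carrier L. \<exists>b\<in>agr A 0. x = ract L l b) \<and> (\<forall>b\<in>agr A 0. ract L l b = (zero L) \<longrightarrow> e \<otimes>\<^bsub>A\<^esub> b = (zero A))"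

context pdga
begin

lemma degree_zero_ring: "ring (degree_zero_ring A)"
proof (rule ringI)
  have am: "a \<oplus> b \<in> agr A 0" if "a \<in> agr A 0" "b \<in> agr A 0" for a b
    using dg_module.mgr_add[OF reg, unfolded reg_simps] that .
  have mi: "\<ominus> a \<in> agr A 0" if a: "a \<in> agr A 0" for a
  proof -
    have "\<ominus>\<^bsub>regular_dgmodule A\<^esub> a = \<ominus> a"
      using abelian_group.minus_equality[of "regular_dgmodule A" "\<ominus> a" a] reg agr_carrier[OF a]
      by (simp add: dg_module_def right_module_def reg_simps A.l_neg)
    thus ?thesis using dg_module.mgr_minus[OF reg, unfolded reg_simps, OF a] by simp
  qed
  show "abelian_group (degree_zero_ring A)"
  proof (rule abelian_groupI)
    fix x assume "x \<in> carrier (degree_zero_ring A)"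
    thus "\<exists>y\<in>carrier (degree_zero_ring A). y \<oplus>\<^bsub>degree_zero_ring A\<^esub> x = \<zero>\<^bsub>degree_zero_ring A\<^esub>"
      using mi agr_carrier by (intro bexI[of _ "\<ominus> x"]) (auto simp: A.l_neg)
  qed (use am agr_zero agr_carrier in \<open>auto simp: A.a_ac\<close>)
  show "monoid (degree_zero_ring A)"
    by (rule monoidI) (use agr_mult0 one_deg agr_carrier in \<open>auto simp: A.m_assoc\<close>)
qed (use agr_carrier in \<open>auto simp: A.l_distr A.r_distr\<close>)

text \<open>As the \<open>E k\<close> sum to one, some product of \<open>x\<close> with an
  \<open>E k\<close> is nonzero, and it serves as \<open>l\<close>. If l b = 0 but e b is nonzero,
  then e = e b c for some \<open>c\<close>, and l = l e = l b c = 0.\<close>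

lemma simple_gen_by:
  assumes S: "simple_rmodule (degree_zero_ring A) (L :: ('a, 'm) rmodule)"
  shows "\<exists>e l. gen_by A L e l"
proof -
  let ?R = "degree_zero_ring A"
  interpret right_module ?R L using S by (simp add: simple_rmodule_def)
  obtain x where x: "x \<in> carrier L" "x \<noteq> (zero L)" using S M.zero_closed unfolding simple_rmodule_def by blast
  obtain n :: nat and E where E: "\<forall>k<n. prim A (E k)" "finsum A E {..<n} = \<one>" using prims by blast
  have "\<exists>k<n. ract L x (E k) \<noteq> (zero L)"
  proof (rule ccontr)
    assume a: "\<not> (\<exists>k<n. ract L x (E k) \<noteq> (zero L))"
    have Ec: "E \<in> {..<n} \<rightarrow> carrier ?R" using E prim_deg by auto
    have "finsum A E {..<n} = finsum ?R E {..<n}"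
      using addmap_finsum[OF R.abelian_group_axioms A.abelian_group_axioms, of "\<lambda>x. x" "{..<n}" E] Ec agr_carrier
      by (simp add: addmap_def Pi_iff)
    hence "x = ract L x (finsum ?R E {..<n})" using E ract_one[OF x(1)] by simp
    also have "\<dots> = finsum L (\<lambda>k. ract L x (E k)) {..<n}"
      by (rule addmap_finsum[OF R.abelian_group_axioms M.abelian_group_axioms _ _ Ec])
        (use x in \<open>auto intro!: addmapI simp: ract_closed ract_r_distr simp del: degree_zero_simps\<close>)
    also have "\<dots> = finsum L (\<lambda>k. (zero L)) {..<n}" by (rule M.finsum_cong') (use a in auto)
    also have "\<dots> = (zero L)" by simp
    finally show False using x by simp
  qed
  then obtain k where k: "k < n" "ract L x (E k) \<noteq> (zero L)" by blast
  define e where "e = E k"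
  define l where "l = ract L x e"
  have e: "prim A e" using E k by (simp add: e_def)
  have e0: "e \<in> carrier ?R" using prim_deg[OF e] by simp
  have l: "l \<in> carrier L" "l \<noteq> (zero L)" using x k e0 by (auto simp: l_def e_def ract_closed simp del: degree_zero_simps)
  have le: "ract L l e = l" using ract_assoc[OF x(1) e0 e0] prim_idem[OF e] by (simp add: l_def)
  have "carrier L = (\<lambda>b. ract L l b) ` carrier ?R" by (rule simple_rmodule_generator[OF S degree_zero_ring l])
  moreover have "e \<otimes> b = \<zero>" if b: "b \<in> agr A 0" "ract L l b = (zero L)" for b
  proof (rule ccontr)
    assume "e \<otimes> b \<noteq> \<zero>"
    then obtain c where c: "c \<in> agr A 0" "e \<otimes> b \<otimes> c = e" using e b by (auto simp: prim_def)
    have "l = ract L l (e \<otimes> b \<otimes> c)" using c le by simp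
    also have "\<dots> = ract L (ract L (ract L l e) b) c"
      using ract_assoc[of l e b] ract_assoc[of l "e \<otimes> b" c] l e0 b c agr_mult0[of e b] by (simp add: ract_closed)
    also have "\<dots> = ract L (zero L) c" using le b by simp
    also have "\<dots> = (zero L)" by (rule M.idem_zero) (use c ract_closed[of "zero L" c] ract_l_distr[of "zero L" "zero L" c] in auto)
    finally show False using l by simp
  qed
  ultimately have "gen_by A L e l"
    unfolding gen_by_def using right_module_axioms e l le by auto
  thus ?thesis by blast
qed

lemma gen_by_transfer:
  assumes g: "gen_by A S e s" and L: "simple_rmodule (degree_zero_ring A) L" and i: "rmodule_iso (degree_zero_ring A) S L"
  shows "\<exists>l. gen_by A L e l"
proof -
  let ?R = "degree_zero_ring A"
  have gS: "right_module ?R S" "prim A e" "s \<in> carrier S" "ract S s e = s"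
    "\<And>x. x \<in> carrier S ==> \<exists>b\<in>agr A 0. x = ract S s b" "\<And>b. [|b \<in> agr A 0; ract S s b = (zero S)|] ==> e \<otimes> b = \<zero>"
    using g by (auto simp: gen_by_def)
  interpret S: right_module ?R S by (rule gS(1))
  interpret L: right_module ?R L using L by (simp add: simple_rmodule_def)
  obtain f where f: "bij_betw f (carrier S) (carrier L)"
    "\<And>x y. [|x \<in> carrier S; y \<in> carrier S|] ==> f (x \<oplus>\<^bsub>S\<^esub> y) = f x \<oplus>\<^bsub>L\<^esub> f y"
    "\<And>x r. [|x \<in> carrier S; r \<in> carrier ?R|] ==> f (ract S x r) = ract L (f x) r"
    using i by (auto simp: rmodule_iso_def)
  have fc: "f x \<in> carrier L" if "x \<in> carrier S" for x using f(1) that by (auto simp: bij_betw_def)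
  have f0: "f (zero S) = (zero L)"
    by (rule addmap_zero[OF S.M.abelian_group_axioms L.M.abelian_group_axioms]) (use f(2) fc in \<open>auto intro: addmapI\<close>)
  have "gen_by A L e (f s)"
    unfolding gen_by_def
  proof (intro conjI ballI impI)
    show "ract L (f s) e = f s" using f(3)[OF gS(3), of e] gS prim_deg by simp
    fix x assume "x \<in> carrier L"
    then obtain y where y: "y \<in> carrier S" "x = f y" using f(1) by (auto simp: bij_betw_def)
    then obtain b where "b \<in> agr A 0" "y = ract S s b" using gS(5) by blast
    thus "\<exists>b\<in>agr A 0. x = ract L (f s) b" using y f(3)[OF gS(3), of b] by auto
  next
    fix b assume b: "b \<in> agr A 0" "ract L (f s) b = (zero L)"
    hence "f (ract S s b) = f (zero S)" using f(3)[OF gS(3), of b] f0 by simp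
    hence "ract S s b = (zero S)"
      using f(1) S.ract_closed[OF gS(3), of b] b unfolding bij_betw_def inj_on_def by simp
    thus "e \<otimes> b = \<zero>" using gS(6) b by blast
  qed (use gS fc L.right_module_axioms in auto)
  thus ?thesis by blast
qed

text \<open>A copy of e A^0 on the type \<open>'m\<close>, because
  \<open>simple_representatives\<close> speaks of simple modules carried by that type.\<close>

lemma prim_simple_module:
  fixes \<iota> :: "'a \<Rightarrow> 'm"
  assumes e: "prim A e" and i: "inj_on \<iota> (carrier A)"
  shows "\<exists>S :: ('a, 'm) rmodule. \<exists>s. simple_rmodule (degree_zero_ring A) S \<and> gen_by A S e s"
proof -
  let ?R = "degree_zero_ring A"
  interpret R: ring ?R by (rule degree_zero_ring)
  let ?I = "(\<otimes>) e ` agr A 0"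
  have e0: "e \<in> agr A 0" and ec: "e \<in> carrier A" and ee: "e \<otimes> e = e" using e prim_deg prim_carrier prim_idem by auto
  have I: "x \<in> agr A 0 \<and> x \<in> carrier A \<and> e \<otimes> x = x" if "x \<in> ?I" for x
    using that e0 ec ee agr_mult0 agr_carrier by (auto simp flip: A.m_assoc)
  have I': "x \<in> ?I" if "x \<in> agr A 0" "e \<otimes> x = x" for x using that by (metis imageI)
  define k where "k = inv_into (carrier A) \<iota>"
  have k\<iota>: "k (\<iota> x) = x" if "x \<in> carrier A" for x using i that by (simp add: k_def)
  define S :: "('a, 'm) rmodule" where "S = \<lparr>carrier = \<iota> ` ?I, monoid.mult = undefined, one = undefined,
     zero = \<iota> \<zero>, add = (\<lambda>x y. \<iota> (k x \<oplus> k y)), ract = (\<lambda>x a. \<iota> (k x \<otimes> a))\<rparr>"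
  have S: "carrier S = \<iota> ` ?I" "zero S = \<iota> \<zero>" "add S = (\<lambda>x y. \<iota> (k x \<oplus> k y))" "ract S = (\<lambda>x a. \<iota> (k x \<otimes> a))"
    by (simp_all add: S_def)
  have Ia: "x \<oplus> y \<in> ?I" if "x \<in> ?I" "y \<in> ?I" for x y
    by (rule I') (use I[OF that(1)] I[OF that(2)] R.a_closed[of x y] ec in \<open>auto simp: A.r_distr\<close>)
  have Im: "\<ominus> x \<in> ?I" if "x \<in> ?I" for x
  proof (rule I')
    have "\<ominus>\<^bsub>?R\<^esub> x = \<ominus> x"
      using R.minus_equality[of "\<ominus>\<^bsub>?R\<^esub> x" x] A.minus_equality[of "\<ominus>\<^bsub>?R\<^esub> x" x] I[OF that] R.l_neg[of x] R.a_inv_closed[of x] agr_carrier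
      by simp
    thus "\<ominus> x \<in> agr A 0" using R.a_inv_closed[of x] I[OF that] by simp
    show "e \<otimes> \<ominus> x = \<ominus> x" using I[OF that] ec by (simp add: A.r_minus)
  qed
  have Ir: "x \<otimes> b \<in> ?I" if "x \<in> ?I" "b \<in> agr A 0" for x b
    by (rule I') (use I[OF that(1)] that agr_mult0 agr_carrier ec in \<open>auto simp flip: A.m_assoc\<close>)
  have I0: "\<zero> \<in> ?I" by (rule I') (use agr_zero ec in auto)
  have ab: "abelian_group S"
  proof (rule abelian_groupI)
    fix x assume "x \<in> carrier S"
    then obtain x' where x': "x' \<in> ?I" "x = \<iota> x'" by (auto simp: S)
    show "\<exists>y\<in>carrier S. y \<oplus>\<^bsub>S\<^esub> x = (zero S)"
      using x' Im[OF x'(1)] I[OF x'(1)] by (intro bexI[of _ "\<iota> (\<ominus> x')"]) (auto simp: S k\<iota> A.l_neg)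
    show "(zero S) \<oplus>\<^bsub>S\<^esub> x = x" using x' I[OF x'(1)] by (simp add: S k\<iota>)
    fix y assume "y \<in> carrier S"
    then obtain y' where y': "y' \<in> ?I" "y = \<iota> y'" by (auto simp: S)
    show "x \<oplus>\<^bsub>S\<^esub> y \<in> carrier S" using x' y' I[OF x'(1)] I[OF y'(1)] Ia[OF x'(1) y'(1)] by (simp add: S k\<iota>)
    show "x \<oplus>\<^bsub>S\<^esub> y = y \<oplus>\<^bsub>S\<^esub> x" using x' y' I[OF x'(1)] I[OF y'(1)] by (simp add: S k\<iota> A.a_comm)
    fix z assume "z \<in> carrier S"
    then obtain z' where z': "z' \<in> ?I" "z = \<iota> z'" by (auto simp: S)
    show "x \<oplus>\<^bsub>S\<^esub> y \<oplus>\<^bsub>S\<^esub> z = x \<oplus>\<^bsub>S\<^esub> (y \<oplus>\<^bsub>S\<^esub> z)"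
      using x' y' z' I[OF x'(1)] I[OF y'(1)] I[OF z'(1)] by (simp add: S k\<iota> A.a_assoc)
  next
    show "(zero S) \<in> carrier S" using I0 by (simp add: S)
  qed
  have rm: "right_module ?R S"
  proof (intro right_module.intro right_module_axioms.intro R.ring_axioms ab)
    fix x r s assume "x \<in> carrier S" and r: "r \<in> carrier ?R"
    then obtain x' where x': "x' \<in> ?I" "x = \<iota> x'" by (auto simp: S)
    have rc: "r \<in> carrier A" "r \<in> agr A 0" using r agr_carrier by auto
    show "ract S x r \<in> carrier S" using x' I[OF x'(1)] Ir[OF x'(1)] r by (simp add: S k\<iota>)
    show "ract S (x \<oplus>\<^bsub>S\<^esub> y) r = ract S x r \<oplus>\<^bsub>S\<^esub> ract S y r" if y: "y \<in> carrier S" for y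
    proof -
      obtain y' where y': "y' \<in> ?I" "y = \<iota> y'" using y by (auto simp: S)
      show ?thesis using x' y' I[OF x'(1)] I[OF y'(1)] rc by (simp add: S k\<iota> A.l_distr)
    qed
    assume s: "s \<in> carrier ?R"
    hence sc: "s \<in> carrier A" using agr_carrier by auto
    show "ract S x (r \<oplus>\<^bsub>?R\<^esub> s) = ract S x r \<oplus>\<^bsub>S\<^esub> ract S x s" using x' I[OF x'(1)] rc sc by (simp add: S k\<iota> A.r_distr)
    show "ract S (ract S x r) s = ract S x (r \<otimes>\<^bsub>?R\<^esub> s)" using x' I[OF x'(1)] rc sc by (simp add: S k\<iota> A.m_assoc)
  next
    fix x assume "x \<in> carrier S"
    then obtain x' where x': "x' \<in> ?I" "x = \<iota> x'" by (auto simp: S)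
    thus "ract S x \<one>\<^bsub>?R\<^esub> = x" using I[OF x'(1)] by (simp add: S k\<iota>)
  qed
  have eI: "e \<in> ?I" by (rule I'[OF e0 ee])
  have inj: "\<iota> x = \<iota> y \<longleftrightarrow> x = y" if "x \<in> carrier A" "y \<in> carrier A" for x y
    using i that by (auto simp: inj_on_def)
  have g: "gen_by A S e (\<iota> e)"
    unfolding gen_by_def
  proof (intro conjI ballI impI)
    show "\<iota> e \<in> carrier S" using eI by (simp add: S)
    show "ract S (\<iota> e) e = \<iota> e" using ec ee by (simp add: S k\<iota>)
    fix x assume "x \<in> carrier S"
    then obtain b where "b \<in> agr A 0" "x = \<iota> (e \<otimes> b)" by (auto simp: S)
    thus "\<exists>b\<in>agr A 0. x = ract S (\<iota> e) b" using ec by (auto simp: S k\<iota>)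
  next
    fix b assume "b \<in> agr A 0" "ract S (\<iota> e) b = (zero S)"
    thus "e \<otimes> b = \<zero>" using inj[of "e \<otimes> b" \<zero>] ec agr_carrier by (simp add: S k\<iota>)
  qed (use rm e in auto)
  have "simple_rmodule ?R S"
    unfolding simple_rmodule_def
  proof (intro conjI allI impI)
    show "right_module ?R S" by (rule rm)
    show "carrier S \<noteq> {zero S}" using eI inj[of e \<zero>] ec prim_nz[OF e] unfolding S by blast
    fix N assume N: "rsubmodule ?R S N"
    hence Ns: "additive_subgroup N S" and Nr: "\<And>n r. [|n \<in> N; r \<in> agr A 0|] ==> ract S n r \<in> N"
      by (auto simp: rsubmodule_def)
    have NC: "N \<subseteq> carrier S" and N0: "(zero S) \<in> N" using additive_subgroup.a_subset[OF Ns] additive_subgroup.zero_closed[OF Ns] by auto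
    show "N = {zero S} \<or> N = carrier S"
    proof (cases "N = {zero S}")
      case False
      then obtain x where x: "x \<in> N" "x \<noteq> (zero S)" using N0 by blast
      have "x \<in> \<iota> ` ?I" using subsetD[OF NC x(1)] by (simp add: S(1))
      then obtain x' where x': "x' \<in> ?I" "x = \<iota> x'" by (rule imageE) (rule that)
      have xI: "x' \<in> agr A 0" "x' \<in> carrier A" "e \<otimes> x' = x'" using I[OF x'(1)] by auto
      have "x' \<noteq> \<zero>" using x x' by (auto simp: S)
      then obtain c where c: "c \<in> agr A 0" "x' \<otimes> c = e" using e xI unfolding prim_def by metis
      have "ract S x c = \<iota> e" using x' xI c by (simp add: S k\<iota>)
      hence eN: "\<iota> e \<in> N" using Nr[OF x(1) c(1)] by simp
      have "carrier S \<subseteq> N"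
      proof
        fix y assume "y \<in> carrier S"
        then obtain b where "b \<in> agr A 0" "y = \<iota> (e \<otimes> b)" by (auto simp: S)
        thus "y \<in> N" using Nr[OF eN, of b] ec by (simp add: S k\<iota>)
      qed
      thus ?thesis using NC by auto
    qed simp
  qed
  thus ?thesis using g by blast
qed

end

section \<open>Induced dg modules and the objects of dgFilt\<close>

locale induced_ctx = pdga A for A :: "('k, 'a) dgalgebra" (structure) +
  fixes L :: "('a, 'm) rmodule" and e :: 'a and l :: 'm
  assumes gen: "gen_by A L e l"
begin

lemma genD: "right_module (degree_zero_ring A) L" "prim A e" "l \<in> carrier L" "ract L l e = l"
  "x \<in> carrier L ==> \<exists>b\<in>agr A 0. x = ract L l b" "[|b \<in> agr A 0; ract L l b = (zero L)|] ==> e \<otimes> b = \<zero>"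
  using gen by (auto simp: gen_by_def)

lemma ec: "e \<in> carrier A" and e0: "e \<in> agr A 0" and ee: "e \<otimes> e = e"
  using genD(2) prim_carrier prim_deg prim_idem by auto

text \<open>The inverse of the isomorphism from e A^0 to \<open>L\<close> that sends
  \<open>b\<close> to l b.\<close>

definition psi :: "'m \<Rightarrow> 'a" where
  "psi m = (SOME b. b \<in> agr A 0 \<and> e \<otimes> b = b \<and> m = ract L l b)"

lemma psi_eqI:
  assumes "b \<in> agr A 0" "e \<otimes> b = b" "m = ract L l b"
  shows "psi m = b"
proof -
  interpret R: ring "degree_zero_ring A" by (rule degree_zero_ring)
  interpret L: right_module "degree_zero_ring A" L by (rule genD(1))
  have "psi m \<in> agr A 0 \<and> e \<otimes> psi m = psi m \<and> m = ract L l (psi m)"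
    unfolding psi_def by (rule someI[of _ b]) (use assms in simp)
  hence p: "psi m \<in> agr A 0" "e \<otimes> psi m = psi m" "m = ract L l (psi m)" by auto
  have am: "addmap (degree_zero_ring A) L (ract L l)"
    using genD(3) by (auto intro!: addmapI simp: L.ract_closed L.ract_r_distr simp del: degree_zero_simps)
  have "ract L l (psi m \<ominus>\<^bsub>degree_zero_ring A\<^esub> b) = ract L l (psi m) \<ominus>\<^bsub>L\<^esub> ract L l b"
    by (rule addmap_diff[OF R.abelian_group_axioms L.M.abelian_group_axioms am]) (use p assms in auto)
  also have "\<dots> = m \<ominus>\<^bsub>L\<^esub> m" using p(3) assms(3) by simp
  also have "\<dots> = (zero L)" using assms L.ract_closed[OF genD(3)] by (simp add: a_minus_def L.M.r_neg)
  finally have z: "e \<otimes> (psi m \<ominus>\<^bsub>degree_zero_ring A\<^esub> b) = \<zero>"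
    using genD(6) R.minus_closed[of "psi m" b] p(1) assms(1) by simp
  have "psi m = (psi m \<ominus>\<^bsub>degree_zero_ring A\<^esub> b) \<oplus> b"
    using R.add.inv_solve_right'[of "psi m" b] p(1) assms(1) R.a_assoc[of "psi m" "\<ominus>\<^bsub>degree_zero_ring A\<^esub> b" b] R.l_neg[of b]
      R.a_inv_closed[of b] R.r_zero[of "psi m"] by (simp add: a_minus_def)
  hence "e \<otimes> psi m = e \<otimes> (psi m \<ominus>\<^bsub>degree_zero_ring A\<^esub> b) \<oplus> e \<otimes> b"
    using A.r_distr[of "psi m \<ominus>\<^bsub>degree_zero_ring A\<^esub> b" b e] ec agr_carrier R.minus_closed[of "psi m" b] p(1) assms(1)
    by (metis degree_zero_simps(1))
  thus ?thesis using z p(2) assms agr_carrier by simp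
qed

lemma psi_spec:
  assumes "m \<in> carrier L"
  shows "psi m \<in> agr A 0" "psi m \<in> carrier A" "e \<otimes> psi m = psi m" "ract L l (psi m) = m"
proof -
  interpret L: right_module "degree_zero_ring A" L by (rule genD(1))
  obtain b where b: "b \<in> agr A 0" "m = ract L l b" using genD(5) assms by blast
  have "m = ract L l (e \<otimes> b)" using L.ract_assoc[OF genD(3), of e b] b e0 genD(4) by simp
  moreover have "e \<otimes> (e \<otimes> b) = e \<otimes> b" using ec ee b agr_carrier by (simp flip: A.m_assoc)
  moreover have "e \<otimes> b \<in> agr A 0" using e0 b agr_mult0 by simp
  ultimately have "psi m = e \<otimes> b" using psi_eqI by blast
  thus "psi m \<in> agr A 0" "psi m \<in> carrier A" "e \<otimes> psi m = psi m" "ract L l (psi m) = m"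
    using \<open>m = ract L l (e \<otimes> b)\<close> \<open>e \<otimes> (e \<otimes> b) = e \<otimes> b\<close> \<open>e \<otimes> b \<in> agr A 0\<close> agr_carrier by auto
qed

lemma psi_add: "[|m \<in> carrier L; m' \<in> carrier L|] ==> psi (m \<oplus>\<^bsub>L\<^esub> m') = psi m \<oplus> psi m'"
proof -
  assume m: "m \<in> carrier L" "m' \<in> carrier L"
  interpret L: right_module "degree_zero_ring A" L by (rule genD(1))
  show ?thesis
    using psi_spec[OF m(1)] psi_spec[OF m(2)] L.ract_r_distr[OF genD(3), of "psi m" "psi m'"] ec
      dg_module.mgr_add[OF reg, unfolded reg_simps]
    by (intro psi_eqI) (auto simp: A.r_distr)
qed

lemma psi_ract: "[|m \<in> carrier L; r \<in> agr A 0|] ==> psi (ract L m r) = psi m \<otimes> r"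
proof -
  assume m: "m \<in> carrier L" "r \<in> agr A 0"
  interpret L: right_module "degree_zero_ring A" L by (rule genD(1))
  show ?thesis
    using psi_spec[OF m(1)] L.ract_assoc[OF genD(3), of "psi m" r] m ec agr_carrier[OF m(2)] agr_mult0
    by (intro psi_eqI) (auto simp flip: A.m_assoc)
qed

lemma psi_l: "psi l = e"
  by (rule psi_eqI) (use e0 ee genD(4) in auto)

section \<open>The tensor product and its identification with eA\<close>

abbreviation "TT \<equiv> tensor_free A L"
abbreviation "HH \<equiv> generate (tensor_free A L) (tensor_relations A L)"
abbreviation "cl \<equiv> tensor_class A L"
abbreviation "SS \<equiv> carrier L \<times> carrier A"

lemma L_add: "[|m \<in> carrier L; m' \<in> carrier L|] ==> m \<oplus>\<^bsub>L\<^esub> m' \<in> carrier L"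
  and L_ract: "[|m \<in> carrier L; r \<in> agr A 0|] ==> ract L m r \<in> carrier L"
proof -
  interpret L: right_module "degree_zero_ring A" L by (rule genD(1))
  show "[|m \<in> carrier L; m' \<in> carrier L|] ==> m \<oplus>\<^bsub>L\<^esub> m' \<in> carrier L" by simp
  show "[|m \<in> carrier L; r \<in> agr A 0|] ==> ract L m r \<in> carrier L" using L.ract_closed by simp
qed

abbreviation "supp \<equiv> Poly_Mapping.keys"

lemma keys_diff': "[|supp u \<subseteq> S; supp v \<subseteq> S|] ==> supp (u - v) \<subseteq> S"
  using keys_diff[of u v] by blast

lemma rel_carrier: "tensor_relations A L \<subseteq> carrier TT"
proof
  fix u assume u: "u \<in> tensor_relations A L"
  have k: "supp (frag_of x) \<subseteq> SS \<longleftrightarrow> x \<in> SS" for x by (simp add: keys_frag_of)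
  have "supp u \<subseteq> SS"
    using u unfolding tensor_relations_def Un_iff mem_Collect_eq
  proof (elim disjE exE conjE)
    fix x x' a assume "u = frag_of (x \<oplus>\<^bsub>L\<^esub> x', a) - frag_of (x, a) - frag_of (x', a)"
      "x \<in> carrier L" "x' \<in> carrier L" "a \<in> carrier A"
    thus ?thesis by (simp add: keys_diff' k L_add)
  next
    fix x a a' assume "u = frag_of (x, a \<oplus> a') - frag_of (x, a) - frag_of (x, a')"
      "x \<in> carrier L" "a \<in> carrier A" "a' \<in> carrier A"
    thus ?thesis by (simp add: keys_diff' k)
  next
    fix x r a assume "u = frag_of (ract L x r, a) - frag_of (x, r \<otimes> a)"
      "x \<in> carrier L" "r \<in> agr A 0" "a \<in> carrier A"
    thus ?thesis using agr_carrier[of r] by (simp add: keys_diff' k L_ract)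
  qed
  thus "u \<in> carrier TT" by (simp add: tensor_free_def)
qed

lemma HH_subgroup: "subgroup HH TT"
  using group.generate_is_subgroup[OF _ rel_carrier] group_free_Abelian_group by (simp add: tensor_free_def)

lemma HH_keys: "u \<in> HH ==> supp u \<subseteq> SS"
  using subgroup.mem_carrier[OF HH_subgroup] by (simp add: tensor_free_def)

lemma HH_0: "0 \<in> HH"
  using subgroup.one_closed[OF HH_subgroup] by (simp add: tensor_free_def)

lemma HH_minus: "u \<in> HH ==> - u \<in> HH"
  using subgroup.m_inv_closed[OF HH_subgroup] HH_keys by (simp add: tensor_free_def)

lemma HH_add: "[|u \<in> HH; v \<in> HH|] ==> u + v \<in> HH"
  using subgroup.m_closed[OF HH_subgroup] by (simp add: tensor_free_def)

lemma HH_diff: "[|u \<in> HH; v \<in> HH|] ==> u - v \<in> HH"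
  using HH_add[OF _ HH_minus] by fastforce

lemma HH_rel: "u \<in> tensor_relations A L ==> u \<in> HH"
  by (rule generate.incl)

lemma cl_eq: "cl u = {h + u | h. h \<in> HH}"
  by (auto simp: tensor_class_def r_coset_def tensor_free_def)

lemma cl_self: "u \<in> cl u"
  unfolding cl_eq using HH_0 by force

lemma cl_iff: "cl u = cl v \<longleftrightarrow> u - v \<in> HH"
proof
  assume "cl u = cl v"
  hence "u \<in> cl v" using cl_self by auto
  thus "u - v \<in> HH" by (auto simp: cl_eq)
next
  assume uv: "u - v \<in> HH"
  show "cl u = cl v"
  proof (intro equalityI subsetI)
    fix x assume "x \<in> cl u"
    then obtain h where "h \<in> HH" "x = h + u" by (auto simp: cl_eq)
    hence "x = (h + (u - v)) + v" "h + (u - v) \<in> HH" using HH_add uv by auto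
    thus "x \<in> cl v" unfolding cl_eq by blast
  next
    fix x assume "x \<in> cl v"
    then obtain h where "h \<in> HH" "x = h + v" by (auto simp: cl_eq)
    hence "x = (h - (u - v)) + u" "h - (u - v) \<in> HH" using HH_diff uv by auto
    thus "x \<in> cl u" unfolding cl_eq by blast
  qed
qed

text \<open>The map from the free group to \<open>A\<close> that induces the isomorphism of L
  \<otimes> A with eA.\<close>

definition ev :: "('m \<times> 'a \<Rightarrow>\<^sub>0 int) \<Rightarrow> 'a" where
  "ev = (SOME h. h \<in> hom (free_Abelian_group SS) (add_monoid A) \<and>
     (\<forall>x\<in>SS. h (frag_of x) = psi (fst x) \<otimes> snd x))"

lemma ev_spec: "ev \<in> hom (free_Abelian_group SS) (add_monoid A)"
  "[|m \<in> carrier L; a \<in> carrier A|] ==> ev (frag_of (m, a)) = psi m \<otimes> a"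
proof -
  have "(\<lambda>x. psi (fst x) \<otimes> snd x) ` SS \<subseteq> carrier (add_monoid A)" using psi_spec by auto
  then obtain h where h: "h \<in> hom (free_Abelian_group SS) (add_monoid A)"
    "\<And>x. x \<in> SS ==> h (frag_of x) = psi (fst x) \<otimes> snd x" using comm_group.free_Abelian_group_universal[OF A.a_comm_group] by blast
  have "ev \<in> hom (free_Abelian_group SS) (add_monoid A) \<and> (\<forall>x\<in>SS. ev (frag_of x) = psi (fst x) \<otimes> snd x)"
    unfolding ev_def by (rule someI[of _ h]) (use h in blast)
  thus "ev \<in> hom (free_Abelian_group SS) (add_monoid A)"
    "[|m \<in> carrier L; a \<in> carrier A|] ==> ev (frag_of (m, a)) = psi m \<otimes> a" by auto
qed

lemma ev_closed: "supp u \<subseteq> SS ==> ev u \<in> carrier A"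
  using ev_spec(1) by (auto simp: hom_def Pi_iff)

lemma ev_add: "[|supp u \<subseteq> SS; supp v \<subseteq> SS|] ==> ev (u + v) = ev u \<oplus> ev v"
  using ev_spec(1) by (auto simp: hom_def Pi_iff)

lemma ev_0: "ev 0 = \<zero>"
proof -
  have "ev 0 = ev 0 \<oplus> ev 0" using ev_add[of 0 0] by simp
  thus ?thesis by (intro A.idem_zero) (simp_all add: ev_closed)
qed

lemma ev_diff: "[|supp u \<subseteq> SS; supp v \<subseteq> SS|] ==> ev (u - v) = ev u \<ominus> ev v"
proof -
  assume u: "supp u \<subseteq> SS" and v: "supp v \<subseteq> SS"
  have "ev u = ev (v + (u - v))" by simp
  also have "\<dots> = ev v \<oplus> ev (u - v)" by (rule ev_add[OF v keys_diff'[OF u v]])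
  finally show ?thesis
    using A.diff_eqI[of "ev v" "ev (u - v)" "ev u"] ev_closed[OF v] ev_closed[OF keys_diff'[OF u v]] by simp
qed

lemma ev_rel: "u \<in> tensor_relations A L ==> ev u = \<zero>"
proof -
  assume u: "u \<in> tensor_relations A L"
  have k: "supp (frag_of x) \<subseteq> SS \<longleftrightarrow> x \<in> SS" for x by (simp add: keys_frag_of)
  have z: "x \<oplus> y \<ominus> x \<ominus> y = \<zero>" if "x \<in> carrier A" "y \<in> carrier A" for x y
    using that A.r_neg[of "x \<oplus> y"] by (simp add: a_minus_def A.minus_add A.a_assoc)
  show ?thesis
    using u unfolding tensor_relations_def Un_iff mem_Collect_eq
  proof (elim disjE exE conjE)
    fix x x' a assume "u = frag_of (x \<oplus>\<^bsub>L\<^esub> x', a) - frag_of (x, a) - frag_of (x', a)"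
      "x \<in> carrier L" "x' \<in> carrier L" "a \<in> carrier A"
    thus ?thesis using psi_spec(2)[of x] psi_spec(2)[of x']
      by (simp add: ev_diff keys_diff' k L_add ev_spec(2) psi_add A.l_distr z)
  next
    fix x a a' assume "u = frag_of (x, a \<oplus> a') - frag_of (x, a) - frag_of (x, a')"
      "x \<in> carrier L" "a \<in> carrier A" "a' \<in> carrier A"
    thus ?thesis using psi_spec(2)[of x]
      by (simp add: ev_diff keys_diff' k ev_spec(2) A.r_distr z)
  next
    fix x r a assume "u = frag_of (ract L x r, a) - frag_of (x, r \<otimes> a)"
      "x \<in> carrier L" "r \<in> agr A 0" "a \<in> carrier A"
    thus ?thesis using agr_carrier[of r] psi_spec(2)[of x]
      by (simp add: ev_diff keys_diff' k L_ract ev_spec(2) psi_ract A.m_assoc a_minus_def A.r_neg)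
  qed
qed

lemma ev_HH: "u \<in> HH ==> ev u = \<zero>"
proof (induction rule: generate.induct)
  case one
  thus ?case using ev_0 by (simp add: tensor_free_def)
next
  case (eng h1 h2)
  thus ?case using ev_add[OF HH_keys HH_keys] by (simp add: tensor_free_def)
next
  case (incl h)
  thus ?case by (rule ev_rel)
next
  case (inv h)
  have "ev h = \<zero>" by (rule ev_rel[OF inv])
  moreover have "supp h \<subseteq> SS" using HH_keys[OF HH_rel[OF inv]] .
  moreover have "\<ominus> \<zero> = \<zero>" using A.minus_equality[of \<zero> \<zero>] by simp
  ultimately show ?case using ev_diff[of 0 h] ev_0 by (simp add: tensor_free_def a_minus_def)
qed

lemma ev_ideal: "supp u \<subseteq> SS ==> e \<otimes> ev u = ev u"
proof -
  assume "supp u \<subseteq> SS"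
  hence "supp u \<subseteq> SS \<and> e \<otimes> ev u = ev u"
  proof (induction u rule: frag_induction)
    case zero
    thus ?case using ev_0 ec by simp
  next
    case (one x)
    thus ?case using psi_spec[of "fst x"] ec by (auto simp: keys_frag_of ev_spec(2) simp flip: A.m_assoc)
  next
    case (diff u v)
    thus ?case using keys_diff'[of u SS v] ec by (simp add: ev_diff ev_closed a_minus_def A.r_distr A.r_minus)
  qed
  thus ?thesis by simp
qed

text \<open>Because m = l psi(m), the generator (m, a) is congruent to (l, psi(m) a), and so every
  element is congruent to a single generator with first entry \<open>l\<close>. It follows that
  \<open>ev\<close> is injective modulo the relations.\<close>

lemma reduce: "supp u \<subseteq> SS ==> u - frag_of (l, ev u) \<in> HH"
proof -
  assume "supp u \<subseteq> SS"
  hence "supp u \<subseteq> SS \<and> u - frag_of (l, ev u) \<in> HH"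
  proof (induction u rule: frag_induction)
    case zero
    have "frag_of (l, \<zero> \<oplus> \<zero>) - frag_of (l, \<zero>) - frag_of (l, \<zero>) \<in> tensor_relations A L"
      unfolding tensor_relations_def using genD(3) A.zero_closed by blast
    from HH_rel[OF this] show ?case by (simp add: ev_0)
  next
    case (one x)
    then obtain m a where x: "x = (m, a)" "m \<in> carrier L" "a \<in> carrier A" by auto
    have "frag_of (ract L l (psi m), a) - frag_of (l, psi m \<otimes> a) \<in> tensor_relations A L"
      unfolding tensor_relations_def using genD(3) psi_spec(1)[OF x(2)] x(3) by blast
    from HH_rel[OF this] show ?case using x by (simp add: ev_spec(2) psi_spec keys_frag_of)
  next
    case (diff u v)
    define x where "x = ev u"
    define y where "y = ev v"
    have xy: "x \<in> carrier A" "y \<in> carrier A" using diff ev_closed by (auto simp: x_def y_def)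
    have "frag_of (l, (x \<ominus> y) \<oplus> y) - frag_of (l, x \<ominus> y) - frag_of (l, y) \<in> tensor_relations A L"
      unfolding tensor_relations_def using genD(3) xy A.minus_closed by blast
    moreover have "(x \<ominus> y) \<oplus> y = x" using xy by (simp add: a_minus_def A.a_assoc A.l_neg)
    ultimately have r: "frag_of (l, x) - frag_of (l, x \<ominus> y) - frag_of (l, y) \<in> HH" using HH_rel by simp
    have "(u - frag_of (l, x)) - (v - frag_of (l, y)) + (frag_of (l, x) - frag_of (l, x \<ominus> y) - frag_of (l, y)) \<in> HH"
      by (rule HH_add[OF HH_diff r]) (use diff in \<open>simp_all add: x_def y_def\<close>)
    hence "u - v - frag_of (l, x \<ominus> y) \<in> HH" by (simp add: algebra_simps)
    thus ?case using diff keys_diff'[of u SS v] by (simp add: ev_diff x_def y_def)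
  qed
  thus ?thesis by simp
qed

text \<open>The inverse of the isomorphism induced by \<open>ev\<close>.\<close>

definition al :: "'a \<Rightarrow> ('m \<times> 'a \<Rightarrow>\<^sub>0 int) set" where "al b = cl (frag_of (l, b))"

lemma cl_al: "supp u \<subseteq> SS ==> cl u = al (ev u)"
  unfolding al_def cl_iff by (rule reduce)

lemma ev_l: "b \<in> ideal_e e ==> ev (frag_of (l, b)) = b"
  using ev_spec(2)[OF genD(3), of b] ideal_eD[OF genD(2), of b] psi_l by simp

lemma keys_l: "b \<in> ideal_e e ==> supp (frag_of (l, b)) \<subseteq> SS"
  using genD(3) ideal_eD[OF genD(2), of b] by (simp add: keys_frag_of)

lemma al_mem: "[|b \<in> ideal_e e; u \<in> al b|] ==> supp u \<subseteq> SS \<and> ev u = b"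
proof -
  assume b: "b \<in> ideal_e e" and "u \<in> al b"
  then obtain h where h: "h \<in> HH" "u = h + frag_of (l, b)" by (auto simp: al_def cl_eq)
  have "supp u \<subseteq> SS" unfolding h(2) using keys_add[of h "frag_of (l, b)"] HH_keys[OF h(1)] keys_l[OF b] by blast
  moreover have "ev u = b"
    unfolding h(2) using ev_add[OF HH_keys[OF h(1)] keys_l[OF b]] ev_HH[OF h(1)] ev_l[OF b] ideal_eD[OF genD(2) b] by simp
  ultimately show ?thesis by simp
qed

lemma induced_simps:
  "carrier (induced A L) = cl ` {u. supp u \<subseteq> SS}" "zero (induced A L) = cl 0"
  "add (induced A L) = set_mult TT"
  "ract (induced A L) = (\<lambda>X b. \<Union>u\<in>X. cl (frag_extend (\<lambda>(l, a). frag_of (l, a \<otimes> b)) u))"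
  "mgr (induced A L) = (\<lambda>i. cl ` {u. supp u \<subseteq> carrier L \<times> agr A i})"
  "mdiff (induced A L) = (\<lambda>X. \<Union>u\<in>X. cl (frag_extend (\<lambda>(l, a). frag_of (l, adiff A a)) u))"
proof -
  have "carrier (free_Abelian_group S) = {u. supp u \<subseteq> S}" for S :: "('m \<times> 'a) set" by auto
  thus "carrier (induced A L) = cl ` {u. supp u \<subseteq> SS}"
    "mgr (induced A L) = (\<lambda>i. cl ` {u. supp u \<subseteq> carrier L \<times> agr A i})"
    by (simp_all add: induced_def tensor_free_def)
qed (simp_all add: induced_def)

lemma ev_in_ideal: "supp u \<subseteq> SS ==> ev u \<in> ideal_e e"
  using ideal_eI[OF genD(2) ev_closed ev_ideal] .

text \<open>Meant for right multiplications and for the differential of \<open>A\<close>. Both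
  commute with left multiplication by A^0, the differential because it vanishes on A^0.\<close>

lemma ev_ext:
  assumes "supp u \<subseteq> SS" and g: "addmap A A g"
    and gp: "\<And>p a. [|p \<in> agr A 0; a \<in> carrier A|] ==> g (p \<otimes> a) = p \<otimes> g a"
  shows "supp (frag_extend (\<lambda>(l, a). frag_of (l, g a)) u) \<subseteq> SS \<and>
     ev (frag_extend (\<lambda>(l, a). frag_of (l, g a)) u) = g (ev u)"
  using assms(1)
proof -
  let ?x = "frag_extend (\<lambda>(l, a). frag_of (l, g a))"
  have "supp u \<subseteq> SS \<and> supp (?x u) \<subseteq> SS \<and> ev (?x u) = g (ev u)"
    using assms(1)
  proof (induction u rule: frag_induction)
    case zero
    thus ?case using ev_0 addmap_zero[OF A.abelian_group_axioms A.abelian_group_axioms g] by simp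
  next
    case (one x)
    then obtain m a where x: "x = (m, a)" "m \<in> carrier L" "a \<in> carrier A" by auto
    show ?case using x psi_spec[OF x(2)] gp[OF psi_spec(1)[OF x(2)] x(3)] addmap_closed[OF g x(3)]
      by (simp add: keys_frag_of ev_spec(2))
  next
    case (diff u v)
    have ku: "supp u \<subseteq> SS" "supp v \<subseteq> SS" "supp (?x u) \<subseteq> SS"
      "supp (?x v) \<subseteq> SS" "ev (?x u) = g (ev u)" "ev (?x v) = g (ev v)" using diff by auto
    have "ev (?x (u - v)) = ev (?x u) \<ominus> ev (?x v)" unfolding frag_extend_diff by (rule ev_diff[OF ku(3,4)])
    also have "\<dots> = g (ev u \<ominus> ev v)"
      using addmap_diff[OF A.abelian_group_axioms A.abelian_group_axioms g ev_closed[OF ku(1)] ev_closed[OF ku(2)]] ku(5,6) by simp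
    also have "\<dots> = g (ev (u - v))" by (simp add: ev_diff[OF ku(1,2)])
    finally show ?case using keys_diff'[OF ku(1,2)] keys_diff'[OF ku(3,4)] by (simp add: frag_extend_diff)
  qed
  thus ?thesis by simp
qed

lemma al_ext:
  assumes b: "b \<in> ideal_e e" and g: "addmap A A g"
    and gp: "\<And>p a. [|p \<in> agr A 0; a \<in> carrier A|] ==> g (p \<otimes> a) = p \<otimes> g a"
  shows "(\<Union>u\<in>al b. cl (frag_extend (\<lambda>(l, a). frag_of (l, g a)) u)) = al (g b)"
proof -
  have "cl (frag_extend (\<lambda>(l, a). frag_of (l, g a)) u) = al (g b)" if "u \<in> al b" for u
    using ev_ext[OF _ g gp, of u] al_mem[OF b that] cl_al by simp
  moreover have "frag_of (l, b) \<in> al b" by (simp add: al_def cl_self)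
  ultimately show ?thesis by blast
qed

lemma al_facts:
  "bij_betw al (ideal_e e) (carrier (induced A L))" "al \<zero> = \<zero>\<^bsub>induced A L\<^esub>"
  "[|b \<in> ideal_e e; c \<in> ideal_e e|] ==> al (b \<oplus> c) = al b \<oplus>\<^bsub>induced A L\<^esub> al c"
  "[|b \<in> ideal_e e; a \<in> carrier A|] ==> al (b \<otimes> a) = ract (induced A L) (al b) a"
  "mgr (induced A L) i = al ` (ideal_e e \<inter> agr A i)"
  "b \<in> ideal_e e ==> al (adiff A b) = mdiff (induced A L) (al b)"
proof -
  show "bij_betw al (ideal_e e) (carrier (induced A L))"
    unfolding bij_betw_def
  proof
    show "inj_on al (ideal_e e)"
    proof (rule inj_onI)
      fix b c assume b: "b \<in> ideal_e e" and c: "c \<in> ideal_e e" and eq: "al b = al c"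
      have "frag_of (l, b) \<in> al c" using eq cl_self by (metis al_def)
      hence "ev (frag_of (l, b)) = c" using al_mem[OF c] by blast
      thus "b = c" using ev_l[OF b] by simp
    qed
    show "al ` ideal_e e = carrier (induced A L)"
      unfolding induced_simps
    proof (intro equalityI subsetI)
      fix X assume "X \<in> al ` ideal_e e"
      then obtain b where "b \<in> ideal_e e" "X = cl (frag_of (l, b))" by (auto simp: al_def)
      thus "X \<in> cl ` {u. supp u \<subseteq> SS}" using keys_l by blast
    next
      fix X assume "X \<in> cl ` {u. supp u \<subseteq> SS}"
      then obtain u where "supp u \<subseteq> SS" "X = cl u" by auto
      thus "X \<in> al ` ideal_e e" using cl_al ev_in_ideal by auto
    qed
  qed
  show "al \<zero> = \<zero>\<^bsub>induced A L\<^esub>" using cl_al[of 0] ev_0 by (simp add: induced_simps)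
  show "al (b \<oplus> c) = al b \<oplus>\<^bsub>induced A L\<^esub> al c" if b: "b \<in> ideal_e e" and c: "c \<in> ideal_e e"
  proof -
    have n: "normal HH TT"
      by (rule comm_group.subgroup_imp_normal[OF abelian_free_Abelian_group[of SS, folded tensor_free_def] HH_subgroup])
    let ?u = "frag_of (l, b)" and ?v = "frag_of (l, c)"
    have "al b \<oplus>\<^bsub>induced A L\<^esub> al c = cl (?u + ?v)"
      using normal.rcos_sum[OF n, of ?u ?v] keys_l[OF b] keys_l[OF c]
      by (simp add: induced_simps al_def tensor_class_def tensor_free_def)
    also have "\<dots> = al (ev (?u + ?v))"
      by (rule cl_al) (use keys_add[of ?u ?v] keys_l[OF b] keys_l[OF c] in blast)
    also have "ev (?u + ?v) = b \<oplus> c" using ev_add[OF keys_l[OF b] keys_l[OF c]] ev_l b c by simp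
    finally show ?thesis by simp
  qed
  show "al (b \<otimes> a) = ract (induced A L) (al b) a" if b: "b \<in> ideal_e e" and a: "a \<in> carrier A"
    using al_ext[OF b, of "\<lambda>x. x \<otimes> a"] a agr_carrier
    by (simp add: induced_simps addmap_def A.l_distr A.m_assoc)
  show "al (adiff A b) = mdiff (induced A L) (al b)" if b: "b \<in> ideal_e e"
    using al_ext[OF b, of "adiff A"] adiff_mult0 dg_module.mdiff_addmap[OF reg]
    by (simp add: induced_simps addmap_def reg_simps)
  show "mgr (induced A L) i = al ` (ideal_e e \<inter> agr A i)"
    unfolding induced_simps
  proof (intro equalityI subsetI)
    fix X assume "X \<in> al ` (ideal_e e \<inter> agr A i)"
    then obtain b where b: "b \<in> ideal_e e" "b \<in> agr A i" "X = cl (frag_of (l, b))" by (auto simp: al_def)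
    hence "supp (frag_of (l, b)) \<subseteq> carrier L \<times> agr A i" using genD(3) by (simp add: keys_frag_of)
    thus "X \<in> cl ` {u. supp u \<subseteq> carrier L \<times> agr A i}" using b by blast
  next
    fix X assume "X \<in> cl ` {u. supp u \<subseteq> carrier L \<times> agr A i}"
    then obtain u where u: "supp u \<subseteq> carrier L \<times> agr A i" "X = cl u" by auto
    \<comment> \<open>\<open>psi\<close> takes values in A^0, so evaluation preserves
      degrees.\<close>
    have "supp u \<subseteq> SS \<and> ev u \<in> agr A i"
      using u(1)
    proof (induction u rule: frag_induction)
      case zero
      thus ?case using ev_0 agr_zero by simp
    next
      case (one x)
      then obtain m a where x: "x = (m, a)" "m \<in> carrier L" "a \<in> agr A i" by auto
      show ?case using x psi_spec[OF x(2)] agr_mult[OF psi_spec(1)[OF x(2)] x(3)] agr_carrier[OF x(3)]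
        by (simp add: keys_frag_of ev_spec(2))
    next
      case (diff u v)
      have "ev u \<ominus> ev v \<in> agr A i"
      proof -
        have "\<ominus>\<^bsub>regular_dgmodule A\<^esub> ev v = \<ominus> ev v"
          using abelian_group.minus_equality[of "regular_dgmodule A" "\<ominus> ev v" "ev v"] reg diff agr_carrier[of "ev v" i]
          by (simp add: dg_module_def right_module_def reg_simps A.l_neg)
        thus ?thesis
          using dg_module.mgr_diff[OF reg, unfolded reg_simps, of "ev u" i "ev v"] diff
          by (simp add: a_minus_def reg_simps)
      qed
      thus ?case using diff keys_diff'[of u SS v] by (simp add: ev_diff)
    qed
    thus "X \<in> al ` (ideal_e e \<inter> agr A i)" using u(2) cl_al ev_in_ideal by blast
  qed
qed

lemma induced_dg_module: "dg_module A (induced A L)"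
  by (rule dg_module_bij[OF eA_dg_module[OF genD(2)], where h = al])
    (use al_facts pdga_axioms in simp_all)

lemma al_hom: "restrict al (ideal_e e) \<in> dg_hom A (eA e) (induced A L)"
proof -
  interpret E: dg_module A "eA e" by (rule eA_dg_module[OF genD(2)])
  show ?thesis
  proof (rule dg_homI)
    fix x assume "x \<in> carrier (eA e)"
    hence x: "x \<in> ideal_e e" by simp
    show "restrict al (ideal_e e) x \<in> carrier (induced A L)" using al_facts(1) x by (auto simp: bij_betw_def)
    show "restrict al (ideal_e e) (x \<oplus>\<^bsub>eA e\<^esub> y) = restrict al (ideal_e e) x \<oplus>\<^bsub>induced A L\<^esub> restrict al (ideal_e e) y"
      if "y \<in> carrier (eA e)" for y using x that al_facts(3)[of x y] E.M.a_closed[of x y] by simp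
    show "restrict al (ideal_e e) (ract (eA e) x a) = ract (induced A L) (restrict al (ideal_e e) x) a" if "a \<in> carrier A" for a
      using x that al_facts(4)[of x a] E.ract_closed[of x a] by simp
    show "restrict al (ideal_e e) (mdiff (eA e) x) = mdiff (induced A L) (restrict al (ideal_e e) x)"
      using x al_facts(6)[of x] E.mdiff_closed[of x] by simp
  next
    fix x i assume "x \<in> mgr (eA e) i"
    thus "restrict al (ideal_e e) x \<in> mgr (induced A L) i" by (simp add: al_facts(5))
  qed simp
qed

end

section \<open>Subquotients and cells\<close>

lemma (in pdga) dg_iso_bij:
  assumes P: "dg_module A P" and Q: "dg_module A Q" and R: "dg_module A R"
    and f: "f \<in> dg_hom A P Q" "bij_betw f (carrier P) (carrier Q)"
    and g: "g \<in> dg_hom A P R" "bij_betw g (carrier P) (carrier R)"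
  shows "dg_iso A Q R"
proof -
  let ?f = "restrict (inv_into (carrier P) f) (carrier Q)" and ?g = "restrict (inv_into (carrier P) g) (carrier R)"
  have h: "?f \<in> dg_hom A Q P" "?g \<in> dg_hom A R P" using hom_bij_inverse P Q R f g by blast+
  have i: "inv_into (carrier P) f y \<in> carrier P \<and> f (inv_into (carrier P) f y) = y" if "y \<in> carrier Q" for y
    using f(2) that by (auto simp: bij_betw_def f_inv_into_f intro: inv_into_into)
  have j: "inv_into (carrier P) g y \<in> carrier P \<and> g (inv_into (carrier P) g y) = y" if "y \<in> carrier R" for y
    using g(2) that by (auto simp: bij_betw_def f_inv_into_f intro: inv_into_into)
  have k: "inv_into (carrier P) f (f x) = x \<and> inv_into (carrier P) g (g x) = x \<and> f x \<in> carrier Q \<and> g x \<in> carrier R"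
    if "x \<in> carrier P" for x using f(2) g(2) that by (auto simp: bij_betw_def)
  show ?thesis
    unfolding dg_iso_def
  proof (intro bexI)
    show "compose (carrier Q) g ?f \<in> dg_hom A Q R" by (rule hom_compose[OF Q h(1) g(1)])
    show "compose (carrier R) f ?g \<in> dg_hom A R Q" by (rule hom_compose[OF R h(2) f(1)])
    show "compose (carrier Q) (compose (carrier R) f ?g) (compose (carrier Q) g ?f) = hom_id Q \<and>
        compose (carrier R) (compose (carrier Q) g ?f) (compose (carrier R) f ?g) = hom_id R"
      using i j k by (auto simp: compose_def hom_id_def fun_eq_iff restrict_def)
  qed
qed

context pdgm
begin

section \<open>Cosets and subquotients\<close>

abbreviation "quo \<equiv> dg_subquotient M"

lemma sub_subgroup: "sub N ==> additive_subgroup N M"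
  by (rule M.add_subgroupI) (auto intro: sub_carrier sub_zero sub_add sub_minus)

lemma coset_mem: "x' \<in> N +>\<^bsub>M\<^esub> x \<longleftrightarrow> (\<exists>h\<in>N. x' = h \<oplus>\<^bsub>M\<^esub> x)"
  by (auto simp: a_r_coset_def')

lemma coset_eq:
  assumes N: "sub N" and x: "x \<in> carrier M" "y \<in> carrier M"
  shows "N +>\<^bsub>M\<^esub> x = N +>\<^bsub>M\<^esub> y \<longleftrightarrow> x \<ominus>\<^bsub>M\<^esub> y \<in> N"
proof -
  interpret N: abelian_subgroup N M by (rule abelian_subgroupI3[OF sub_subgroup[OF N] M.abelian_group_axioms])
  show ?thesis
  proof
    assume "N +>\<^bsub>M\<^esub> x = N +>\<^bsub>M\<^esub> y"
    hence "x \<in> N +>\<^bsub>M\<^esub> y" using N.a_rcos_self[OF x(1)] by simp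
    then obtain h where h: "h \<in> N" "x = h \<oplus>\<^bsub>M\<^esub> y" by (auto simp: coset_mem)
    hence "x \<ominus>\<^bsub>M\<^esub> y = h" using add_cancel[of y h] x sub_carrier[OF N h(1)] by (simp add: M.a_comm)
    thus "x \<ominus>\<^bsub>M\<^esub> y \<in> N" using h by simp
  next
    assume h: "x \<ominus>\<^bsub>M\<^esub> y \<in> N"
    have "x = (x \<ominus>\<^bsub>M\<^esub> y) \<oplus>\<^bsub>M\<^esub> y" using x by (simp add: a_minus_def M.a_assoc M.l_neg)
    hence "x \<in> N +>\<^bsub>M\<^esub> y" using h coset_mem by blast
    thus "N +>\<^bsub>M\<^esub> x = N +>\<^bsub>M\<^esub> y" using M.a_repr_independence[OF _ x(2) N.a_subgroup] by simp
  qed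
qed

text \<open>The operations of \<open>dg_subquotient\<close> are unions over representatives. As
  \<open>g\<close> maps \<open>N\<close> into itself, all representatives give the same
  coset.\<close>

lemma coset_union:
  assumes N: "sub N" and x: "x \<in> carrier M" and g: "addmap M M g" "\<And>y. y \<in> N ==> g y \<in> N"
  shows "(\<Union>y\<in>N +>\<^bsub>M\<^esub> x. N +>\<^bsub>M\<^esub> g y) = N +>\<^bsub>M\<^esub> g x"
proof -
  interpret N: abelian_subgroup N M by (rule abelian_subgroupI3[OF sub_subgroup[OF N] M.abelian_group_axioms])
  have "N +>\<^bsub>M\<^esub> g y = N +>\<^bsub>M\<^esub> g x" if y: "y \<in> N +>\<^bsub>M\<^esub> x" for y
  proof -
    obtain h where h: "h \<in> N" "y = h \<oplus>\<^bsub>M\<^esub> x" using y by (auto simp: coset_mem)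
    note hc = sub_carrier[OF N h(1)]
    have "g y = g x \<oplus>\<^bsub>M\<^esub> g h" using g(1) h hc x by (simp add: addmap_def Pi_iff M.a_comm)
    hence "g y \<ominus>\<^bsub>M\<^esub> g x = g h" using add_cancel[of "g x" "g h"] addmap_closed[OF g(1)] hc x by simp
    thus ?thesis using coset_eq[OF N] addmap_closed[OF g(1)] x hc h g(2) by simp
  qed
  hence "(\<Union>y\<in>N +>\<^bsub>M\<^esub> x. N +>\<^bsub>M\<^esub> g y) = (\<Union>y\<in>N +>\<^bsub>M\<^esub> x. N +>\<^bsub>M\<^esub> g x)" by simp
  thus ?thesis using N.a_rcos_self[OF x] by (metis UN_constant empty_iff)
qed

lemma quo_simps:
  assumes N: "sub N" and F: "sub F"
  shows "carrier (quo F N) = (\<lambda>x. N +>\<^bsub>M\<^esub> x) ` F" "zero (quo F N) = N"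
    "mgr (quo F N) i = (\<lambda>x. N +>\<^bsub>M\<^esub> x) ` (F \<inter> mgr M i)"
    "[|x \<in> F; y \<in> F|] ==> (N +>\<^bsub>M\<^esub> x) \<oplus>\<^bsub>quo F N\<^esub> (N +>\<^bsub>M\<^esub> y) = N +>\<^bsub>M\<^esub> (x \<oplus>\<^bsub>M\<^esub> y)"
    "[|x \<in> F; a \<in> carrier A|] ==> ract (quo F N) (N +>\<^bsub>M\<^esub> x) a = N +>\<^bsub>M\<^esub> ract M x a"
    "x \<in> F ==> mdiff (quo F N) (N +>\<^bsub>M\<^esub> x) = N +>\<^bsub>M\<^esub> mdiff M x"
proof -
  interpret N: abelian_subgroup N M by (rule abelian_subgroupI3[OF sub_subgroup[OF N] M.abelian_group_axioms])
  show "[|x \<in> F; y \<in> F|] ==> (N +>\<^bsub>M\<^esub> x) \<oplus>\<^bsub>quo F N\<^esub> (N +>\<^bsub>M\<^esub> y) = N +>\<^bsub>M\<^esub> (x \<oplus>\<^bsub>M\<^esub> y)"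
    using N.a_rcos_sum sub_carrier[OF F] by (simp add: dg_subquotient_def)
  show "[|x \<in> F; a \<in> carrier A|] ==> ract (quo F N) (N +>\<^bsub>M\<^esub> x) a = N +>\<^bsub>M\<^esub> ract M x a"
    using coset_union[OF N _ ract_addmap_l sub_ract[OF N]] sub_carrier[OF F] by (simp add: dg_subquotient_def)
  show "x \<in> F ==> mdiff (quo F N) (N +>\<^bsub>M\<^esub> x) = N +>\<^bsub>M\<^esub> mdiff M x"
    using coset_union[OF N _ mdiff_addmap sub_mdiff[OF N]] sub_carrier[OF F] by (simp add: dg_subquotient_def)
qed (simp_all add: dg_subquotient_def)

lemma coset_zero: "sub N ==> x \<in> carrier M ==> N +>\<^bsub>M\<^esub> x = N \<longleftrightarrow> x \<in> N"
  using coset_eq[of N x "zero M"] M.a_coset_join2[of "zero M" N] additive_subgroup.a_subgroup[OF sub_subgroup] sub_zero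
    M.minus_equality[of "zero M" "zero M"]
  by (simp add: a_minus_def)

text \<open>The map sends \<open>b\<close> in a shift of eA to the coset of v b. It is onto because
  v a = v (e a), injective by the cell condition, and commutes with the differentials because dv
  lies in \<open>N\<close>.\<close>

lemma cell_dg_iso:
  assumes N: "sub N" and c: "cell A M j e v N" and g: "gen_by A L e l"
  shows "dg_iso A (quo (ad N v) N) (shift (- j) (induced A L))"
proof -
  interpret I: induced_ctx A L e l by unfold_locales (rule g)
  let ?F = "ad N v" and ?P = "shift (- j) (eA e)"
  have F: "sub ?F" by (rule cell_sub[OF N c])
  have v: "v \<in> mgr M j" and vc: "v \<in> carrier M" and ve: "ract M v e = v" and vd: "mdiff M v \<in> N"
    and vN: "\<And>a. [|a \<in> carrier A; ract M v a \<in> N|] ==> e \<otimes> a = \<zero>" and pe: "prim A e"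
    using c mgr_carrier by (auto simp: cell_def)
  note ec = prim_carrier[OF pe] and Q = quo_simps[OF N F]
  have va: "ract M v (e \<otimes> a) = ract M v a" if "a \<in> carrier A" for a
    using ract_assoc[OF vc ec that] ve by simp
  have vF: "ract M v a \<in> ?F" "ract M v a \<in> carrier M" if "a \<in> carrier A" for a
    using ad_gen[OF N vc that] ract_closed[OF vc that] by auto
  have id: "b \<in> carrier A" "e \<otimes> b = b" if "b \<in> ideal_e e" for b using ideal_eD[OF pe that] by auto
  have ea: "e \<otimes> a \<in> ideal_e e" if "a \<in> carrier A" for a using that by (simp add: ideal_e_def)
  let ?g = "\<lambda>b. N +>\<^bsub>M\<^esub> ract M v b"
  have nv: "N +>\<^bsub>M\<^esub> (n \<oplus>\<^bsub>M\<^esub> x) = N +>\<^bsub>M\<^esub> x" if "n \<in> N" "x \<in> carrier M" for n x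
  proof -
    have "(n \<oplus>\<^bsub>M\<^esub> x) \<ominus>\<^bsub>M\<^esub> x = n"
      using add_cancel[of x n] that sub_carrier[OF N that(1)] by (simp add: M.a_comm)
    thus ?thesis using coset_eq[OF N] that sub_carrier[OF N that(1)] by simp
  qed
  have P: "dg_module A ?P" by (intro shift_dg_module eA_dg_module pe)
  have bij: "bij_betw ?g (carrier ?P) (carrier (quo ?F N))"
    unfolding bij_betw_def
  proof
    show "inj_on ?g (carrier ?P)"
    proof (rule inj_onI)
      fix b b' assume "b \<in> carrier ?P" "b' \<in> carrier ?P" and eq: "?g b = ?g b'"
      hence b: "b \<in> ideal_e e" "b' \<in> ideal_e e" by auto
      note bc = id[OF b(1)] id[OF b(2)]
      have "ract M v b \<ominus>\<^bsub>M\<^esub> ract M v b' \<in> N" using eq coset_eq[OF N] vF bc by simp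
      also have "ract M v b \<ominus>\<^bsub>M\<^esub> ract M v b' = ract M v (b \<ominus> b')"
        using addmap_diff[OF A.abelian_group_axioms M.abelian_group_axioms ract_addmap_r[OF vc]] bc by simp
      finally have "e \<otimes> (b \<ominus> b') = \<zero>" using vN bc by simp
      hence "b \<ominus> b' = \<zero>" using bc ec by (simp add: a_minus_def A.r_distr A.r_minus)
      thus "b = b'" using A.diff_zero_imp_eq[of b b'] bc by simp
    qed
    show "?g ` carrier ?P = carrier (quo ?F N)"
      unfolding Q
    proof (intro equalityI subsetI)
      fix X assume "X \<in> ?g ` carrier ?P"
      thus "X \<in> (\<lambda>x. N +>\<^bsub>M\<^esub> x) ` ?F" using vF id by auto
    next
      fix X assume "X \<in> (\<lambda>x. N +>\<^bsub>M\<^esub> x) ` ?F"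
      then obtain x where x: "x \<in> ?F" "X = N +>\<^bsub>M\<^esub> x" by auto
      obtain n a where na: "n \<in> N" "a \<in> carrier A" "x = n \<oplus>\<^bsub>M\<^esub> ract M v a" using x(1) by (rule adE)
      hence "X = ?g (e \<otimes> a)" using x nv vF va by simp
      thus "X \<in> ?g ` carrier ?P" using ea[OF na(2)] by simp
    qed
  qed
  have g0: "?g \<zero> = N" using coset_zero[OF N] sub_zero[OF N] vc by (simp add: ract_zero_r)
  have ga: "?g (b \<oplus> b') = ?g b \<oplus>\<^bsub>quo ?F N\<^esub> ?g b'" if "b \<in> ideal_e e" "b' \<in> ideal_e e" for b b'
    using that id vF vc by (simp add: Q ract_r_distr)
  have gr: "?g (b \<otimes> a) = ract (quo ?F N) (?g b) a" if "b \<in> ideal_e e" "a \<in> carrier A" for b a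
    using that id vF vc by (simp add: Q ract_assoc)
  have gg: "mgr (quo ?F N) i = ?g ` mgr ?P i" for i
    unfolding Q
  proof (intro equalityI subsetI)
    fix X assume "X \<in> (\<lambda>x. N +>\<^bsub>M\<^esub> x) ` (?F \<inter> mgr M i)"
    then obtain x where x: "x \<in> ?F" "x \<in> mgr M i" "X = N +>\<^bsub>M\<^esub> x" by auto
    obtain n a where na: "n \<in> N" "a \<in> agr A (i - j)" "x = n \<oplus>\<^bsub>M\<^esub> ract M v a" using ad_deg[OF N v x(1,2)] by metis
    hence "X = ?g (e \<otimes> a)" using x nv vF va agr_carrier[OF na(2)] by simp
    moreover have "e \<otimes> a \<in> agr A (i - j)" using agr_mult[OF prim_deg[OF pe] na(2)] by simp
    ultimately show "X \<in> ?g ` mgr ?P i" using ea[OF agr_carrier[OF na(2)]] by simp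
  next
    fix X assume "X \<in> ?g ` mgr ?P i"
    then obtain b where b: "b \<in> ideal_e e" "b \<in> agr A (i - j)" "X = ?g b" by auto
    thus "X \<in> (\<lambda>x. N +>\<^bsub>M\<^esub> x) ` (?F \<inter> mgr M i)" using vF id mgr_ract[OF v b(2)] by simp
  qed
  have gd: "?g (mdiff ?P b) = mdiff (quo ?F N) (?g b)" if b: "b \<in> ideal_e e" for b
  proof -
    note bc = id[OF b]
    have db: "adiff A b \<in> ideal_e e" using dg_module.mdiff_closed[OF eA_dg_module[OF pe]] b by simp
    have "mdiff M (ract M v b) = ract M (mdiff M v) b \<oplus>\<^bsub>M\<^esub> sign M j (ract M v (adiff A b))"
      by (rule mdiff_ract[OF v bc(1)])
    also have "sign M j (ract M v (adiff A b)) = ract M v (mdiff ?P b)"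
      using eA_minus[OF pe db] ract_minus_r[of "adiff A b" v] id[OF db] vc by (simp add: sign_def)
    finally show ?thesis
      using nv[OF sub_ract[OF N vd bc(1)]] vF bc id[OF db] by (simp add: Q sign_def eA_minus[OF pe db])
  qed
  \<comment> \<open>The quotient is recognised as a dg module through the bijection, so the axioms
    are not checked on cosets.\<close>
  have Qm: "dg_module A (quo ?F N)"
    by (rule dg_module_bij[OF P bij]) (use g0 ga gr gg gd Q(2) pdga_axioms in simp_all)
  interpret P: dg_module A ?P by (rule P)
  have gh: "restrict ?g (carrier ?P) \<in> dg_hom A ?P (quo ?F N)"
  proof (rule dg_homI)
    show "restrict ?g (carrier ?P) x \<in> carrier (quo ?F N)" if "x \<in> carrier ?P" for x
      using bij that by (auto simp: bij_betw_def)
    show "restrict ?g (carrier ?P) x \<in> mgr (quo ?F N) i" if "x \<in> mgr ?P i" for x i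
      using that P.mgr_carrier[OF that] by (simp add: gg)
    show "restrict ?g (carrier ?P) (ract ?P x a) = ract (quo ?F N) (restrict ?g (carrier ?P) x) a"
      if "x \<in> carrier ?P" "a \<in> carrier A" for x a using that P.ract_closed[OF that] gr by simp
    show "restrict ?g (carrier ?P) (mdiff ?P x) = mdiff (quo ?F N) (restrict ?g (carrier ?P) x)"
      if "x \<in> carrier ?P" for x using that P.mdiff_closed[OF that] gd by simp
    show "restrict ?g (carrier ?P) (x \<oplus>\<^bsub>?P\<^esub> y) = restrict ?g (carrier ?P) x \<oplus>\<^bsub>quo ?F N\<^esub> restrict ?g (carrier ?P) y"
      if "x \<in> carrier ?P" "y \<in> carrier ?P" for x y using that P.M.a_closed[OF that] ga by simp
  qed simp
  show ?thesis
  proof (rule dg_iso_bij[OF P Qm _ gh])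
    show "dg_module A (shift (- j) (induced A L))" by (rule shift_dg_module[OF I.induced_dg_module])
    show "restrict I.al (ideal_e e) \<in> dg_hom A ?P (shift (- j) (induced A L))"
      by (rule hom_shift[OF eA_dg_module[OF pe] I.induced_dg_module I.al_hom])
    show "bij_betw (restrict ?g (carrier ?P)) (carrier ?P) (carrier (quo ?F N))"
      using bij bij_betw_cong[of "carrier ?P" "restrict ?g (carrier ?P)" ?g] by simp
    show "bij_betw (restrict I.al (ideal_e e)) (carrier ?P) (carrier (shift (- j) (induced A L)))"
      using I.al_facts(1) bij_betw_cong[of "carrier ?P" "restrict I.al (ideal_e e)" I.al] by simp
  qed
qed

text \<open>The generator represents the image of l \<otimes> e, which has degree \<open>- k\<close>
  in the shift by \<open>k\<close>. Injectivity of the isomorphism gives the cell condition,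
  surjectivity gives N + vA = F.\<close>

lemma dg_iso_cell:
  assumes N: "sub N" and F: "sub F" and NF: "N \<subseteq> F" and gen: "gen_by A L e l"
    and iso: "dg_iso A (quo F N) (shift k (induced A L))"
  shows "\<exists>v. cell A M (- k) e v N \<and> ad N v = F"
proof -
  interpret I: induced_ctx A L e l by unfold_locales (rule gen)
  let ?I = "shift k (induced A L)"
  note Q = quo_simps[OF N F] and FC = sub_carrier[OF F]
  interpret J: dg_module A ?I by (rule shift_dg_module[OF I.induced_dg_module])
  obtain f g where f: "f \<in> dg_hom A (quo F N) ?I" and g: "g \<in> dg_hom A ?I (quo F N)"
    and fg: "compose (carrier (quo F N)) g f = hom_id (quo F N)" "compose (carrier ?I) f g = hom_id ?I"
    using iso by (auto simp: dg_iso_def)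
  have fgx: "g (f X) = X" if "X \<in> carrier (quo F N)" for X
    using fun_cong[OF fg(1), of X] that by (simp add: compose_def hom_id_def)
  have gfy: "f (g y) = y" if "y \<in> carrier ?I" for y
    using fun_cong[OF fg(2), of y] that by (simp add: compose_def hom_id_def)
  note gD = dg_homD[OF g] and ec = I.ec and pe = I.genD(2)
  have eI: "e \<in> ideal_e e" by (rule ideal_eI[OF pe ec I.ee])
  have zI: "\<zero> \<in> ideal_e e" using ideal_eI[OF pe A.zero_closed] ec by simp
  have alc: "I.al b \<in> carrier ?I" if "b \<in> ideal_e e" for b using I.al_facts(1) that by (auto simp: bij_betw_def)
  have ea: "e \<otimes> a \<in> ideal_e e" if "a \<in> carrier A" for a using that by (simp add: ideal_e_def)
  \<comment> \<open>The quotient is not yet known to be a group, so the image of zero is found from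
    its idempotency: a representative \<open>y\<close> satisfies y + y = y modulo
    \<open>N\<close>.\<close>
  have g0: "g (zero ?I) = N"
  proof -
    obtain y where y: "y \<in> F" "g (zero ?I) = N +>\<^bsub>M\<^esub> y" using gD(1)[OF J.M.zero_closed] Q(1) by auto
    have "g (zero ?I) = g ((zero ?I) \<oplus>\<^bsub>?I\<^esub> (zero ?I))" using J.M.l_zero[OF J.M.zero_closed] by simp
    also have "\<dots> = N +>\<^bsub>M\<^esub> (y \<oplus>\<^bsub>M\<^esub> y)" using gD(2)[OF J.M.zero_closed J.M.zero_closed] y Q(4) by simp
    finally have "N +>\<^bsub>M\<^esub> (y \<oplus>\<^bsub>M\<^esub> y) = N +>\<^bsub>M\<^esub> y" using y by simp
    hence "y \<oplus>\<^bsub>M\<^esub> y \<ominus>\<^bsub>M\<^esub> y \<in> N" using coset_eq[OF N] FC[OF y(1)] by simp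
    thus ?thesis using y coset_zero[OF N] FC[OF y(1)] add_cancel[of y y] by simp
  qed
  have "I.al e \<in> mgr ?I (- k)" using I.al_facts(5)[of 0] I.e0 eI by auto
  hence "g (I.al e) \<in> mgr (quo F N) (- k)" by (rule gD(4))
  then obtain v0 where v0: "v0 \<in> F" "v0 \<in> mgr M (- k)" "g (I.al e) = N +>\<^bsub>M\<^esub> v0" using Q(3) by auto
  \<comment> \<open>Multiplication by \<open>e\<close> enforces v e = v; the coset does not change,
    as \<open>e\<close> is idempotent.\<close>
  define v where "v = ract M v0 e"
  have gal: "g (I.al (e \<otimes> a)) = N +>\<^bsub>M\<^esub> ract M v0 a" if a: "a \<in> carrier A" for a
  proof -
    have "I.al (e \<otimes> a) = ract ?I (I.al e) a" using I.al_facts(4)[OF eI a] by simp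
    thus ?thesis using gD(3)[OF alc[OF eI] a] v0 Q(5)[OF v0(1) a] by simp
  qed
  have vF: "v \<in> F" using sub_ract[OF F v0(1) ec] by (simp add: v_def)
  have ve: "ract M v e = v" using ract_assoc[OF FC[OF v0(1)] ec ec] I.ee by (simp add: v_def)
  have vm: "v \<in> mgr M (- k)" using mgr_ract[OF v0(2) I.e0] by (simp add: v_def)
  have gv: "g (I.al e) = N +>\<^bsub>M\<^esub> v" using gal[OF ec] I.ee by (simp add: v_def)
  have gva: "g (I.al (e \<otimes> a)) = N +>\<^bsub>M\<^esub> ract M v a" if a: "a \<in> carrier A" for a
    using gal[of "e \<otimes> a"] a ec I.ee ract_assoc[OF FC[OF v0(1)] ec a] by (simp add: v_def flip: A.m_assoc)
  have "cell A M (- k) e v N"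
    unfolding cell_def
  proof (intro conjI ballI impI vm pe ve)
    have "mdiff ?I (I.al e) = sign (induced A L) k (I.al \<zero>)" using I.al_facts(6)[OF eI] adiff0[OF I.e0] by simp
    also have "\<dots> = (zero ?I)" using J.M.minus_equality[OF J.M.l_zero[OF J.M.zero_closed]] J.M.zero_closed I.al_facts(2) by (simp add: sign_def)
    finally have "N +>\<^bsub>M\<^esub> mdiff M v = N" using gD(5)[OF alc[OF eI]] g0 gv Q(6)[OF vF] by simp
    thus "mdiff M v \<in> N" using coset_zero[OF N] mdiff_closed FC[OF vF] by simp
    fix a assume a: "a \<in> carrier A" and "ract M v a \<in> N"
    hence "N +>\<^bsub>M\<^esub> ract M v a = N" using coset_zero[OF N ract_closed[OF FC[OF vF] a]] by blast
    hence "g (I.al (e \<otimes> a)) = N" using gva[OF a] by simp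
    moreover have "g (I.al \<zero>) = N" using g0 I.al_facts(2) by simp
    ultimately have "I.al (e \<otimes> a) = I.al \<zero>" using gfy[OF alc[OF ea[OF a]]] gfy[OF alc[OF zI]] by metis
    thus "e \<otimes> a = \<zero>" using I.al_facts(1) ea[OF a] zI unfolding bij_betw_def inj_on_def by blast
  qed
  moreover have "ad N v = F"
  proof
    show "ad N v \<subseteq> F" by (rule ad_least[OF F NF vF])
    show "F \<subseteq> ad N v"
    proof
      fix x assume x: "x \<in> F"
      have X: "N +>\<^bsub>M\<^esub> x \<in> carrier (quo F N)" using x Q(1) by simp
      have "f (N +>\<^bsub>M\<^esub> x) \<in> I.al ` ideal_e e" using dg_homD(1)[OF f X] I.al_facts(1) by (simp add: bij_betw_def)
      then obtain b where b: "b \<in> ideal_e e" "f (N +>\<^bsub>M\<^esub> x) = I.al b" by auto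
      have bc: "b \<in> carrier A" "e \<otimes> b = b" using ideal_eD[OF pe b(1)] by auto
      have "N +>\<^bsub>M\<^esub> x = N +>\<^bsub>M\<^esub> ract M v b" using gva[OF bc(1)] bc(2) b(2) fgx[OF X] by simp
      hence n: "x \<ominus>\<^bsub>M\<^esub> ract M v b \<in> N" using coset_eq[OF N] FC[OF x] ract_closed[OF FC[OF vF] bc(1)] by simp
      have "x = (x \<ominus>\<^bsub>M\<^esub> ract M v b) \<oplus>\<^bsub>M\<^esub> ract M v b"
        using FC[OF x] ract_closed[OF FC[OF vF] bc(1)] by (simp add: a_minus_def M.a_assoc M.l_neg)
      thus "x \<in> ad N v" by (rule adI[OF n bc(1)])
    qed
  qed
  ultimately show ?thesis by blast
qed

end

context pdga
begin

lemma filt_objects_subset: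
  fixes L :: "'x \<Rightarrow> ('a, 'm) rmodule"
  assumes L: "simple_representatives (degree_zero_ring A) W L" and M: "M \<in> filt_objects A W L"
  shows "filt A M"
proof -
  obtain n F l x where dM: "dg_module A M" and F0: "F 0 = {zero M}" and Fn: "F (n::nat) = carrier M"
    and Fs: "\<forall>i\<le>n. dg_submodule A M (F i)" and Fi: "\<forall>i\<in>{1..n}. F (i - 1) \<subseteq> F i"
    and ls: "\<forall>i\<in>{1..n}. \<forall>j\<in>{1..n}. i \<le> j \<longrightarrow> l j \<le> l i"
    and Fx: "\<forall>i\<in>{1..n}. x i \<in> W \<and> dg_iso A (dg_subquotient M (F i) (F (i - 1))) (shift (l i) (induced A (L (x i))))"
    using M by (auto simp: filt_objects_def)
  interpret pdgm A M by (rule pdgmI[OF dM])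
  \<comment> \<open>A shift by \<open>l i\<close> puts the generator in degree \<open>- l i\<close>.
    The layers are numbered from 1 and the entries of the list from 0, hence
    \<open>Suc i\<close>.\<close>
  have "m \<le> n ==> rf A M (map (\<lambda>i. - l (Suc i)) [0..<m]) {zero M} (F m)" for m
  proof (induction m)
    case 0
    thus ?case using F0 rf.Nil by simp
  next
    case (Suc m)
    have i: "Suc m \<in> {1..n}" using Suc.prems by auto
    have s: "sub (F m)" "sub (F (Suc m))" using Fs Suc.prems dg_submodule_iff by auto
    have "x (Suc m) \<in> W" using Fx i by blast
    hence "simple_rmodule (degree_zero_ring A) (L (x (Suc m)))" using L by (simp add: simple_representatives_def)
    then obtain e u where g: "gen_by A (L (x (Suc m))) e u" using simple_gen_by by metis
    have "F m \<subseteq> F (Suc m)" "dg_iso A (quo (F (Suc m)) (F m)) (shift (l (Suc m)) (induced A (L (x (Suc m)))))"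
      using bspec[OF Fi i] bspec[OF Fx i] by auto
    from dg_iso_cell[OF s this(1) g this(2)]
    obtain v where v: "cell A M (- l (Suc m)) e v (F m)" "ad (F m) v = F (Suc m)" by blast
    have "rf A M [- l (Suc m)] (F m) (F (Suc m))" using rf.Cons[OF v(1), of "[]" "F (Suc m)"] rf.Nil[of A M "F (Suc m)"] v(2) by simp
    thus ?case using rf_append[OF Suc.IH] Suc.prems by simp
  qed
  from this[of n] have "rf A M (map (\<lambda>i. - l (Suc i)) [0..<n]) {zero M} (carrier M)" using Fn by simp
  moreover have "sorted (map (\<lambda>i. - l (Suc i)) [0..<n])"
    using ls by (auto simp: sorted_iff_nth_mono)
  ultimately show ?thesis using dM by (auto simp: filt_def)
qed

text \<open>A cell only knows its idempotent \<open>e\<close>. Completeness of the representatives,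
  applied to a copy of the simple module e A^0 in \<open>'m\<close>, yields the index
  \<open>x\<close>, and \<open>gen_by_transfer\<close> moves the generator to
  \<open>L x\<close>.\<close>

lemma rf_chain:
  fixes L :: "'x \<Rightarrow> ('a, 'm) rmodule" and M :: "('a, 'm) dgmodule"
  assumes L: "simple_representatives (degree_zero_ring A) W L" and i: "inj_on (\<iota> :: 'a \<Rightarrow> 'm) (carrier A)"
    and dM: "dg_module A M"
  shows "rf A M js N T ==> dsub A M N ==> \<exists>F. F 0 = N \<and> F (length js) = T \<and> (\<forall>i\<le>length js. dsub A M (F i)) \<and>
    (\<forall>i<length js. F i \<subseteq> F (Suc i) \<and>
      (\<exists>x\<in>W. dg_iso A (dg_subquotient M (F (Suc i)) (F i)) (shift (- (js ! i)) (induced A (L x)))))"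
proof (induction rule: rf.induct)
  case (Nil N)
  thus ?case by (intro exI[of _ "\<lambda>i. N"]) simp
next
  case (Cons j e v N js T)
  interpret pdgm A M by (rule pdgmI[OF dM])
  have s: "sub (ad N v)" by (rule cell_sub[OF Cons.prems Cons.hyps(1)])
  have N: "N \<subseteq> ad N v" using ad_base[OF Cons.prems cellD(5)[OF Cons.hyps(1)]] by blast
  from Cons.IH[OF s] obtain F where F: "F 0 = ad N v" "F (length js) = T" "\<forall>i\<le>length js. sub (F i)"
    "\<forall>i<length js. F i \<subseteq> F (Suc i) \<and>
      (\<exists>x\<in>W. dg_iso A (quo (F (Suc i)) (F i)) (shift (- (js ! i)) (induced A (L x))))" by blast
  have pe: "prim A e" using cellD(2)[OF Cons.hyps(1)] .
  obtain S :: "('a, 'm) rmodule" and s0 where S: "simple_rmodule (degree_zero_ring A) S" "gen_by A S e s0"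
    using prim_simple_module[OF pe i] by blast
  obtain x where x: "x \<in> W" "rmodule_iso (degree_zero_ring A) S (L x)" "simple_rmodule (degree_zero_ring A) (L x)"
    using L S(1) unfolding simple_representatives_def by blast
  obtain l where l: "gen_by A (L x) e l" using gen_by_transfer[OF S(2) x(3,2)] by blast
  note iso = cell_dg_iso[OF Cons.prems Cons.hyps(1) l]
  show ?case
  proof (intro exI[of _ "case_nat N F"] conjI allI impI)
    show "case_nat N F (length (j # js)) = T" using F by simp
    show "sub (case_nat N F i)" if "i \<le> length (j # js)" for i using that F(3) Cons.prems by (cases i) auto
    show "case_nat N F i \<subseteq> case_nat N F (Suc i)" if "i < length (j # js)" for i
      using that F N by (cases i) auto
    show "\<exists>x\<in>W. dg_iso A (quo (case_nat N F (Suc i)) (case_nat N F i)) (shift (- ((j # js) ! i)) (induced A (L x)))"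
      if "i < length (j # js)" for i
      using that F x(1) iso by (cases i) auto
  qed simp
qed

lemma filt_objects_eq:
  fixes L :: "'x \<Rightarrow> ('a, 'm) rmodule" and \<iota> :: "'a \<Rightarrow> 'm"
  assumes L: "simple_representatives (degree_zero_ring A) W L" and i: "inj_on \<iota> (carrier A)"
  shows "filt_objects A W L = {M. filt A M}"
proof (intro equalityI subsetI CollectI)
  fix M :: "('a, 'm) dgmodule" assume "M \<in> filt_objects A W L"
  thus "filt A M" by (rule filt_objects_subset[OF L])
next
  fix M :: "('a, 'm) dgmodule" assume "M \<in> {M. filt A M}"
  then obtain js where dM: "dg_module A M" and js: "sorted js" "rf A M js {zero M} (carrier M)" by (auto simp: filt_def)
  interpret pdgm A M by (rule pdgmI[OF dM])
  obtain F where F: "F 0 = {zero M}" "F (length js) = carrier M" "\<forall>i\<le>length js. sub (F i)"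
    "\<forall>i<length js. F i \<subseteq> F (Suc i) \<and>
      (\<exists>x\<in>W. dg_iso A (quo (F (Suc i)) (F i)) (shift (- (js ! i)) (induced A (L x))))"
    using rf_chain[OF L i dM js(2) pdgm_sub_zero[OF dM]] by blast
  then obtain x where x: "\<And>i. i < length js ==> x i \<in> W \<and>
      dg_iso A (quo (F (Suc i)) (F i)) (shift (- (js ! i)) (induced A (L (x i))))" by metis
  show "M \<in> filt_objects A W L"
    unfolding filt_objects_def
  proof (intro CollectI conjI dM exI[of _ "length js"] exI[of _ F] exI[of _ "\<lambda>i. - (js ! (i - 1))"] exI[of _ "\<lambda>i. x (i - 1)"]
      F(1,2) ballI allI impI)
    show "dg_submodule A M (F i)" if "i \<le> length js" for i using F(3) that dg_submodule_iff by simp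
    fix i assume i: "i \<in> {1..length js}"
    then obtain k where k: "i = Suc k" "k < length js" by (cases i) auto
    show "F (i - 1) \<subseteq> F i" "x (i - 1) \<in> W"
      "dg_iso A (quo (F i) (F (i - 1))) (shift (- (js ! (i - 1))) (induced A (L (x (i - 1)))))"
      using k F(4) x[of k] by auto
    fix j assume "j \<in> {1..length js}" "i \<le> j"
    thus "- (js ! (j - 1)) \<le> - (js ! (i - 1))"
      using i sorted_nth_mono[OF js(1), of "i - 1" "j - 1"] by simp
  qed
qed

end

section \<open>Krull-Remak-Schmidt decompositions\<close>

context preadd
begin

lemma iso_conj:
  assumes ob: "N \<in> Ob" "F \<in> Ob" and ab: "a \<in> Mo N F" "b \<in> Mo F N" "cp N F N b a = Idn N" "cp F N F a b = Idn F"
  defines "\<phi> \<equiv> \<lambda>x. cp F N F (cp N N F a x) b"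
  shows "x \<in> Mo N N ==> \<phi> x \<in> Mo F F" "[|x \<in> Mo N N; y \<in> Mo N N|] ==> \<phi> (cp N N N x y) = cp F F F (\<phi> x) (\<phi> y)"
    "\<phi> (Idn N) = Idn F" "x \<in> Mo N N ==> cp N F N (cp F F N b (\<phi> x)) a = x"
proof -
  show mo: "\<phi> x \<in> Mo F F" if "x \<in> Mo N N" for x using that ob ab by (simp add: \<phi>_def cp_mor)
  have ba: "cp N F Z (cp F N Z w b) a = w" if "Z \<in> Ob" "w \<in> Mo N Z" for Z w
    using that ob ab cp_assoc[of N F N Z a b w] by (simp add: Id_r)
  show "\<phi> (cp N N N x y) = cp F F F (\<phi> x) (\<phi> y)" if x: "x \<in> Mo N N" and y: "y \<in> Mo N N"
  proof -
    have ax: "cp N N F a x \<in> Mo N F" and ay: "cp N N F a y \<in> Mo N F" using x y ob ab by (auto intro: cp_mor)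
    have "cp F F F (\<phi> x) (cp F N F (cp N N F a y) b) = cp F N F (cp N F F (\<phi> x) (cp N N F a y)) b"
      by (rule cp_assoc) (use ob ab ay mo[OF x] in auto)
    also have "cp N F F (\<phi> x) (cp N N F a y) = cp N N F (cp N F F (\<phi> x) a) y"
      by (rule cp_assoc) (use ob ab y mo[OF x] in auto)
    also have "cp N F F (\<phi> x) a = cp N N F a x" unfolding \<phi>_def by (rule ba) (use ob ax in auto)
    also have "cp N N F (cp N N F a x) y = cp N N F a (cp N N N x y)" by (rule cp_assoc[symmetric]) (use ob ab x y in auto)
    finally show ?thesis by (simp only: \<phi>_def)
  qed
  show "\<phi> (Idn N) = Idn F" using ob ab by (simp add: \<phi>_def Id_r)
  show "cp N F N (cp F F N b (\<phi> x)) a = x" if x: "x \<in> Mo N N"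
  proof -
    have ax: "cp N N F a x \<in> Mo N F" using x ob ab by (auto intro: cp_mor)
    have "cp F F N b (\<phi> x) = cp F N N (cp N F N b (cp N N F a x)) b"
      unfolding \<phi>_def by (rule cp_assoc) (use ob ab ax in auto)
    also have "cp N F N b (cp N N F a x) = cp N N N (cp N F N b a) x" by (rule cp_assoc) (use ob ab x in auto)
    also have "\<dots> = x" using ob ab x by (simp add: Id_l)
    finally show ?thesis using ba[OF ob(1) x] by simp
  qed
qed

text \<open>Conjugation by the isomorphism respects composition and identities, hence powers, so it
  transports invertibility and nilpotency.\<close>

lemma fitting_object_iso:
  assumes F: "fitting_object F" and ob: "N \<in> Ob"
    and ab: "a \<in> Mo N F" "b \<in> Mo F N" "cp N F N b a = Idn N" "cp F N F a b = Idn F"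
  shows "fitting_object N"
proof -
  have Fo: "F \<in> Ob" and F1: "Idn F \<noteq> Ze F F" using F by (auto simp: fitting_object_def)
  interpret N: ring "end_ring C N" by (rule end_ring[OF ob])
  interpret F: ring "end_ring C F" by (rule end_ring[OF Fo])
  define \<phi> where "\<phi> x = cp F N F (cp N N F a x) b" for x
  define \<psi> where "\<psi> y = cp N F N (cp F F N b y) a" for y
  note cN = iso_conj[OF ob Fo ab, folded \<phi>_def \<psi>_def]
  note cF = iso_conj[OF Fo ob ab(2,1,4,3), folded \<psi>_def]
  have F0: "\<psi> (Ze F F) = Ze N N" using ob Fo ab by (simp add: \<psi>_def Ze_l Ze_r)
  have "Idn N \<noteq> Ze N N"
  proof
    assume "Idn N = Ze N N"
    hence "\<phi> (Idn N) = Ze F F" using ob Fo ab by (simp add: \<phi>_def Ze_l Ze_r)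
    thus False using cN(3) F1 by simp
  qed
  moreover have "is_iso_mor C N N x \<or> nilpotent (end_ring C N) x" if x: "x \<in> Mo N N" for x
  proof -
    have pw: "\<phi> (x [^]\<^bsub>end_ring C N\<^esub> n) = \<phi> x [^]\<^bsub>end_ring C F\<^esub> n" for n :: nat
    proof (induction n)
      case (Suc n)
      have "x [^]\<^bsub>end_ring C N\<^esub> n \<in> Mo N N" using N.nat_pow_closed[of x n] x by simp
      thus ?case using Suc cN(2)[OF _ x] by simp
    qed (use cN(3) in simp)
    from F cN(1)[OF x] consider "is_iso_mor C F F (\<phi> x)" | "nilpotent (end_ring C F) (\<phi> x)"
      unfolding fitting_object_def by blast
    thus ?thesis
    proof cases
      case 1
      then obtain y where y: "y \<in> Mo F F" "cp F F F y (\<phi> x) = Idn F" "cp F F F (\<phi> x) y = Idn F"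
        unfolding is_iso_mor_def by blast
      have "cp N N N (\<psi> y) x = Idn N" "cp N N N x (\<psi> y) = Idn N"
        using cF(2)[OF y(1) cN(1)[OF x]] cF(2)[OF cN(1)[OF x] y(1)] y cF(3) cN(4)[OF x] by (simp_all add: \<psi>_def)
      thus ?thesis using x cF(1)[OF y(1)] unfolding is_iso_mor_def by (auto simp: \<psi>_def)
    next
      case 2
      then obtain n :: nat where "\<phi> x [^]\<^bsub>end_ring C F\<^esub> n = Ze F F" by (auto simp: nilpotent_def)
      hence "\<phi> (x [^]\<^bsub>end_ring C N\<^esub> n) = Ze F F" using pw by simp
      moreover have "\<psi> (\<phi> (x [^]\<^bsub>end_ring C N\<^esub> n)) = x [^]\<^bsub>end_ring C N\<^esub> n"
        using cN(4)[of "x [^]\<^bsub>end_ring C N\<^esub> n"] N.nat_pow_closed[of x n] x by (simp add: \<psi>_def)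
      ultimately have "x [^]\<^bsub>end_ring C N\<^esub> n = Ze N N" using F0 by simp
      thus ?thesis using x by (auto simp: nilpotent_def)
    qed
  qed
  ultimately show ?thesis using ob by (auto simp: fitting_object_def)
qed

end

lemma (in abelian_group) diff_zero: "x \<in> carrier G ==> x \<ominus> \<zero> = x"
  using minus_equality[of \<zero> \<zero>] by (simp add: a_minus_def)

text \<open>Injections into the universe \<open>'m\<close>: \<open>\<iota>\<close> for
  \<open>A\<close> itself, \<open>\<rho>\<close> for a module with one cell attached, and
  \<open>\<sigma>\<close> for direct sums.\<close>

locale pdga_univ = pdga A for A :: "('k, 'a) dgalgebra" (structure) +
  fixes \<iota> :: "'a \<Rightarrow> 'm" and \<rho> :: "'m \<times> 'a \<Rightarrow> 'm" and \<sigma> :: "'m \<times> 'm \<Rightarrow> 'm"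
  assumes iota: "inj_on \<iota> (carrier A)" and rho: "inj_on \<rho> (UNIV \<times> carrier A)" and sigma: "inj_on \<sigma> UNIV"

sublocale pdga_univ \<subseteq> Mod: preadd "dgMod A :: (('a, 'm) dgmodule, 'm \<Rightarrow> 'm) precat"
  by (rule dgMod_preadd)

sublocale pdga_univ \<subseteq> Hot: preadd "dgHot A :: (('a, 'm) dgmodule, ('m \<Rightarrow> 'm) set) precat"
  by (rule dgHot_preadd)

context pdga_univ
begin

lemma Mod_pow:
  fixes M :: "('a, 'm) dgmodule"
  assumes M: "dg_module A M" and f: "f \<in> dg_hom A M M"
  shows "f [^]\<^bsub>end_ring (dgMod A) M\<^esub> (n::nat) = restrict (f ^^ n) (carrier M)"
proof -
  interpret R: ring "end_ring (dgMod A) M" using Mod.end_ring M by simp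
  show ?thesis
  proof (induction n)
    case 0
    show ?case by (simp add: hom_id_def fun_eq_iff)
  next
    case (Suc n)
    have "f [^]\<^bsub>end_ring (dgMod A) M\<^esub> Suc n = compose (carrier M) (f [^]\<^bsub>end_ring (dgMod A) M\<^esub> n) f" by simp
    also have "\<dots> = restrict (f ^^ Suc n) (carrier M)"
      unfolding Suc using dg_homD(1)[OF f] by (auto simp: compose_def fun_eq_iff funpow_swap1)
    finally show ?case .
  qed
qed

lemma Hot_pow:
  fixes M :: "('a, 'm) dgmodule"
  assumes M: "dg_module A M" and f: "f \<in> dg_hom A M M"
  shows "hcls A M M f [^]\<^bsub>end_ring (dgHot A) M\<^esub> (n::nat) = hcls A M M (restrict (f ^^ n) (carrier M))"
    "restrict (f ^^ n) (carrier M) \<in> dg_hom A M M"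
proof -
  interpret R: ring "end_ring (dgMod A) M" using Mod.end_ring M by simp
  interpret H: ring "end_ring (dgHot A) M" using Hot.end_ring M by (simp add: dgHot_simps)
  have cl: "f [^]\<^bsub>end_ring (dgMod A) M\<^esub> n \<in> dg_hom A M M" for n :: nat using R.nat_pow_closed[of f n] f by simp
  show "restrict (f ^^ n) (carrier M) \<in> dg_hom A M M" using cl[of n] Mod_pow[OF M f] by simp
  have "hcls A M M f [^]\<^bsub>end_ring (dgHot A) M\<^esub> n = hcls A M M (f [^]\<^bsub>end_ring (dgMod A) M\<^esub> n)"
  proof (induction n)
    case 0
    show ?case by (simp add: dgHot_simps)
  next
    case (Suc n)
    thus ?case using hcls_comp[OF M M M f cl[of n]] by simp
  qed
  thus "hcls A M M f [^]\<^bsub>end_ring (dgHot A) M\<^esub> n = hcls A M M (restrict (f ^^ n) (carrier M))"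
    using Mod_pow[OF M f] by simp
qed

lemma direct_sum_hot:
  fixes M X Y :: "('a, 'm) dgmodule"
  assumes "is_direct_sum (dgMod A) M [X, Y]"
  shows "is_direct_sum (dgHot A) M [X, Y]"
proof -
  from assms obtain i p j q where ob: "M \<in> Mod.Ob" "X \<in> Mod.Ob" "Y \<in> Mod.Ob"
    and mo: "i \<in> Mod.Mo X M" "p \<in> Mod.Mo M X" "j \<in> Mod.Mo Y M" "q \<in> Mod.Mo M Y"
    and eq: "Mod.cp X M X p i = Mod.Idn X" "Mod.cp Y M Y q j = Mod.Idn Y"
      "Mod.cp Y M X p j = Mod.Ze Y X" "Mod.cp X M Y q i = Mod.Ze X Y"
      "Mod.Pl M M (Mod.cp M X M i p) (Mod.cp M Y M j q) = Mod.Idn M"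
    by (rule Mod.direct_sum_pairE)
  have d: "dg_module A M" "dg_module A X" "dg_module A Y" using ob by auto
  have h: "i \<in> dg_hom A X M" "p \<in> dg_hom A M X" "j \<in> dg_hom A Y M" "q \<in> dg_hom A M Y" using mo by auto
  show ?thesis
    by (rule Hot.direct_sum_pairI[where i = "hcls A X M i" and p = "hcls A M X p" and j = "hcls A Y M j" and q = "hcls A M Y q"])
      (use d h eq in \<open>simp_all add: dgHot_simps hcls_comp hcls_plus hom_compose\<close>)
qed

lemma zero_module_iff:
  fixes M :: "('a, 'm) dgmodule"
  assumes M: "dg_module A M"
  shows "hom_id M = hom_zero M M \<longleftrightarrow> carrier M = {zero M}"
proof -
  interpret dg_module A M by (rule M)
  show ?thesis
  proof
    assume eq: "hom_id M = hom_zero M M"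
    have "x = (zero M)" if "x \<in> carrier M" for x using fun_cong[OF eq, of x] that by (simp add: hom_id_def hom_zero_def)
    thus "carrier M = {zero M}" by auto
  next
    assume "carrier M = {zero M}"
    thus "hom_id M = hom_zero M M" by (simp add: hom_id_def hom_zero_def fun_eq_iff)
  qed
qed

text \<open>A null-homotopic identity has a power that maps \<open>M\<close> to zero by
  \<open>rf_homotopy_nilpotent\<close>, but all its powers are the identity.\<close>

lemma filt_zero_iff:
  fixes M :: "('a, 'm) dgmodule"
  assumes M: "filt A M"
  shows "Hot.Idn M = Hot.Ze M M \<longleftrightarrow> carrier M = {zero M}"
proof
  note dM = filt_dg[OF M]
  interpret pdgm A M by (rule pdgmI[OF dM])
  {
    assume "Hot.Idn M = Hot.Ze M M"
    hence "htp A M M (hom_id M) (hom_zero M M)"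
      using hcls_eq[OF dM dM hom_id_hom[OF dM] hom_zero_hom[OF dM dM]] by (simp add: dgHot_simps)
    then obtain h where h: "dg_homotopy A M M h"
      "\<And>x. x \<in> carrier M ==> hom_id M x \<ominus>\<^bsub>M\<^esub> hom_zero M M x = mdiff M (h x) \<oplus>\<^bsub>M\<^esub> h (mdiff M x)"
      unfolding htp_def by blast
    have hx: "id x = mdiff M (h x) \<oplus>\<^bsub>M\<^esub> h (mdiff M x)" if "x \<in> carrier M" for x
      using h(2)[OF that] that M.diff_zero[OF that] by (simp add: hom_id_def hom_zero_def)
    have h0: "h x \<in> {zero M}" if "x \<in> {zero M}" for x
      using addmap_zero[OF M.abelian_group_axioms M.abelian_group_axioms dg_homotopyD(5)[OF h(1)]] that by simp
    obtain js where js: "sorted js" "rf A M js {zero M} (carrier M)" using M by (auto simp: filt_def)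
    have "((\<lambda>x. x) ^^ n) x = x" for n and x :: 'm by (induction n) simp_all
    hence "x = (zero M)" if x: "x \<in> carrier M" for x
      using rf_homotopy_nilpotent[OF js(2) refl pdgm_sub_zero[OF dM] js(1) h(1) h0 hx x] by (simp add: id_def)
    thus "carrier M = {zero M}" by auto
  next
    assume "carrier M = {zero M}"
    thus "Hot.Idn M = Hot.Ze M M" using zero_module_iff[OF dM] by (simp add: dgHot_simps)
  }
qed

lemma rst_inc: "[|dg_module A M; dsub A M P|] ==> (\<lambda>x\<in>P. x) \<in> dg_hom A (rst M P) M"
  by (rule dg_homI) (auto simp: dsub_def)

lemma hom_into_rst:
  assumes "dg_module A L" "f \<in> dg_hom A L M" "f ` carrier L \<subseteq> P"
  shows "f \<in> dg_hom A L (rst M P)"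
proof -
  interpret L: dg_module A L by fact
  show ?thesis
    by (rule dg_homI) (use assms(3) dg_homD[OF assms(2)] L.mgr_carrier in auto)
qed

text \<open>\<open>rf_split\<close> distributes the cells over the images of \<open>p\<close> and 1
  - p. That the lengths add up is what drives the induction in \<open>decompose\<close>.\<close>

lemma split_idem:
  fixes M :: "('a, 'm) dgmodule"
  assumes dM: "dg_module A M" and js: "sorted js" "rf A M js {zero M} (carrier M)"
    and p: "p \<in> dg_hom A M M" and pp: "\<And>x. x \<in> carrier M ==> p (p x) = p x"
  shows "\<exists>X Y js1 js2. X = rst M (p ` carrier M) \<and> carrier X = p ` carrier M \<and> carrier Y = (\<lambda>x. x \<ominus>\<^bsub>M\<^esub> p x) ` carrier M \<and>
    is_direct_sum (dgMod A) M [X, Y] \<and> zero X = zero M \<and> zero Y = zero M \<and> dg_module A X \<and> dg_module A Y \<and>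
    sorted js1 \<and> sorted js2 \<and> length js1 + length js2 = length js \<and>
    rf A X js1 {zero M} (carrier X) \<and> rf A Y js2 {zero M} (carrier Y)"
proof -
  interpret pdgm A M by (rule pdgmI[OF dM])
  define q where "q = (\<lambda>x\<in>carrier M. x \<ominus>\<^bsub>M\<^esub> p x)"
  note pD = dg_homD[OF p]
  have "q = hom_plus M M (hom_id M) (\<lambda>x\<in>carrier M. \<ominus>\<^bsub>M\<^esub> p x)"
    by (simp add: q_def hom_plus_def hom_id_def a_minus_def fun_eq_iff)
  hence q: "q \<in> dg_hom A M M" using hom_plus_hom[OF dM dM hom_id_hom[OF dM] hom_minus_hom[OF dM dM p]] by simp
  note qD = dg_homD[OF q]
  have p0: "p (zero M) = (zero M)" and q0: "q (zero M) = (zero M)" using hom_zero_val[OF dM dM] p q by auto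
  have qx: "q x = x \<ominus>\<^bsub>M\<^esub> p x" if "x \<in> carrier M" for x using that by (simp add: q_def)
  have pq: "p (q x) = (zero M)" if x: "x \<in> carrier M" for x
    using addmap_diff[OF M.abelian_group_axioms M.abelian_group_axioms pD(7) x pD(1)[OF x]] pp[OF x] x qx[OF x] diff_self[OF pD(1)[OF x]]
    by simp
  have qp: "q (p x) = (zero M)" if x: "x \<in> carrier M" for x
    using qx[OF pD(1)[OF x]] pp[OF x] diff_self[OF pD(1)[OF x]] by simp
  have qq: "q (q x) = q x" if x: "x \<in> carrier M" for x
    using qx[OF qD(1)[OF x]] pq[OF x] M.diff_zero[OF qD(1)[OF x]] by simp
  have sum: "p x \<oplus>\<^bsub>M\<^esub> q x = x" if x: "x \<in> carrier M" for x
    using qx[OF x] x pD(1)[OF x] by (simp add: a_minus_def M.a_lcomm[of "p x" x] M.r_neg)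
  have z: "p ` {zero M} = {zero M}" "q ` {zero M} = {zero M}" using p0 q0 by auto
  have s0: "sub {zero M}" by (rule pdgm_sub_zero[OF dM])
  have "x = p x \<oplus>\<^bsub>M\<^esub> q x \<and> p (q x) = (zero M) \<and> q (p x) = (zero M)" if "x \<in> carrier M" for x
    using sum[OF that] pq[OF that] qp[OF that] by simp
  from rf_split[OF p q this js(2) s0 js(1)] z
  obtain js1 js2 where j: "sorted js1" "sorted js2" "length js1 + length js2 = length js"
    "rf A M js1 {zero M} (p ` carrier M)" "rf A M js2 {zero M} (q ` carrier M)" by auto
  define X where "X = rst M (p ` carrier M)"
  define Y where "Y = rst M (q ` carrier M)"
  have sX: "sub (p ` carrier M)" and sY: "sub (q ` carrier M)" using rf_sub[OF j(4) s0] rf_sub[OF j(5) s0] by auto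
  have d: "dg_module A X" "dg_module A Y" using rst_dg_module sX sY by (auto simp: X_def Y_def)
  have i: "(\<lambda>x\<in>p ` carrier M. x) \<in> dg_hom A X M" "(\<lambda>x\<in>q ` carrier M. x) \<in> dg_hom A Y M"
    using rst_inc[OF dM] sX sY by (auto simp: X_def Y_def)
  have r: "p \<in> dg_hom A M X" "q \<in> dg_hom A M Y" using hom_into_rst[OF dM] p q by (auto simp: X_def Y_def)
  have "is_direct_sum (dgMod A) M [X, Y]"
  proof (rule Mod.direct_sum_pairI[where i = "\<lambda>x\<in>p ` carrier M. x" and j = "\<lambda>x\<in>q ` carrier M. x" and p = p and q = q])
    show "Mod.cp X M X p (\<lambda>x\<in>p ` carrier M. x) = Mod.Idn X"
      using pp by (auto simp: X_def compose_def hom_id_def fun_eq_iff)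
    show "Mod.cp Y M Y q (\<lambda>x\<in>q ` carrier M. x) = Mod.Idn Y"
      using qq by (auto simp: Y_def compose_def hom_id_def fun_eq_iff)
    show "Mod.cp Y M X p (\<lambda>x\<in>q ` carrier M. x) = Mod.Ze Y X"
      using pq by (auto simp: X_def Y_def compose_def hom_zero_def fun_eq_iff)
    show "Mod.cp X M Y q (\<lambda>x\<in>p ` carrier M. x) = Mod.Ze X Y"
      using qp by (auto simp: X_def Y_def compose_def hom_zero_def fun_eq_iff)
    show "Mod.Pl M M (Mod.cp M X M (\<lambda>x\<in>p ` carrier M. x) p) (Mod.cp M Y M (\<lambda>x\<in>q ` carrier M. x) q) =
        Mod.Idn M"
      using sum by (auto simp: compose_def hom_plus_def hom_id_def fun_eq_iff)
  qed (use dM d i r in simp_all)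
  moreover have "rf A X js1 {zero M} (carrier X)" "rf A Y js2 {zero M} (carrier Y)"
    using rst_rf[OF j(4) pdgm_axioms s0 order_refl] rst_rf[OF j(5) pdgm_axioms s0 order_refl] by (simp_all add: X_def Y_def)
  moreover have "carrier Y = (\<lambda>x. x \<ominus>\<^bsub>M\<^esub> p x) ` carrier M" using qx by (auto simp: Y_def)
  ultimately show ?thesis using d j(1-3)
    by (intro exI[of _ X] exI[of _ Y] exI[of _ js1] exI[of _ js2]) (simp add: X_def Y_def)
qed

text \<open>The common form to which indecomposability in dgMod and in dgFilt is reduced. It speaks
  of strict idempotents, which are what Fitting's lemma produces.\<close>

definition connected :: "('a, 'm) dgmodule \<Rightarrow> bool" where
  "connected M \<longleftrightarrow> filt A M \<and> carrier M \<noteq> {zero M} \<and> (\<forall>p\<in>dg_hom A M M. (\<forall>x\<in>carrier M. p (p x) = p x) \<longrightarrow>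
     p ` carrier M = {zero M} \<or> (\<forall>x\<in>carrier M. p x = x))"

text \<open>The projection that Fitting's lemma attaches to \<open>f\<close> is zero or one, so f^n
  is zero or \<open>f\<close> is bijective. This is proved for representatives and passes to
  homotopy classes; that the identity is not null-homotopic is \<open>filt_zero_iff\<close>.\<close>

lemma connected_fitting:
  assumes "connected M"
  shows "Mod.fitting_object M" "Hot.fitting_object M"
proof -
  have F: "filt A M" and nz: "carrier M \<noteq> {zero M}" using assms by (auto simp: connected_def)
  note dM = filt_dg[OF F]
  obtain js where js: "sorted js" "rf A M js {zero M} (carrier M)" using F by (auto simp: filt_def)
  have en: "(\<exists>g\<in>dg_hom A M M. compose (carrier M) g f = hom_id M \<and> compose (carrier M) f g = hom_id M) \<or>
      (\<exists>n::nat. restrict (f ^^ n) (carrier M) = hom_zero M M)" if f: "f \<in> dg_hom A M M" for f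
  proof -
    interpret pdgm A M by (rule pdgmI[OF dM])
    interpret pdgm_end A M f by unfold_locales (rule f)
    obtain n p g where n: "n > 0" and p: "p \<in> dg_hom A M M" and g: "g \<in> dg_hom A M M"
      and eq: "\<And>x. x \<in> carrier M ==> p (p x) = p x \<and> (f ^^ n) (p x) = (f ^^ n) x \<and> p ((f ^^ n) x) = (f ^^ n) x \<and>
        (f ^^ n) (g x) = p x \<and> g ((f ^^ n) x) = p x"
      using fitting[OF js(2,1)] by metis
    consider "p ` carrier M = {zero M}" | "\<forall>x\<in>carrier M. p x = x"
      using assms p eq unfolding connected_def by blast
    thus ?thesis
    proof cases
      case 1
      have "(f ^^ n) x = (zero M)" if x: "x \<in> carrier M" for x
      proof -
        have "p x = (zero M)" using 1 x by blast
        hence "(f ^^ n) x = (f ^^ n) (zero M)" using eq[OF x] by simp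
        thus ?thesis using addmap_zero[OF M.abelian_group_axioms M.abelian_group_axioms pow_addmap[of n]] by simp
      qed
      hence "restrict (f ^^ n) (carrier M) = hom_zero M M" by (auto simp: hom_zero_def fun_eq_iff)
      thus ?thesis by blast
    next
      case 2
      \<comment> \<open>Positivity of \<open>n\<close> lets f^n factor through \<open>f\<close> on
        either side.\<close>
      obtain m where m: "n = Suc m" using n by (cases n) auto
      have b: "bij_betw f (carrier M) (carrier M)"
        unfolding bij_betw_def
      proof
        show "inj_on f (carrier M)"
        proof (rule inj_onI)
          fix x y assume x: "x \<in> carrier M" and y: "y \<in> carrier M" and "f x = f y"
          hence "(f ^^ n) x = (f ^^ n) y" unfolding m funpow_Suc_right by simp
          hence "p x = p y" using eq[OF x] eq[OF y] by metis
          thus "x = y" using 2 x y by simp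
        qed
        show "f ` carrier M = carrier M"
        proof
          show "f ` carrier M \<subseteq> carrier M" using fD(1) by blast
          show "carrier M \<subseteq> f ` carrier M"
          proof
            fix x assume x: "x \<in> carrier M"
            have "x = f ((f ^^ m) (g x))" using eq[OF x] 2 x unfolding m by simp
            moreover have "(f ^^ m) (g x) \<in> carrier M" using pow_closed dg_homD(1)[OF g x] by simp
            ultimately show "x \<in> f ` carrier M" by (rule image_eqI)
          qed
        qed
      qed
      let ?g = "restrict (inv_into (carrier M) f) (carrier M)"
      have "?g \<in> dg_hom A M M" by (rule hom_bij_inverse[OF dM dM f b])
      moreover have "compose (carrier M) ?g f = hom_id M" "compose (carrier M) f ?g = hom_id M"
        using compose_inv_into_id[OF b] compose_id_inv_into[of f "carrier M" "carrier M"] b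
        by (simp_all add: hom_id_def bij_betw_def)
      ultimately show ?thesis by blast
    qed
  qed
  have "is_iso_mor (dgMod A) M M f \<or> nilpotent (end_ring (dgMod A) M) f" if f: "f \<in> dg_hom A M M" for f
    using en[OF f] f Mod_pow[OF dM f] by (auto simp: is_iso_mor_def nilpotent_def)
  thus "Mod.fitting_object M"
    using dM nz zero_module_iff[OF dM] by (auto simp: Mod.fitting_object_def)
  have "is_iso_mor (dgHot A) M M (hcls A M M f) \<or> nilpotent (end_ring (dgHot A) M) (hcls A M M f)" if f: "f \<in> dg_hom A M M" for f
    using en[OF f]
  proof (elim disjE bexE conjE exE)
    fix g assume g: "g \<in> dg_hom A M M" "compose (carrier M) g f = hom_id M" "compose (carrier M) f g = hom_id M"
    hence "is_iso_mor (dgHot A) M M (hcls A M M f)"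
      using hcls_comp[OF dM dM dM f g(1)] hcls_comp[OF dM dM dM g(1) f] f
      unfolding is_iso_mor_def dgHot_simps by auto
    thus ?thesis ..
  next
    fix n assume "restrict (f ^^ n) (carrier M) = hom_zero M M"
    hence "hcls A M M f [^]\<^bsub>end_ring (dgHot A) M\<^esub> n = Hot.Ze M M"
      using Hot_pow(1)[OF dM f, of n] by (simp add: dgHot_simps)
    hence "nilpotent (end_ring (dgHot A) M) (hcls A M M f)" using f by (auto simp: nilpotent_def dgHot_simps(2))
    thus ?thesis ..
  qed
  thus "Hot.fitting_object M"
    using dM nz filt_zero_iff[OF F] unfolding Hot.fitting_object_def dgHot_simps(1,2) by blast
qed

text \<open>Only decompositions in dgMod with filtered summands are tested, which is what
  \<open>split_idem\<close> provides. By \<open>direct_sum_hot\<close> they are decompositions in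
  dgHot as well, so the criterion serves for dgMod, dgFilt and dgPer alike.\<close>

lemma connectedI:
  assumes F: "filt A M" and nz: "carrier M \<noteq> {zero M}"
    and ds: "\<And>X Y. [|is_direct_sum (dgMod A) M [X, Y]; filt A X; filt A Y|] ==> carrier X = {zero X} \<or> carrier Y = {zero Y}"
  shows "connected M"
  unfolding connected_def
proof (intro conjI ballI impI F nz)
  fix p assume p: "p \<in> dg_hom A M M" and pp: "\<forall>x\<in>carrier M. p (p x) = p x"
  note dM = filt_dg[OF F]
  interpret pdgm A M by (rule pdgmI[OF dM])
  obtain js where js: "sorted js" "rf A M js {zero M} (carrier M)" using F by (auto simp: filt_def)
  have pp': "p (p x) = p x" if "x \<in> carrier M" for x using pp that by blast
  obtain X Y js1 js2 where X: "carrier X = p ` carrier M" "carrier Y = (\<lambda>x. x \<ominus>\<^bsub>M\<^esub> p x) ` carrier M"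
    "is_direct_sum (dgMod A) M [X, Y]" "zero X = zero M" "zero Y = zero M" "dg_module A X" "dg_module A Y"
    "sorted js1" "sorted js2" "rf A X js1 {zero M} (carrier X)" "rf A Y js2 {zero M} (carrier Y)"
    using split_idem[OF dM js p pp'] by blast
  have "filt A X" "filt A Y" using X unfolding filt_def by metis+
  from ds[OF X(3) this] show "p ` carrier M = {zero M} \<or> (\<forall>x\<in>carrier M. p x = x)"
  proof
    assume "carrier X = {zero X}"
    thus ?thesis using X(1,4) by simp
  next
    assume "carrier Y = {zero Y}"
    hence "x \<ominus>\<^bsub>M\<^esub> p x = (zero M)" if "x \<in> carrier M" for x
      using X(5) imageI[OF that, of "\<lambda>x. x \<ominus>\<^bsub>M\<^esub> p x", folded X(2)] by auto
    hence "p x = x" if "x \<in> carrier M" for x using M.diff_zero_imp_eq[of x "p x"] dg_homD(1)[OF p that] that by simp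
    thus ?thesis by blast
  qed
qed

text \<open>Induction on the number of cells: a proper idempotent gives two nonzero summands, each
  with at least one cell and hence with fewer cells than \<open>M\<close>. The class
  \<open>S\<close> is carried along so that summands can be kept in dgPer.\<close>

lemma decompose:
  fixes M :: "('a, 'm) dgmodule"
  assumes "dg_module A M" "sorted js" "rf A M js {zero M} (carrier M)"
    and cl: "\<And>M X Y. [|is_direct_sum (dgHot A) M [X, Y]; M \<in> S|] ==> X \<in> S \<and> Y \<in> S" and "M \<in> S"
  shows "\<exists>Xs. is_direct_sum (dgHot A) M Xs \<and> (\<forall>X\<in>set Xs. connected X \<and> X \<in> S)"
  using assms(1-3,5)
proof (induction "length js" arbitrary: M js rule: less_induct)
  case less
  note dM = less.prems(1) and js = less.prems(2,3)
  have F: "filt A M" using dM js by (auto simp: filt_def)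
  consider "carrier M = {zero M}" | "connected M" | p where "p \<in> dg_hom A M M" "\<forall>x\<in>carrier M. p (p x) = p x"
    "p ` carrier M \<noteq> {zero M}" "\<not> (\<forall>x\<in>carrier M. p x = x)"
    using F unfolding connected_def by blast
  thus ?case
  proof cases
    case 1
    hence "is_direct_sum (dgHot A) M []"
      using filt_zero_iff[OF F] dM by (intro Hot.direct_sum_empty) (simp_all add: dgHot_simps(1))
    thus ?thesis by (intro exI[of _ "[]"]) simp
  next
    case 2
    have "is_direct_sum (dgHot A) M [M]" using dM by (intro Hot.direct_sum_single) (simp add: dgHot_simps(1))
    thus ?thesis using 2 less.prems(4) by (intro exI[of _ "[M]"]) simp
  next
    case 3
    interpret pdgm A M by (rule pdgmI[OF dM])
    have pp': "p (p x) = p x" if "x \<in> carrier M" for x using 3(2) that by blast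
    obtain X Y js1 js2 where X: "carrier X = p ` carrier M" "carrier Y = (\<lambda>x. x \<ominus>\<^bsub>M\<^esub> p x) ` carrier M"
      "is_direct_sum (dgMod A) M [X, Y]" "zero X = zero M" "zero Y = zero M" "dg_module A X" "dg_module A Y"
      "sorted js1" "sorted js2" "length js1 + length js2 = length js"
      "rf A X js1 {zero M} (carrier X)" "rf A Y js2 {zero M} (carrier Y)"
      using split_idem[OF dM js 3(1) pp'] by blast
    have nX: "carrier X \<noteq> {zero M}" using 3(3) X(1) by simp
    have nY: "carrier Y \<noteq> {zero M}"
    proof
      assume "carrier Y = {zero M}"
      hence "x \<ominus>\<^bsub>M\<^esub> p x = (zero M)" if "x \<in> carrier M" for x
        using imageI[OF that, of "\<lambda>x. x \<ominus>\<^bsub>M\<^esub> p x", folded X(2)] by auto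
      hence "p x = x" if "x \<in> carrier M" for x using M.diff_zero_imp_eq[of x "p x"] dg_homD(1)[OF 3(1) that] that by simp
      thus False using 3(4) by blast
    qed
    have n1: "js1 \<noteq> []" using X(11) nX by (auto elim: rf.cases)
    have n2: "js2 \<noteq> []" using X(12) nY by (auto elim: rf.cases)
    have l: "length js1 < length js" "length js2 < length js" using X(10) n1 n2 by (auto simp flip: length_greater_0_conv)
    have hs: "is_direct_sum (dgHot A) M [X, Y]" by (rule direct_sum_hot[OF X(3)])
    have S: "X \<in> S" "Y \<in> S" using cl[OF hs less.prems(4)] by auto
    have rX: "rf A X js1 {zero X} (carrier X)" and rY: "rf A Y js2 {zero Y} (carrier Y)" using X by auto
    obtain Xs where Xs: "is_direct_sum (dgHot A) X Xs" "\<forall>X\<in>set Xs. connected X \<and> X \<in> S"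
      using less.hyps[OF l(1) X(6,8) rX S(1)] by blast
    obtain Ys where Ys: "is_direct_sum (dgHot A) Y Ys" "\<forall>X\<in>set Ys. connected X \<and> X \<in> S"
      using less.hyps[OF l(2) X(7,9) rY S(2)] by blast
    have "is_direct_sum (dgHot A) M (Xs @ Ys)" by (rule Hot.direct_sum_append[OF hs Xs(1) Ys(1)])
    thus ?thesis using Xs(2) Ys(2) by (intro exI[of _ "Xs @ Ys"]) auto
  qed
qed


section \<open>Closure properties of dgPer and filtered replacements\<close>

abbreviation "per \<equiv> (per_objects A :: ('a, 'm) dgmodule set)"

lemma per_facts:
  assumes "N \<in> per" shows "dg_module A N" "domf TYPE('m) A N"
  using per_domf[OF assms] rho iota by blast+

lemma per_zero: "zero_object (dgHot A) Z ==> Z \<in> per"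
  unfolding per_objects_def triangulated_subcategory_def by blast

lemma per_iso: "[|M \<in> per; dg_module A N; isomorphic (dgHot A) M N|] ==> N \<in> per"
  unfolding per_objects_def triangulated_subcategory_def by blast

lemma per_shift: "M \<in> per ==> shift l M \<in> per"
  unfolding per_objects_def triangulated_subcategory_def by blast

lemma per_cone:
  "[|M \<in> per; N \<in> per; f \<in> dg_hom A M N; dg_module A C; homotopy_equivalent A C (cone M N f)|] ==> C \<in> per"
  unfolding per_objects_def triangulated_subcategory_def by blast

lemma per_summand: "[|is_direct_sum (dgHot A) P [X, Y]; P \<in> per|] ==> X \<in> per"
  unfolding per_objects_def closed_under_summands_def by blast

lemma per_summands: "[|is_direct_sum (dgHot A) P [X, Y]; P \<in> per|] ==> X \<in> per \<and> Y \<in> per"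
  using per_summand Hot.direct_sum_swap by blast

text \<open>If \<open>N\<close> is dominated by \<open>M\<close>, then \<open>f = i r\<close> is a homotopy idempotent of \<open>M\<close>, and the strict
  idempotent \<open>p\<close> given by Fitting's lemma is homotopic to \<open>f\<close>. Hence \<open>N\<close> is homotopy equivalent to
  the image of \<open>p\<close>.\<close>

lemma filt_replacement:
  fixes N :: "('a, 'm) dgmodule"
  assumes dN: "dg_module A N" and dom: "domf TYPE('m) A N"
  shows "\<exists>F a b. filt A F \<and> a \<in> Hot.Mo N F \<and> b \<in> Hot.Mo F N \<and>
    Hot.cp N F N b a = Hot.Idn N \<and> Hot.cp F N F a b = Hot.Idn F"
proof -
  obtain M :: "('a, 'm) dgmodule" and i r where FM: "filt A M" and i: "i \<in> dg_hom A N M" and r: "r \<in> dg_hom A M N"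
    and h: "htp A N N (\<lambda>x. r (i x)) (\<lambda>x. x)"
    using dom unfolding domf_def dominated_def by blast
  note dM = filt_dg[OF FM] and ix = dg_homD(1)[OF i] and rx = dg_homD(1)[OF r]
  obtain js where js: "sorted js" "rf A M js {zero M} (carrier M)" using FM by (auto simp: filt_def)
  define f where "f = compose (carrier M) i r"
  have f: "f \<in> dg_hom A M M" unfolding f_def by (rule hom_compose[OF dM r i])
  have fx: "f x = i (r x)" if "x \<in> carrier M" for x using that by (simp add: f_def compose_def)
  interpret pdgm A M by (rule pdgmI[OF dM])
  interpret pdgm_end A M f by unfold_locales (rule f)
  interpret H: ring "end_ring (dgHot A) M" using Hot.end_ring dM by (simp add: dgHot_simps)
  obtain n p g where n: "n > 0" and p: "p \<in> dg_hom A M M" and g: "g \<in> dg_hom A M M"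
    and eq: "\<And>x. x \<in> carrier M ==> p (p x) = p x \<and> (f ^^ n) (p x) = (f ^^ n) x \<and> p ((f ^^ n) x) = (f ^^ n) x \<and>
      (f ^^ n) (g x) = p x \<and> g ((f ^^ n) x) = p x"
    using fitting[OF js(2,1)] by metis
  note px = dg_homD(1)[OF p] and gx = dg_homD(1)[OF g]
  define e where "e = hcls A M M f"
  have eH: "e \<in> Hot.Mo M M" using f by (simp add: e_def dgHot_simps)
  have pf: "htp A M M p f"
  proof -
    have "htp A M N (\<lambda>x. r (i (r x))) (\<lambda>x. r x)" by (rule htp_precomp[OF dM r h])
    hence "htp A M M (\<lambda>x. i (r (i (r x)))) (\<lambda>x. i (r x))"
      by (rule htp_postcomp[OF dM dN dM, rotated 2]) (use ix rx i in auto)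
    hence "htp A M M (compose (carrier M) f f) f"
      by (rule htp_cong[THEN iffD1, rotated 2]) (use ix rx in \<open>simp_all add: f_def compose_def\<close>)
    hence ee: "Hot.cp M M M e e = e"
      using hcls_comp[OF dM dM dM f f] hcls_eq[OF dM dM hom_compose[OF dM f f] f] by (simp add: e_def)
    \<comment> \<open>In dgHot the class \<open>e\<close> is idempotent, so the class of f^n is
      again \<open>e\<close>, as \<open>n\<close> is positive.\<close>
    have pw: "e [^]\<^bsub>end_ring (dgHot A) M\<^esub> Suc k = e" for k :: nat
    proof (induction k)
      case 0
      show ?case using H.l_one[of e] eH by simp
    next
      case (Suc k)
      thus ?case using ee H.nat_pow_Suc[of e "Suc k"] by simp
    qed
    let ?fn = "restrict (f ^^ n) (carrier M)"
    have fn: "?fn \<in> dg_hom A M M" by (rule Hot_pow(2)[OF dM f])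
    have he: "hcls A M M ?fn = e" using Hot_pow(1)[OF dM f, of n] pw[of "n - 1"] n by (simp add: e_def)
    have c: "compose (carrier M) ?fn g = p" "compose (carrier M) ?fn p = ?fn"
      using eq gx px dg_homD(6)[OF p] by (auto simp: compose_def fun_eq_iff extensional_def)
    \<comment> \<open>From f^n g = p and f^n p = f^n the classes satisfy [p] = e [g] and e [p] = e.
      Hence e = e e [g] = e [g] = [p].\<close>
    have 1: "hcls A M M p = Hot.cp M M M e (hcls A M M g)"
      using hcls_comp[OF dM dM dM g fn] c he by simp
    have 2: "Hot.cp M M M e (hcls A M M p) = e"
      using hcls_comp[OF dM dM dM p fn] c he by simp
    have gH: "hcls A M M g \<in> Hot.Mo M M" using g by (simp add: dgHot_simps)
    have "Hot.cp M M M e (hcls A M M p) = Hot.cp M M M (Hot.cp M M M e e) (hcls A M M g)"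
      unfolding 1 using H.m_assoc[of e e "hcls A M M g"] eH gH by simp
    hence "hcls A M M p = hcls A M M f" using 1 2 ee by (simp add: e_def)
    thus ?thesis using hcls_eq[OF dM dM p f] by simp
  qed
  have fp: "htp A M M f p" by (rule htp_sym[OF dM dM hom_fun[OF p] hom_fun[OF f] pf])
  define F where "F = rst M (p ` carrier M)"
  have pp: "p (p x) = p x" if "x \<in> carrier M" for x using eq[OF that] by simp
  obtain X Y js1 js2 where X: "X = rst M (p ` carrier M)" "zero X = zero M" "dg_module A X" "sorted js1"
    "rf A X js1 {zero M} (carrier X)"
    using split_idem[OF dM js p pp] by blast
  have "filt A X" unfolding filt_def using X(2-5) by metis
  hence FF: "filt A F" and dF: "dg_module A F" using X(1,3) by (simp_all add: F_def)
  have pC: "p ` carrier M \<subseteq> carrier M" using px by blast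
  hence "dg_submodule A M (p ` carrier M)" unfolding dg_submodule_def using dF by (simp add: F_def rst_def)
  hence inc: "(\<lambda>x\<in>p ` carrier M. x) \<in> dg_hom A F M" unfolding F_def dg_submodule_iff by (rule rst_inc[OF dM])
  have pF: "p \<in> dg_hom A M F" unfolding F_def by (rule hom_into_rst[OF dM p order_refl])
  define a where "a = compose (carrier N) p i"
  define b where "b = compose (carrier F) r (\<lambda>x\<in>p ` carrier M. x)"
  have a: "a \<in> dg_hom A N F" unfolding a_def by (rule hom_compose[OF dN i pF])
  have b: "b \<in> dg_hom A F N" unfolding b_def by (rule hom_compose[OF dF inc r])
  have ba: "htp A N N (\<lambda>x. b (a x)) (\<lambda>x. x)"
  proof -
    \<comment> \<open>The composite r p i is homotopic to r f i = (r i)(r i), and r i is homotopic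
      to the identity.\<close>
    have "htp A N M (\<lambda>x. p (i x)) (\<lambda>x. f (i x))" by (rule htp_precomp[OF dN i pf])
    hence 1: "htp A N N (\<lambda>x. r (p (i x))) (\<lambda>x. r (f (i x)))"
      by (rule htp_postcomp[OF dN dM dN, rotated 2]) (use ix px fD(1) r in auto)
    have "htp A N N (\<lambda>x. r (i (compose (carrier N) r i x))) (\<lambda>x. compose (carrier N) r i x)"
      by (rule htp_precomp[OF dN hom_compose[OF dN i r] h])
    hence 2: "htp A N N (\<lambda>x. r (f (i x))) (\<lambda>x. r (i x))"
      by (rule htp_cong[THEN iffD1, rotated 2]) (use ix in \<open>simp_all add: compose_def fx\<close>)
    have 3: "htp A N N (\<lambda>x. r (p (i x))) (\<lambda>x. r (i x))"
      by (rule htp_trans[OF dN dN _ _ _ 1 2]) (use ix px rx fD(1) in auto)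
    have "htp A N N (\<lambda>x. r (p (i x))) (\<lambda>x. x)"
      by (rule htp_trans[OF dN dN _ _ _ 3 h]) (use ix px rx in auto)
    thus ?thesis
      by (rule htp_cong[THEN iffD1, rotated 2]) (use ix px in \<open>simp_all add: a_def b_def compose_def F_def\<close>)
  qed
  have ab: "htp A F F (\<lambda>x. a (b x)) (\<lambda>x. x)"
  proof -
    \<comment> \<open>On the image of \<open>p\<close>, the composite p i r = p f is homotopic to p
      p, which is the identity there.\<close>
    have "htp A F M (\<lambda>x. f ((\<lambda>x\<in>p ` carrier M. x) x)) (\<lambda>x. p ((\<lambda>x\<in>p ` carrier M. x) x))"
      by (rule htp_precomp[OF dF inc fp])
    hence "htp A F F (\<lambda>x. p (f ((\<lambda>x\<in>p ` carrier M. x) x))) (\<lambda>x. p (p ((\<lambda>x\<in>p ` carrier M. x) x)))"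
      by (rule htp_postcomp[OF dF dM dF, rotated 2]) (use px fD(1) pC pF in \<open>auto simp: F_def\<close>)
    thus ?thesis
      by (rule htp_cong[THEN iffD1, rotated 2]) (use rx px pC pp fx in \<open>auto simp: a_def b_def compose_def F_def\<close>)
  qed
  show ?thesis
  proof (intro exI conjI)
    show "filt A F" by (rule FF)
    show "hcls A N F a \<in> Hot.Mo N F" "hcls A F N b \<in> Hot.Mo F N" using a b by (simp_all add: dgHot_simps)
    show "Hot.cp N F N (hcls A F N b) (hcls A N F a) = Hot.Idn N" using hot_iso_htp[OF dN dF a b] ba by simp
    show "Hot.cp F N F (hcls A N F a) (hcls A F N b) = Hot.Idn F" using hot_iso_htp[OF dF dN b a] ab by simp
  qed
qed

text \<open>The cone of the zero map from \<open>X\<close> shifted by -1 to \<open>Y\<close> is Y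
  \<oplus> X with its ordinary differential, as the two signs cancel, and \<open>\<sigma>\<close>
  carries it to the universe. Its presentation as a cone makes the closure properties of dgPer
  applicable.\<close>

lemma direct_sum_exists:
  fixes X Y :: "('a, 'm) dgmodule"
  assumes dX: "dg_module A X" and dY: "dg_module A Y"
  shows "\<exists>P. dg_module A P \<and> is_direct_sum (dgMod A) P [X, Y] \<and>
    homotopy_equivalent A P (cone (shift (- 1) X) Y (hom_zero (shift (- 1) X) Y))"
proof -
  interpret X: dg_module A X by fact
  interpret Y: dg_module A Y by fact
  define C where "C = cone (shift (- 1) X) Y (hom_zero (shift (- 1) X) Y)"
  have hz: "hom_zero (shift (- 1) X) Y \<in> dg_hom A (shift (- 1) X) Y" by (rule hom_zero_hom[OF shift_dg_module[OF dX] dY])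
  have dC: "dg_module A C" unfolding C_def by (rule cone_dg_module[OF shift_dg_module[OF dX] dY hz])
  interpret C: dg_module A C by (rule dC)
  have Cs: "carrier C = carrier Y \<times> carrier X" "zero C = ((zero Y), (zero X))"
    "\<And>y x y' x'. (y, x) \<oplus>\<^bsub>C\<^esub> (y', x') = (y \<oplus>\<^bsub>Y\<^esub> y', x \<oplus>\<^bsub>X\<^esub> x')"
    "\<And>y x a. ract C (y, x) a = (ract Y y a, ract X x a)" "\<And>i. mgr C i = mgr Y i \<times> mgr X i"
    by (simp_all add: C_def)
  have Cd: "mdiff C (y, x) = (mdiff Y y, mdiff X x)" if "y \<in> carrier Y" "x \<in> carrier X" for x y
    using that X.mdiff_closed Y.mdiff_closed by (simp add: C_def hom_zero_def sign_def)
  have sg: "inj_on \<sigma> (carrier C)" using sigma inj_on_subset by blast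
  define P where "P = transport \<sigma> C"
  define t where "t = restrict \<sigma> (carrier C)"
  define t' where "t' = restrict (inv_into (carrier C) \<sigma>) (\<sigma> ` carrier C)"
  have dP: "dg_module A P" unfolding P_def by (rule transport_dg_module[OF dC sg])
  have t: "t \<in> dg_hom A C P" "t' \<in> dg_hom A P C" using transport_iso[OF dC sg] by (auto simp: P_def t_def t'_def)
  have Pc: "carrier P = \<sigma> ` carrier C" by (simp add: P_def transport_def)
  have tt: "t' (t z) = z" if "z \<in> carrier C" for z using that sg by (simp add: t_def t'_def)
  have tt': "t (t' w) = w" if "w \<in> carrier P" for w
    using that by (simp add: Pc t_def t'_def f_inv_into_f inv_into_into)
  note tx = dg_homD(1)[OF t(1)] and tx' = dg_homD(1)[OF t(2)]
  note zs = X.mgr_zero Y.mgr_zero X.mgr_carrier Y.mgr_carrier X.mdiff_zero Y.mdiff_zero X.ract_zero_l Y.ract_zero_l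
  have hom: "(\<lambda>x\<in>carrier X. ((zero Y), x)) \<in> dg_hom A X C" "(\<lambda>y\<in>carrier Y. (y, (zero X))) \<in> dg_hom A Y C"
    "(\<lambda>z\<in>carrier C. snd z) \<in> dg_hom A C X" "(\<lambda>z\<in>carrier C. fst z) \<in> dg_hom A C Y"
    by (rule dg_homI; use X.mdiff_closed Y.mdiff_closed X.ract_closed Y.ract_closed in \<open>auto simp: Cs Cd zs\<close>)+
  have "is_direct_sum (dgMod A) P [X, Y]"
  proof (rule Mod.direct_sum_pairI[where i = "compose (carrier X) t (\<lambda>x\<in>carrier X. ((zero Y), x))"
        and j = "compose (carrier Y) t (\<lambda>y\<in>carrier Y. (y, (zero X)))"
        and p = "compose (carrier P) (\<lambda>z\<in>carrier C. snd z) t'" and q = "compose (carrier P) (\<lambda>z\<in>carrier C. fst z) t'"])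
    show "Mod.Pl P P
        (Mod.cp P X P (compose (carrier X) t (\<lambda>x\<in>carrier X. ((zero Y), x))) (compose (carrier P) (\<lambda>z\<in>carrier C. snd z) t'))
        (Mod.cp P Y P (compose (carrier Y) t (\<lambda>y\<in>carrier Y. (y, (zero X)))) (compose (carrier P) (\<lambda>z\<in>carrier C. fst z) t')) =
      Mod.Idn P"
    proof
      fix w
      show "Mod.Pl P P
        (Mod.cp P X P (compose (carrier X) t (\<lambda>x\<in>carrier X. ((zero Y), x))) (compose (carrier P) (\<lambda>z\<in>carrier C. snd z) t'))
        (Mod.cp P Y P (compose (carrier Y) t (\<lambda>y\<in>carrier Y. (y, (zero X)))) (compose (carrier P) (\<lambda>z\<in>carrier C. fst z) t')) w =
      Mod.Idn P w"
      proof (cases "w \<in> carrier P")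
        case True
        obtain y x where yx: "t' w = (y, x)" "y \<in> carrier Y" "x \<in> carrier X" using tx'[OF True] Cs(1) by auto
        have "t ((zero Y), x) \<oplus>\<^bsub>P\<^esub> t (y, (zero X)) = t (((zero Y), x) \<oplus>\<^bsub>C\<^esub> (y, (zero X)))"
          by (rule dg_homD(2)[OF t(1), symmetric]) (use yx in \<open>simp_all add: Cs\<close>)
        also have "\<dots> = w" using yx tt'[OF True] by (simp add: Cs)
        finally show ?thesis using True yx by (simp add: hom_plus_def hom_id_def compose_def Cs)
      qed (simp add: hom_plus_def hom_id_def)
    qed
  next
    show "compose (carrier X) t (\<lambda>x\<in>carrier X. ((zero Y), x)) \<in> Mod.Mo X P"
      "compose (carrier P) (\<lambda>z\<in>carrier C. snd z) t' \<in> Mod.Mo P X"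
      "compose (carrier Y) t (\<lambda>y\<in>carrier Y. (y, (zero X))) \<in> Mod.Mo Y P"
      "compose (carrier P) (\<lambda>z\<in>carrier C. fst z) t' \<in> Mod.Mo P Y"
      unfolding dgMod_simps
      by (rule hom_compose[OF dX hom(1) t(1)] hom_compose[OF dP t(2) hom(3)] hom_compose[OF dY hom(2) t(1)]
          hom_compose[OF dP t(2) hom(4)])+
  qed (use dX dY dP tt tx in \<open>simp_all add: compose_def hom_id_def hom_zero_def fun_eq_iff Cs\<close>)
  moreover have "homotopy_equivalent A P C" unfolding P_def by (rule transport_dominated(2)[OF dC sg])
  ultimately show ?thesis using dP unfolding C_def by blast
qed


section \<open>Indecomposable objects, decompositions and additivity\<close>

abbreviation "FILT \<equiv> full_subcat (dgHot A) {M :: ('a, 'm) dgmodule. filt A M}"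
abbreviation "PER \<equiv> full_subcat (dgHot A) per"

lemma zero_object_mod: "zero_object (dgMod A) X \<longleftrightarrow> dg_module A X \<and> carrier X = {zero X}" for X :: "('a, 'm) dgmodule"
  using Mod.zero_object_iff[of X] zero_module_iff[of X] by auto

lemma zero_object_hot: "filt A X ==> zero_object (dgHot A) X \<longleftrightarrow> carrier X = {zero X}" for X :: "('a, 'm) dgmodule"
  using Hot.zero_object_iff[of X] filt_zero_iff[of X] filt_dg[of X] by (auto simp: dgHot_simps(1))

lemma connected_filt: "connected M ==> filt A M"
  by (simp add: connected_def)

lemma indecomposable_mod_iff:
  assumes F: "filt A M"
  shows "indecomposable (dgMod A) M \<longleftrightarrow> connected M"
proof
  assume i: "indecomposable (dgMod A) M"
  show "connected M"
  proof (rule connectedI[OF F])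
    show "carrier M \<noteq> {zero M}" using i filt_dg[OF F] zero_object_mod[of M] by (auto simp: indecomposable_def)
    fix X Y assume "is_direct_sum (dgMod A) M [X, Y]"
    hence "zero_object (dgMod A) X \<or> zero_object (dgMod A) Y" using i unfolding indecomposable_def by blast
    thus "carrier X = {zero X} \<or> carrier Y = {zero Y}" using zero_object_mod by blast
  qed
next
  assume "connected M"
  hence f: "Mod.fitting_object M" by (rule connected_fitting)
  show "indecomposable (dgMod A) M"
    unfolding indecomposable_def
  proof (intro conjI allI impI)
    show "M \<in> Mod.Ob" "\<not> zero_object (dgMod A) M" using f Mod.zero_object_iff[of M] unfolding Mod.fitting_object_def by auto
    fix X Y assume d: "is_direct_sum (dgMod A) M [X, Y]"
    hence "X \<in> Mod.Ob" "Y \<in> Mod.Ob" by (auto simp: is_direct_sum_def)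
    thus "zero_object (dgMod A) X \<or> zero_object (dgMod A) Y"
      using Mod.fitting_object_decomp[OF f d] Mod.zero_object_iff by blast
  qed
qed

lemma indecomposable_filt_iff: "indecomposable FILT M \<longleftrightarrow> connected M"
proof
  assume i: "indecomposable FILT M"
  hence F: "filt A M" by (simp add: indecomposable_def)
  show "connected M"
  proof (rule connectedI[OF F])
    show "carrier M \<noteq> {zero M}" using i F zero_object_hot[OF F] by (auto simp: indecomposable_def Hot.full_zero)
    fix X Y assume s: "is_direct_sum (dgMod A) M [X, Y]" and XY: "filt A X" "filt A Y"
    hence "is_direct_sum FILT M [X, Y]" using direct_sum_hot[OF s] F by (simp add: Hot.full_direct_sum)
    hence "zero_object FILT X \<or> zero_object FILT Y" using i unfolding indecomposable_def by blast
    thus "carrier X = {zero X} \<or> carrier Y = {zero Y}"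
      using zero_object_hot XY unfolding Hot.full_zero by blast
  qed
next
  assume "connected M"
  thus "indecomposable FILT M"
    using connected_fitting(2) connected_filt by (intro Hot.fitting_object_indecomposable) auto
qed

lemma per_replacement:
  assumes N: "N \<in> per"
  shows "\<exists>F a b. filt A F \<and> F \<in> per \<and> a \<in> Hot.Mo N F \<and> b \<in> Hot.Mo F N \<and>
    Hot.cp N F N b a = Hot.Idn N \<and> Hot.cp F N F a b = Hot.Idn F"
proof -
  obtain F a b where F: "filt A F" "a \<in> Hot.Mo N F" "b \<in> Hot.Mo F N"
    "Hot.cp N F N b a = Hot.Idn N" "Hot.cp F N F a b = Hot.Idn F"
    using filt_replacement[OF per_facts[OF N]] by blast
  hence "isomorphic (dgHot A) N F" unfolding isomorphic_def is_iso_mor_def by blast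
  hence "F \<in> per" using per_iso[OF N filt_dg[OF F(1)]] by simp
  thus ?thesis using F by blast
qed

text \<open>A decomposition in dgMod of the filtered replacement \<open>F\<close> becomes one of
  \<open>N\<close> in dgPer, so \<open>F\<close> is connected. Its Fitting property then returns to
  \<open>N\<close> along the isomorphism in dgHot.\<close>

lemma indecomposable_per_fitting:
  assumes i: "indecomposable PER N"
  shows "Hot.fitting_object N"
proof -
  have N: "N \<in> per" using i by (simp add: indecomposable_def)
  note dN = per_facts(1)[OF N]
  obtain F a b where F: "filt A F" "F \<in> per" and ab: "a \<in> Hot.Mo N F" "b \<in> Hot.Mo F N"
    "Hot.cp N F N b a = Hot.Idn N" "Hot.cp F N F a b = Hot.Idn F"
    using per_replacement[OF N] by blast
  have ob: "N \<in> Hot.Ob" "F \<in> Hot.Ob" using dN filt_dg[OF F(1)] by (simp_all add: dgHot_simps(1))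
  have "connected F"
  proof (rule connectedI[OF F(1)])
    show "carrier F \<noteq> {zero F}"
    proof
      assume "carrier F = {zero F}"
      hence z: "Hot.Idn F = Hot.Ze F F" using filt_zero_iff[OF F(1)] by simp
      have "a = Hot.cp N F F (Hot.Idn F) a" using Hot.Id_l[OF ob ab(1)] by simp
      also have "\<dots> = Hot.Ze N F" unfolding z by (rule Hot.Ze_l[OF ob ob(2) ab(1)])
      finally have "Hot.Idn N = Hot.Ze N N" using ab(3) Hot.Ze_r[OF ob ob(1) ab(2)] by simp
      thus False using i N ob Hot.zero_object_iff[of N] unfolding indecomposable_def Hot.full_zero by blast
    qed
    fix X Y assume s: "is_direct_sum (dgMod A) F [X, Y]" and XY: "filt A X" "filt A Y"
    note s' = direct_sum_hot[OF s]
    have "is_direct_sum (dgHot A) N [X, Y]" by (rule Hot.direct_sum_iso[OF s' ob(1) ab])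
    hence "is_direct_sum PER N [X, Y]" using per_summands[OF s' F(2)] N by (simp add: Hot.full_direct_sum)
    hence "zero_object PER X \<or> zero_object PER Y" using i unfolding indecomposable_def by blast
    thus "carrier X = {zero X} \<or> carrier Y = {zero Y}"
      using zero_object_hot XY unfolding Hot.full_zero by blast
  qed
  thus ?thesis using Hot.fitting_object_iso[OF connected_fitting(2) ob(1) ab] by simp
qed

lemma filt_decomposition:
  assumes M: "filt A (M :: ('a, 'm) dgmodule)"
  shows "\<exists>Xs. is_direct_sum FILT M Xs \<and> (\<forall>X\<in>set Xs. connected X)"
proof -
  obtain js where js: "sorted js" "rf A M js {zero M} (carrier M)" using M by (auto simp: filt_def)
  obtain Xs where "is_direct_sum (dgHot A) M Xs" "\<forall>X\<in>set Xs. connected X \<and> X \<in> UNIV"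
    using decompose[OF filt_dg[OF M] js, of UNIV] by blast
  thus ?thesis using M connected_filt by (intro exI[of _ Xs]) (auto simp: Hot.full_direct_sum)
qed

lemma per_decomposition:
  assumes N: "N \<in> per"
  shows "\<exists>Xs. is_direct_sum PER N Xs \<and> (\<forall>X\<in>set Xs. connected X \<and> X \<in> per)"
proof -
  obtain F a b where F: "filt A F" "F \<in> per" and ab: "a \<in> Hot.Mo N F" "b \<in> Hot.Mo F N"
    "Hot.cp N F N b a = Hot.Idn N" "Hot.cp F N F a b = Hot.Idn F"
    using per_replacement[OF N] by blast
  obtain js where js: "sorted js" "rf A F js {zero F} (carrier F)" using F(1) by (auto simp: filt_def)
  have "\<exists>Xs. is_direct_sum (dgHot A) F Xs \<and> (\<forall>X\<in>set Xs. connected X \<and> X \<in> per)"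
    by (rule decompose[OF filt_dg[OF F(1)] js _ F(2)]) (rule per_summands)
  then obtain Xs where Xs: "is_direct_sum (dgHot A) F Xs" "\<forall>X\<in>set Xs. connected X \<and> X \<in> per" by blast
  have "is_direct_sum (dgHot A) N Xs"
    by (rule Hot.direct_sum_iso[OF Xs(1) _ ab]) (use per_facts(1)[OF N] in \<open>simp add: dgHot_simps(1)\<close>)
  thus ?thesis using Xs(2) N by (intro exI[of _ Xs]) (auto simp: Hot.full_direct_sum)
qed

lemma zero_exists: "\<exists>Z :: ('a, 'm) dgmodule. filt A Z \<and> zero_object (dgHot A) Z"
proof -
  have "dg_module A (transport \<iota> (regular_dgmodule A))" by (rule transport_dg_module[OF reg]) (simp add: reg_simps iota)
  from filt_zero[OF this] show ?thesis using zero_object_hot by fastforce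
qed

text \<open>Cells of two modules do not directly line up in one sorted list. The direct sum
  \<open>P\<close> is therefore treated as a cone of filtered modules: it is dominated by a filtered
  module, and its replacement \<open>F\<close> is a direct sum in dgHot.\<close>

lemma additive_FILT: "additive_category FILT"
  unfolding additive_category_def
proof (intro conjI ballI Hot.full_preadditive)
  show "\<exists>Z. zero_object FILT Z" using zero_exists by (simp add: Hot.full_zero) blast
  fix X Y assume "X \<in> Obj FILT" "Y \<in> Obj FILT"
  hence XY: "filt A X" "filt A Y" by auto
  note dX = filt_dg[OF XY(1)] and dY = filt_dg[OF XY(2)]
  define C where "C = cone (shift (- 1) X) Y (hom_zero (shift (- 1) X) Y)"
  have hz: "hom_zero (shift (- 1) X) Y \<in> dg_hom A (shift (- 1) X) Y" by (rule hom_zero_hom[OF shift_dg_module[OF dX] dY])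
  obtain P where P: "dg_module A P" "is_direct_sum (dgMod A) P [X, Y]" "homotopy_equivalent A P C"
    using direct_sum_exists[OF dX dY] unfolding C_def by blast
  have "domf TYPE('m) A C" unfolding C_def by (rule domf_cone_filt[OF filt_shift[OF XY(1)] XY(2) hz]) (use rho in blast)
  moreover have "dg_module A C" unfolding C_def by (rule cone_dg_module[OF shift_dg_module[OF dX] dY hz])
  ultimately have "domf TYPE('m) A P" using domf_dominated[OF P(1) _ homotopy_equivalent_dominated(1)[OF P(3)]] by blast
  from filt_replacement[OF P(1) this]
  obtain F a b where F: "filt A F" and ab: "a \<in> Hot.Mo P F" "b \<in> Hot.Mo F P"
    "Hot.cp P F P b a = Hot.Idn P" "Hot.cp F P F a b = Hot.Idn F" by blast
  have "is_direct_sum (dgHot A) F [X, Y]"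
    by (rule Hot.direct_sum_iso[OF direct_sum_hot[OF P(2)] _ ab(2,1,4,3)]) (use filt_dg[OF F] in \<open>simp add: dgHot_simps(1)\<close>)
  thus "\<exists>M. is_direct_sum FILT M [X, Y]" using F XY by (intro exI[of _ F]) (simp add: Hot.full_direct_sum)
qed

lemma additive_PER: "additive_category PER"
  unfolding additive_category_def
proof (intro conjI ballI Hot.full_preadditive)
  show "\<exists>Z. zero_object PER Z" using zero_exists per_zero by (simp add: Hot.full_zero) blast
  fix X Y assume "X \<in> Obj PER" "Y \<in> Obj PER"
  hence XY: "X \<in> per" "Y \<in> per" by auto
  note dX = per_facts(1)[OF XY(1)] and dY = per_facts(1)[OF XY(2)]
  have hz: "hom_zero (shift (- 1) X) Y \<in> dg_hom A (shift (- 1) X) Y" by (rule hom_zero_hom[OF shift_dg_module[OF dX] dY])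
  obtain P where P: "dg_module A P" "is_direct_sum (dgMod A) P [X, Y]"
    "homotopy_equivalent A P (cone (shift (- 1) X) Y (hom_zero (shift (- 1) X) Y))"
    using direct_sum_exists[OF dX dY] by blast
  have "P \<in> per" by (rule per_cone[OF per_shift[OF XY(1)] XY(2) hz P(1,3)])
  thus "\<exists>M. is_direct_sum PER M [X, Y]"
    using direct_sum_hot[OF P(2)] XY by (intro exI[of _ P]) (simp add: Hot.full_direct_sum)
qed

end

theorem proposition37:
  fixes K :: "'k ring" and A :: "('k, 'a) dgalgebra"
    and W :: "'x set" and L :: "'x \<Rightarrow> ('a, 'm) rmodule"
  assumes "dg_algebra K A"
    and P1: "\<forall>i<0. agr A i = {\<zero>\<^bsub>A\<^esub>}"
    and P2: "semisimple_ring (degree_zero_ring A)"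
    and P3: "\<forall>a\<in>agr A 0. adiff A a = \<zero>\<^bsub>A\<^esub>"
    and "finite W" and "simple_representatives (degree_zero_ring A) W L"
    and universe: "infinite (UNIV :: 'm set)" "\<exists>\<iota> :: 'a \<Rightarrow> 'm. inj_on \<iota> (carrier A)"
  shows
    "(\<forall>M\<in>Obj (dgFilt A W L).
        indecomposable (dgFilt A W L) M \<longleftrightarrow> indecomposable (dgMod A) M) \<and>
     (\<forall>M. indecomposable (dgFilt A W L) M \<longrightarrow>
        iso_or_nilpotent_endos (dgMod A) M \<and> local_ring (end_ring (dgMod A) M)) \<and>
     (\<forall>N. indecomposable (dgPer A :: (('a, 'm) dgmodule, _) precat) N \<longrightarrow>
        iso_or_nilpotent_endos (dgHot A) N \<and> local_ring (end_ring (dgHot A) N)) \<and>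
     (\<forall>M\<in>Obj (dgFilt A W L). \<exists>Xs. is_direct_sum (dgFilt A W L) M Xs \<and>
        (\<forall>X\<in>set Xs. indecomposable (dgFilt A W L) X)) \<and>
     (\<forall>N\<in>Obj (dgPer A :: (('a, 'm) dgmodule, _) precat). \<exists>Xs. is_direct_sum (dgPer A) N Xs \<and>
        (\<forall>X\<in>set Xs. indecomposable (dgPer A) X)) \<and>
     Krull_Remak_Schmidt (dgFilt A W L) \<and>
     Krull_Remak_Schmidt (dgPer A :: (('a, 'm) dgmodule, _) precat)"
proof -
  interpret pdga A by (rule pdga_dg_algebra[OF assms(1) P1 P2 P3])
  obtain \<iota> :: "'a \<Rightarrow> 'm" where \<iota>: "inj_on \<iota> (carrier A)" using universe(2) by blast
  \<comment> \<open>An infinite type is in bijection with its square. This provides pairing inside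
    the universe, and together with \<open>\<iota>\<close> also the injection for pairs from
    \<open>'m\<close> and the carrier of \<open>A\<close>.\<close>
  have "\<exists>\<sigma> :: 'm \<times> 'm \<Rightarrow> 'm. bij_betw \<sigma> (UNIV \<times> UNIV) UNIV"
    unfolding card_of_ordIso by (rule card_of_Times_same_infinite[OF universe(1)])
  then obtain \<sigma> :: "'m \<times> 'm \<Rightarrow> 'm" where \<sigma>0: "bij_betw \<sigma> (UNIV \<times> UNIV) UNIV" ..
  have \<sigma>: "inj_on \<sigma> UNIV" using bij_betw_imp_inj_on[OF \<sigma>0] by simp
  have \<rho>: "inj_on (\<lambda>(m, a). \<sigma> (m, \<iota> a)) (UNIV \<times> carrier A)"
  proof (rule inj_onI)
    fix z w assume z: "z \<in> (UNIV :: 'm set) \<times> carrier A" "w \<in> (UNIV :: 'm set) \<times> carrier A"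
      and eq: "(\<lambda>(m, a). \<sigma> (m, \<iota> a)) z = (\<lambda>(m, a). \<sigma> (m, \<iota> a)) w"
    obtain m a m' a' where zw: "z = (m, a)" "w = (m', a')" by (metis surj_pair)
    have "(m, \<iota> a) = (m', \<iota> a')" using inj_onD[OF \<sigma>, of "(m, \<iota> a)" "(m', \<iota> a')"] eq zw by simp
    thus "z = w" using inj_onD[OF \<iota>, of a a'] z zw by simp
  qed
  interpret U: pdga_univ A \<iota> "\<lambda>(m, a). \<sigma> (m, \<iota> a)" \<sigma> by unfold_locales (rule \<iota> \<rho> \<sigma>)+
  have dF: "dgFilt A W L = U.FILT" using filt_objects_eq[OF assms(6) \<iota>] by (simp add: dgFilt_def)
  have dP: "dgPer A = U.PER" by (simp add: dgPer_def)
  have ip: "indecomposable U.PER X" if "U.connected X" "X \<in> U.per" for X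
    using U.Hot.fitting_object_indecomposable[OF U.connected_fitting(2)[OF that(1)] that(2)] .
  have lc: "local_ring (end_ring (dgHot A) X)" if "U.connected X" for X
    by (rule U.Hot.fitting_object_local(2)[OF U.connected_fitting(2)[OF that]])
  show ?thesis
    unfolding dF dP
  proof (intro conjI ballI allI impI)
    fix M assume "M \<in> Obj U.FILT"
    hence M: "filt A M" by simp
    show "indecomposable U.FILT M \<longleftrightarrow> indecomposable (dgMod A) M"
      using U.indecomposable_mod_iff[OF M] U.indecomposable_filt_iff by simp
    show "\<exists>Xs. is_direct_sum U.FILT M Xs \<and> (\<forall>X\<in>set Xs. indecomposable U.FILT X)"
      using U.filt_decomposition[OF M] U.indecomposable_filt_iff by simp
  next
    fix M assume "indecomposable U.FILT M"
    hence f: "U.Mod.fitting_object M" using U.indecomposable_filt_iff U.connected_fitting(1) by blast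
    show "iso_or_nilpotent_endos (dgMod A) M" "local_ring (end_ring (dgMod A) M)" by (rule U.Mod.fitting_object_local[OF f])+
  next
    fix N assume "indecomposable U.PER N"
    hence f: "U.Hot.fitting_object N" by (rule U.indecomposable_per_fitting)
    show "iso_or_nilpotent_endos (dgHot A) N" "local_ring (end_ring (dgHot A) N)" by (rule U.Hot.fitting_object_local[OF f])+
  next
    fix N assume "N \<in> Obj U.PER"
    hence "N \<in> U.per" by simp
    from U.per_decomposition[OF this] show "\<exists>Xs. is_direct_sum U.PER N Xs \<and> (\<forall>X\<in>set Xs. indecomposable U.PER X)"
      using ip by blast
  next
    show "Krull_Remak_Schmidt U.FILT"
      unfolding Krull_Remak_Schmidt_def
    proof (intro conjI ballI U.additive_FILT)
      fix M assume "M \<in> Obj U.FILT"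
      hence "filt A M" by simp
      from U.filt_decomposition[OF this] show "\<exists>Xs. is_direct_sum U.FILT M Xs \<and> (\<forall>X\<in>set Xs. local_ring (end_ring U.FILT X))"
        using lc by (simp add: U.Hot.full_simps) blast
    qed
    show "Krull_Remak_Schmidt U.PER"
      unfolding Krull_Remak_Schmidt_def
    proof (intro conjI ballI U.additive_PER)
      fix N assume "N \<in> Obj U.PER"
      hence "N \<in> U.per" by simp
      from U.per_decomposition[OF this] show "\<exists>Xs. is_direct_sum U.PER N Xs \<and> (\<forall>X\<in>set Xs. local_ring (end_ring U.PER X))"
        using lc by (simp add: U.Hot.full_simps) blast
    qed
  qed
qed

end
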